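(* For every integer $n>1$, the coefficient of $t^{n-2}$ in the Kazhdan--Lusztig polynomial $P_{B_{2n-1}}(t)$ of the braid matroid $B_{2n-1}$ is equal to $$|\mathcal{S}(2n-2,n)| = (2n-1)^{n-2}\cdot (2n-3)!! - \frac{(n-2)(n-1)^{n-5}\cdot (2n-1)!}{3\cdot (n-2)!}.$$
   Context: For a positive integer $k$, the braid matroid $B_k$ is the graphic (cycle) matroid of the complete graph on $k$ vertices; it has rank $k-1$. For a loopless matroid $M$ with lattice of flats $\mathscr{L}(M)$, $M|_F$ denotes the restriction of $M$ to the flat $F$ and $M/F$ the contraction. The Kazhdan--Lusztig polynomials $P_M(t)\in\mathbb{Z}[t]$ are the unique family of polynomials, indexed by loopless matroids (and depending only on the isomorphism class), such that: $P_M(t)=1$ if $\mathrm{rk}\, M=0$; $\deg P_M(t)<\frac12\mathrm{rk}\, M$ if $\mathrm{rk}\, M>0$; and $t^{\mathrm{rk}\, M}P_M(t^{-1})=\sum_{F\in\mathscr{L}(M)}\chi_{M|_F}(t)\,P_{M/F}(t)$ for all $M$, where $\chi$ is the characteristic polynomial. A series-parallel matroid is the graphic matroid either of a single non-loop edge, or of a graph obtained from a pair of parallel edges (two vertices joined by two edges) by repeatedly either adding an edge parallel to an existing one or subdividing an edge. A matroid is quasi series-parallel if it is isomorphic to a direct sum of loops and series-parallel matroids; equivalently, it has no minor isomorphic to $B_4$ or to the uniform matroid $U_{2,4}$ of rank two on four elements. For nonnegative integers $p,k$, $\mathcal{S}(p,k)$ denotes the set of simple quasi series-parallel matroids of rank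 $k$ on the ground set $[p]=\{1,\dots,p\}$ (labelled matroids, not up to isomorphism). $m!!$ denotes the double factorial ($1!!=1$, $m!!=m\cdot(m-2)!!$), and powers with negative exponents are rational numbers. *)

theory Defs
  imports "HOL-Computational_Algebra.Polynomial"
begin

record 'a matroid =
  ground :: "'a set"
  indep :: "'a set set"

definition matroid :: "'a matroid \<Rightarrow> bool" where
  "matroid M \<longleftrightarrow>
     finite (ground M) \<and>
     indep M \<subseteq> Pow (ground M) \<and>
     {} \<in> indep M \<and>
     (\<forall>I\<in>indep M. \<forall>J. J \<subseteq> I \<longrightarrow> J \<in> indep M) \<and>
     (\<forall>I\<in>indep M. \<forall>J\<in>indep M. card I < card J \<longrightarrow> (\<exists>x\<in>J - I. insert x I \<in> indep M))"

definition rank_of :: "'a matroid \<Rightarrow> 'a set \<Rightarrow> nat" where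
  "rank_of M A = Max (card ` {I \<in> indep M. I \<subseteq> A})"

abbreviation rk :: "'a matroid \<Rightarrow> nat" where
  "rk M \<equiv> rank_of M (ground M)"

definition matroid_iso :: "'a matroid \<Rightarrow> 'b matroid \<Rightarrow> bool" where
  "matroid_iso M N \<longleftrightarrow>
     (\<exists>f. bij_betw f (ground M) (ground N) \<and>
          (\<forall>X. X \<subseteq> ground M \<longrightarrow> (X \<in> indep M \<longleftrightarrow> f ` X \<in> indep N)))"

definition loopless :: "'a matroid \<Rightarrow> bool" where
  "loopless M \<longleftrightarrow> (\<forall>x\<in>ground M. {x} \<in> indep M)"

text \<open>The case \<open>x = y\<close> excludes loops, the case \<open>x \<noteq> y\<close> excludes parallel elements.\<close>

definition simple :: "'a matroid \<Rightarrow> bool" where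
  "simple M \<longleftrightarrow> (\<forall>x\<in>ground M. \<forall>y\<in>ground M. {x, y} \<in> indep M)"

definition flats :: "'a matroid \<Rightarrow> 'a set set" where
  "flats M = {F. F \<subseteq> ground M \<and> (\<forall>x\<in>ground M - F. rank_of M F < rank_of M (insert x F))}"

definition restriction :: "'a matroid \<Rightarrow> 'a set \<Rightarrow> 'a matroid" where
  "restriction M F = \<lparr>ground = F, indep = {I \<in> indep M. I \<subseteq> F}\<rparr>"

definition contraction :: "'a matroid \<Rightarrow> 'a set \<Rightarrow> 'a matroid" where
  "contraction M F =
     \<lparr>ground = ground M - F,
      indep = {I. I \<subseteq> ground M - F \<and> rank_of M (I \<union> F) = card I + rank_of M F}\<rparr>"

definition direct_sum :: "'a matroid set \<Rightarrow> 'a matroid" where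
  "direct_sum \<M> =
     \<lparr>ground = (\<Union>M\<in>\<M>. ground M),
      indep = {I. I \<subseteq> (\<Union>M\<in>\<M>. ground M) \<and> (\<forall>M\<in>\<M>. I \<inter> ground M \<in> indep M)}\<rparr>"

text \<open>The Moebius function of a family \<open>L\<close> of finite sets ordered by inclusion.\<close>

function moebius :: "'a set set \<Rightarrow> 'a set \<Rightarrow> 'a set \<Rightarrow> int" where
  "moebius L X Y =
     (if X = Y then 1
      else if X \<subset> Y \<and> finite Y then - (\<Sum>Z\<in>{Z \<in> L. X \<subseteq> Z \<and> Z \<subset> Y}. moebius L X Z)
      else 0)"
  by auto
termination
  by (relation "measure (\<lambda>(L, X, Y). card Y)") (auto intro: psubset_card_mono)

declare moebius.simps [simp del]

text \<open>\<open>\<Inter>(flats M)\<close> is the least flat; it is empty when \<open>M\<close> is loopless.\<close>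

definition characteristic_poly :: "'a matroid \<Rightarrow> int poly" where
  "characteristic_poly M =
     (\<Sum>F\<in>flats M. monom (moebius (flats M) (\<Inter>(flats M)) F) (rk M - rank_of M F))"

text \<open>The polynomial \<open>t\<^sup>d p(t\<^sup>-\<^sup>1)\<close>, for \<open>degree p \<le> d\<close>: \<^const>\<open>reflect_poly\<close> is the case
  \<open>d = degree p\<close>.\<close>

definition reversal :: "nat \<Rightarrow> int poly \<Rightarrow> int poly" where
  "reversal d p = monom 1 (d - degree p) * reflect_poly p"

text \<open>Contractions of a matroid on a type \<open>'a\<close> are again matroids on \<open>'a\<close>, so the defining
  recursion determines the family on each type separately. The value \<open>0\<close> outside the loopless
  matroids is a dummy that makes the family unique as a total function.\<close>

definition kl_family :: "('a matroid \<Rightarrow> int poly) \<Rightarrow> bool" where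
  "kl_family P \<longleftrightarrow>
     (\<forall>M. \<not> (matroid M \<and> loopless M) \<longrightarrow> P M = 0) \<and>
     (\<forall>M N. matroid M \<and> loopless M \<and> matroid N \<and> loopless N \<and> matroid_iso M N \<longrightarrow> P M = P N) \<and>
     (\<forall>M. matroid M \<and> loopless M \<longrightarrow>
        (rk M = 0 \<longrightarrow> P M = 1) \<and>
        (rk M > 0 \<longrightarrow> 2 * degree (P M) < rk M) \<and>
        reversal (rk M) (P M) =
          (\<Sum>F\<in>flats M. characteristic_poly (restriction M F) * P (contraction M F)))"

definition kl_poly :: "'a matroid \<Rightarrow> int poly" where
  "kl_poly = (THE P. kl_family P)"

text \<open>Undirected multigraphs: \<open>ends G e\<close> is the set of endpoints of the edge \<open>e\<close>, a singleton
  if \<open>e\<close> is a loop.\<close>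

record ('v, 'e) multigraph =
  verts :: "'v set"
  edges :: "'e set"
  ends :: "'e \<Rightarrow> 'v set"

text \<open>Length one gives the loops, length two the pairs of parallel edges.\<close>

definition graph_cycle :: "('v, 'e) multigraph \<Rightarrow> 'v list \<Rightarrow> 'e list \<Rightarrow> bool" where
  "graph_cycle G vs es \<longleftrightarrow>
     es \<noteq> [] \<and> length vs = length es \<and> distinct vs \<and> distinct es \<and>
     set vs \<subseteq> verts G \<and> set es \<subseteq> edges G \<and>
     (\<forall>i<length es. ends G (es ! i) = {vs ! i, vs ! (Suc i mod length es)})"

definition graphic_matroid :: "('v, 'e) multigraph \<Rightarrow> 'e matroid" where
  "graphic_matroid G =
     \<lparr>ground = edges G,
      indep = {I. I \<subseteq> edges G \<and> \<not> (\<exists>vs es. graph_cycle G vs es \<and> set es \<subseteq> I)}\<rparr>"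

definition complete_graph :: "nat \<Rightarrow> (nat, nat set) multigraph" where
  "complete_graph k =
     \<lparr>verts = {1..k}, edges = {e. e \<subseteq> {1..k} \<and> card e = 2}, ends = (\<lambda>e. e)\<rparr>"

definition braid_matroid :: "nat \<Rightarrow> nat set matroid" where
  "braid_matroid k = graphic_matroid (complete_graph k)"

definition single_edge :: "('v, 'e) multigraph \<Rightarrow> bool" where
  "single_edge G \<longleftrightarrow>
     (\<exists>u v e. u \<noteq> v \<and> verts G = {u, v} \<and> edges G = {e} \<and> ends G e = {u, v})"

inductive series_parallel_graph :: "('v, 'e) multigraph \<Rightarrow> bool" where
  parallel_pair:
    "u \<noteq> v \<Longrightarrow> e \<noteq> f \<Longrightarrow> verts G = {u, v} \<Longrightarrow> edges G = {e, f} \<Longrightarrow>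
     ends G e = {u, v} \<Longrightarrow> ends G f = {u, v} \<Longrightarrow> series_parallel_graph G"
| add_parallel:
    "series_parallel_graph G \<Longrightarrow> f \<in> edges G \<Longrightarrow> e \<notin> edges G \<Longrightarrow>
     series_parallel_graph
       (G\<lparr>edges := insert e (edges G), ends := (ends G)(e := ends G f)\<rparr>)"
| subdivide:
    "series_parallel_graph G \<Longrightarrow> f \<in> edges G \<Longrightarrow> ends G f = {u, v} \<Longrightarrow>
     e \<notin> edges G \<Longrightarrow> w \<notin> verts G \<Longrightarrow>
     series_parallel_graph
       (G\<lparr>verts := insert w (verts G), edges := insert e (edges G),
          ends := (ends G)(f := {u, w}, e := {w, v})\<rparr>)"

text \<open>Every finite graph has an isomorphic copy with natural numbers as vertices, so fixing the
  vertex type is no restriction.\<close>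

definition series_parallel :: "'a matroid \<Rightarrow> bool" where
  "series_parallel M \<longleftrightarrow>
     (\<exists>G :: (nat, 'a) multigraph.
        (single_edge G \<or> series_parallel_graph G) \<and> M = graphic_matroid G)"

definition loop_matroid :: "'a matroid \<Rightarrow> bool" where
  "loop_matroid M \<longleftrightarrow> (\<exists>x. M = \<lparr>ground = {x}, indep = {{}}\<rparr>)"

definition quasi_series_parallel :: "'a matroid \<Rightarrow> bool" where
  "quasi_series_parallel M \<longleftrightarrow>
     (\<exists>\<M> :: 'a matroid set.
        finite \<M> \<and>
        (\<forall>N\<in>\<M>. loop_matroid N \<or> series_parallel N) \<and>
        (\<forall>N\<in>\<M>. \<forall>N'\<in>\<M>. N \<noteq> N' \<longrightarrow> ground N \<inter> ground N' = {}) \<and>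
        matroid_iso M (direct_sum \<M>))"

definition simple_qsp_matroids :: "nat \<Rightarrow> nat \<Rightarrow> nat matroid set" where
  "simple_qsp_matroids p k =
     {M. matroid M \<and> ground M = {1..p} \<and> rk M = k \<and> simple M \<and> quasi_series_parallel M}"

fun double_fact :: "nat \<Rightarrow> nat" where
  "double_fact 0 = 1"
| "double_fact (Suc 0) = 1"
| "double_fact (Suc (Suc m)) = Suc (Suc m) * double_fact m"

end

theory Submission
  imports Defs "HOL-Computational_Algebra.Computational_Algebra" "HOL-Library.Disjoint_Sets" "HOL-Library.FuncSet"
begin

text \<open>Both numbers are computed. For the braid matroids, colourings express the Kazhdan--Lusztig
  recursion through an exponential generating function in \<open>y\<close>, with \<open>t = s\<^sup>-\<^sup>2\<close>: it is matched by a
  system of differential equations that is invariant under \<open>s \<mapsto> 1 / s\<close>, and the coefficients of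
  \<open>t\<^sup>n\<^sup>-\<^sup>2\<close> are the lowest-order terms at \<open>s = 0\<close>, which are polynomials in \<open>y\<close> and the tree
  series \<open>G = exp (y\<^sup>2 G\<^sup>2 / 2)\<close>.

  On the other side, a simple quasi series-parallel matroid of rank \<open>m + 1\<close> on \<open>2 m\<close> elements is
  binary, and its cycle space arises by deleting one point from a space spanned by the edges of a
  hypertree whose edges are triples on \<open>2 m + 1\<close> vertices. The space determines the hypertree unless
  the deleted vertex \<open>x\<close> has degree at most 2, so the matroids are counted by hypertrees, corrected by
  rooted hyperforests with two and four components and by hyperforests with two components. Rooted
  hyperforests are counted by Pitman's double counting.\<close>

text \<open>With t = 1 / s^2 the function s^(k-1) P(1 / s^2), P the polynomial of the braid matroid
  on k \<ge> 2 vertices, is a polynomial in s, and the degree bound on P says that it vanishes at s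
  = 0. A block of size b contributes (t-1)...(t-b+1) to the recursion, with exponential generating
  function ((1+x)^t - 1) / t; this is the origin of the substitution \<open>shift_fps\<close>. A
  polynomial that vanishes at 0 and is invariant under inversion is zero, so any solution with the
  right symmetry is the generating function. On the matroid side the obstacle is that the
  construction of a simple matroid may pass through parallel elements, so representatives of
  parallel classes are tracked instead. A nonempty simple series-parallel space of dimension c needs
  2 c + 1 points; rank m + 1 on 2 m points means c = m - 1, one point above the minimum, hence a
  single deleted point. Both numbers become h - 10 s + e / 3: h counts hypertrees on 2 m + 1
  vertices, s rooted hyperforests with four components on 2 m vertices, and e is 120 times the
  number of those with six.\<close>

section \<open>Reversal of polynomials and the lower half of an antisymmetric one\<close>

lemma coeff_reversal:
 assumes "degree p <= d"
 shows "coeff (reversal d p) i = (if i <= d then coeff p (d - i) else 0)"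
 using assms
 by (auto simp: reversal_def coeff_monom_mult coeff_reflect_poly coeff_eq_0 not_le
   intro!: arg_cong[where f="coeff p"])

lemma reversal_mult:
 assumes "degree p <= a" "degree q <= b"
 shows "reversal (a + b) (p * q) = reversal a p * reversal b q"
proof (cases "p = 0 | q = 0")
 case False
 then have "degree (p * q) = degree p + degree q" by (simp add: degree_mult_eq)
 then have "a + b - degree (p * q) = (a - degree p) + (b - degree q)" using assms by simp
 then show ?thesis
  using mult_monom[of "1 :: int" "a - degree p" 1 "b - degree q"]
  by (simp add: reversal_def reflect_poly_mult)
qed (auto simp: reversal_def)

lemma reversal_sum:
 assumes "!!x. x \<in> A ==> degree (f x) <= d"
 shows "reversal d (sum f A) = (\<Sum>x\<in>A. reversal d (f x))"
proof (rule poly_eqI)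
 fix i
 have deg: "degree (sum f A) <= d"
  by (cases "finite A") (auto intro: degree_sum_le assms)
 show "coeff (reversal d (sum f A)) i = coeff (\<Sum>x\<in>A. reversal d (f x)) i"
  using deg assms by (auto simp: coeff_reversal coeff_sum intro!: sum.neutral)
qed

lemma degree_reversal: "degree p <= d ==> degree (reversal d p) <= d"
 by (auto intro!: degree_le simp: coeff_reversal)

lemma reversal_monom: "k <= d ==> reversal d (monom c k) = monom c (d - k)"
 using order.trans[OF degree_monom_le, of k d c]
 by (intro poly_eqI) (auto simp: coeff_reversal)

text \<open>The reversal of a polynomial of degree below d/2 has no terms below d/2, so the low
  coefficients of the difference are those of the polynomial up to sign. This is the uniqueness half
  of the Kazhdan--Lusztig recursion.\<close>

lemma reversal_diff_unique:
 assumes "reversal d p - p = reversal d q - q" "2 * degree p < d" "2 * degree q < d"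
 shows "p = q"
proof (rule poly_eqI)
 fix i
 show "coeff p i = coeff q i"
 proof (cases "2 * i < d")
  case True
  then have "degree p < d - i" "degree q < d - i" using assms by auto
  then have *: "coeff p (d - i) = 0" "coeff q (d - i) = 0" by (auto intro: coeff_eq_0)
  have "coeff (reversal d p - p) i = coeff (reversal d q - q) i" using assms(1) by (rule arg_cong)
  moreover have "degree p <= d" "degree q <= d" using assms by auto
  ultimately show ?thesis using * True by (simp add: coeff_reversal)
 next
  case False
  then show ?thesis using assms by (simp add: coeff_eq_0)
 qed
qed

text \<open>The truncation that extracts a Kazhdan--Lusztig polynomial from the rest of its
  recursion; the middle degree of an even d is excluded.\<close>

definition lower_half :: "nat => int poly => int poly" where
 "lower_half d R = (\<Sum>i | 2 * i < d. monom (coeff R i) i)"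

lemma coeff_lower_half: "coeff (lower_half d R) i = (if 2 * i < d then coeff R i else 0)"
proof -
 have "finite {i::nat. 2 * i < d}" by (rule finite_subset[of _ "{..<d}"]) auto
 then show ?thesis by (auto simp: lower_half_def coeff_sum)
qed

lemma degree_lower_half:
 assumes "d > 0" shows "2 * degree (lower_half d R) < d"
proof -
 have "degree (lower_half d R) <= (d - 1) div 2"
  by (rule degree_le) (use assms in \<open>auto simp: coeff_lower_half\<close>)
 then show ?thesis using assms by linarith
qed

text \<open>The low terms of an antisymmetric R are those of -P, the high ones are their
  reflections, and the middle coefficient, if there is one, is its own negative and so vanishes.
  This is the existence half of the recursion.\<close>

lemma reversal_lower_half:
 assumes "degree R <= d" "reversal d R = - R" "d > 0"
 shows "reversal d (lower_half d (- R)) = lower_half d (- R) + R"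
proof (rule poly_eqI)
 fix i
 have anti: "coeff R (d - j) = - coeff R j" if "j <= d" for j
  using arg_cong[OF assms(2), of "%p. coeff p j"] that assms(1) by (simp add: coeff_reversal)
 have deg: "degree (lower_half d (- R)) <= d"
  using degree_lower_half[OF assms(3), of "- R"] by simp
 show "coeff (reversal d (lower_half d (- R))) i = coeff (lower_half d (- R) + R) i"
 proof (cases "i <= d")
  case True
  consider "2 * i < d" | "2 * i = d" | "2 * i > d" by linarith
  then show ?thesis
  proof cases
   case 2
   then have "coeff R i = 0" using anti[of i] True by auto
   then show ?thesis using 2 deg True by (auto simp: coeff_reversal coeff_lower_half)
  qed (use anti[of i] True deg in \<open>auto simp: coeff_reversal coeff_lower_half\<close>)
 next
  case False
  then show ?thesis using deg assms(1) by (simp add: coeff_reversal coeff_lower_half coeff_eq_0)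
 qed
qed

section \<open>Kazhdan--Lusztig polynomials of ranked families of sets\<close>

definition interval :: "'a set set => 'a set => 'a set => 'a set set" where
 "interval L X Y = {Z \<in> L. X <= Z & Z <= Y}"

definition chi :: "'a set set => ('a set => nat) => 'a set => 'a set => int poly" where
 "chi L r X Y = (\<Sum>Z\<in>interval L X Y. monom (moebius L X Z) (r Y - r Z))"

text \<open>The polynomial of the upper interval from X to \<open>\<Union>L\<close>. Inside one
  fixed family the contractions of a matroid become the points X, so the recursion runs over X
  instead of over matroids. The \<open>else\<close> branch supplies the value 1 at the top.\<close>

function klp :: "'a set set => ('a set => nat) => 'a set => int poly" where
 "klp L r X =
   (if X \<subset> \<Union>L & finite (\<Union>L)
   then lower_half (r (\<Union>L) - r X) (- (\<Sum>Y\<in>{Y \<in> L. X \<subset> Y}. chi L r X Y * klp L r Y))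
   else 1)"
 by auto
termination
 by (relation "measure (%(L, r, X). card (\<Union>L - X))") (auto intro!: psubset_card_mono)

declare klp.simps [simp del]

text \<open>Flats enter the theory of the recursion through these properties alone, which allows all
  upper intervals of one family to be treated together.\<close>

locale ranked_family =
 fixes L :: "'a set set" and r :: "'a set => nat"
 assumes finite_Union: "finite (\<Union>L)"
  and top_in: "\<Union>L \<in> L"
  and r_strict: "!!X Y. X \<in> L ==> Y \<in> L ==> X \<subset> Y ==> r X < r Y"
begin

lemma finite_L: "finite L"
 using finite_Union by (rule finite_UnionD)

lemma finite_member: "X \<in> L ==> finite X"
 using finite_Union by (metis Union_upper finite_subset)

lemma r_mono: "X \<in> L ==> Y \<in> L ==> X <= Y ==> r X <= r Y"
 using r_strict by (metis less_imp_le order_refl psubsetI)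

lemma finite_interval [simp]: "finite (interval L X Y)"
 using finite_L by (simp add: interval_def)

lemma interval_self: "X \<in> L ==> interval L X X = {X}"
 by (auto simp: interval_def)

lemma interval_swap:
 "(\<Sum>Z\<in>interval L X Y. \<Sum>V\<in>interval L X Z. g V Z) =
  (\<Sum>V\<in>interval L X Y. \<Sum>Z\<in>interval L V Y. (g V Z :: 'b :: comm_monoid_add))"
 unfolding interval_def
 by (subst (1 2) sum.Sigma)
  (simp_all add: finite_L, rule sum.reindex_bij_witness[of _ "%(a, b). (b, a)" "%(a, b). (b, a)"],
   auto 0 3)

lemma moebius_sum_left:
 assumes "X \<in> L" "Y \<in> L" "X <= Y"
 shows "(\<Sum>Z\<in>interval L X Y. moebius L X Z) = (if X = Y then 1 else 0)"
proof (cases "X = Y")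
 case True
 then show ?thesis using assms by (simp add: interval_self moebius.simps)
next
 case False
 then have "X \<subset> Y" using assms by auto
 have "interval L X Y = insert Y {Z \<in> L. X <= Z & Z \<subset> Y}"
  using assms by (auto simp: interval_def)
 moreover have "finite {Z \<in> L. X <= Z & Z \<subset> Y}" using finite_L by simp
 ultimately show ?thesis
  using \<open>X \<subset> Y\<close> finite_member[OF assms(2)] by (simp add: moebius.simps[of L X Y])
qed

text \<open>Summing the left-hand side over all upper ends in [X, Y] gives 1, by exchanging the
  summations and the left identity. By induction the upper ends below Y contribute 1 if X and Y
  differ and 0 otherwise, which leaves the claimed value for Y.\<close>

lemma moebius_sum_right:
 assumes "X \<in> L" "Y \<in> L" "X <= Y"
 shows "(\<Sum>Z\<in>interval L X Y. moebius L Z Y) = (if X = Y then 1 else 0)"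
 using assms(2,3)
proof (induction "card Y" arbitrary: Y rule: less_induct)
 case less
 let ?f = "%Y. \<Sum>Z\<in>interval L X Y. moebius L Z Y"
 have "(\<Sum>Z\<in>interval L X Y. ?f Z) =
   (\<Sum>V\<in>interval L X Y. \<Sum>Z\<in>interval L V Y. moebius L V Z)"
  by (rule interval_swap)
 also have "\<dots> = (\<Sum>V\<in>interval L X Y. if V = Y then 1 else 0)"
  by (intro sum.cong refl moebius_sum_left) (use less.prems in \<open>auto simp: interval_def\<close>)
 also have "Y \<in> interval L X Y" using less.prems by (simp add: interval_def)
 then have "(\<Sum>V\<in>interval L X Y. if V = Y then 1 else 0) = (1 :: int)" by simp
 finally have total: "(\<Sum>Z\<in>interval L X Y. ?f Z) = 1" .
 have ins: "interval L X Y = insert Y (interval L X Y - {Y})"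
  using less.prems by (auto simp: interval_def)
 have "(\<Sum>Z\<in>interval L X Y. ?f Z) = ?f Y + (\<Sum>Z\<in>interval L X Y - {Y}. ?f Z)"
  by (subst ins, subst sum.insert) auto
 also have "(\<Sum>Z\<in>interval L X Y - {Y}. ?f Z) = (\<Sum>Z\<in>interval L X Y - {Y}. if X = Z then 1 else 0)"
 proof (intro sum.cong refl less.hyps)
  fix Z assume "Z \<in> interval L X Y - {Y}"
  then show "card Z < card Y" "Z \<in> L" "X <= Z"
   using finite_member[OF less.prems(1)] by (auto simp: interval_def intro!: psubset_card_mono)
 qed
 also have "\<dots> = (if X = Y then 0 else 1)"
 proof -
  have "X \<in> interval L X Y" using less.prems assms(1) by (simp add: interval_def)
  then show ?thesis by (subst sum.delta') auto
 qed
 finally show ?case using total by (auto split: if_splits)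
qed

lemma degree_chi: "X \<in> L ==> Y \<in> L ==> X <= Y ==> degree (chi L r X Y) <= r Y - r X"
 unfolding chi_def
 by (rule degree_sum_le)
  (auto simp: interval_def finite_L intro!: order.trans[OF degree_monom_le] diff_le_mono2 r_mono)

lemma chi_self: "X \<in> L ==> chi L r X X = 1"
 by (simp add: chi_def interval_self moebius.simps monom_eq_1)

lemma reversal_chi:
 assumes "X \<in> L" "Y \<in> L" "X <= Y"
 shows "reversal (r Y - r X) (chi L r X Y) =
  (\<Sum>Z\<in>interval L X Y. monom (moebius L X Z) (r Z - r X))"
 unfolding chi_def
proof (subst reversal_sum)
 show "degree (monom (moebius L X Z) (r Y - r Z)) <= r Y - r X" if "Z \<in> interval L X Y" for Z
  using that assms
  by (auto simp: interval_def intro!: order.trans[OF degree_monom_le] diff_le_mono2 r_mono)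
 show "(\<Sum>Z\<in>interval L X Y. reversal (r Y - r X) (monom (moebius L X Z) (r Y - r Z))) =
  (\<Sum>Z\<in>interval L X Y. monom (moebius L X Z) (r Z - r X))"
 proof (intro sum.cong refl)
  fix Z assume "Z \<in> interval L X Y"
  then have "r X <= r Z" "r Z <= r Y" using assms by (auto simp: interval_def intro: r_mono)
  then show "reversal (r Y - r X) (monom (moebius L X Z) (r Y - r Z)) =
    monom (moebius L X Z) (r Z - r X)"
   by (subst reversal_monom) (auto intro: arg_cong[where f="monom _"])
 qed
qed

text \<open>The characteristic polynomial is a kernel in the sense of Stanley. After expanding the
  reversed factor, the sum of chi(Z, Y) over Z in [V, Y] collapses to t^(r Y - r V); the two powers
  of t multiply to one that does not depend on V, and a plain sum of Moebius values remains.\<close>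

lemma chi_kernel:
 assumes "X \<in> L" "Y \<in> L" "X <= Y"
 shows "(\<Sum>Z\<in>interval L X Y. reversal (r Z - r X) (chi L r X Z) * chi L r Z Y) =
  (if X = Y then 1 else 0)"
proof -
 let ?m = "%V. monom (moebius L X V) (r V - r X)"
 have inner: "(\<Sum>Z\<in>interval L V Y. chi L r Z Y) = monom 1 (r Y - r V)"
  if "V \<in> interval L X Y" for V
 proof -
  have V: "V \<in> L" "V <= Y" using that by (auto simp: interval_def)
  have "(\<Sum>Z\<in>interval L V Y. chi L r Z Y) =
   (\<Sum>U\<in>interval L V Y. \<Sum>Z\<in>interval L V U. monom (moebius L Z U) (r Y - r U))"
   unfolding chi_def by (rule interval_swap[symmetric])
  also have "\<dots> = (\<Sum>U\<in>interval L V Y. monom (if V = U then 1 else 0) (r Y - r U))"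
  proof (intro sum.cong refl)
   fix U assume "U \<in> interval L V Y"
   then have "(\<Sum>Z\<in>interval L V U. moebius L Z U) = (if V = U then 1 else 0)"
    using V by (intro moebius_sum_right) (auto simp: interval_def)
   then show "(\<Sum>Z\<in>interval L V U. monom (moebius L Z U) (r Y - r U)) =
     monom (if V = U then 1 else 0) (r Y - r U)"
    by (simp flip: monom_sum)
  qed
  also have "\<dots> = (\<Sum>U\<in>interval L V Y. if V = U then monom 1 (r Y - r U) else 0)"
   by (intro sum.cong) auto
  also have "V \<in> interval L V Y" using V by (simp add: interval_def)
  then have "(\<Sum>U\<in>interval L V Y. if V = U then monom 1 (r Y - r U) else 0) =
    (monom 1 (r Y - r V) :: int poly)" by simp
  finally show ?thesis .
 qed
 have "(\<Sum>Z\<in>interval L X Y. reversal (r Z - r X) (chi L r X Z) * chi L r Z Y) =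
  (\<Sum>Z\<in>interval L X Y. \<Sum>V\<in>interval L X Z. ?m V * chi L r Z Y)"
  by (intro sum.cong refl, subst reversal_chi)
   (use assms in \<open>auto simp: interval_def sum_distrib_right\<close>)
 also have "\<dots> = (\<Sum>V\<in>interval L X Y. ?m V * (\<Sum>Z\<in>interval L V Y. chi L r Z Y))"
  by (subst interval_swap) (simp add: sum_distrib_left)
 also have "\<dots> = (\<Sum>V\<in>interval L X Y. monom (moebius L X V) (r Y - r X))"
 proof (intro sum.cong refl)
  fix V assume V: "V \<in> interval L X Y"
  then have "r X <= r V" "r V <= r Y" using assms by (auto simp: interval_def intro: r_mono)
  then show "?m V * (\<Sum>Z\<in>interval L V Y. chi L r Z Y) = monom (moebius L X V) (r Y - r X)"
   using inner[OF V] by (simp add: mult_monom)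
 qed
 also have "\<dots> = monom (if X = Y then 1 else 0) (r Y - r X)"
  by (simp add: moebius_sum_left[OF assms] flip: monom_sum)
 finally show ?thesis by (auto simp: monom_eq_1)
qed

lemma klp_top: "klp L r (\<Union>L) = 1"
 by (simp add: klp.simps)

lemma top_rank: "X \<in> L ==> X ~= \<Union>L ==> r X < r (\<Union>L)"
 using top_in by (intro r_strict) auto

lemma degree_klp: "X \<in> L ==> X ~= \<Union>L ==> 2 * degree (klp L r X) < r (\<Union>L) - r X"
 using top_rank[of X] finite_Union
 by (subst klp.simps) (auto intro!: degree_lower_half)

lemma degree_klp_le: "X \<in> L ==> degree (klp L r X) <= r (\<Union>L) - r X"
 using degree_klp[of X] by (cases "X = \<Union>L") (auto simp: klp_top)

text \<open>The point is that the sum R over all Y strictly above X is antisymmetric. Reversing each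
  product and inserting the recursion at Y gives a double sum over Y \<le> W, whose inner sum over Y
  is the one of \<open>chi_kernel\<close> without its term Y = X, hence equals -chi(X, W).\<close>

lemma klp_recursion:
 assumes "X \<in> L"
 shows "reversal (r (\<Union>L) - r X) (klp L r X) =
  (\<Sum>Y\<in>{Y \<in> L. X <= Y}. chi L r X Y * klp L r Y)"
 using assms
proof (induction "card (\<Union>L - X)" arbitrary: X rule: less_induct)
 case less
 let ?T = "\<Union>L" and ?P = "klp L r"
 let ?d = "%X. r ?T - r X"
 show ?case
 proof (cases "X = ?T")
  case True
  then have "{Y \<in> L. X <= Y} = {X}" using less.prems by auto
  then show ?thesis using True less.prems by (simp add: chi_self klp_top reversal_def)
 next
  case False
  then have sub: "X \<subset> ?T" using less.prems by auto
  define R where "R = (\<Sum>Y\<in>{Y \<in> L. X \<subset> Y}. chi L r X Y * ?P Y)"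
  have P: "?P X = lower_half (?d X) (- R)"
   using sub finite_Union by (subst klp.simps) (simp add: R_def)
  have pos: "?d X > 0" using top_rank[OF less.prems False] by simp
  have dsplit: "?d X = (r Y - r X) + ?d Y" if "Y \<in> L" "X <= Y" for Y
   using r_mono[of X Y] r_mono[OF _ top_in Union_upper, of Y] that less.prems by simp
  have degR: "degree (chi L r X Y * ?P Y) <= ?d X" if "Y \<in> L" "X \<subset> Y" for Y
   using degree_chi[of X Y] degree_klp_le[of Y] that less.prems dsplit[of Y]
   by (intro order.trans[OF degree_mult_le]) auto
  have "reversal (?d X) R = (\<Sum>Y\<in>{Y \<in> L. X \<subset> Y}. reversal (?d X) (chi L r X Y * ?P Y))"
   unfolding R_def by (rule reversal_sum) (auto intro: degR)
  also have "\<dots> = (\<Sum>Y\<in>{Y \<in> L. X \<subset> Y}. reversal (r Y - r X) (chi L r X Y) *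
    (\<Sum>W\<in>{W \<in> L. Y <= W}. chi L r Y W * ?P W))"
  proof (intro sum.cong refl)
   fix Y assume Y: "Y \<in> {Y \<in> L. X \<subset> Y}"
   then have "reversal (?d X) (chi L r X Y * ?P Y) =
     reversal (r Y - r X) (chi L r X Y) * reversal (?d Y) (?P Y)"
    using dsplit[of Y] degree_chi[of X Y] degree_klp_le[of Y] less.prems
    by (metis (no_types, lifting) mem_Collect_eq psubset_imp_subset reversal_mult)
   moreover have "reversal (?d Y) (?P Y) = (\<Sum>W\<in>{W \<in> L. Y <= W}. chi L r Y W * ?P W)"
   proof (rule less.hyps)
    show "card (?T - Y) < card (?T - X)" "Y \<in> L"
     using Y finite_Union by (auto intro!: psubset_card_mono)
   qed
   ultimately show "reversal (?d X) (chi L r X Y * ?P Y) = reversal (r Y - r X) (chi L r X Y) *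
    (\<Sum>W\<in>{W \<in> L. Y <= W}. chi L r Y W * ?P W)" by simp
  qed
  also have "\<dots> = (\<Sum>W\<in>{W \<in> L. X \<subset> W}. (\<Sum>Y\<in>{Y \<in> L. X \<subset> Y & Y <= W}.
    reversal (r Y - r X) (chi L r X Y) * chi L r Y W) * ?P W)"
   unfolding sum_distrib_left sum_distrib_right
   by (subst (1 2) sum.Sigma)
    (auto simp: finite_L ac_simps
     intro!: sum.reindex_bij_witness[of _ "%(a, b). (b, a)" "%(a, b). (b, a)"])
  also have "\<dots> = (\<Sum>W\<in>{W \<in> L. X \<subset> W}. (- chi L r X W) * ?P W)"
  proof (intro sum.cong refl arg_cong2[where f="(*)"])
   fix W assume W: "W \<in> {W \<in> L. X \<subset> W}"
   have ins: "interval L X W = insert X {Y \<in> L. X \<subset> Y & Y <= W}"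
    using W less.prems by (auto simp: interval_def)
   have "(\<Sum>Y\<in>interval L X W. reversal (r Y - r X) (chi L r X Y) * chi L r Y W) = 0"
    using W less.prems by (subst chi_kernel) auto
   moreover have "reversal 0 (chi L r X X) = 1" using less.prems by (simp add: chi_self reversal_def)
   ultimately show "(\<Sum>Y\<in>{Y \<in> L. X \<subset> Y & Y <= W}.
     reversal (r Y - r X) (chi L r X Y) * chi L r Y W) = - chi L r X W"
    unfolding ins using finite_L by (subst (asm) sum.insert) (auto simp: eq_neg_iff_add_eq_0 add.commute)
  qed
  also have "\<dots> = - R" by (simp add: R_def sum_negf)
  finally have "reversal (?d X) R = - R" .
  moreover have "degree R <= ?d X" unfolding R_def by (rule degree_sum_le) (auto simp: finite_L intro: degR)
  ultimately have "reversal (?d X) (?P X) = ?P X + R"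
   unfolding P using pos by (intro reversal_lower_half) auto
  also have "\<dots> = (\<Sum>Y\<in>insert X {Y \<in> L. X \<subset> Y}. chi L r X Y * ?P Y)"
   using finite_L less.prems by (subst sum.insert) (auto simp: R_def chi_self)
  also have "insert X {Y \<in> L. X \<subset> Y} = {Y \<in> L. X <= Y}" using less.prems by auto
  finally show ?thesis .
 qed
qed

text \<open>Induction down from the top: all terms above Y agree, so the two candidates at Y have
  the same difference to their reversals.\<close>

lemma klp_unique:
 assumes "X \<in> L"
  and one: "p (\<Union>L) = 1"
  and deg: "!!Y. Y \<in> L ==> X <= Y ==> Y ~= \<Union>L ==> 2 * degree (p Y) < r (\<Union>L) - r Y"
  and rec: "!!Y. Y \<in> L ==> X <= Y ==> Y ~= \<Union>L ==> reversal (r (\<Union>L) - r Y) (p Y) =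
   (\<Sum>Z\<in>{Z \<in> L. Y <= Z}. chi L r Y Z * p Z)"
 shows "p X = klp L r X"
proof -
 have "p Y = klp L r Y" if "Y \<in> L" "X <= Y" for Y
  using that
 proof (induction "card (\<Union>L - Y)" arbitrary: Y rule: less_induct)
  case less
  show ?case
  proof (cases "Y = \<Union>L")
   case True
   then show ?thesis using one by (simp add: klp_top)
  next
   case False
   have ins: "{Z \<in> L. Y <= Z} = insert Y {Z \<in> L. Y \<subset> Z}" using less.prems by auto
   have "(\<Sum>Z\<in>{Z \<in> L. Y \<subset> Z}. chi L r Y Z * p Z) = (\<Sum>Z\<in>{Z \<in> L. Y \<subset> Z}. chi L r Y Z * klp L r Z)"
   proof (intro sum.cong refl arg_cong2[where f="(*)"] less.hyps)
    fix Z assume "Z \<in> {Z \<in> L. Y \<subset> Z}"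
    then show "card (\<Union>L - Z) < card (\<Union>L - Y)" "Z \<in> L" "X <= Z"
     using less.prems finite_Union by (auto intro!: psubset_card_mono)
   qed
   then have "reversal (r (\<Union>L) - r Y) (p Y) - p Y =
     reversal (r (\<Union>L) - r Y) (klp L r Y) - klp L r Y"
    using rec[OF less.prems False] klp_recursion[OF less.prems(1)] less.prems(1) finite_L
    by (simp add: ins chi_self)
   then show ?thesis
    using deg[OF less.prems False] degree_klp[OF less.prems(1) False] by (rule reversal_diff_unique)
  qed
 qed
 then show ?thesis using assms(1) by blast
qed

end

lemma moebius_lower:
 assumes "finite Y" "Y <= F"
 shows "moebius {H \<in> L. H <= F} X Y = moebius L X Y"
 using assms
proof (induction "card Y" arbitrary: Y rule: less_induct)
 case less
 have "{Z \<in> {H \<in> L. H <= F}. X <= Z & Z \<subset> Y} = {Z \<in> L. X <= Z & Z \<subset> Y}"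
  using less.prems by auto
 moreover have "(\<Sum>Z\<in>{Z \<in> L. X <= Z & Z \<subset> Y}. moebius {H \<in> L. H <= F} X Z) =
   (\<Sum>Z\<in>{Z \<in> L. X <= Z & Z \<subset> Y}. moebius L X Z)"
  using less.prems by (intro sum.cong refl less.hyps) (auto intro: psubset_card_mono finite_subset)
 ultimately show ?case by (simp add: moebius.simps[of _ X Y])
qed

text \<open>A Moebius value only sees sets above the lower end of its interval, so an order
  isomorphism between up-closed parts of the two families is enough.\<close>

lemma moebius_iso:
 assumes "!!X. X \<in> U ==> finite X" "!!X. X \<in> U ==> finite (\<phi> X)"
  and "U <= L" "!!X Y. X \<in> U ==> Y \<in> L ==> X <= Y ==> Y \<in> U"
  and "\<phi> ` U <= L'" "!!X Y. X \<in> U ==> Y \<in> L' ==> \<phi> X <= Y ==> Y \<in> \<phi> ` U"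
  and ord: "!!X Y. X \<in> U ==> Y \<in> U ==> \<phi> X <= \<phi> Y \<longleftrightarrow> X <= Y"
  and "X \<in> U" "Y \<in> U"
 shows "moebius L' (\<phi> X) (\<phi> Y) = moebius L X Y"
 using \<open>Y \<in> U\<close>
proof (induction "card Y" arbitrary: Y rule: less_induct)
 case less
 have inj: "\<phi> A = \<phi> B \<longleftrightarrow> A = B" if "A \<in> U" "B \<in> U" for A B
  using ord[of A B] ord[of B A] that by auto
 have sub: "\<phi> A \<subset> \<phi> B \<longleftrightarrow> A \<subset> B" if "A \<in> U" "B \<in> U" for A B
  using ord that inj by (auto simp: psubset_eq)
 have img: "{Z \<in> L'. \<phi> X <= Z & Z \<subset> \<phi> Y} = \<phi> ` {Z \<in> L. X <= Z & Z \<subset> Y}" (is "?A = \<phi> ` ?B")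
 proof (intro equalityI subsetI)
  fix Z assume Z: "Z \<in> ?A"
  then obtain W where "W \<in> U" "Z = \<phi> W" using assms(6)[OF \<open>X \<in> U\<close>, of Z] by auto
  then show "Z \<in> \<phi> ` ?B" using Z ord sub \<open>X \<in> U\<close> less.prems assms(3) by auto
 next
  fix Z assume "Z \<in> \<phi> ` ?B"
  then obtain W where W: "W \<in> ?B" "Z = \<phi> W" by auto
  then have "W \<in> U" using assms(4)[OF \<open>X \<in> U\<close>, of W] by auto
  then show "Z \<in> ?A" using W ord sub \<open>X \<in> U\<close> less.prems assms(5) by auto
 qed
 have BU: "?B <= U" using assms(4)[OF \<open>X \<in> U\<close>] by auto
 have "(\<Sum>Z\<in>?A. moebius L' (\<phi> X) Z) = (\<Sum>Z\<in>?B. moebius L' (\<phi> X) (\<phi> Z))"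
  unfolding img by (subst sum.reindex) (use BU inj in \<open>auto simp: inj_on_def subset_iff\<close>)
 also have "\<dots> = (\<Sum>Z\<in>?B. moebius L X Z)"
 proof (intro sum.cong refl less.hyps)
  fix Z assume "Z \<in> ?B"
  then show "card Z < card Y" "Z \<in> U"
   using assms(1)[OF less.prems] BU by (auto intro!: psubset_card_mono)
 qed
 finally show ?case
  using inj[OF \<open>X \<in> U\<close> less.prems] sub[OF \<open>X \<in> U\<close> less.prems] assms(1,2)[OF less.prems]
  by (simp add: moebius.simps[of L' "\<phi> X"] moebius.simps[of L X])
qed

text \<open>The polynomial at X depends on the upper interval and on rank differences only. The rank
  hypothesis is written with sums to avoid subtraction of naturals. It serves contractions,
  relabellings and the quotients of complete graphs.\<close>

lemma klp_iso:
 assumes L: "ranked_family L r" and L': "ranked_family L' r'"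
  and X: "X \<in> L" and X': "X' \<in> L'"
  and bij: "bij_betw \<phi> {Y \<in> L. X <= Y} {Y \<in> L'. X' <= Y}"
  and ord: "!!Y Z. Y \<in> L ==> X <= Y ==> Z \<in> L ==> X <= Z ==> \<phi> Y <= \<phi> Z \<longleftrightarrow> Y <= Z"
  and rank: "!!Y. Y \<in> L ==> X <= Y ==> r' (\<phi> Y) + r X = r Y + r' X'"
 shows "klp L r X = klp L' r' X'"
proof -
 interpret A: ranked_family L r by fact
 interpret B: ranked_family L' r' by fact
 define U where "U = {Y \<in> L. X <= Y}"
 have img: "\<phi> ` U = {Y \<in> L'. X' <= Y}" using bij by (simp add: bij_betw_def U_def)
 have inj: "inj_on \<phi> U" using bij by (simp add: bij_betw_def U_def)
 have ordU: "\<phi> Y <= \<phi> Z \<longleftrightarrow> Y <= Z" if "Y \<in> U" "Z \<in> U" for Y Z using ord that by (auto simp: U_def)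
 have XU: "X \<in> U" and TU: "\<Union>L \<in> U" using X A.top_in by (auto simp: U_def)
 have phiX: "\<phi> X = X'"
 proof -
  have "X' \<in> \<phi> ` U" using img X' by auto
  then obtain W where W: "W \<in> U" "X' = \<phi> W" by auto
  then have "\<phi> X <= X'" using ordU[OF XU W(1)] by (simp add: U_def)
  then show ?thesis using img XU by auto
 qed
 have phiT: "\<phi> (\<Union>L) = \<Union>L'"
 proof -
  have "\<Union>L' \<in> \<phi> ` U" using img B.top_in X' by auto
  then obtain W where W: "W \<in> U" "\<Union>L' = \<phi> W" by auto
  then have "\<Union>L' <= \<phi> (\<Union>L)" using ordU[OF W(1) TU] by (auto simp: U_def)
  then show ?thesis using img TU by auto
 qed
 have mem: "\<phi> Y \<in> L'" if "Y \<in> U" for Y using img that by auto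
 have moeb: "moebius L' (\<phi> Y) (\<phi> Z) = moebius L Y Z" if "Y \<in> U" "Z \<in> U" for Y Z
 proof (rule moebius_iso[where U=U])
  show "finite W" "finite (\<phi> W)" if "W \<in> U" for W
   using that A.finite_member B.finite_member mem by (auto simp: U_def)
  show "W \<in> \<phi> ` U" if "V \<in> U" "W \<in> L'" "\<phi> V <= W" for V W using img that by auto
 qed (use ordU that mem in \<open>auto simp: U_def\<close>)
 have up: "{Z \<in> L'. \<phi> Y <= Z} = \<phi> ` {Z \<in> L. Y <= Z}" if "Y \<in> U" for Y
 proof (intro equalityI subsetI)
  fix Z assume Z: "Z \<in> {Z \<in> L'. \<phi> Y <= Z}"
  then have "Z \<in> \<phi> ` U" using img that by auto
  then show "Z \<in> \<phi> ` {Z \<in> L. Y <= Z}" using Z ordU[OF that] by (auto simp: U_def)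
 next
  fix Z assume "Z \<in> \<phi> ` {Z \<in> L. Y <= Z}"
  then obtain W where W: "W \<in> L" "Y <= W" "Z = \<phi> W" by auto
  then have "W \<in> U" using that by (auto simp: U_def)
  then show "Z \<in> {Z \<in> L'. \<phi> Y <= Z}" using W ordU[OF that] mem by auto
 qed
 have rdiff: "r' (\<phi> Z) - r' (\<phi> Y) = r Z - r Y" if "Y \<in> U" "Z \<in> U" "Y <= Z" for Y Z
  using rank[of Y] rank[of Z] that by (auto simp: U_def)
 have chi: "chi L' r' (\<phi> Y) (\<phi> Z) = chi L r Y Z" if "Y \<in> U" "Z \<in> U" for Y Z
 proof -
  have "interval L' (\<phi> Y) (\<phi> Z) = \<phi> ` interval L Y Z"
  proof -
   have "interval L' (\<phi> Y) (\<phi> Z) = {W \<in> \<phi> ` {W \<in> L. Y <= W}. W <= \<phi> Z}"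
    by (simp add: interval_def flip: up[OF that(1)])
   also have "\<dots> = \<phi> ` {W \<in> {W \<in> L. Y <= W}. \<phi> W <= \<phi> Z}" by blast
   also have "{W \<in> {W \<in> L. Y <= W}. \<phi> W <= \<phi> Z} = interval L Y Z"
    using ordU[OF _ that(2)] that by (auto simp: interval_def U_def)
   finally show ?thesis .
  qed
  moreover have sub: "interval L Y Z <= U" using that by (auto simp: interval_def U_def)
  ultimately have "chi L' r' (\<phi> Y) (\<phi> Z) =
    (\<Sum>V\<in>interval L Y Z. monom (moebius L' (\<phi> Y) (\<phi> V)) (r' (\<phi> Z) - r' (\<phi> V)))"
   unfolding chi_def using inj_on_subset[OF inj sub] by (simp add: sum.reindex)
  also have "\<dots> = chi L r Y Z"
   unfolding chi_def
   by (intro sum.cong refl arg_cong2[where f=monom] moeb rdiff)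
    (use sub that in \<open>auto simp: interval_def\<close>)
  finally show ?thesis .
 qed
 have "klp L' r' (\<phi> X) = klp L r X"
 proof (rule A.klp_unique[OF X])
  show "klp L' r' (\<phi> (\<Union>L)) = 1" by (simp add: phiT B.klp_top)
 next
  fix Y assume Y: "Y \<in> L" "X <= Y" "Y ~= \<Union>L"
  then have YU: "Y \<in> U" by (simp add: U_def)
  then have "\<phi> Y ~= \<Union>L'" using inj TU Y(3) phiT by (metis inj_onD)
  then show "2 * degree (klp L' r' (\<phi> Y)) < r (\<Union>L) - r Y"
   using B.degree_klp[of "\<phi> Y"] mem[OF YU] rdiff[OF YU TU Union_upper[OF Y(1)]] phiT by simp
  have "reversal (r (\<Union>L) - r Y) (klp L' r' (\<phi> Y)) =
   (\<Sum>Z\<in>{Z \<in> L'. \<phi> Y <= Z}. chi L' r' (\<phi> Y) Z * klp L' r' Z)"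
   using B.klp_recursion[OF mem[OF YU]] rdiff[OF YU TU Union_upper[OF Y(1)]] phiT by simp
  also have "\<dots> = (\<Sum>Z\<in>{Z \<in> L. Y <= Z}. chi L' r' (\<phi> Y) (\<phi> Z) * klp L' r' (\<phi> Z))"
   unfolding up[OF YU] by (subst sum.reindex) (use Y in \<open>auto intro!: inj_on_subset[OF inj] simp: U_def\<close>)
  also have "\<dots> = (\<Sum>Z\<in>{Z \<in> L. Y <= Z}. chi L r Y Z * klp L' r' (\<phi> Z))"
   by (intro sum.cong refl, subst chi) (use Y in \<open>auto simp: U_def\<close>)
  finally show "reversal (r (\<Union>L) - r Y) (klp L' r' (\<phi> Y)) =
   (\<Sum>Z\<in>{Z \<in> L. Y <= Z}. chi L r Y Z * klp L' r' (\<phi> Z))" .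
 qed
 then show ?thesis by (simp add: phiX)
qed


section \<open>Rank and flats of matroids\<close>

context
 fixes M :: "'a matroid"
 assumes M: "matroid M"
begin

lemma finite_ground: "finite (ground M)"
 and indep_subset_ground: "I \<in> indep M ==> I <= ground M"
 and indep_empty: "{} \<in> indep M"
 and indep_subset: "I \<in> indep M ==> J <= I ==> J \<in> indep M"
 and indep_augment: "I \<in> indep M ==> J \<in> indep M ==> card I < card J ==>
  \<exists>x\<in>J - I. insert x I \<in> indep M"
 using M unfolding matroid_def by blast+

lemma finite_indep: "I \<in> indep M ==> finite I"
 using finite_ground indep_subset_ground finite_subset by metis

lemma finite_indep_subsets: "finite {I \<in> indep M. I <= A}"
 by (rule finite_subset[of _ "Pow (ground M)"]) (use finite_ground indep_subset_ground in auto)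

lemma rank_ge: "I \<in> indep M ==> I <= A ==> card I <= rank_of M A"
 unfolding rank_of_def using finite_indep_subsets by (intro Max_ge) auto

lemma rank_basis: obtains I where "I \<in> indep M" "I <= A" "card I = rank_of M A"
proof -
 have "rank_of M A \<in> card ` {I \<in> indep M. I <= A}"
  unfolding rank_of_def using finite_indep_subsets indep_empty by (intro Max_in) auto
 then show ?thesis using that by auto
qed

lemma basis_extend:
 assumes "B \<in> indep M" "B <= A"
 obtains C where "C \<in> indep M" "B <= C" "C <= A" "card C = rank_of M A"
proof -
 have "\<exists>C. C \<in> indep M & B <= C & C <= A & card C = rank_of M A"
  using assms
 proof (induction "rank_of M A - card B" arbitrary: B rule: less_induct)
  case less
  obtain J where J: "J \<in> indep M" "J <= A" "card J = rank_of M A" by (rule rank_basis)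
  show ?case
  proof (cases "card B = rank_of M A")
   case False
   then have lt: "card B < card J" using rank_ge[OF less.prems] J by simp
   then obtain x where x: "x \<in> J - B" "insert x B \<in> indep M"
    using indep_augment less.prems J by blast
   have "card (insert x B) = Suc (card B)" using x finite_indep less.prems by simp
   then have "\<exists>C. C \<in> indep M & insert x B <= C & C <= A & card C = rank_of M A"
    using x less.prems J lt by (intro less.hyps) auto
   then show ?thesis by blast
  qed (use less.prems in blast)
 qed
 then show ?thesis using that by blast
qed

lemma rank_mono: "A <= B ==> rank_of M A <= rank_of M B"
proof -
 assume "A <= B"
 obtain I where "I \<in> indep M" "I <= A" "card I = rank_of M A" by (rule rank_basis)
 then show ?thesis using rank_ge[of I B] \<open>A <= B\<close> by auto
qed

lemma rank_indep: "I \<in> indep M ==> rank_of M I = card I"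
proof -
 assume "I \<in> indep M"
 obtain J where "J \<in> indep M" "J <= I" "card J = rank_of M I" by (rule rank_basis)
 then show ?thesis
  using rank_ge[of I I] card_mono[of I J] finite_indep[of I] \<open>I \<in> indep M\<close> by auto
qed

lemma indepI_rank: "finite I ==> rank_of M I = card I ==> I \<in> indep M"
proof -
 assume "finite I" "rank_of M I = card I"
 obtain J where "J \<in> indep M" "J <= I" "card J = rank_of M I" by (rule rank_basis)
 then show ?thesis using card_subset_eq[of I J] \<open>finite I\<close> \<open>rank_of M I = card I\<close> by auto
qed

lemma rank_eq_card:
 assumes "B \<in> indep M" "B <= A" "!!x. x \<in> A - B ==> insert x B ~: indep M"
 shows "rank_of M A = card B"
proof -
 obtain C where C: "C \<in> indep M" "B <= C" "C <= A" "card C = rank_of M A"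
  using assms(1,2) by (rule basis_extend)
 have "C <= B"
 proof
  fix x assume "x \<in> C"
  then have "insert x B \<in> indep M" using C indep_subset by (metis insert_subset)
  then show "x \<in> B" using assms(3) \<open>x \<in> C\<close> C by blast
 qed
 then show ?thesis using C by auto
qed

text \<open>A basis of X Un F that extends B meets F in an independent set containing B, hence
  exactly in B, so it lies in X Un B.\<close>

lemma rank_union_basis:
 assumes "B \<in> indep M" "B <= F" "card B = rank_of M F"
 shows "rank_of M (X Un B) = rank_of M (X Un F)"
proof (rule order_antisym)
 show "rank_of M (X Un B) <= rank_of M (X Un F)" using assms by (intro rank_mono) auto
 obtain C where C: "C \<in> indep M" "B <= C" "C <= X Un F" "card C = rank_of M (X Un F)"
  using basis_extend[of B "X Un F"] assms by blast
 have "C Int F \<in> indep M" using C indep_subset by blast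
 then have "card (C Int F) <= card B" using rank_ge assms by simp
 then have "B = C Int F" using C assms finite_indep by (intro card_seteq) auto
 then have "C <= X Un B" using C by auto
 then show "rank_of M (X Un F) <= rank_of M (X Un B)" using rank_ge C by metis
qed

text \<open>Monotonicity of closure: both A and \<open>insert x A\<close> may be replaced by a
  common basis contained in A, which adds nothing to B.\<close>

lemma rank_insert_stable:
 assumes "rank_of M (insert x A) = rank_of M A" "A <= B"
 shows "rank_of M (insert x B) = rank_of M B"
proof -
 obtain C where C: "C \<in> indep M" "C <= A" "card C = rank_of M A" by (rule rank_basis)
 then have "rank_of M (B Un C) = rank_of M (B Un insert x A)"
  using assms by (intro rank_union_basis) auto
 moreover have "B Un C = B" "B Un insert x A = insert x B" using C assms by auto
 ultimately show ?thesis by simp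
qed

lemma rank_insert_le: "rank_of M (insert x A) <= Suc (rank_of M A)"
proof -
 obtain C where C: "C \<in> indep M" "C <= insert x A" "card C = rank_of M (insert x A)"
  by (rule rank_basis)
 then have "card (C - {x}) <= rank_of M A" using indep_subset by (intro rank_ge) auto
 moreover have "card C <= Suc (card (C - {x}))" using finite_indep[OF C(1)] 
  by (cases "x \<in> C") (auto simp: card_Diff_singleton_if)
 ultimately show ?thesis using C by simp
qed

lemma flats_subset: "F \<in> flats M ==> F <= ground M"
 by (auto simp: flats_def)

lemma ground_flat: "ground M \<in> flats M"
 by (auto simp: flats_def)

lemma Union_flats: "\<Union>(flats M) = ground M"
 using flats_subset ground_flat by auto

lemma ranked_family_flats: "ranked_family (flats M) (rank_of M)"
proof
 show "finite (\<Union>(flats M))" "\<Union>(flats M) \<in> flats M"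
  by (simp_all add: Union_flats finite_ground ground_flat)
 fix X Y assume *: "X \<in> flats M" "Y \<in> flats M" "X \<subset> Y"
 then obtain x where x: "x \<in> Y - X" by auto
 then have "x \<in> ground M - X" using * flats_subset[of Y] by blast
 then have "rank_of M X < rank_of M (insert x X)" using *(1) by (simp add: flats_def)
 also have "\<dots> <= rank_of M Y" using x * by (intro rank_mono) auto
 finally show "rank_of M X < rank_of M Y" .
qed

lemma empty_flat: "loopless M ==> {} \<in> flats M"
 using rank_indep[OF indep_empty] rank_indep by (auto simp: flats_def loopless_def)

lemma rank_restriction: "A <= F ==> rank_of (restriction M F) A = rank_of M A"
 unfolding rank_of_def restriction_def by (rule arg_cong[where f="%S. Max (card ` S)"]) auto

lemma flats_restriction:
 assumes "F \<in> flats M"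
 shows "flats (restriction M F) = {H \<in> flats M. H <= F}"
proof (intro equalityI subsetI)
 fix H assume H: "H \<in> flats (restriction M F)"
 then have HF: "H <= F" by (auto simp: flats_def restriction_def)
 have "rank_of M H < rank_of M (insert x H)" if x: "x \<in> ground M - H" for x
 proof (cases "x \<in> F")
  case True
  then have "rank_of (restriction M F) H < rank_of (restriction M F) (insert x H)"
   using H x by (auto simp: flats_def restriction_def)
  then show ?thesis using True HF rank_restriction[of H F] rank_restriction[of "insert x H" F]
   by simp
 next
  case False
  then have "rank_of M F < rank_of M (insert x F)" using x assms by (auto simp: flats_def)
  then have "rank_of M (insert x H) ~= rank_of M H" using rank_insert_stable[OF _ HF, of x] by auto
  moreover have "rank_of M H <= rank_of M (insert x H)" by (intro rank_mono) auto
  ultimately show ?thesis by simp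
 qed
 then show "H \<in> {H \<in> flats M. H <= F}" using HF flats_subset[OF assms] by (auto simp: flats_def)
next
 fix H assume H: "H \<in> {H \<in> flats M. H <= F}"
 have "rank_of (restriction M F) H < rank_of (restriction M F) (insert x H)" if "x \<in> F - H" for x
  using H that rank_restriction[of H F] rank_restriction[of "insert x H" F] flats_subset[OF assms]
  by (auto simp: flats_def)
 then show "H \<in> flats (restriction M F)" using H by (auto simp: flats_def restriction_def)
qed

lemma characteristic_poly_restriction:
 assumes "loopless M" "F \<in> flats M"
 shows "characteristic_poly (restriction M F) = chi (flats M) (rank_of M) {} F"
proof -
 have fl: "flats (restriction M F) = {H \<in> flats M. H <= F}" using assms by (simp add: flats_restriction)
 have "\<Inter>(flats (restriction M F)) = {}" using fl empty_flat[OF assms(1)] by auto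
 moreover have "moebius {H \<in> flats M. H <= F} {} H = moebius (flats M) {} H" if "H <= F" for H
  using that flats_subset[OF assms(2)] finite_ground
  by (intro moebius_lower) (auto intro: finite_subset)
 moreover have grd: "ground (restriction M F) = F" by (simp add: restriction_def)
 moreover have "interval (flats M) {} F = {H \<in> flats M. H <= F}" by (auto simp: interval_def)
 ultimately show ?thesis
  unfolding characteristic_poly_def chi_def fl
  by (intro sum.cong) (auto simp: rank_restriction grd)
qed

end

context
 fixes M :: "'a matroid"
 assumes M: "matroid M"
begin

lemma ground_contraction: "ground (contraction M F) = ground M - F"
 by (simp add: contraction_def)

text \<open>Contracting F amounts to contracting a fixed basis of F. The matroid axioms for the
  contraction then reduce to those of M applied to sets containing that basis.\<close>

lemma indep_contraction_iff:
 assumes "F <= ground M" "B \<in> indep M" "B <= F" "card B = rank_of M F"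
 shows "I \<in> indep (contraction M F) \<longleftrightarrow> I Int F = {} & I Un B \<in> indep M"
proof -
 have *: "rank_of M (I Un B) = rank_of M (I Un F)" using assms by (intro rank_union_basis[OF M]) auto
 have card: "card (I Un B) = card I + card B" if "I Int F = {}" "finite I"
  using that assms finite_indep[OF M] by (intro card_Un_disjoint) auto
 show ?thesis
 proof
  assume I: "I \<in> indep (contraction M F)"
  then have fin: "finite I" "I Int F = {}" "finite (I Un B)"
   using finite_ground[OF M] finite_indep[OF M assms(2)] by (auto simp: contraction_def intro: finite_subset)
  then have "I Un B \<in> indep M"
   using I * card assms(4) by (intro indepI_rank[OF M]) (auto simp: contraction_def)
  then show "I Int F = {} & I Un B \<in> indep M" using fin by simp
 next
  assume I: "I Int F = {} & I Un B \<in> indep M"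
  then have "finite I" using finite_indep[OF M] by auto
  then show "I \<in> indep (contraction M F)"
   using I * card assms(4) rank_indep[OF M, of "I Un B"] indep_subset_ground[OF M, of "I Un B"]
   by (auto simp: contraction_def)
 qed
qed

lemma matroid_contraction:
 assumes "F <= ground M"
 shows "matroid (contraction M F)"
proof -
 obtain B where B: "B \<in> indep M" "B <= F" "card B = rank_of M F" by (rule rank_basis[OF M])
 note iff = indep_contraction_iff[OF assms B]
 show ?thesis
  unfolding matroid_def
 proof (intro conjI ballI allI impI)
  show "finite (ground (contraction M F))" using finite_ground[OF M] by (simp add: ground_contraction)
  show "indep (contraction M F) <= Pow (ground (contraction M F))" by (auto simp: contraction_def)
  show "{} \<in> indep (contraction M F)" using B by (simp add: iff)
 next
  fix I J assume "I \<in> indep (contraction M F)" "J <= I"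
  then show "J \<in> indep (contraction M F)"
   using indep_subset[OF M, of "I Un B" "J Un B"] by (auto simp: iff)
 next
  fix I J assume IJ: "I \<in> indep (contraction M F)" "J \<in> indep (contraction M F)" "card I < card J"
  have *: "card (K Un B) = card K + card B" if "K \<in> indep (contraction M F)" for K
   using that B finite_indep[OF M, of "K Un B"] by (intro card_Un_disjoint) (auto simp: iff)
  have "card (I Un B) < card (J Un B)" using *[OF IJ(1)] *[OF IJ(2)] IJ(3) by simp
  then obtain x where "x \<in> (J Un B) - (I Un B)" "insert x (I Un B) \<in> indep M"
   using indep_augment[OF M] IJ by (meson iff)
  then show "\<exists>x\<in>J - I. insert x I \<in> indep (contraction M F)" using IJ by (auto simp: iff)
 qed
qed

lemma rank_contraction:
 assumes F: "F <= ground M" and A: "A Int F = {}"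
 shows "rank_of (contraction M F) A + rank_of M F = rank_of M (A Un F)"
proof -
 obtain B where B: "B \<in> indep M" "B <= F" "card B = rank_of M F" by (rule rank_basis[OF M])
 note iff = indep_contraction_iff[OF F B]
 have *: "rank_of M (A Un B) = rank_of M (A Un F)" using B by (intro rank_union_basis[OF M]) auto
 obtain C where C: "C \<in> indep M" "B <= C" "C <= A Un B" "card C = rank_of M (A Un B)"
  using basis_extend[OF M, of B "A Un B"] B by blast
 define I where "I = C - B"
 have I: "I <= A" "I Int F = {}" "I Un B = C" using C A by (auto simp: I_def)
 have cardI: "card C = card I + card B"
  unfolding I_def using C(2) finite_indep[OF M C(1)] finite_indep[OF M B(1)]
  by (simp add: card_Diff_subset card_mono)
 have "I \<in> indep (contraction M F)" using I C by (simp add: iff)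
 moreover have "insert x I ~: indep (contraction M F)" if x: "x \<in> A - I" for x
 proof
  assume "insert x I \<in> indep (contraction M F)"
  then have "insert x C \<in> indep M" using I by (simp add: iff)
  moreover have "x ~: C" using x A B by (auto simp: I_def)
  ultimately have "Suc (card C) <= rank_of M (A Un B)"
   using rank_ge[OF M, of "insert x C" "A Un B"] x C finite_indep[OF M C(1)] by auto
  then show False using C by simp
 qed
 ultimately have "rank_of (contraction M F) A = card I"
  using I matroid_contraction[OF F] by (intro rank_eq_card) auto
 then show ?thesis using cardI C B * by simp
qed


lemma rank_contraction_flat:
 assumes "F <= ground M" "F <= H"
 shows "rank_of (contraction M F) (H - F) + rank_of M F = rank_of M H"
proof -
 have "(H - F) Int F = {}" "(H - F) Un F = H" using assms(2) by auto
 then show ?thesis using rank_contraction[OF assms(1), of "H - F"] by simp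
qed

lemma flats_contraction:
 assumes F: "F \<in> flats M"
 shows "flats (contraction M F) = (%H. H - F) ` {H \<in> flats M. F <= H}"
proof -
 have FM: "F <= ground M" using F flats_subset[OF M] by auto
 have key: "H - F \<in> flats (contraction M F) \<longleftrightarrow> H \<in> flats M" if "F <= H" "H <= ground M" for H
 proof -
  have "rank_of (contraction M F) (H - F) < rank_of (contraction M F) (insert x (H - F)) \<longleftrightarrow>
    rank_of M H < rank_of M (insert x H)" if x: "x \<in> ground M - H" for x
  proof -
   have "insert x (H - F) = insert x H - F" using x \<open>F <= H\<close> by auto
   then have eq: "rank_of (contraction M F) (insert x (H - F)) = rank_of (contraction M F) (insert x H - F)"
    by simp
   show ?thesis
    unfolding eq
    using rank_contraction_flat[OF FM \<open>F <= H\<close>]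
     rank_contraction_flat[OF FM subset_insertI2[OF \<open>F <= H\<close>], of x]
    by linarith
  qed
  moreover have "ground M - F - (H - F) = ground M - H" using that by auto
  ultimately show ?thesis using that by (auto simp: flats_def ground_contraction)
 qed
 show ?thesis
 proof (intro equalityI subsetI)
  fix K assume K: "K \<in> flats (contraction M F)"
  then have "K <= ground M - F" by (auto simp: flats_def ground_contraction)
  then have "(K Un F) - F = K" "F <= K Un F" "K Un F <= ground M" using FM by auto
  then show "K \<in> (%H. H - F) ` {H \<in> flats M. F <= H}" using key[of "K Un F"] K
   by (intro image_eqI[of _ _ "K Un F"]) auto
 next
  fix K assume "K \<in> (%H. H - F) ` {H \<in> flats M. F <= H}"
  then show "K \<in> flats (contraction M F)" using key flats_subset[OF M] by auto
 qed
qed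

lemma rank_empty: "rank_of M {} = 0"
 using rank_indep[OF M indep_empty[OF M]] by simp

lemma loopless_contraction:
 assumes F: "F \<in> flats M"
 shows "loopless (contraction M F)"
 unfolding loopless_def
proof
 fix x assume x: "x \<in> ground (contraction M F)"
 then have "rank_of M F < rank_of M (insert x F)" using F by (auto simp: flats_def ground_contraction)
 then have "rank_of M (insert x F) = Suc (rank_of M F)" using rank_insert_le[OF M, of x F] by simp
 then show "{x} \<in> indep (contraction M F)" using x by (auto simp: contraction_def)
qed

text \<open>Subtracting F is an order isomorphism from the flats above F to the flats of the
  contraction, and it lowers all ranks by the rank of F.\<close>

lemma klp_contraction:
 assumes F: "F \<in> flats M"
 shows "klp (flats (contraction M F)) (rank_of (contraction M F)) {} = klp (flats M) (rank_of M) F"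
proof -
 have FM: "F <= ground M" using F flats_subset[OF M] by auto
 let ?N = "contraction M F"
 have N: "matroid ?N" by (rule matroid_contraction[OF FM])
 show ?thesis
 proof (rule klp_iso[symmetric, where \<phi>="%H. H - F"])
  show "ranked_family (flats M) (rank_of M)" "ranked_family (flats ?N) (rank_of ?N)"
   by (rule ranked_family_flats, fact)+
  show "{} \<in> flats ?N" by (rule empty_flat[OF N loopless_contraction[OF F]])
  show "bij_betw (%H. H - F) {H \<in> flats M. F <= H} {H \<in> flats ?N. {} <= H}"
   unfolding bij_betw_def by (auto simp: flats_contraction[OF F] inj_on_def)
  show "rank_of ?N (H - F) + rank_of M F = rank_of M H + rank_of ?N {}" if "F <= H" for H
   using rank_contraction_flat[OF FM that] rank_contraction_flat[OF FM, of F] by auto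
 qed (use F in auto)
qed

end

section \<open>Isomorphism invariance, and the unique family satisfying the definition\<close>

lemma matroid_iso_rank:
 assumes f: "bij_betw f (ground M) (ground N)"
  and ind: "!!X. X <= ground M ==> X \<in> indep M \<longleftrightarrow> f ` X \<in> indep N"
  and M: "matroid M" and A: "A <= ground M"
 shows "rank_of N (f ` A) = rank_of M A"
proof -
 have inj: "inj_on f (ground M)" using f by (simp add: bij_betw_def)
 have "{I \<in> indep N. I <= f ` A} = (`) f ` {I \<in> indep M. I <= A}"
  using A ind indep_subset_ground[OF M] by (fastforce simp: subset_image_iff)
 moreover have "card (f ` I) = card I" if "I \<in> indep M" for I
  using inj indep_subset_ground[OF M that] by (meson card_image inj_on_subset)
 ultimately have "card ` {I \<in> indep N. I <= f ` A} = card ` {I \<in> indep M. I <= A}"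
  by (auto simp: image_image)
 then show ?thesis by (simp add: rank_of_def)
qed

lemma matroid_iso_flats:
 assumes f: "bij_betw f (ground M) (ground N)"
  and ind: "!!X. X <= ground M ==> X \<in> indep M \<longleftrightarrow> f ` X \<in> indep N"
  and M: "matroid M"
 shows "flats N = (`) f ` flats M"
proof -
 have inj: "inj_on f (ground M)" and img: "f ` ground M = ground N" using f by (auto simp: bij_betw_def)
 have key: "f ` F \<in> flats N \<longleftrightarrow> F \<in> flats M" if F: "F <= ground M" for F
 proof -
  have "ground N - f ` F = f ` (ground M - F)" using inj img F by (metis inj_on_image_set_diff Diff_subset)
  moreover have "f ` F <= ground N" using F img by auto
  ultimately have "f ` F \<in> flats N \<longleftrightarrow> (\<forall>x\<in>ground M - F. rank_of N (f ` F) < rank_of N (f ` insert x F))"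
   by (auto simp: flats_def)
  also have "\<dots> \<longleftrightarrow> (\<forall>x\<in>ground M - F. rank_of M F < rank_of M (insert x F))"
   using F by (intro ball_cong refl) (auto simp: matroid_iso_rank[OF f ind M] simp del: image_insert)
  finally show ?thesis using F by (auto simp: flats_def)
 qed
 show ?thesis
 proof (intro equalityI subsetI)
  fix K assume K: "K \<in> flats N"
  then have "K <= f ` ground M" using img by (auto simp: flats_def)
  then obtain F where "F <= ground M" "K = f ` F" by (auto simp: subset_image_iff)
  then show "K \<in> (`) f ` flats M" using key K by auto
 next
  fix K assume "K \<in> (`) f ` flats M"
  then show "K \<in> flats N" using key flats_subset[OF M] by auto
 qed
qed

lemma klp_matroid_iso:
 assumes "matroid M" "loopless M" "matroid N" "loopless N" "matroid_iso M N"
 shows "klp (flats M) (rank_of M) {} = klp (flats N) (rank_of N) {}"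
proof -
 obtain f where f: "bij_betw f (ground M) (ground N)"
  and ind: "!!X. X <= ground M ==> X \<in> indep M \<longleftrightarrow> f ` X \<in> indep N"
  using assms(5) by (auto simp: matroid_iso_def)
 have inj: "inj_on f (ground M)" using f by (simp add: bij_betw_def)
 note sub = flats_subset[OF assms(1)]
 show ?thesis
 proof (rule klp_iso[where \<phi>="(`) f"])
  show "bij_betw ((`) f) {Y \<in> flats M. {} <= Y} {Y \<in> flats N. {} <= Y}"
   unfolding bij_betw_def
   using matroid_iso_flats[OF f ind assms(1)] sub inj_on_image_eq_iff[OF inj]
   by (simp add: inj_on_def)
  show "f ` Y <= f ` Z \<longleftrightarrow> Y <= Z" if "Y \<in> flats M" "Z \<in> flats M" for Y Z
   proof
   assume "f ` Y <= f ` Z"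
   then show "Y <= Z" using that sub inj_onD[OF inj] by blast
  qed auto
  show "rank_of N (f ` Y) + rank_of M {} = rank_of M Y + rank_of N {}" if "Y \<in> flats M" for Y
   using that sub matroid_iso_rank[OF f ind assms(1)] assms(1,3) by (simp add: rank_empty)
 qed (use assms in \<open>auto intro: ranked_family_flats empty_flat\<close>)
qed

definition kl_of :: "'a matroid => int poly" where
 "kl_of M = (if matroid M & loopless M then klp (flats M) (rank_of M) {} else 0)"

lemma rank_ground_eq_0:
 assumes "matroid M" "loopless M"
 shows "rk M = 0 \<longleftrightarrow> ground M = {}"
 using ranked_family.top_rank[OF ranked_family_flats[OF assms(1)] empty_flat[OF assms]]
  Union_flats[OF assms(1)] rank_empty[OF assms(1)]
 by fastforce

lemma kl_of_rec_sum:
 assumes "matroid M" "loopless M"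
 shows "(\<Sum>F\<in>flats M. characteristic_poly (restriction M F) * kl_of (contraction M F)) =
  (\<Sum>F\<in>flats M. chi (flats M) (rank_of M) {} F * klp (flats M) (rank_of M) F)"
 using assms flats_subset[OF assms(1)]
 by (intro sum.cong refl)
  (auto simp: characteristic_poly_restriction kl_of_def matroid_contraction loopless_contraction klp_contraction)

lemma kl_of_props:
 assumes "matroid M" "loopless M"
 shows "rk M = 0 ==> kl_of M = 1"
  and "rk M > 0 ==> 2 * degree (kl_of M) < rk M"
  and "reversal (rk M) (kl_of M) =
   (\<Sum>F\<in>flats M. characteristic_poly (restriction M F) * kl_of (contraction M F))"
proof -
 interpret ranked_family "flats M" "rank_of M" by (rule ranked_family_flats[OF assms(1)])
 note E = empty_flat[OF assms]
 note U = Union_flats[OF assms(1)] and r0 = rank_empty[OF assms(1)]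
 have kl: "kl_of M = klp (flats M) (rank_of M) {}" using assms by (simp add: kl_of_def)
 show "kl_of M = 1" if "rk M = 0"
  using klp_top that rank_ground_eq_0[OF assms] unfolding U kl by simp
 show "2 * degree (kl_of M) < rk M" if "rk M > 0"
 proof -
  have "{} ~= ground M" using that r0 by (metis less_irrefl)
  then show ?thesis using degree_klp[OF E] unfolding U kl r0 by simp
 qed
 show "reversal (rk M) (kl_of M) =
   (\<Sum>F\<in>flats M. characteristic_poly (restriction M F) * kl_of (contraction M F))"
  unfolding kl_of_rec_sum[OF assms] using klp_recursion[OF E] unfolding U kl r0 by simp
qed

lemma kl_family_kl_of: "kl_family (kl_of :: 'a matroid => int poly)"
proof -
 have "kl_of M = kl_of N"
  if "matroid M" "loopless M" "matroid N" "loopless N" "matroid_iso M N" for M N :: "'a matroid"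
  unfolding kl_of_def using klp_matroid_iso[OF that] that(1-4) by (simp only: simp_thms if_True)
 moreover have "kl_of M = 0" if "\<not> (matroid M & loopless M)" for M :: "'a matroid"
  unfolding kl_of_def using that by (simp only: if_False)
 ultimately show ?thesis unfolding kl_family_def using kl_of_props by blast
qed

lemma contraction_empty:
 assumes "matroid M" shows "contraction M {} = M"
proof -
 have "{I. I <= ground M & rank_of M I = card I} = indep M"
 proof (intro equalityI subsetI)
  fix I assume "I \<in> {I. I <= ground M & rank_of M I = card I}"
  then show "I \<in> indep M"
   using indepI_rank[OF assms, of I] finite_subset[OF _ finite_ground[OF assms]] by blast
 next
  fix I assume "I \<in> indep M"
  then show "I \<in> {I. I <= ground M & rank_of M I = card I}"
   using rank_indep[OF assms] indep_subset_ground[OF assms] by blast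
 qed
 then show ?thesis unfolding contraction_def by (simp add: rank_empty[OF assms])
qed

text \<open>Induction on the size of the ground set. The empty flat contributes the value at M
  itself and every other flat a contraction with fewer elements, so two families differ by the same
  amount from their reversals at M.\<close>

lemma kl_family_unique:
 assumes Q: "kl_family (Q :: 'a matroid => int poly)"
 shows "Q = kl_of"
proof
 fix M :: "'a matroid"
 note K = kl_family_kl_of[where 'a='a]
 show "Q M = kl_of M"
 proof (induction "card (ground M)" arbitrary: M rule: less_induct)
  case less
  consider "\<not> (matroid M & loopless M)" | "matroid M" "loopless M" "rk M = 0" | "matroid M" "loopless M" "rk M > 0"
   by blast
  then show ?case
  proof cases
   case 1
   then show ?thesis using Q by (auto simp: kl_family_def kl_of_def)
  next
   case 2
   then show ?thesis using Q K unfolding kl_family_def by metis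
  next
   case 3
   note E = empty_flat[OF 3(1,2)]
   have fin: "finite (flats M)" using ranked_family_flats[OF 3(1)] by (rule ranked_family.finite_L)
   let ?c = "%F. characteristic_poly (restriction M F)"
   have c1: "?c {} = 1"
    using 3 E by (simp add: characteristic_poly_restriction ranked_family.chi_self[OF ranked_family_flats])
   have split: "(\<Sum>F\<in>flats M. ?c F * P (contraction M F)) =
     P M + (\<Sum>F\<in>flats M - {{}}. ?c F * P (contraction M F))" for P
    using fin E c1 3 by (simp add: sum.remove[of _ "{}"] contraction_empty)
   have "(\<Sum>F\<in>flats M - {{}}. ?c F * Q (contraction M F)) =
     (\<Sum>F\<in>flats M - {{}}. ?c F * kl_of (contraction M F))"
   proof (intro sum.cong refl arg_cong2[where f="(*)"] less)
    fix F assume F: "F \<in> flats M - {{}}"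
    then have "ground M - F \<subset> ground M" using flats_subset[OF 3(1)] by blast
    then show "card (ground (contraction M F)) < card (ground M)"
     using finite_ground[OF 3(1)] 3(1) by (simp add: ground_contraction psubset_card_mono)
   qed
   moreover have "reversal (rk M) (Q M) = (\<Sum>F\<in>flats M. ?c F * Q (contraction M F))"
    "2 * degree (Q M) < rk M"
    using Q 3 unfolding kl_family_def by blast+
   moreover note kl_of_props(2,3)[OF 3(1,2)]
   ultimately have "reversal (rk M) (Q M) - Q M = reversal (rk M) (kl_of M) - kl_of M"
    unfolding split[of Q] split[of kl_of] by simp
   then show ?thesis
    using \<open>2 * degree (Q M) < rk M\<close> kl_of_props(2)[OF 3] by (rule reversal_diff_unique)
  qed
 qed
qed

lemma kl_poly_eq:
 assumes "matroid M" "loopless M"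
 shows "kl_poly M = klp (flats M) (rank_of M) {}"
proof -
 have "kl_poly = (kl_of :: 'a matroid => int poly)"
  unfolding kl_poly_def using kl_family_kl_of kl_family_unique by (intro the_equality) auto
 then show ?thesis using assms by (simp add: kl_of_def)
qed

section \<open>Binary matroids from cycle spaces\<close>

definition sdiff :: "'a set => 'a set => 'a set" where
 "sdiff A B = {x. (x \<in> A) ~= (x \<in> B)}"

lemma in_sdiff [simp]: "x \<in> sdiff A B \<longleftrightarrow> (x \<in> A) ~= (x \<in> B)"
 by (simp add: sdiff_def)

lemma sdiff_simps [simp]:
 "sdiff A A = {}" "sdiff A {} = A" "sdiff {} A = A" "sdiff A (sdiff A B) = B"
 "sdiff (sdiff A B) B = A" "sdiff (sdiff B A) B = A" "sdiff A B = {} \<longleftrightarrow> A = B" "{} = sdiff A B \<longleftrightarrow> A = B"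
 by (auto simp: sdiff_def)

lemma even_card_sdiff:
 assumes "finite A" "finite B"
 shows "even (card (sdiff A B)) \<longleftrightarrow> (even (card A) \<longleftrightarrow> even (card B))"
proof -
 have "sdiff A B = (A - B) Un (B - A)" by auto
 then have "card (sdiff A B) = card (A - B) + card (B - A)"
  using assms by (simp only:, intro card_Un_disjoint) auto
 moreover have "card A = card (A - B) + card (A Int B)"
  using assms card_Int_Diff[of A B] by simp
 moreover have "card B = card (B - A) + card (A Int B)"
  using assms card_Int_Diff[of B A] by (simp add: Int_commute)
 ultimately show ?thesis by presburger
qed

text \<open>A linear subspace over the field with two elements; vectors are sets, addition is
  \<open>sdiff\<close>.\<close>

definition set_space :: "'a set set => bool" where
 "set_space Z \<longleftrightarrow> {} \<in> Z & (\<forall>a\<in>Z. \<forall>b\<in>Z. sdiff a b \<in> Z)"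

lemma set_space_empty: "set_space Z ==> {} \<in> Z"
 and set_space_sdiff: "set_space Z ==> a \<in> Z ==> b \<in> Z ==> sdiff a b \<in> Z"
 by (auto simp: set_space_def)

lemma set_space_sdiff_iff:
 assumes "set_space Z" "b \<in> Z" shows "sdiff a b \<in> Z \<longleftrightarrow> a \<in> Z"
 using set_space_sdiff[OF assms(1) _ assms(2), of a] set_space_sdiff[OF assms(1) _ assms(2), of "sdiff a b"]
 by auto

text \<open>The binary matroid with cycle space Z: its dependent sets are those that contain a
  nonzero vector of Z.\<close>

definition bm :: "'a set => 'a set set => 'a matroid" where
 "bm E Z = \<lparr>ground = E, indep = {I. I <= E & (\<forall>z\<in>Z. z <= I --> z = {})}\<rparr>"

lemma ground_bm [simp]: "ground (bm E Z) = E"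
 and indep_bm: "I \<in> indep (bm E Z) \<longleftrightarrow> I <= E & (\<forall>z\<in>Z. z <= I --> z = {})"
 by (simp_all add: bm_def)

text \<open>Each element of A outside I is exchanged, modulo Z, for the part inside I of the vector
  that closes it up.\<close>

lemma reduce_mod_space:
 assumes Z: "set_space Z" and fin: "finite A"
  and dep: "!!x. x \<in> A - I ==> \<exists>z\<in>Z. x \<in> z & z <= insert x I"
 shows "\<exists>B\<subseteq>I. sdiff A B \<in> Z"
 using fin dep
proof (induction A)
 case empty
 then show ?case using set_space_empty[OF Z] by (intro exI[of _ "{}"]) auto
next
 case (insert x A)
 then obtain B where B: "B <= I" "sdiff A B \<in> Z" by auto
 show ?case
 proof (cases "x \<in> I")
  case True
  have "sdiff (insert x A) (sdiff B {x}) = sdiff A B" using insert.hyps by auto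
  then show ?thesis using B True by (intro exI[of _ "sdiff B {x}"]) auto
 next
  case False
  then obtain z where z: "z \<in> Z" "x \<in> z" "z <= insert x I" using insert.prems by auto
  have "sdiff (insert x A) (sdiff B (z - {x})) = sdiff (sdiff A B) z"
   using insert.hyps z False B by (auto simp: set_eq_iff)
  then show ?thesis using B z set_space_sdiff[OF Z] by (intro exI[of _ "sdiff B (z - {x})"]) auto
 qed
qed

text \<open>If no element of J extends I, every subset of J is congruent modulo Z to some subset of
  I. A choice of these is injective, because J contains no nonzero vector of Z, so 2^|J| \<le> 2^|I|
  against |I| < |J|.\<close>

lemma matroid_bm:
 assumes "finite E" and Z: "set_space Z"
 shows "matroid (bm E Z)"
 unfolding matroid_def
proof (intro conjI ballI allI impI)
 fix I J assume IJ: "I \<in> indep (bm E Z)" "J \<in> indep (bm E Z)" "card I < card J"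
 have fin: "finite I" "finite J" using IJ assms(1) by (auto simp: indep_bm intro: finite_subset)
 show "\<exists>x\<in>J - I. insert x I \<in> indep (bm E Z)"
 proof (rule ccontr)
  assume neg: "\<not> (\<exists>x\<in>J - I. insert x I \<in> indep (bm E Z))"
  have dep: "\<exists>z\<in>Z. x \<in> z & z <= insert x I" if x: "x \<in> J - I" for x
  proof -
   have "insert x I ~: indep (bm E Z)" "insert x I <= E" using neg x IJ by (auto simp: indep_bm)
   then obtain z where z: "z \<in> Z" "z <= insert x I" "z ~= {}" by (auto simp: indep_bm)
   then have "\<not> z <= I" using IJ by (auto simp: indep_bm)
   then show ?thesis using z by auto
  qed
  have "\<forall>A\<in>Pow J. \<exists>B\<subseteq>I. sdiff A B \<in> Z"
  proof
   fix A assume "A \<in> Pow J"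
   then show "\<exists>B\<subseteq>I. sdiff A B \<in> Z"
    using reduce_mod_space[OF Z, of A I] dep fin finite_subset[of A J] by blast
  qed
  then obtain \<phi> where \<phi>: "!!A. A \<in> Pow J ==> \<phi> A <= I & sdiff A (\<phi> A) \<in> Z" by metis
  have "inj_on \<phi> (Pow J)"
  proof (rule inj_onI)
   fix A B assume AB: "A \<in> Pow J" "B \<in> Pow J" "\<phi> A = \<phi> B"
   have "sdiff (sdiff A (\<phi> A)) (sdiff B (\<phi> B)) = sdiff A B" using AB(3) by auto
   then have "sdiff A B \<in> Z" using set_space_sdiff[OF Z] \<phi> AB by metis
   moreover have "sdiff A B <= J" using AB by auto
   ultimately show "A = B" using IJ(2) by (auto simp: indep_bm)
  qed
  then have "card (Pow J) <= card (Pow I)" using \<phi> fin by (intro card_inj_on_le[of \<phi>]) auto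
  then show False using IJ(3) fin by (simp add: card_Pow)
 qed
qed (use assms in \<open>auto simp: indep_bm\<close>)

text \<open>The subsets of a basis form a complement of Z in the space of all subsets of E: they
  span modulo Z by maximality and meet Z trivially by independence.\<close>

lemma rank_bm:
 assumes "finite E" and Z: "set_space Z" and ZE: "Z <= Pow E"
 shows "card Z * 2 ^ rk (bm E Z) = 2 ^ card E"
proof -
 note M = matroid_bm[OF assms(1) Z]
 obtain B where B: "B \<in> indep (bm E Z)" "B <= E" "card B = rk (bm E Z)"
  using rank_basis[OF M, of E] by auto
 have dep: "\<exists>z\<in>Z. x \<in> z & z <= insert x B" if x: "x \<in> E - B" for x
 proof -
  have "insert x B ~: indep (bm E Z)"
  proof
   assume "insert x B \<in> indep (bm E Z)"
   then have "card (insert x B) <= rk (bm E Z)" using rank_ge[OF M] x B by auto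
   then show False using x B finite_subset[OF B(2) assms(1)] by simp
  qed
  then obtain z where z: "z \<in> Z" "z <= insert x B" "z ~= {}" using x B by (auto simp: indep_bm)
  then have "\<not> z <= B" using B by (auto simp: indep_bm)
  then show ?thesis using z by auto
 qed
 have "bij_betw (%(A, z). sdiff A z) (Pow B \<times> Z) (Pow E)"
  unfolding bij_betw_def
 proof (intro conjI)
  show "inj_on (%(A, z). sdiff A z) (Pow B \<times> Z)"
  proof (rule inj_onI, clarify)
   fix A z A' z' assume h: "A <= B" "z \<in> Z" "A' <= B" "z' \<in> Z" "sdiff A z = sdiff A' z'"
   then have eq: "sdiff A A' = sdiff z z'" by (auto simp: set_eq_iff)
   then have "sdiff A A' \<in> Z" using set_space_sdiff[OF Z] h by simp
   moreover have "sdiff A A' <= B" using h by auto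
   ultimately have "A = A'" using B by (auto simp: indep_bm)
   then show "A = A' & z = z'" using eq by simp
  qed
  show "(%(A, z). sdiff A z) ` (Pow B \<times> Z) = Pow E"
  proof (intro equalityI subsetI)
   fix A assume "A \<in> Pow E"
   then have "finite A" using assms(1) finite_subset by auto
   then obtain B' where "B' <= B" "sdiff A B' \<in> Z"
    using reduce_mod_space[OF Z, of A B] dep \<open>A \<in> Pow E\<close> by blast
   then show "A \<in> (%(A, z). sdiff A z) ` (Pow B \<times> Z)"
    by (intro image_eqI[of _ _ "(B', sdiff A B')"]) (auto simp: set_eq_iff)
  next
   fix A assume "A \<in> (%(A, z). sdiff A z) ` (Pow B \<times> Z)"
   then obtain a b where "A = sdiff a b" "b \<in> Z" "a <= B" by auto
   then show "A \<in> Pow E" using ZE B(2) unfolding sdiff_def by blast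
  qed
 qed
 then have "card (Pow B \<times> Z) = card (Pow E)" by (rule bij_betw_same_card)
 then show ?thesis
  using B finite_subset[OF B(2) assms(1)] assms(1) by (simp add: card_cartesian_product card_Pow mult.commute)
qed

text \<open>Both spaces have the same dependent sets. A nonzero z in Z contains a nonzero w in Z',
  which contains a nonzero u in Z. Either u = z and then w = z, or z is the sum of the smaller
  members u and z - u of Z, to which induction applies.\<close>

lemma bm_eqD_subset:
 assumes "finite E" "set_space Z" "set_space Z'" "Z <= Pow E" "Z' <= Pow E" and eq: "bm E Z = bm E Z'"
 shows "Z <= Z'"
proof
 fix z assume "z \<in> Z"
 then show "z \<in> Z'"
 proof (induction "card z" arbitrary: z rule: less_induct)
  case less
  have indep: "I \<in> indep (bm E Z) \<longleftrightarrow> I \<in> indep (bm E Z')" for I using eq by simp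
  have dep: "\<exists>w\<in>Y. w ~= {} & w <= u" if "Y \<in> {Z, Z'}" "u \<in> Z Un Z'" "u ~= {}" for u Y
   using that indep[of u] assms(4,5) by (auto simp: indep_bm)
  show ?case
  proof (cases "z = {}")
   case False
   have finz: "finite z" using less.prems assms(1,4) by (meson PowD finite_subset subsetD)
   obtain w where w: "w \<in> Z'" "w ~= {}" "w <= z" using dep[of Z' z] False less.prems by auto
   obtain u where u: "u \<in> Z" "u ~= {}" "u <= w" using dep[of Z w] w by auto
   have uz: "u <= z" using u w by auto
   show ?thesis
   proof (cases "u = z")
    case True
    then show ?thesis using u w by auto
   next
    case False
    then have "u \<subset> z" using uz by auto
    then have "u \<in> Z'" using less.hyps[of u] u finz by (simp add: psubset_card_mono)
    have "sdiff z u = z - u" using uz by auto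
    moreover have "z - u \<subset> z" using u uz by auto
    ultimately have "sdiff z u \<in> Z'"
     using less.hyps[of "sdiff z u"] set_space_sdiff[OF assms(2) less.prems u(1)] finz
     by (simp add: psubset_card_mono)
    then show ?thesis using set_space_sdiff_iff[OF assms(3) \<open>u \<in> Z'\<close>] by simp
   qed
  qed (use set_space_empty[OF assms(3)] in simp)
 qed
qed

lemma bm_inject:
 assumes "finite E" "set_space Z" "set_space Z'" "Z <= Pow E" "Z' <= Pow E" "bm E Z = bm E Z'"
 shows "Z = Z'"
 using bm_eqD_subset[of E Z Z'] bm_eqD_subset[of E Z' Z] assms by auto

lemma simple_bm:
 assumes "finite E" "Z <= Pow E"
 shows "simple (bm E Z) \<longleftrightarrow> (\<forall>z\<in>Z. z ~= {} --> 3 <= card z)"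
proof
 assume s: "simple (bm E Z)"
 show "\<forall>z\<in>Z. z ~= {} --> 3 <= card z"
 proof (intro ballI impI, rule ccontr)
  fix z assume z: "z \<in> Z" "z ~= {}" "\<not> 3 <= card z"
  have "finite z" using z assms by (meson PowD finite_subset subsetD)
  then have "card z ~= 0" using z by simp
  then have "card z = 1 | card z = 2" using z(3) by linarith
  then obtain x y where "z = {x, y}" by (auto simp: card_1_singleton_iff card_2_iff)
  then show False using s z assms by (auto simp: simple_def indep_bm)
 qed
next
 assume h: "\<forall>z\<in>Z. z ~= {} --> 3 <= card z"
 show "simple (bm E Z)"
  unfolding simple_def indep_bm
 proof (intro ballI conjI impI)
  fix x y z assume z: "z \<in> Z" "z <= {x, y}"
  then have "card z <= card {x, y}" by (intro card_mono) auto
  also have "\<dots> <= 2" by (simp add: card_insert_if)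
  finally show "z = {}" using h z by fastforce
 qed auto
qed

section \<open>Graphic matroids are binary\<close>

text \<open>Edge sets of even degree at every vertex. Incidence counts a loop once, so the parity of
  the degree is correct for graphs as in \<open>loopless_graph\<close>.\<close>

definition cycle_space :: "('v, 'e) multigraph => 'e set set" where
 "cycle_space G = {z. z <= edges G & (\<forall>v. even (card {e \<in> z. v \<in> ends G e}))}"

definition loopless_graph :: "('v, 'e) multigraph => bool" where
 "loopless_graph G \<longleftrightarrow> finite (edges G) & (\<forall>e\<in>edges G. ends G e <= verts G & card (ends G e) = 2)"

lemma set_space_cycle_space:
 assumes "finite (edges G)" shows "set_space (cycle_space G)"
 unfolding set_space_def
proof (intro conjI ballI)
 show "{} \<in> cycle_space G" by (simp add: cycle_space_def)
 fix a b assume ab: "a \<in> cycle_space G" "b \<in> cycle_space G"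
 then have "finite a" "finite b" using assms by (auto simp: cycle_space_def intro: finite_subset)
 moreover have "{e \<in> sdiff a b. v \<in> ends G e} = sdiff {e \<in> a. v \<in> ends G e} {e \<in> b. v \<in> ends G e}" for v
  by auto
 ultimately show "sdiff a b \<in> cycle_space G"
  using ab by (auto simp: cycle_space_def even_card_sdiff)
qed

lemma cycle_in_cycle_space:
 assumes G: "loopless_graph G" and c: "graph_cycle G vs es"
 shows "set es \<in> cycle_space G"
proof -
 define n where "n = length es"
 have n: "n > 0" "length vs = n" "distinct vs" "distinct es" "set es <= edges G"
  and ends: "!!i. i < n ==> ends G (es ! i) = {vs ! i, vs ! (Suc i mod n)}"
  using c by (auto simp: graph_cycle_def n_def)
 have n2: "n >= 2"
 proof (rule ccontr)
  assume "\<not> n >= 2"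
  then have "n = 1" using n by simp
  then have "card (ends G (es ! 0)) <= 1" "es ! 0 \<in> edges G" using ends[of 0] n by (auto simp: n_def)
  then show False using G by (auto simp: loopless_graph_def)
 qed
 have "even (card {e \<in> set es. v \<in> ends G e})" for v
 proof (cases "v \<in> set vs")
  case False
  have "vs ! (Suc i mod n) \<in> set vs" "vs ! i \<in> set vs" if "i < n" for i using n that by auto
  then have "{e \<in> set es. v \<in> ends G e} = {}" using False ends by (fastforce simp: in_set_conv_nth n_def)
  then show ?thesis by (metis card.empty even_zero)
 next
  case True
  then obtain i where i: "i < n" "v = vs ! i" using n by (auto simp: in_set_conv_nth)
  \<comment> \<open>The cyclic predecessor of i: its edge is the second one at
    \<open>vs ! i\<close>, and \<open>n2\<close> makes it different from the first.\<close>
  define j where "j = (if i = 0 then n - 1 else i - 1)"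
  have j: "j < n" "j ~= i" using i n2 by (auto simp: j_def)
  have jk: "Suc k mod n = i \<longleftrightarrow> k = j" if "k < n" for k
   using that i n2 by (cases "Suc k = n") (auto simp: j_def)
  have "v \<in> ends G (es ! k) \<longleftrightarrow> k = i | k = j" if "k < n" for k
  proof -
   have "vs ! i = vs ! k \<longleftrightarrow> i = k" "vs ! i = vs ! (Suc k mod n) \<longleftrightarrow> i = Suc k mod n"
    using n that i by (auto simp: nth_eq_iff_index_eq)
   then show ?thesis using ends[OF that] jk[OF that] i by auto
  qed
  then have "{e \<in> set es. v \<in> ends G e} = {es ! i, es ! j}"
   using i(1) j(1) by (auto simp: in_set_conv_nth n_def)
  moreover have "es ! i ~= es ! j" using n(4) i j by (simp add: nth_eq_iff_index_eq n_def)
  ultimately show ?thesis by simp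
 qed
 then show ?thesis using n by (auto simp: cycle_space_def)
qed

definition edge_path :: "('v, 'e) multigraph => 'e set => 'v list => 'e list => bool" where
 "edge_path G z vs es \<longleftrightarrow> length vs = Suc (length es) & distinct vs & set vs <= \<Union>(ends G ` z) &
   set es <= z & (\<forall>i<length es. ends G (es ! i) = {vs ! i, vs ! Suc i})"

text \<open>A longest path in a nonempty even edge set closes up to a cycle at its last vertex.\<close>

lemma cycle_space_contains_cycle:
 assumes G: "loopless_graph G" and z: "z \<in> cycle_space G" "z ~= {}"
 shows "\<exists>vs es. graph_cycle G vs es & set es <= z"
proof -
 have zG: "z <= edges G" and even: "!!v. even (card {e \<in> z. v \<in> ends G e})"
  using z by (auto simp: cycle_space_def)
 have fin: "finite z" using zG G finite_subset by (auto simp: loopless_graph_def)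
 have card2: "card (ends G e) = 2" "ends G e <= verts G" if "e \<in> z" for e
  using that zG G by (auto simp: loopless_graph_def)
 have finv: "finite (\<Union>(ends G ` z))" using fin card2 by (auto intro: card_ge_0_finite)
 let ?P = "%k. \<exists>vs es. edge_path G z vs es & length es = k & es ~= []"
 obtain e0 where e0: "e0 \<in> z" using z by auto
 then obtain u0 v0 where "ends G e0 = {u0, v0}" "u0 ~= v0" using card2 by (meson card_2_iff)
 then have "edge_path G z [u0, v0] [e0]" using e0 by (auto simp: edge_path_def)
 then have ex: "\<exists>k. ?P k" by (intro exI[of _ 1] exI[of _ "[u0, v0]"] exI[of _ "[e0]"]) auto
 have bound: "k <= card (\<Union>(ends G ` z))" if P: "?P k" for k
 proof -
  obtain vs es where "edge_path G z vs es" "length es = k" using P by blast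
  then have "Suc k = card (set vs)" "set vs <= \<Union>(ends G ` z)" by (auto simp: edge_path_def distinct_card)
  then have "Suc k <= card (\<Union>(ends G ` z))" using card_mono[OF finv] by metis
  then show ?thesis by simp
 qed
 obtain k where k: "?P k" "!!l. ?P l ==> l <= k"
  using ex bound Greatest_le_nat[of ?P] GreatestI_ex_nat[of ?P] by (metis (no_types, lifting))
 then obtain vs es where p: "edge_path G z vs es" "length es = k" "es ~= []" by blast
 have len: "length vs = Suc k" "distinct vs" "set es <= z" "set vs <= \<Union>(ends G ` z)"
  and ends: "!!i. i < k ==> ends G (es ! i) = {vs ! i, vs ! Suc i}"
  using p by (auto simp: edge_path_def)
 have kpos: "k > 0" using p by auto
 define v where "v = vs ! k"
 define e where "e = es ! (k - 1)"
 have e: "e \<in> z" "v \<in> ends G e"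
  using ends[of "k - 1"] kpos len p by (auto simp: e_def v_def)
 have "\<exists>e'. e' \<in> z & v \<in> ends G e' & e' ~= e"
 proof (rule ccontr)
  assume "\<not> ?thesis"
  then have "{e' \<in> z. v \<in> ends G e'} = {e}" using e by blast
  then have "card {e' \<in> z. v \<in> ends G e'} = 1" by simp
  then show False using even[of v] by simp
 qed
 then obtain e' where e': "e' \<in> z" "v \<in> ends G e'" "e' ~= e" by auto
 obtain a b where ab: "ends G e' = {a, b}" "a ~= b" using card2[OF e'(1)] by (meson card_2_iff)
 define w where "w = (if a = v then b else a)"
 have w: "ends G e' = {v, w}" "w ~= v" using ab e' by (auto simp: w_def)
 show ?thesis
 proof (cases "w \<in> set vs")
  case False
  have "edge_path G z (vs @ [w]) (es @ [e'])"
   unfolding edge_path_def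
  proof (intro conjI allI impI)
   fix i assume i: "i < length (es @ [e'])"
   show "ends G ((es @ [e']) ! i) = {(vs @ [w]) ! i, (vs @ [w]) ! Suc i}"
    using i p(2) len(1) ends[of i] w by (cases "i < k") (auto simp: nth_append v_def not_less less_Suc_eq)
  qed (use len p False e' w in auto)
  then have "?P (Suc k)" using p by (intro exI[of _ "vs @ [w]"] exI[of _ "es @ [e']"]) auto
  then show ?thesis using k(2) by fastforce
 next
  case True
  then obtain i where i: "i <= k" "w = vs ! i" using len by (auto simp: in_set_conv_nth less_Suc_eq_le)
  then have ik: "i < k" using w by (auto simp: v_def order_le_less)
  have dist: "distinct es"
   unfolding distinct_conv_nth
  proof (intro allI impI)
   fix s t assume st: "s < length es" "t < length es" "s ~= t"
   show "es ! s ~= es ! t"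
   proof
    assume "es ! s = es ! t"
    then have "{vs ! s, vs ! Suc s} = {vs ! t, vs ! Suc t}" using ends[of s] ends[of t] st p(2) by auto
    then show False using st len p(2) by (auto simp: doubleton_eq_iff nth_eq_iff_index_eq)
   qed
  qed
  have new: "e' ~: set es"
  proof
   assume "e' \<in> set es"
   then obtain t where t: "t < k" "e' = es ! t" using p by (auto simp: in_set_conv_nth)
   then have "vs ! k \<in> {vs ! t, vs ! Suc t}" using ends[OF t(1)] e'(2) by (simp add: v_def)
   then have "Suc t = k" using t len by (auto simp: nth_eq_iff_index_eq)
   then show False using t e'(3) by (auto simp: e_def)
  qed
  have "graph_cycle G (drop i vs) (drop i es @ [e'])"
   unfolding graph_cycle_def
  proof (intro conjI allI impI)
   show "distinct (drop i vs)" using len by simp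
   show "distinct (drop i es @ [e'])" using dist new by (auto dest: in_set_dropD)
   have "set vs <= verts G" using len(4) card2 by blast
   then show "set (drop i vs) <= verts G" using set_drop_subset[of i vs] by auto
   show "set (drop i es @ [e']) <= edges G" using zG len(3) e' set_drop_subset[of i es] by auto
   fix t assume t: "t < length (drop i es @ [e'])"
   show "ends G ((drop i es @ [e']) ! t) =
     {drop i vs ! t, drop i vs ! (Suc t mod length (drop i es @ [e']))}"
   proof (cases "t < k - i")
    case True
    then show ?thesis using ends[of "i + t"] p(2) len(1) ik by (auto simp: nth_append)
   next
    case False
    then have "t = k - i" using t p(2) by auto
    then show ?thesis using w i ik p(2) len(1) by (auto simp: nth_append v_def)
   qed
  qed (use p len ik in auto)
  moreover have "set (drop i es @ [e']) <= z" using len(3) e' set_drop_subset[of i es] by auto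
  ultimately show ?thesis by blast
 qed
qed

lemma graphic_matroid_eq_bm:
 assumes "loopless_graph G"
 shows "graphic_matroid G = bm (edges G) (cycle_space G)"
proof -
 have "(\<exists>vs es. graph_cycle G vs es & set es <= I) \<longleftrightarrow> (\<exists>z\<in>cycle_space G. z <= I & z ~= {})" for I
 proof
  assume "\<exists>vs es. graph_cycle G vs es & set es <= I"
  then show "\<exists>z\<in>cycle_space G. z <= I & z ~= {}"
   using cycle_in_cycle_space[OF assms] by (auto simp: graph_cycle_def)
 next
  assume "\<exists>z\<in>cycle_space G. z <= I & z ~= {}"
  then show "\<exists>vs es. graph_cycle G vs es & set es <= I"
   using cycle_space_contains_cycle[OF assms] by blast
 qed
 then show ?thesis by (auto simp: graphic_matroid_def bm_def)
qed

section \<open>Series-parallel cycle spaces\<close>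

text \<open>A vector using e is mapped back to the old space by exchanging e for its parallel f. As
  preimages of a linear map these extensions are evidently subspaces; the image forms below serve
  cardinalities and renaming.\<close>

definition par_ext :: "'a => 'a => 'a set set => 'a set set" where
 "par_ext e f Z = {z. (if e \<in> z then sdiff z {e, f} else z) \<in> Z}"

definition ser_ext :: "'a => 'a => 'a set set => 'a set set" where
 "ser_ext e f Z = {z. (e \<in> z \<longleftrightarrow> f \<in> z) & z - {e} \<in> Z}"

text \<open>A parallel extension at \<open>g\<close> followed by a series extension: a triangle \<open>{e, f, g}\<close> is glued on.\<close>

definition tri_ext :: "'a => 'a => 'a => 'a set set => 'a set set" where
 "tri_ext e f g Z = {z. (e \<in> z \<longleftrightarrow> f \<in> z) & (if e \<in> z then sdiff z {e, f, g} else z) \<in> Z}"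

lemma par_ext_image:
 assumes "Z <= Pow E" "e ~: E" "f \<in> E"
 shows "par_ext e f Z = Z Un (%z. sdiff z {e, f}) ` Z"
proof (intro equalityI subsetI)
 fix z assume z: "z \<in> par_ext e f Z"
 show "z \<in> Z Un (%z. sdiff z {e, f}) ` Z"
 proof (cases "e \<in> z")
  case True
  then have "sdiff z {e, f} \<in> Z" using z by (simp add: par_ext_def)
  then show ?thesis by (intro UnI2 image_eqI[of _ _ "sdiff z {e, f}"]) simp_all
 qed (use z in \<open>simp add: par_ext_def\<close>)
next
 fix z assume "z \<in> Z Un (%z. sdiff z {e, f}) ` Z"
 then obtain w where w: "w \<in> Z" "z = w | z = sdiff w {e, f}" by auto
 then have "e ~: w" using assms by auto
 then show "z \<in> par_ext e f Z" using w by (auto simp: par_ext_def)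
qed

lemma ser_ext_image:
 assumes "Z <= Pow E" "e ~: E" "f \<in> E"
 shows "ser_ext e f Z = (%z. if f \<in> z then insert e z else z) ` Z"
proof (intro equalityI subsetI)
 fix z assume z: "z \<in> ser_ext e f Z"
 then have "z - {e} \<in> Z" "f \<in> z - {e} \<longleftrightarrow> f \<in> z" "e \<in> z \<longleftrightarrow> f \<in> z" using assms by (auto simp: ser_ext_def)
 then show "z \<in> (%z. if f \<in> z then insert e z else z) ` Z" by (intro image_eqI[of _ _ "z - {e}"]) auto
next
 fix z assume "z \<in> (%z. if f \<in> z then insert e z else z) ` Z"
 then obtain w where w: "w \<in> Z" "z = (if f \<in> w then insert e w else w)" by auto
 then have "e ~: w" using assms by auto
 then show "z \<in> ser_ext e f Z" using w assms by (auto simp: ser_ext_def)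
qed

lemma tri_ext_image:
 assumes "Z <= Pow E" "e ~: E" "f ~: E" "e ~= f" "g \<in> E"
 shows "tri_ext e f g Z = Z Un (%z. sdiff z {e, f, g}) ` Z"
proof (intro equalityI subsetI)
 fix z assume z: "z \<in> tri_ext e f g Z"
 show "z \<in> Z Un (%z. sdiff z {e, f, g}) ` Z"
 proof (cases "e \<in> z")
  case True
  then have "sdiff z {e, f, g} \<in> Z" using z by (simp add: tri_ext_def)
  then show ?thesis by (intro UnI2 image_eqI[of _ _ "sdiff z {e, f, g}"]) simp_all
 qed (use z in \<open>simp add: tri_ext_def\<close>)
next
 fix z assume "z \<in> Z Un (%z. sdiff z {e, f, g}) ` Z"
 then obtain w where w: "w \<in> Z" "z = w | z = sdiff w {e, f, g}" by auto
 then have "e ~: w" "f ~: w" using assms by auto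
 then show "z \<in> tri_ext e f g Z" using w by (auto simp: tri_ext_def)
qed

lemma tri_ext_eq:
 assumes "Z <= Pow E" "e ~: E" "f ~: E" "e ~= f" "g \<in> E"
 shows "tri_ext e f g Z = ser_ext e f (par_ext f g Z)"
proof -
 have "z \<in> tri_ext e f g Z \<longleftrightarrow> z \<in> ser_ext e f (par_ext f g Z)" for z
 proof (cases "e \<in> z & f \<in> z")
  case True
  then have "sdiff (z - {e}) {f, g} = sdiff z {e, f, g}" using assms by auto
  then show ?thesis using True assms(4) by (simp add: tri_ext_def ser_ext_def par_ext_def)
 next
  case False
  then show ?thesis by (auto simp: tri_ext_def ser_ext_def par_ext_def)
 qed
 then show ?thesis by blast
qed

lemma set_space_preimage:
 assumes "set_space Z" "\<pi> {} = {}" "!!a b. \<pi> (sdiff a b) = sdiff (\<pi> a) (\<pi> b)"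
 shows "set_space {z. \<pi> z \<in> Z}"
 using assms by (auto simp: set_space_def)

lemma set_space_Int: "set_space Y ==> set_space Z ==> set_space (Y Int Z)"
 by (auto simp: set_space_def)

lemma set_space_par_ext: "set_space Z ==> set_space (par_ext e f Z)"
 unfolding par_ext_def by (rule set_space_preimage) (auto simp: set_eq_iff)

lemma set_space_ser_ext:
 assumes "set_space Z" shows "set_space (ser_ext e f Z)"
proof -
 have "set_space {z. e \<in> z \<longleftrightarrow> f \<in> z}" by (auto simp: set_space_def)
 moreover have "set_space {z. z - {e} \<in> Z}" by (rule set_space_preimage[OF assms]) (auto simp: set_eq_iff)
 moreover have "ser_ext e f Z = {z. e \<in> z \<longleftrightarrow> f \<in> z} Int {z. z - {e} \<in> Z}" by (auto simp: ser_ext_def)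
 ultimately show ?thesis by (simp add: set_space_Int)
qed

lemma sdiff_Un: "sdiff A B = (A - B) Un (B - A)"
 by auto

lemma image_sdiff: "inj_on \<phi> (a Un b) ==> \<phi> ` sdiff a b = sdiff (\<phi> ` a) (\<phi> ` b)"
proof -
 assume inj: "inj_on \<phi> (a Un b)"
 have "\<phi> ` (a - b) = \<phi> ` a - \<phi> ` b" "\<phi> ` (b - a) = \<phi> ` b - \<phi> ` a"
  by (rule inj_on_image_set_diff[OF inj]; blast)+
 then show ?thesis by (simp only: sdiff_Un image_Un)
qed

lemma rename_par_ext:
 assumes Z: "Z <= Pow E" "e ~: E" "f \<in> E" and inj: "inj_on \<phi> (insert e E)"
 shows "(`) \<phi> ` par_ext e f Z = par_ext (\<phi> e) (\<phi> f) ((`) \<phi> ` Z)"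
proof -
 have "\<phi> e ~: \<phi> ` E" "(`) \<phi> ` Z <= Pow (\<phi> ` E)" "\<phi> f \<in> \<phi> ` E" using Z inj by (auto simp: inj_on_def)
 moreover have "\<phi> ` sdiff z {e, f} = sdiff (\<phi> ` z) {\<phi> e, \<phi> f}" if "z \<in> Z" for z
 proof -
  have "z Un {e, f} <= insert e E" using that Z by blast
  from image_sdiff[OF inj_on_subset[OF inj this]] show ?thesis by simp
 qed
 ultimately show ?thesis
  using Z by (simp add: par_ext_image[where E=E] par_ext_image[where E="\<phi> ` E"] image_Un image_image)
qed

lemma rename_ser_ext:
 assumes Z: "Z <= Pow E" "e ~: E" "f \<in> E" and inj: "inj_on \<phi> (insert e E)"
 shows "(`) \<phi> ` ser_ext e f Z = ser_ext (\<phi> e) (\<phi> f) ((`) \<phi> ` Z)"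
proof -
 have "\<phi> e ~: \<phi> ` E" "(`) \<phi> ` Z <= Pow (\<phi> ` E)" "\<phi> f \<in> \<phi> ` E" using Z inj by (auto simp: inj_on_def)
 moreover have "\<phi> ` (if f \<in> z then insert e z else z) = (if \<phi> f \<in> \<phi> ` z then insert (\<phi> e) (\<phi> ` z) else \<phi> ` z)"
  if "z \<in> Z" for z
 proof -
  have "\<phi> f \<in> \<phi> ` z \<longleftrightarrow> f \<in> z"
   by (rule inj_on_image_mem_iff[of \<phi> E]) (use that Z inj in \<open>auto simp: inj_on_insert\<close>)
  then show ?thesis by simp
 qed
 then have "(%z. \<phi> ` (if f \<in> z then insert e z else z)) ` Z =
   (%z. if \<phi> f \<in> \<phi> ` z then insert (\<phi> e) (\<phi> ` z) else \<phi> ` z) ` Z" by (rule image_cong[OF refl])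
 ultimately show ?thesis
  unfolding ser_ext_image[OF Z] by (simp only: ser_ext_image[where E="\<phi> ` E"] image_image simp_thms)
qed

lemma rename_tri_ext:
 assumes Z: "Z <= Pow E" "e ~: E" "f ~: E" "e ~= f" "g \<in> E" and inj: "inj_on \<phi> (insert e (insert f E))"
 shows "(`) \<phi> ` tri_ext e f g Z = tri_ext (\<phi> e) (\<phi> f) (\<phi> g) ((`) \<phi> ` Z)"
proof -
 have "\<phi> e ~: \<phi> ` E" "\<phi> f ~: \<phi> ` E" "\<phi> e ~= \<phi> f" "(`) \<phi> ` Z <= Pow (\<phi> ` E)" "\<phi> g \<in> \<phi> ` E"
  using Z inj by (auto simp: inj_on_def)
 moreover have "\<phi> ` sdiff z {e, f, g} = sdiff (\<phi> ` z) {\<phi> e, \<phi> f, \<phi> g}" if "z \<in> Z" for z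
 proof -
  have "z Un {e, f, g} <= insert e (insert f E)" using that Z by blast
  from image_sdiff[OF inj_on_subset[OF inj this]] show ?thesis by simp
 qed
 ultimately show ?thesis
  using Z by (simp add: tri_ext_image[where E=E] tri_ext_image[where E="\<phi> ` E"] image_Un image_image)
qed

text \<open>A relaxed notion of series-parallel: coloops may be added at any time and series steps
  may be applied to them. Direct sums are thus included and inductions have a trivial start;
  \<open>sp_decomp\<close> recovers the graphs of the strict definition.\<close>

inductive sp_space :: "'a set => 'a set set => bool" where
 sp_empty: "sp_space {} {{}}"
| sp_coloop: "sp_space E Z ==> e ~: E ==> sp_space (insert e E) Z"
| sp_parallel: "sp_space E Z ==> f \<in> E ==> e ~: E ==> sp_space (insert e E) (par_ext e f Z)"
| sp_series: "sp_space E Z ==> f \<in> E ==> e ~: E ==> sp_space (insert e E) (ser_ext e f Z)"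

lemma sp_space_basic:
 assumes "sp_space E Z"
 shows "finite E" "Z <= Pow E" "set_space Z" "!!x. {x} ~: Z"
proof -
 have "finite E & Z <= Pow E & set_space Z & (\<forall>x. {x} ~: Z)"
  using assms
 proof induction
  case sp_empty
  then show ?case by (simp add: set_space_def)
 next
  case (sp_coloop E Z e)
  then show ?case by auto
 next
  case (sp_parallel E Z f e)
  have "z <= insert e E" if "z \<in> par_ext e f Z" for z
  proof -
   have "(if e \<in> z then sdiff z {e, f} else z) <= E" using that sp_parallel.IH by (auto simp: par_ext_def)
   then show ?thesis using sp_parallel.hyps by (auto simp: subset_iff split: if_splits)
  qed
  moreover have "{x} ~: par_ext e f Z" for x
  proof (cases "x = e")
   case True
   then have "sdiff {x} {e, f} = {f}" using sp_parallel.hyps by auto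
   then show ?thesis using sp_parallel.IH True by (simp add: par_ext_def)
  qed (use sp_parallel.IH in \<open>simp add: par_ext_def\<close>)
  ultimately show ?case using sp_parallel.IH by (auto simp: set_space_par_ext)
 next
  case (sp_series E Z f e)
  have "z <= insert e E" if "z \<in> ser_ext e f Z" for z
   using that sp_series.IH by (auto simp: ser_ext_def)
  moreover have "{x} ~: ser_ext e f Z" for x
  proof
   assume x: "{x} \<in> ser_ext e f Z"
   then have "x ~= e" using sp_series.hyps by (auto simp: ser_ext_def)
   then have "{x} - {e} = {x}" by auto
   then show False using x sp_series.IH by (simp add: ser_ext_def)
  qed
  ultimately show ?case using sp_series.IH by (auto simp: set_space_ser_ext)
 qed
 then show "finite E" "Z <= Pow E" "set_space Z" "!!x. {x} ~: Z" by auto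
qed

lemma sp_space_rename:
 assumes "sp_space E Z" "inj_on \<phi> E"
 shows "sp_space (\<phi> ` E) ((`) \<phi> ` Z)"
 using assms
proof induction
 case sp_empty
 then show ?case using sp_space.sp_empty by simp
next
 case (sp_coloop E Z e)
 have "\<phi> e ~: \<phi> ` E" using sp_coloop.prems sp_coloop.hyps by (auto simp: inj_on_insert)
 then show ?case using sp_coloop by (auto intro: sp_space.sp_coloop)
next
 case (sp_parallel E Z f e)
 have "\<phi> e ~: \<phi> ` E" using sp_parallel.prems sp_parallel.hyps by (auto simp: inj_on_insert)
 then show ?case
  using sp_parallel rename_par_ext[OF sp_space_basic(2)[OF sp_parallel.hyps(1)] sp_parallel.hyps(3,2) sp_parallel.prems]
  by (auto intro: sp_space.sp_parallel)
next
 case (sp_series E Z f e)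
 have "\<phi> e ~: \<phi> ` E" using sp_series.prems sp_series.hyps by (auto simp: inj_on_insert)
 then show ?case
  using sp_series rename_ser_ext[OF sp_space_basic(2)[OF sp_series.hyps(1)] sp_series.hyps(3,2) sp_series.prems]
  by (auto intro: sp_space.sp_series)
qed

definition space_sum :: "'a set => 'a set set => 'a set => 'a set set => 'a set set" where
 "space_sum E1 Z1 E2 Z2 = {z. z <= E1 Un E2 & z Int E1 \<in> Z1 & z Int E2 \<in> Z2}"

lemma sp_space_sum:
 assumes "sp_space E2 Z2" "sp_space E1 Z1" "E1 Int E2 = {}"
 shows "sp_space (E1 Un E2) (space_sum E1 Z1 E2 Z2)"
 using assms
proof induction
 case sp_empty
 have "space_sum E1 Z1 {} {{}} = Z1"
  using sp_space_basic(2)[OF sp_empty(1)] by (auto simp: space_sum_def Int_absorb2)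
 then show ?case using sp_empty by simp
next
 case (sp_coloop E Z e)
 have "z \<in> space_sum E1 Z1 (insert e E) Z \<longleftrightarrow> z \<in> space_sum E1 Z1 E Z" for z
 proof (cases "e \<in> z")
  case True
  then have "z Int insert e E ~: Z" using sp_coloop.hyps sp_space_basic(2)[OF sp_coloop.hyps(1)] by auto
  moreover have "\<not> z <= E1 Un E" using True sp_coloop by auto
  ultimately show ?thesis by (simp add: space_sum_def)
 qed (auto simp: space_sum_def)
 then have "space_sum E1 Z1 (insert e E) Z = space_sum E1 Z1 E Z" by blast
 then show ?case using sp_coloop by (auto intro: sp_space.sp_coloop)
next
 case (sp_parallel E Z f e)
 have "z \<in> space_sum E1 Z1 (insert e E) (par_ext e f Z) \<longleftrightarrow> z \<in> par_ext e f (space_sum E1 Z1 E Z)" for z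
 proof (cases "e \<in> z")
  case True
  have "sdiff (z Int insert e E) {e, f} = sdiff z {e, f} Int E" using True sp_parallel.hyps by auto
  moreover have "sdiff z {e, f} Int E1 = z Int E1" using sp_parallel.hyps sp_parallel.prems by auto
  moreover have "sdiff z {e, f} <= E1 Un E \<longleftrightarrow> z <= E1 Un insert e E"
   using True sp_parallel.hyps by auto
  ultimately show ?thesis using True by (simp add: space_sum_def par_ext_def)
 qed (auto simp: space_sum_def par_ext_def)
 then have "space_sum E1 Z1 (insert e E) (par_ext e f Z) = par_ext e f (space_sum E1 Z1 E Z)" by blast
 moreover have "sp_space (insert e (E1 Un E)) (par_ext e f (space_sum E1 Z1 E Z))"
  using sp_parallel by (intro sp_space.sp_parallel) auto
 ultimately show ?case by simp
next
 case (sp_series E Z f e)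
 have "z \<in> space_sum E1 Z1 (insert e E) (ser_ext e f Z) \<longleftrightarrow> z \<in> ser_ext e f (space_sum E1 Z1 E Z)" for z
 proof -
  have "z Int insert e E - {e} = (z - {e}) Int E" using sp_series.hyps by auto
  moreover have "(z - {e}) Int E1 = z Int E1" using sp_series.prems by auto
  ultimately show ?thesis using sp_series.hyps by (auto simp: space_sum_def ser_ext_def)
 qed
 then have "space_sum E1 Z1 (insert e E) (ser_ext e f Z) = ser_ext e f (space_sum E1 Z1 E Z)" by blast
 moreover have "sp_space (insert e (E1 Un E)) (ser_ext e f (space_sum E1 Z1 E Z))"
  using sp_series by (intro sp_space.sp_series) auto
 ultimately show ?case by simp
qed

section \<open>Cycle spaces of series-parallel graphs\<close>

lemma single_edge_cycle_space:
 assumes "single_edge G"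
 obtains e where "edges G = {e}" "cycle_space G = {{}}" "loopless_graph G" "finite (verts G)"
proof -
 obtain u v e where G: "u ~= v" "verts G = {u, v}" "edges G = {e}" "ends G e = {u, v}"
  using assms by (auto simp: single_edge_def)
 have "{e} ~: cycle_space G"
 proof
  assume "{e} \<in> cycle_space G"
  then have "even (card {e' \<in> {e}. u \<in> ends G e'})" by (simp add: cycle_space_def)
  moreover have "{e' \<in> {e}. u \<in> ends G e'} = {e}" using G by auto
  ultimately show False by simp
 qed
 moreover have "{} \<in> cycle_space G" by (simp add: cycle_space_def)
 moreover have "cycle_space G <= {{}, {e}}" using G by (auto simp: cycle_space_def)
 ultimately have "cycle_space G = {{}}" by auto
 moreover have "loopless_graph G" "finite (verts G)" using G by (simp_all add: loopless_graph_def)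
 ultimately show ?thesis using that G by blast
qed

text \<open>Exchanging e for f changes no degree parity, as both edges have the same ends.\<close>

lemma add_parallel_graph:
 assumes G: "loopless_graph G" and f: "f \<in> edges G" and e: "e ~: edges G"
 defines "G' \<equiv> G\<lparr>edges := insert e (edges G), ends := (ends G)(e := ends G f)\<rparr>"
 shows "loopless_graph G'" "cycle_space G' = par_ext e f (cycle_space G)"
proof -
 show "loopless_graph G'" using G f by (auto simp: loopless_graph_def G'_def)
 have "z \<in> cycle_space G' \<longleftrightarrow> z \<in> par_ext e f (cycle_space G)" for z
 proof (cases "e \<in> z & z <= insert e (edges G)")
  case True
  let ?w = "sdiff z {e, f}"
  have w: "?w <= edges G" using True f by auto
  have fin: "finite ?w" using w G finite_subset by (auto simp: loopless_graph_def)
  have "even (card {x \<in> z. v \<in> ends G' x}) \<longleftrightarrow> even (card {x \<in> ?w. v \<in> ends G x})" for v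
  proof -
   have "{x \<in> z. v \<in> ends G' x} = sdiff {x \<in> ?w. v \<in> ends G x} (if v \<in> ends G f then {e, f} else {})"
    using True e f by (auto simp: G'_def split: if_splits)
   moreover have "e ~= f" using e f by auto
   then have "even (card (if v \<in> ends G f then {e, f} else {}))" by simp
   moreover have "finite {x \<in> ?w. v \<in> ends G x}" using fin by (rule rev_finite_subset) blast
   moreover have "finite (if v \<in> ends G f then {e, f} else {})" by simp
   ultimately show ?thesis by (simp only: even_card_sdiff simp_thms)
  qed
  then show ?thesis using True w by (simp add: cycle_space_def par_ext_def) (simp add: G'_def)
 next
  case False
  show ?thesis
  proof (cases "e \<in> z")
   case True
   then have "\<not> z <= insert e (edges G)" using False by simp
   moreover have "\<not> sdiff z {e, f} <= edges G" using calculation f by auto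
   ultimately show ?thesis using True by (simp add: cycle_space_def par_ext_def G'_def)
  next
   case False
   then have "{x \<in> z. v \<in> ends G' x} = {x \<in> z. v \<in> ends G x}" for v by (auto simp: G'_def)
   then show ?thesis using False by (auto simp: cycle_space_def par_ext_def G'_def)
  qed
 qed
 then show "cycle_space G' = par_ext e f (cycle_space G)" by blast
qed

text \<open>Only e and f meet the new vertex w, so even degree there means that both or none are
  used. At every other vertex the pair has the same effect as the old edge f.\<close>

lemma subdivide_graph:
 assumes G: "loopless_graph G" and f: "f \<in> edges G" "ends G f = {u, v}" and e: "e ~: edges G"
  and w: "w ~: verts G"
 defines "G' \<equiv> G\<lparr>verts := insert w (verts G), edges := insert e (edges G),
     ends := (ends G)(f := {u, w}, e := {w, v})\<rparr>"
 shows "loopless_graph G'" "cycle_space G' = ser_ext e f (cycle_space G)"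
proof -
 have ends: "ends G x <= verts G" "card (ends G x) = 2" if "x \<in> edges G" for x
  using G that by (auto simp: loopless_graph_def)
 have ef: "e ~= f" using e f by auto
 have uv: "u \<in> verts G" "v \<in> verts G" "u ~= v" "w ~= u" "w ~= v"
  using ends[OF f(1)] f(2) w by auto
 have ends': "ends G' e = {w, v}" "ends G' f = {u, w}" "!!x. x ~= e ==> x ~= f ==> ends G' x = ends G x"
  using ef by (auto simp: G'_def)
 have edges': "edges G' = insert e (edges G)" by (simp add: G'_def)
 show "loopless_graph G'" using G f e uv ends by (auto simp: loopless_graph_def G'_def)
 have "z \<in> cycle_space G' \<longleftrightarrow> z \<in> ser_ext e f (cycle_space G)" for z
 proof (cases "z <= insert e (edges G)")
  case True
  have fin: "finite z" using True G finite_subset by (auto simp: loopless_graph_def)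
  have zw: "{x \<in> z. w \<in> ends G' x} = z Int {e, f}"
   using True ends w by (auto simp: G'_def)
  show ?thesis
  proof (cases "e \<in> z \<longleftrightarrow> f \<in> z")
   case True
   have "even (card {x \<in> z. a \<in> ends G' x}) \<longleftrightarrow> even (card {x \<in> z - {e}. a \<in> ends G x})" for a
   proof (cases "a = w")
    case True
    have "{x \<in> z - {e}. a \<in> ends G x} = {}" using True \<open>z <= insert e (edges G)\<close> ends w by auto
    then have "even (card {x \<in> z - {e}. a \<in> ends G x})" by (simp only: card.empty even_zero)
    moreover have "z Int {e, f} = (if e \<in> z then {e, f} else {})" using \<open>e \<in> z \<longleftrightarrow> f \<in> z\<close> by auto
    then have "even (card {x \<in> z. a \<in> ends G' x})" using True ef zw by simp
    ultimately show ?thesis by blast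
   next
    case False
    \<comment> \<open>Only at v do the incident edges change: there e takes over from f. Since e and
      f are both in z or both outside, the change is by the whole pair, which is even.\<close>
    have "{x \<in> z. a \<in> ends G' x} = sdiff {x \<in> z - {e}. a \<in> ends G x} (if a = v & e \<in> z then {e, f} else {})"
     (is "?L = sdiff ?S ?T")
    proof (rule set_eqI)
     fix x
     consider "x = e" | "x = f" | "x ~= e" "x ~= f" by blast
     then show "x \<in> ?L \<longleftrightarrow> x \<in> sdiff ?S ?T"
     proof cases
      case 1
      then show ?thesis using False by (auto simp: ends')
     next
      case 2
      then show ?thesis using False True ef uv f(2) by (auto simp: ends')
     qed (simp add: ends')
    qed
    moreover have "even (card ?T)" using ef by simp
    moreover have "finite ?S" using fin by simp
    moreover have "finite ?T" by simp
    ultimately show ?thesis by (simp only: even_card_sdiff simp_thms)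
   qed
   moreover have "z - {e} <= edges G" using \<open>z <= insert e (edges G)\<close> by auto
   ultimately show ?thesis using True \<open>z <= insert e (edges G)\<close>
    by (simp add: cycle_space_def ser_ext_def edges')
  next
   case False
   then have "z Int {e, f} = {e} | z Int {e, f} = {f}" by auto
   then have "card {x \<in> z. w \<in> ends G' x} = 1" using zw by auto
   then have "\<not> even (card {x \<in> z. w \<in> ends G' x})" by simp
   then have "z ~: cycle_space G'" unfolding cycle_space_def by blast
   then show ?thesis using False by (simp add: ser_ext_def)
  qed
 next
  case False
  then show ?thesis by (auto simp: cycle_space_def ser_ext_def edges')
 qed
 then show "cycle_space G' = ser_ext e f (cycle_space G)" by blast
qed

text \<open>The initial graph of the strict definition is thereby a parallel extension of a coloop,
  a step already available for \<open>sp_space\<close>.\<close>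

lemma parallel_pair_as_ext:
 assumes "u ~= v" "e ~= f" "verts G = {u, v}" "edges G = {e, f}" "ends G e = {u, v}" "ends G f = {u, v}"
 shows "cycle_space G = par_ext e f {{}}" "loopless_graph G"
proof -
 show "loopless_graph G" using assms by (auto simp: loopless_graph_def)
 have "z \<in> cycle_space G \<longleftrightarrow> z \<in> {{}, {e, f}}" for z
 proof
  assume z: "z \<in> cycle_space G"
  then have sub: "z <= {e, f}" using assms by (simp add: cycle_space_def)
  then have "{x \<in> z. u \<in> ends G x} = z" using assms by auto
  moreover have "even (card {x \<in> z. u \<in> ends G x})" using z unfolding cycle_space_def by blast
  ultimately have "even (card z)" by simp
  moreover have "z = {} | z = {e} | z = {f} | z = {e, f}" using sub by blast
  ultimately show "z \<in> {{}, {e, f}}" by (elim disjE) simp_all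
 next
  assume z: "z \<in> {{}, {e, f}}"
  have "{x \<in> {e, f}. a \<in> ends G x} = (if a \<in> {u, v} then {e, f} else {})" for a using assms by auto
  then show "z \<in> cycle_space G" using z assms by (auto simp: cycle_space_def)
 qed
 moreover have "z \<in> par_ext e f {{}} \<longleftrightarrow> z \<in> {{}, {e, f}}" for z by (auto simp: par_ext_def)
 ultimately show "cycle_space G = par_ext e f {{}}" by blast
qed

lemma series_parallel_graph_space:
 assumes "series_parallel_graph G"
 shows "loopless_graph G & finite (verts G) & sp_space (edges G) (cycle_space G)"
 using assms
proof induction
 case (parallel_pair u v e f G)
 have "sp_space {f} {{}}" using sp_coloop[OF sp_empty, of f] by simp
 then have "sp_space {e, f} (par_ext e f {{}})" using sp_parallel[of "{f}" "{{}}" f e] parallel_pair by auto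
 then show ?case using parallel_pair_as_ext[OF parallel_pair] parallel_pair by simp
next
 case (add_parallel G f e)
 then show ?case using add_parallel_graph[of G f e] sp_parallel[of "edges G" "cycle_space G" f e] by simp
next
 case (subdivide G f u v e w)
 then show ?case using subdivide_graph[of G f u v e w] sp_series[of "edges G" "cycle_space G" f e] by simp
qed

section \<open>Quasi series-parallel matroids as binary matroids\<close>

lemma indep_bm_sum:
 assumes "E1 Int E2 = {}" "Z1 <= Pow E1" "Z2 <= Pow E2" "{} \<in> Z1" "{} \<in> Z2"
 shows "I \<in> indep (bm (E1 Un E2) (space_sum E1 Z1 E2 Z2)) \<longleftrightarrow>
  I <= E1 Un E2 & I Int E1 \<in> indep (bm E1 Z1) & I Int E2 \<in> indep (bm E2 Z2)"
proof
 assume I: "I \<in> indep (bm (E1 Un E2) (space_sum E1 Z1 E2 Z2))"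
 have "z \<in> space_sum E1 Z1 E2 Z2" if "z \<in> Z1 | z \<in> Z2" for z
 proof -
  have "z \<in> Z1 & z Int E1 = z & z Int E2 = {} | z \<in> Z2 & z Int E2 = z & z Int E1 = {}"
   using that assms by blast
  then show ?thesis using assms by (auto simp: space_sum_def)
 qed
 then show "I <= E1 Un E2 & I Int E1 \<in> indep (bm E1 Z1) & I Int E2 \<in> indep (bm E2 Z2)"
  using I by (simp add: indep_bm)
next
 assume I: "I <= E1 Un E2 & I Int E1 \<in> indep (bm E1 Z1) & I Int E2 \<in> indep (bm E2 Z2)"
 have "z = {}" if z: "z \<in> space_sum E1 Z1 E2 Z2" "z <= I" for z
 proof -
  have "z Int E1 <= I Int E1" "z Int E2 <= I Int E2" using z by auto
  then have "z Int E1 = {}" "z Int E2 = {}" using I z by (auto simp: indep_bm space_sum_def)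
  then show ?thesis using z by (auto simp: space_sum_def)
 qed
 then show "I \<in> indep (bm (E1 Un E2) (space_sum E1 Z1 E2 Z2))" using I by (simp add: indep_bm)
qed

lemma direct_sum_sp:
 assumes "finite \<M>" "\<forall>N\<in>\<M>. \<exists>Z. sp_space (ground N) Z & N = bm (ground N) Z"
  and "\<forall>N\<in>\<M>. \<forall>N'\<in>\<M>. N ~= N' --> ground N Int ground N' = {}"
 shows "\<exists>Z. sp_space (ground (direct_sum \<M>)) Z & direct_sum \<M> = bm (ground (direct_sum \<M>)) Z"
 using assms
proof (induction \<M>)
 case empty
 have "direct_sum {} = bm {} {{}}" by (auto simp: direct_sum_def bm_def)
 then show ?case using sp_empty by (metis ground_bm)
next
 case (insert N \<M>)
 let ?D = "direct_sum \<M>" and ?D' = "direct_sum (insert N \<M>)"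
 obtain Z where Z: "sp_space (ground ?D) Z" "?D = bm (ground ?D) Z" using insert.IH insert.prems by auto
 obtain Z1 where Z1: "sp_space (ground N) Z1" "N = bm (ground N) Z1" using insert.prems by auto
 have disj: "ground N Int ground ?D = {}" using insert.prems(2) insert.hyps by (fastforce simp: direct_sum_def)
 let ?S = "space_sum (ground N) Z1 (ground ?D) Z"
 have gr: "ground ?D' = ground N Un ground ?D" by (simp add: direct_sum_def)
 have "I \<in> indep ?D' \<longleftrightarrow> I \<in> indep (bm (ground N Un ground ?D) ?S)" for I
 proof -
  have "I \<in> indep (bm (ground N Un ground ?D) ?S) \<longleftrightarrow>
    I <= ground N Un ground ?D & I Int ground N \<in> indep N & I Int ground ?D \<in> indep ?D"
   using indep_bm_sum[OF disj sp_space_basic(2)[OF Z1(1)] sp_space_basic(2)[OF Z(1)]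
     set_space_empty[OF sp_space_basic(3)[OF Z1(1)]] set_space_empty[OF sp_space_basic(3)[OF Z(1)]], of I]
    Z(2) Z1(2) by simp
  moreover have "I Int ground ?D Int ground N' = I Int ground N'" if "N' \<in> \<M>" for N'
   using that by (auto simp: direct_sum_def)
  then have "I Int ground ?D \<in> indep ?D \<longleftrightarrow> (\<forall>N'\<in>\<M>. I Int ground N' \<in> indep N')"
   by (simp add: direct_sum_def)
  ultimately show ?thesis by (auto simp: direct_sum_def)
 qed
 then have "?D' = bm (ground ?D') ?S" using gr by (intro matroid.equality) auto
 moreover have "sp_space (ground ?D') ?S" unfolding gr by (rule sp_space_sum[OF Z(1) Z1(1) disj])
 ultimately show ?case by blast
qed

text \<open>Simplicity excludes loop summands. The remaining ones are cycle matroids of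
  series-parallel graphs; the direct sum of their spaces is transported back along the inverse of
  the isomorphism.\<close>

lemma qsp_imp_sp_space:
 fixes M :: "'a matroid"
 assumes M: "matroid M" "simple M" and q: "quasi_series_parallel M"
 shows "\<exists>Z. sp_space (ground M) Z & M = bm (ground M) Z"
proof -
 obtain \<M> :: "'a matroid set" where fin: "finite \<M>"
  and comp: "\<forall>N\<in>\<M>. loop_matroid N | series_parallel N"
  and disj: "\<forall>N\<in>\<M>. \<forall>N'\<in>\<M>. N ~= N' --> ground N Int ground N' = {}"
  and iso: "matroid_iso M (direct_sum \<M>)"
  using q by (auto simp: quasi_series_parallel_def)
 obtain f where f: "bij_betw f (ground M) (ground (direct_sum \<M>))"
  and ind: "!!X. X <= ground M ==> X \<in> indep M \<longleftrightarrow> f ` X \<in> indep (direct_sum \<M>)"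
  using iso by (auto simp: matroid_iso_def)
 have "\<exists>Z. sp_space (ground N) Z & N = bm (ground N) Z" if N: "N \<in> \<M>" for N
 proof -
  have "\<not> loop_matroid N"
  proof
   assume "loop_matroid N"
   then obtain x where x: "N = \<lparr>ground = {x}, indep = {{}}\<rparr>" by (auto simp: loop_matroid_def)
   then have "x \<in> ground N" by simp
   then have "x \<in> ground (direct_sum \<M>)" using N unfolding direct_sum_def by auto
   then obtain y where y: "y \<in> ground M" "f y = x" using f unfolding bij_betw_def by (metis imageE)
   then have "{y, y} \<in> indep M" using M(2) unfolding simple_def by blast
   then have "{y} \<in> indep M" by simp
   then have "{x} \<in> indep (direct_sum \<M>)" using ind[of "{y}"] y by simp
   then have "{x} Int ground N \<in> indep N" using N by (simp add: direct_sum_def)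
   then show False using x by simp
  qed
  then obtain G :: "(nat, 'a) multigraph" where G: "single_edge G | series_parallel_graph G" "N = graphic_matroid G"
   using comp N by (auto simp: series_parallel_def)
  have "loopless_graph G & sp_space (edges G) (cycle_space G)"
   using G(1)
  proof
   assume "single_edge G"
   then obtain e where "edges G = {e}" "cycle_space G = {{}}" "loopless_graph G"
    by (rule single_edge_cycle_space)
   then show ?thesis using sp_coloop[OF sp_empty, of e] by simp
  qed (simp add: series_parallel_graph_space)
  then show ?thesis using graphic_matroid_eq_bm[of G] G(2) by (auto simp: bm_def)
 qed
 then obtain Z where Z: "sp_space (ground (direct_sum \<M>)) Z" "direct_sum \<M> = bm (ground (direct_sum \<M>)) Z"
  using direct_sum_sp[OF fin _ disj] by auto
 let ?E = "ground (direct_sum \<M>)"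
 define g where "g = inv_into (ground M) f"
 have g: "bij_betw g ?E (ground M)" using f unfolding g_def by (rule bij_betw_inv_into)
 have fg: "f (g y) = y" if "y \<in> ?E" for y using f that by (simp add: g_def bij_betw_inv_into_right)
 have gf: "g (f x) = x" if "x \<in> ground M" for x using f that by (simp add: g_def bij_betw_inv_into_left)
 have "sp_space (g ` ?E) ((`) g ` Z)" using Z(1) g by (intro sp_space_rename) (auto simp: bij_betw_def)
 moreover have "g ` ?E = ground M" using g by (simp add: bij_betw_def)
 moreover have "M = bm (ground M) ((`) g ` Z)"
 proof (rule matroid.equality)
  have "X \<in> indep M \<longleftrightarrow> X \<in> indep (bm (ground M) ((`) g ` Z))" for X
  proof (cases "X <= ground M")
   case True
   have fX: "f ` X <= ?E" using True f by (auto simp: bij_betw_def)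
   have "X \<in> indep M \<longleftrightarrow> f ` X \<in> indep (bm ?E Z)" using ind[OF True] Z(2) by simp
   also have "\<dots> \<longleftrightarrow> (\<forall>z\<in>Z. z <= f ` X --> z = {})" using fX by (simp add: indep_bm)
   also have "\<dots> \<longleftrightarrow> (\<forall>z\<in>Z. g ` z <= X --> g ` z = {})"
   proof (intro ball_cong refl)
    fix z assume "z \<in> Z"
    then have "z <= ?E" using sp_space_basic(2)[OF Z(1)] by auto
    have "z <= f ` X \<longleftrightarrow> g ` z <= X"
    proof
     assume zX: "z <= f ` X"
     show "g ` z <= X"
     proof
      fix a assume "a \<in> g ` z"
      then obtain x where "x \<in> X" "a = g (f x)" using zX by blast
      then show "a \<in> X" using True gf[of x] by auto
     qed
    next
     assume gz: "g ` z <= X"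
     show "z <= f ` X"
     proof
      fix y assume y: "y \<in> z"
      then have "f (g y) = y" using \<open>z <= ?E\<close> fg by blast
      then show "y \<in> f ` X" using gz y by (metis image_eqI image_subset_iff)
     qed
    qed
    then show "(z <= f ` X --> z = {}) \<longleftrightarrow> (g ` z <= X --> g ` z = {})" by simp
   qed
   also have "\<dots> \<longleftrightarrow> X \<in> indep (bm (ground M) ((`) g ` Z))" using True by (simp add: indep_bm)
   finally show ?thesis .
  next
   case False
   then show ?thesis using indep_subset_ground[OF M(1)] by (auto simp: indep_bm)
  qed
  then show "indep M = indep (bm (ground M) ((`) g ` Z))" by blast
 qed simp_all
 ultimately show ?thesis by auto
qed

definition sp_block :: "'a set => 'a set set => bool" where
 "sp_block B Z \<longleftrightarrow> (\<exists>G :: (nat, 'a) multigraph. (single_edge G | series_parallel_graph G) &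
   edges G = B & cycle_space G = Z)"

text \<open>The fourth condition says that Z is the direct sum of its restrictions to the blocks,
  the last that each restriction comes from a graph in the strict sense.\<close>

definition sp_decomp :: "'a set => 'a set set => 'a set set => bool" where
 "sp_decomp E Z \<B> \<longleftrightarrow> finite \<B> & \<Union>\<B> = E & (\<forall>B\<in>\<B>. \<forall>C\<in>\<B>. B ~= C --> B Int C = {}) &
   (\<forall>z. z \<in> Z \<longleftrightarrow> z <= E & (\<forall>B\<in>\<B>. z Int B \<in> Z)) & (\<forall>B\<in>\<B>. sp_block B (Z Int Pow B))"

lemma sp_decompI:
 assumes "finite \<B>" "\<Union>\<B> = E" "!!B C. B \<in> \<B> ==> C \<in> \<B> ==> B ~= C ==> B Int C = {}"
  and "!!z. z \<in> Z \<longleftrightarrow> z <= E & (\<forall>B\<in>\<B>. z Int B \<in> Z)" "!!B. B \<in> \<B> ==> sp_block B (Z Int Pow B)"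
 shows "sp_decomp E Z \<B>"
 unfolding sp_decomp_def by (intro conjI ballI allI impI assms)

lemma sp_decompD:
 assumes "sp_decomp E Z \<B>"
 shows "finite \<B>" "\<Union>\<B> = E" "!!B C. B \<in> \<B> ==> C \<in> \<B> ==> B ~= C ==> B Int C = {}"
  and "!!z. z \<in> Z \<longleftrightarrow> z <= E & (\<forall>B\<in>\<B>. z Int B \<in> Z)" "!!B. B \<in> \<B> ==> sp_block B (Z Int Pow B)"
proof -
 note h = assms[unfolded sp_decomp_def]
 note * = h[THEN conjunct1] h[THEN conjunct2, THEN conjunct1] h[THEN conjunct2, THEN conjunct2, THEN conjunct1]
  h[THEN conjunct2, THEN conjunct2, THEN conjunct2, THEN conjunct1]
  h[THEN conjunct2, THEN conjunct2, THEN conjunct2, THEN conjunct2]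
 show "finite \<B>" "\<Union>\<B> = E" by (fact *)+
 show "B \<in> \<B> ==> C \<in> \<B> ==> B ~= C ==> B Int C = {}" for B C using *(3) by blast
 show "z \<in> Z \<longleftrightarrow> z <= E & (\<forall>B\<in>\<B>. z Int B \<in> Z)" for z by (rule spec[OF *(4)])
 show "B \<in> \<B> ==> sp_block B (Z Int Pow B)" for B using *(5) by blast
qed

lemma sp_block_coloop: "sp_block {e} {{}}"
proof -
 let ?G = "\<lparr>verts = {0, 1}, edges = {e}, ends = %_. {0, 1}\<rparr> :: (nat, 'a) multigraph"
 have s: "single_edge ?G" unfolding single_edge_def by (intro exI[of _ 0] exI[of _ 1] exI[of _ e]) simp
 then obtain e' where "cycle_space ?G = {{}}" by (rule single_edge_cycle_space)
 then show ?thesis unfolding sp_block_def using s by (intro exI[of _ ?G]) simp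
qed

lemma sp_block_cases:
 assumes "sp_block B Z"
 obtains (single) e where "B = {e}" "Z = {{}}"
 | (graph) G :: "(nat, 'a) multigraph" where "series_parallel_graph G" "edges G = B" "cycle_space G = Z"
 using assms unfolding sp_block_def by (metis single_edge_cycle_space)

lemma sp_block_par_ext:
 assumes "sp_block B Z" "f \<in> B" "e ~: B"
 shows "sp_block (insert e B) (par_ext e f Z)"
 using assms(1)
proof (cases rule: sp_block_cases)
 case (single e')
 let ?G = "\<lparr>verts = {0, 1}, edges = {e, f}, ends = %_. {0, 1}\<rparr> :: (nat, 'a) multigraph"
 have "e ~= f" "B = {f}" using assms single by auto
 then have "series_parallel_graph ?G" "cycle_space ?G = par_ext e f {{}}"
  using parallel_pair[of 0 1 e f ?G] parallel_pair_as_ext(1)[of 0 1 e f ?G] by auto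
 then show ?thesis unfolding sp_block_def using single \<open>B = {f}\<close> by (intro exI[of _ ?G]) simp
next
 case (graph G)
 then have "loopless_graph G" using series_parallel_graph_space by blast
 then show ?thesis unfolding sp_block_def
  using graph assms add_parallel[of G f e] add_parallel_graph(2)[of G f e]
  by (intro exI[of _ "G\<lparr>edges := insert e (edges G), ends := (ends G)(e := ends G f)\<rparr>"]) auto
qed

lemma sp_block_ser_ext:
 assumes "series_parallel_graph (G :: (nat, 'a) multigraph)" "edges G = B" "cycle_space G = Z" "f \<in> B" "e ~: B"
 shows "sp_block (insert e B) (ser_ext e f Z)"
proof -
 have G: "loopless_graph G" "finite (verts G)" using series_parallel_graph_space[OF assms(1)] by auto
 obtain w where w: "w ~: verts G" using ex_new_if_finite[OF infinite_UNIV_nat G(2)] by auto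
 have "card (ends G f) = 2" using G assms by (auto simp: loopless_graph_def)
 then obtain u v where uv: "ends G f = {u, v}" by (auto simp: card_2_iff)
 show ?thesis unfolding sp_block_def
  using assms subdivide[of G f u v e w] subdivide_graph(2)[of G f u v e w] G uv w
  by (intro exI[of _ "G\<lparr>verts := insert w (verts G), edges := insert e (edges G),
     ends := (ends G)(f := {u, w}, e := {w, v})\<rparr>"]) auto
qed

lemma sp_decomp_coloop:
 assumes D: "sp_decomp E Z \<B>" and Z: "Z <= Pow E" "{} \<in> Z" and e: "e ~: E"
 shows "sp_decomp (insert e E) Z (insert {e} \<B>)"
proof -
 note D' = sp_decompD[OF D]
 have Ze: "Z Int Pow {e} = {{}}" using Z e by auto
 show ?thesis
 proof (rule sp_decompI)
  show "finite (insert {e} \<B>)" "\<Union>(insert {e} \<B>) = insert e E" using D'(1,2) by auto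
  show "z \<in> Z \<longleftrightarrow> z <= insert e E & (\<forall>B\<in>insert {e} \<B>. z Int B \<in> Z)" for z
  proof (cases "e \<in> z")
   case True
   then have "z Int {e} ~: Z" "z ~: Z" using Z(1) e by auto
   then show ?thesis by blast
  next
   case False
   then have "z Int {e} \<in> Z" "z <= insert e E \<longleftrightarrow> z <= E" using Z(2) by auto
   then show ?thesis using D'(4)[of z] by blast
  qed
  have "B Int {e} = {}" if "B \<in> \<B>" for B using that D'(2) e by auto
  then show "B Int C = {}" if "B \<in> insert {e} \<B>" "C \<in> insert {e} \<B>" "B ~= C" for B C
   using that D'(3) by blast
  show "sp_block B (Z Int Pow B)" if "B \<in> insert {e} \<B>" for B
   using that sp_block_coloop[of e] D'(5) Ze by auto
 qed
qed

text \<open>One block of a decomposition is enlarged; \<open>\<pi>\<close> maps the new space back to the old one.\<close>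

lemma sp_decomp_replace:
 assumes D: "sp_decomp E Z \<B>" and B: "B \<in> \<B>" and e: "e ~: E"
  and mem: "!!z. z \<in> Z' \<longleftrightarrow> P z & \<pi> z \<in> Z"
  and loc: "!!z. P (z Int insert e B) \<longleftrightarrow> P z" "!!z. \<pi> (z Int insert e B) = \<pi> z Int B"
  and off: "!!z C. z <= C ==> C Int insert e B = {} ==> P z & \<pi> z = z"
  and off': "!!z C. C Int insert e B = {} ==> \<pi> z Int C = z Int C"
  and sub: "!!z. P z ==> \<pi> z <= E \<longleftrightarrow> z <= insert e E"
  and blk: "sp_block (insert e B) (Z' Int Pow (insert e B))"
 shows "sp_decomp (insert e E) Z' (insert (insert e B) (\<B> - {B}))"
proof -
 note fin = sp_decompD(1)[OF D] and U = sp_decompD(2)[OF D] and dj = sp_decompD(3)[OF D]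
  and Z = sp_decompD(4)[OF D] and blks = sp_decompD(5)[OF D]
 have oth: "C Int insert e B = {}" if "C \<in> \<B> - {B}" for C using that dj[of C B] B U e by auto
 have same: "z \<in> Z' \<longleftrightarrow> z \<in> Z" if "z <= C" "C \<in> \<B> - {B}" for z C
  using off[OF that(1) oth[OF that(2)]] mem by simp
 have "z \<in> Z' \<longleftrightarrow> z <= insert e E & (\<forall>C\<in>insert (insert e B) (\<B> - {B}). z Int C \<in> Z')" for z
 proof -
  have "\<pi> z \<in> Z \<longleftrightarrow> \<pi> z <= E & \<pi> z Int B \<in> Z & (\<forall>C\<in>\<B> - {B}. \<pi> z Int C \<in> Z)"
   using Z[of "\<pi> z"] B by auto
  moreover have "\<pi> z Int C \<in> Z \<longleftrightarrow> z Int C \<in> Z'" if "C \<in> \<B> - {B}" for C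
   using off'[OF oth[OF that]] same[OF _ that, of "z Int C"] by simp
  moreover have "z Int insert e B \<in> Z' \<longleftrightarrow> P z & \<pi> z Int B \<in> Z" using mem loc by simp
  ultimately show ?thesis using mem[of z] sub[of z] by auto
 qed
 moreover have "sp_block C (Z' Int Pow C)" if C: "C \<in> \<B> - {B}" for C
 proof -
  have "Z' Int Pow C = Z Int Pow C" using same[OF _ C] by auto
  then show ?thesis using blks C by simp
 qed
 moreover have "\<Union>(insert (insert e B) (\<B> - {B})) = insert e E" using U B by auto
 moreover have "C Int C' = {}" if "C \<in> insert (insert e B) (\<B> - {B})" "C' \<in> insert (insert e B) (\<B> - {B})" "C ~= C'" for C C'
  using that oth dj by blast
 ultimately show ?thesis using blk fin by (intro sp_decompI) (simp, assumption, assumption, assumption, blast)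
qed

text \<open>Each step enlarges the block containing f. The exception is a series step at a coloop:
  the strict definition does not subdivide a single edge. But then f occurs in no vector, so the
  extension leaves Z unchanged and e becomes a coloop block of its own.\<close>

lemma sp_space_decomp: "sp_space E Z ==> \<exists>\<B>. sp_decomp E Z \<B>"
proof (induction rule: sp_space.induct)
 case sp_empty
 have "sp_decomp {} {{}} {}" by (rule sp_decompI) auto
 then show ?case by blast
next
 case (sp_coloop E Z e)
 then obtain \<B> where D: "sp_decomp E Z \<B>" by auto
 note basic = sp_space_basic[OF sp_coloop.hyps(1)]
 have "sp_decomp (insert e E) Z (insert {e} \<B>)"
  by (rule sp_decomp_coloop[OF D basic(2) set_space_empty[OF basic(3)] sp_coloop.hyps(2)])
 then show ?case by blast
next
 case (sp_parallel E Z f e)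
 then obtain \<B> where D: "sp_decomp E Z \<B>" by auto
 then obtain B where B: "B \<in> \<B>" "f \<in> B" using sp_parallel.hyps(2) sp_decompD(2)[OF D] by blast
 have BE: "B <= E" using B sp_decompD(2)[OF D] by blast
 then have eB: "e ~: B" using sp_parallel.hyps by auto
 let ?\<pi> = "%z. if e \<in> z then sdiff z {e, f} else z"
 have ef: "e ~= f" using sp_parallel.hyps by auto
 have "sp_block (insert e B) (par_ext e f (Z Int Pow B))"
  by (rule sp_block_par_ext[OF sp_decompD(5)[OF D B(1)] B(2) eB])
 also have "par_ext e f (Z Int Pow B) = par_ext e f Z Int Pow (insert e B)"
  using B(2) eB by (auto simp: par_ext_def split: if_splits)
 finally have "sp_decomp (insert e E) (par_ext e f Z) (insert (insert e B) (\<B> - {B}))"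
 proof (rule sp_decomp_replace[OF D B(1) sp_parallel.hyps(3), where P="%_. True" and \<pi>="?\<pi>", rotated -1])
  show "z \<in> par_ext e f Z \<longleftrightarrow> True & ?\<pi> z \<in> Z" for z by (simp add: par_ext_def)
  show "?\<pi> (z Int insert e B) = ?\<pi> z Int B" for z using B(2) eB by auto
  show "True & ?\<pi> z = z" if "z <= C" "C Int insert e B = {}" for z C using that by auto
  show "?\<pi> z Int C = z Int C" if "C Int insert e B = {}" for z C using that B(2) by auto
  show "?\<pi> z <= E \<longleftrightarrow> z <= insert e E" for z using sp_parallel.hyps by auto
 qed simp_all
 then show ?case by blast
next
 case (sp_series E Z f e)
 then obtain \<B> where D: "sp_decomp E Z \<B>" by auto
 then obtain B where B: "B \<in> \<B>" "f \<in> B" using sp_series.hyps(2) sp_decompD(2)[OF D] by blast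
 have BE: "B <= E" using B sp_decompD(2)[OF D] by blast
 then have eB: "e ~: B" using sp_series.hyps by auto
 note basic = sp_space_basic[OF sp_series.hyps(1)]
 have ef: "e ~= f" using sp_series.hyps by auto
 have "sp_block B (Z Int Pow B)" by (rule sp_decompD(5)[OF D B(1)])
 then show ?case
 proof (cases rule: sp_block_cases)
  case (single e')
  then have "B = {f}" using B by auto
  have nf: "f ~: z" if "z \<in> Z" for z
  proof
   assume "f \<in> z"
   have "z Int B \<in> Z" using sp_decompD(4)[OF D, of z] B that by blast
   moreover have "z Int B = {f}" using \<open>B = {f}\<close> \<open>f \<in> z\<close> by auto
   ultimately show False using basic(4) by simp
  qed
  have "ser_ext e f Z = (%z. if f \<in> z then insert e z else z) ` Z"
   by (rule ser_ext_image[OF basic(2) sp_series.hyps(3,2)])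
  also have "\<dots> = Z" using nf by simp
  finally have "ser_ext e f Z = Z" .
  then show ?thesis
   using sp_decomp_coloop[OF D basic(2) set_space_empty[OF basic(3)] sp_series.hyps(3)] by auto
 next
  case (graph G)
  let ?P = "%z. e \<in> z \<longleftrightarrow> f \<in> z" and ?\<pi> = "%z. z - {e}"
  have "sp_block (insert e B) (ser_ext e f (Z Int Pow B))"
   using graph B eB by (intro sp_block_ser_ext) auto
  also have "ser_ext e f (Z Int Pow B) = ser_ext e f Z Int Pow (insert e B)"
   using B(2) eB by (auto simp: ser_ext_def)
  finally have "sp_decomp (insert e E) (ser_ext e f Z) (insert (insert e B) (\<B> - {B}))"
  proof (rule sp_decomp_replace[OF D B(1) sp_series.hyps(3), where P="?P" and \<pi>="?\<pi>", rotated -1])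
   show "z \<in> ser_ext e f Z \<longleftrightarrow> ?P z & ?\<pi> z \<in> Z" for z by (simp add: ser_ext_def)
   show "?P (z Int insert e B) \<longleftrightarrow> ?P z" for z using B(2) by auto
   show "?\<pi> (z Int insert e B) = ?\<pi> z Int B" for z using eB by auto
   show "?P z & ?\<pi> z = z" if "z <= C" "C Int insert e B = {}" for z C using that B(2) by auto
   show "?\<pi> z Int C = z Int C" if "C Int insert e B = {}" for z C using that by auto
   show "?\<pi> z <= E \<longleftrightarrow> z <= insert e E" for z by auto
  qed
  then show ?thesis by blast
 qed
qed

lemma sp_space_imp_qsp:
 assumes "sp_space E Z"
 shows "quasi_series_parallel (bm E Z)"
proof -
 obtain \<B> where D: "sp_decomp E Z \<B>" using sp_space_decomp[OF assms] by auto
 note fin = sp_decompD(1)[OF D] and U = sp_decompD(2)[OF D] and dj = sp_decompD(3)[OF D]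
  and Z = sp_decompD(4)[OF D] and blks = sp_decompD(5)[OF D]
 let ?N = "%B. bm B (Z Int Pow B)"
 have sp: "series_parallel (?N B)" if B: "B \<in> \<B>" for B
 proof -
  obtain G :: "(nat, 'a) multigraph" where G: "single_edge G | series_parallel_graph G" "edges G = B"
   "cycle_space G = Z Int Pow B" using blks[OF B] by (auto simp: sp_block_def)
  have "loopless_graph G" using G(1) series_parallel_graph_space single_edge_cycle_space by metis
  then show ?thesis unfolding series_parallel_def using G graphic_matroid_eq_bm by metis
 qed
 have "direct_sum (?N ` \<B>) = bm E Z"
 proof (rule matroid.equality)
  have "I \<in> indep (direct_sum (?N ` \<B>)) \<longleftrightarrow> I \<in> indep (bm E Z)" for I
  proof
   assume "I \<in> indep (direct_sum (?N ` \<B>))"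
   then have I: "I <= E" "!!B. B \<in> \<B> ==> I Int B \<in> indep (?N B)" using U by (auto simp: direct_sum_def)
   have "z = {}" if z: "z \<in> Z" "z <= I" for z
   proof -
    have "z Int B = {}" if B: "B \<in> \<B>" for B
    proof -
     have "z Int B \<in> Z Int Pow B" using Z[of z] z B by blast
     moreover have "z Int B <= I Int B" using z by auto
     ultimately show ?thesis using I(2)[OF B] by (simp add: indep_bm)
    qed
    moreover have "z <= \<Union>\<B>" using z I(1) U by blast
    ultimately show ?thesis by blast
   qed
   then show "I \<in> indep (bm E Z)" using I by (simp add: indep_bm)
  next
   assume "I \<in> indep (bm E Z)"
   then show "I \<in> indep (direct_sum (?N ` \<B>))" using U by (auto simp: direct_sum_def indep_bm)
  qed
  then show "indep (direct_sum (?N ` \<B>)) = indep (bm E Z)" by blast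
  show "ground (direct_sum (?N ` \<B>)) = ground (bm E Z)" using U by (simp add: direct_sum_def)
 qed simp
 moreover have "matroid_iso M M" for M :: "'a matroid"
  unfolding matroid_iso_def by (intro exI[of _ id]) auto
 moreover have "ground N Int ground N' = {}" if N: "N \<in> ?N ` \<B>" "N' \<in> ?N ` \<B>" "N ~= N'" for N N'
 proof -
  obtain B C where "B \<in> \<B>" "N = ?N B" "C \<in> \<B>" "N' = ?N C" using N by blast
  then show ?thesis using dj[of B C] N(3) by fastforce
 qed
 ultimately show ?thesis
  unfolding quasi_series_parallel_def using fin sp by (intro exI[of _ "?N ` \<B>"]) auto
qed

section \<open>Simple series-parallel spaces\<close>

inductive nice_space :: "'a set => 'a set set => nat => bool" where
 nice_empty: "nice_space {} {{}} 0"
| nice_coloop: "nice_space E Z c ==> e ~: E ==> nice_space (insert e E) Z c"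
| nice_tri: "nice_space E Z c ==> g \<in> E ==> e ~: E ==> f ~: E ==> e ~= f ==>
  nice_space (insert e (insert f E)) (tri_ext e f g Z) (Suc c)"
| nice_subdivide: "nice_space E Z c ==> f \<in> E ==> e ~: E ==> nice_space (insert e E) (ser_ext e f Z) c"

text \<open>These spaces have dimension \<open>c\<close> on \<open>2 c + 1\<close> elements.\<close>

inductive tri_space :: "'a set => 'a set set => bool" where
 tri_single: "tri_space {e} {{}}"
| tri_glue: "tri_space E Z ==> g \<in> E ==> e ~: E ==> f ~: E ==> e ~= f ==>
  tri_space (insert e (insert f E)) (tri_ext e f g Z)"

lemma tri_ext_sub: "Z <= Pow E ==> g \<in> E ==> tri_ext e f g Z <= Pow (insert e (insert f E))"
proof
 fix z assume Z: "Z <= Pow E" "g \<in> E" and z: "z \<in> tri_ext e f g Z"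
 show "z \<in> Pow (insert e (insert f E))"
 proof (cases "e \<in> z")
  case True
  then have "sdiff z {e, f, g} <= E" using z Z by (auto simp: tri_ext_def)
  then show ?thesis using Z(2) by auto
 qed (use z Z in \<open>auto simp: tri_ext_def\<close>)
qed

lemma ser_ext_sub: "Z <= Pow E ==> ser_ext e f Z <= Pow (insert e E)"
 by (auto simp: ser_ext_def)

lemma card_tri_ext:
 assumes Z: "Z <= Pow E" "e ~: E" "f ~: E" "e ~= f" "g \<in> E" and fin: "finite E"
 shows "card (tri_ext e f g Z) = 2 * card Z"
proof -
 have finZ: "finite Z" using Z(1) fin by (meson finite_Pow_iff finite_subset)
 have "e \<in> sdiff z {e, f, g}" if "z \<in> Z" for z using that Z by auto
 then have "Z Int (%z. sdiff z {e, f, g}) ` Z = {}" using Z by blast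
 moreover have "inj_on (%z. sdiff z {e, f, g}) Z" by (rule inj_on_inverseI[of _ "%z. sdiff z {e, f, g}"]) simp
 ultimately show ?thesis
  unfolding tri_ext_image[OF Z] using finZ by (simp add: card_Un_disjoint card_image)
qed

lemma card_ser_ext:
 assumes Z: "Z <= Pow E" "e ~: E" "f \<in> E"
 shows "card (ser_ext e f Z) = card Z"
proof -
 have "inj_on (%z. if f \<in> z then insert e z else z) Z"
  by (rule inj_on_inverseI[of _ "%z. z - {e}"]) (use Z in auto)
 then show ?thesis unfolding ser_ext_image[OF Z] by (rule card_image)
qed

lemma nice_space_basic:
 assumes "nice_space E Z c"
 shows "finite E" "Z <= Pow E" "card Z = 2 ^ c" "E = {} ==> Z = {{}} & c = 0"
proof -
 have "finite E & Z <= Pow E & card Z = 2 ^ c & (E = {} --> Z = {{}} & c = 0)"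
  using assms
 proof induction
  case (nice_tri E Z c g e f)
  then show ?case using tri_ext_sub[of Z E g e f] card_tri_ext[of Z E e f g] by simp
 next
  case (nice_subdivide E Z c f e)
  then show ?case using ser_ext_sub[of Z E e f] card_ser_ext[of Z E e f] by simp
 qed auto
 then show "finite E" "Z <= Pow E" "card Z = 2 ^ c" "E = {} ==> Z = {{}} & c = 0" by auto
qed

lemma nice_space_rename:
 assumes "nice_space E Z c" "inj_on \<phi> E"
 shows "nice_space (\<phi> ` E) ((`) \<phi> ` Z) c"
 using assms
proof induction
 case nice_empty
 then show ?case using nice_space.nice_empty by simp
next
 case (nice_coloop E Z c e)
 have "\<phi> e ~: \<phi> ` E" using nice_coloop.prems nice_coloop.hyps by (auto simp: inj_on_insert)
 then show ?case using nice_coloop by (auto intro: nice_space.nice_coloop)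
next
 case (nice_tri E Z c g e f)
 have new: "\<phi> e ~: \<phi> ` E" "\<phi> f ~: \<phi> ` E" "\<phi> e ~= \<phi> f"
  using nice_tri.prems nice_tri.hyps by (auto simp: inj_on_def)
 have "inj_on \<phi> E" using nice_tri.prems by (auto intro: inj_on_subset)
 then have "nice_space (insert (\<phi> e) (insert (\<phi> f) (\<phi> ` E))) (tri_ext (\<phi> e) (\<phi> f) (\<phi> g) ((`) \<phi> ` Z)) (Suc c)"
  using nice_tri.IH nice_tri.hyps(2) new by (intro nice_space.nice_tri) auto
 then show ?case
  using rename_tri_ext[OF nice_space_basic(2)[OF nice_tri.hyps(1)] nice_tri.hyps(3,4,5,2) nice_tri.prems] by simp
next
 case (nice_subdivide E Z c f e)
 have new: "\<phi> e ~: \<phi> ` E" using nice_subdivide.prems nice_subdivide.hyps by (auto simp: inj_on_insert)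
 have "inj_on \<phi> E" using nice_subdivide.prems by (auto intro: inj_on_subset)
 then have "nice_space (insert (\<phi> e) (\<phi> ` E)) (ser_ext (\<phi> e) (\<phi> f) ((`) \<phi> ` Z)) c"
  using nice_subdivide.IH nice_subdivide.hyps(2) new by (intro nice_space.nice_subdivide) auto
 then show ?case
  using rename_ser_ext[OF nice_space_basic(2)[OF nice_subdivide.hyps(1)] nice_subdivide.hyps(3,2) nice_subdivide.prems]
  by simp
qed

definition parallel_in :: "'a set set => 'a => 'a => bool" where
 "parallel_in Z a b \<longleftrightarrow> a = b | {a, b} \<in> Z"

lemma parallel_in_sym: "parallel_in Z a b ==> parallel_in Z b a"
 by (auto simp: parallel_in_def insert_commute)

lemma parallel_in_trans:
 assumes "set_space Z" "parallel_in Z a b" "parallel_in Z b c"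
 shows "parallel_in Z a c"
proof (cases "a = b | b = c | a = c")
 case False
 then have "{a, b} \<in> Z" "{b, c} \<in> Z" using assms by (auto simp: parallel_in_def)
 then have "sdiff {a, b} {b, c} \<in> Z" using assms(1) set_space_sdiff by blast
 moreover have "sdiff {a, b} {b, c} = {a, c}" using False by auto
 ultimately show ?thesis by (simp add: parallel_in_def)
qed (use assms in \<open>auto simp: parallel_in_def\<close>)

text \<open>It serves twice: for representatives of the parallel classes and, as
  \<open>roots\<close>, for one vertex in each component of a hyperforest.\<close>

definition transversal :: "'a set => ('a => 'a => bool) => 'a set => bool" where
 "transversal E R B \<longleftrightarrow> B <= E & (\<forall>a\<in>E. \<exists>!b. b \<in> B & R a b)"

lemma transversalI:
 assumes "B <= E" "!!a. a \<in> E ==> \<exists>b\<in>B. R a b" "!!a b c. a \<in> E ==> b \<in> B ==> c \<in> B ==> R a b ==> R a c ==> b = c"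
 shows "transversal E R B"
 unfolding transversal_def using assms by blast

lemma transversalD:
 assumes "transversal E R B"
 shows "B <= E" "a \<in> E ==> \<exists>b\<in>B. R a b" "a \<in> E ==> b \<in> B ==> c \<in> B ==> R a b ==> R a c ==> b = c"
 using assms unfolding transversal_def by blast+

text \<open>The new e joins the parallel class of f. A transversal containing e becomes one of the
  old classes when e is renamed to f.\<close>

lemma nice_parallel_step:
 assumes sp: "sp_space E Z" and f: "f \<in> E" and e: "e ~: E"
  and IH: "!!B. transversal E (parallel_in Z) B ==> \<exists>c. nice_space B (Z Int Pow B) c"
  and B: "transversal (insert e E) (parallel_in (par_ext e f Z)) B"
 shows "\<exists>c. nice_space B (par_ext e f Z Int Pow B) c"
proof -
 note basic = sp_space_basic[OF sp]
 have ef: "e ~= f" using e f by auto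
 have old: "parallel_in (par_ext e f Z) a b \<longleftrightarrow> parallel_in Z a b" if "a ~= e" "b ~= e" for a b
  using that by (auto simp: parallel_in_def par_ext_def)
 have new: "parallel_in (par_ext e f Z) a e \<longleftrightarrow> parallel_in Z a f" if "a \<in> E" for a
 proof -
  have ae: "a ~= e" using that e by auto
  have "sdiff {a, e} {e, f} = (if a = f then {} else {a, f})" using ae ef by auto
  then show ?thesis using ae set_space_empty[OF basic(3)] by (auto simp: parallel_in_def par_ext_def)
 qed
 have ff: "parallel_in Z f f" by (simp add: parallel_in_def)
 show ?thesis
 proof (cases "e \<in> B")
  case False
  have "transversal E (parallel_in Z) B"
  proof (rule transversalI)
   show "B <= E" using transversalD(1)[OF B] False by auto
   show "\<exists>b\<in>B. parallel_in Z a b" if "a \<in> E" for a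
    using transversalD(2)[OF B, of a] that old e False by (metis insertCI)
   show "b = c" if "a \<in> E" "b \<in> B" "c \<in> B" "parallel_in Z a b" "parallel_in Z a c" for a b c
    using transversalD(3)[OF B, of a b c] that old e False by (metis insertCI)
  qed
  moreover have "par_ext e f Z Int Pow B = Z Int Pow B" using False by (auto simp: par_ext_def)
  ultimately show ?thesis using IH by simp
 next
  case True
  have fe: "parallel_in (par_ext e f Z) f e" using new[OF f] ff by simp
  have fB: "f ~: B"
  proof
   assume "f \<in> B"
   then have "f = e" using transversalD(3)[OF B, of f f e] True fe f by (simp add: parallel_in_def)
   then show False using ef by simp
  qed
  let ?B = "insert f (B - {e})"
  have BE: "B - {e} <= E" using transversalD(1)[OF B] by auto
  have eqv: "parallel_in Z a b \<longleftrightarrow> parallel_in (par_ext e f Z) a (if b = f then e else b)"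
   if "a \<in> E" "b \<in> ?B" for a b
   using that old[of a b] new[of a] e by auto
  have "transversal E (parallel_in Z) ?B"
  proof (rule transversalI)
   show "?B <= E" using BE f by auto
   show "\<exists>b\<in>?B. parallel_in Z a b" if a: "a \<in> E" for a
   proof -
    obtain b where b: "b \<in> B" "parallel_in (par_ext e f Z) a b" using transversalD(2)[OF B, of a] a by auto
    show ?thesis
    proof (cases "b = e")
     case True
     then show ?thesis using b new[OF a] by auto
    next
     case False
     then have "b \<in> ?B" "b ~= f" using b fB by auto
     then show ?thesis using eqv[OF a, of b] b by auto
    qed
   qed
   show "b = c" if h: "a \<in> E" "b \<in> ?B" "c \<in> ?B" "parallel_in Z a b" "parallel_in Z a c" for a b c
   proof -
    have "(if b = f then e else b) = (if c = f then e else c)"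
    proof (rule transversalD(3)[OF B, of a])
     show "(if b = f then e else b) \<in> B" "(if c = f then e else c) \<in> B" using h True by auto
    qed (use h eqv in auto)
    then show ?thesis using h e BE by (auto split: if_splits)
   qed
  qed
  then obtain c where c: "nice_space ?B (Z Int Pow ?B) c" using IH by auto
  let ?\<phi> = "%a. if a = f then e else a"
  have inj: "inj_on ?\<phi> ?B" by (auto simp: inj_on_def)
  have img: "?\<phi> ` ?B = B" using True fB by (auto simp: image_iff)
  have "(`) ?\<phi> ` (Z Int Pow ?B) = par_ext e f Z Int Pow B"
  proof (intro equalityI subsetI)
   fix z assume "z \<in> (`) ?\<phi> ` (Z Int Pow ?B)"
   then obtain w where w: "w \<in> Z" "w <= ?B" "z = ?\<phi> ` w" by auto
   have "e ~: w" using w basic(2) e by auto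
   have "z = (if f \<in> w then sdiff w {e, f} else w)" using w(3) \<open>e ~: w\<close> ef by (auto simp: image_iff)
   then have "z \<in> par_ext e f Z" using w(1) \<open>e ~: w\<close> by (auto simp: par_ext_def)
   moreover have "z <= B" using w img by blast
   ultimately show "z \<in> par_ext e f Z Int Pow B" by simp
  next
   fix z assume z: "z \<in> par_ext e f Z Int Pow B"
   define w where "w = (if e \<in> z then sdiff z {e, f} else z)"
   have fz: "f ~: z" using z fB by auto
   have "w \<in> Z" using z by (simp add: par_ext_def w_def)
   moreover have "w <= ?B" using z by (auto simp: w_def)
   moreover have "z = ?\<phi> ` w" using fz ef by (auto simp: w_def image_iff)
   ultimately show "z \<in> (`) ?\<phi> ` (Z Int Pow ?B)" by blast
  qed
  then show ?thesis using nice_space_rename[OF c inj] img by auto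
 qed
qed

text \<open>Subdividing f isolates both e and f in the parallel relation, so B contains both. If f
  had no parallel partner, e subdivides f within the old transversal. Otherwise the partner is
  represented by some g in B; then B without e and f is a transversal of the old classes, and e, f,
  g form a triangle glued at g.\<close>

lemma nice_series_step:
 assumes sp: "sp_space E Z" and f: "f \<in> E" and e: "e ~: E"
  and IH: "!!B. transversal E (parallel_in Z) B ==> \<exists>c. nice_space B (Z Int Pow B) c"
  and B: "transversal (insert e E) (parallel_in (ser_ext e f Z)) B"
 shows "\<exists>c. nice_space B (ser_ext e f Z Int Pow B) c"
proof -
 note basic = sp_space_basic[OF sp]
 have ef: "e ~= f" using e f by auto
 have old: "parallel_in (ser_ext e f Z) a b \<longleftrightarrow> parallel_in Z a b" if "a ~: {e, f}" "b ~: {e, f}" for a b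
  using that by (auto simp: parallel_in_def ser_ext_def)
 have iso: "parallel_in (ser_ext e f Z) a b \<longleftrightarrow> a = b" if "a \<in> {e, f} | b \<in> {e, f}" for a b
 proof -
  have "{a, b} ~: ser_ext e f Z" if ab: "a ~= b"
  proof
   assume m: "{a, b} \<in> ser_ext e f Z"
   then have "{a, b} = {e, f}" using ab ef \<open>a \<in> {e, f} | b \<in> {e, f}\<close> by (auto simp: ser_ext_def)
   then have "{a, b} - {e} = {f}" using ef by auto
   then show False using m basic(4)[of f] by (simp add: ser_ext_def)
  qed
  then show ?thesis by (auto simp: parallel_in_def)
 qed
 have eB: "e \<in> B" "f \<in> B" using transversalD(2)[OF B, of e] transversalD(2)[OF B, of f] iso f by auto
 have BE: "B - {e} <= E" using transversalD(1)[OF B] by auto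
 show ?thesis
 proof (cases "\<exists>g. g ~= f & {f, g} \<in> Z")
  case False
  have only: "parallel_in Z a f \<longleftrightarrow> a = f" for a
   using False by (auto simp: parallel_in_def insert_commute)
  then have only': "parallel_in Z f a \<longleftrightarrow> a = f" for a using parallel_in_sym by metis
  have eqv: "parallel_in Z a b \<longleftrightarrow> parallel_in (ser_ext e f Z) a b" if "a ~= e" "b ~= e" for a b
   using that old[of a b] iso[of a b] only only' by (cases "a = f | b = f") auto
  have "transversal E (parallel_in Z) (B - {e})"
  proof (rule transversalI)
   show "B - {e} <= E" by (rule BE)
   show "\<exists>b\<in>B - {e}. parallel_in Z a b" if a: "a \<in> E" for a
   proof -
    obtain b where b: "b \<in> B" "parallel_in (ser_ext e f Z) a b" using transversalD(2)[OF B, of a] a by auto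
    have "a ~= e" using a e by auto
    then have "b ~= e" using b(2) iso[of a b] by auto
    then show ?thesis using b eqv[OF \<open>a ~= e\<close>] by auto
   qed
   show "b = c" if h: "a \<in> E" "b \<in> B - {e}" "c \<in> B - {e}" "parallel_in Z a b" "parallel_in Z a c" for a b c
   proof -
    have "a ~= e" using h e by auto
    then have "parallel_in (ser_ext e f Z) a b" "parallel_in (ser_ext e f Z) a c" using h eqv by auto
    then show ?thesis using transversalD(3)[OF B, of a b c] h by auto
   qed
  qed
  then obtain c where "nice_space (B - {e}) (Z Int Pow (B - {e})) c" using IH by auto
  then have "nice_space (insert e (B - {e})) (ser_ext e f (Z Int Pow (B - {e}))) c"
   using eB ef by (intro nice_subdivide) auto
  moreover have "ser_ext e f (Z Int Pow (B - {e})) = ser_ext e f Z Int Pow B"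
   using eB by (auto simp: ser_ext_def)
  ultimately show ?thesis using eB by (auto simp: insert_absorb)
 next
  case True
  then obtain g0 where g0: "g0 ~= f" "{f, g0} \<in> Z" by auto
  then have g0E: "g0 \<in> E" "g0 ~= e" using basic(2) e by auto
  obtain g where g: "g \<in> B" "parallel_in (ser_ext e f Z) g0 g" using transversalD(2)[OF B, of g0] g0E by auto
  have gef: "g ~: {e, f}" using g(2) iso[of g0 g] g0 g0E by auto
  then have gg0: "parallel_in Z g0 g" using g(2) old[of g0 g] g0 g0E by auto
  have "parallel_in Z f g0" using g0 by (simp add: parallel_in_def)
  then have fg: "parallel_in Z f g" using gg0 parallel_in_trans[OF basic(3)] by blast
  then have fgZ: "{f, g} \<in> Z" using gef by (auto simp: parallel_in_def)
  let ?B = "B - {e, f}"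
  have "transversal E (parallel_in Z) ?B"
  proof (rule transversalI)
   show "?B <= E" using BE by auto
   show "\<exists>b\<in>?B. parallel_in Z a b" if a: "a \<in> E" for a
   proof (cases "a = f")
    case True
    then show ?thesis using fg g gef by auto
   next
    case False
    have "a ~= e" using a e by auto
    obtain b where b: "b \<in> B" "parallel_in (ser_ext e f Z) a b" using transversalD(2)[OF B, of a] a by auto
    have "b ~: {e, f}" using b(2) iso[of a b] False \<open>a ~= e\<close> by auto
    then show ?thesis using b old[of a b] False \<open>a ~= e\<close> by auto
   qed
   show "b = c" if h: "a \<in> E" "b \<in> ?B" "c \<in> ?B" "parallel_in Z a b" "parallel_in Z a c" for a b c
   proof -
    \<comment> \<open>In the new space f is parallel only to itself, so uniqueness within its old
      class has to be read off at the partner g.\<close>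
    define a' where "a' = (if a = f then g else a)"
    have "parallel_in Z a' d" if "parallel_in Z a d" for d
     using parallel_in_trans[OF basic(3) parallel_in_sym[OF fg], of d] that by (cases "a = f") (simp_all add: a'_def)
    then have par: "parallel_in Z a' b" "parallel_in Z a' c" using h(4,5) by auto
    have a': "a' ~: {e, f}" "a' \<in> insert e E" using h(1) e gef g(1) transversalD(1)[OF B] by (auto simp: a'_def)
    show ?thesis using transversalD(3)[OF B a'(2), of b c] h(2,3) par old[OF a'(1), of b] old[OF a'(1), of c] by auto
   qed
  qed
  then obtain c where c: "nice_space ?B (Z Int Pow ?B) c" using IH by auto
  have "nice_space (insert e (insert f ?B)) (tri_ext e f g (Z Int Pow ?B)) (Suc c)"
   using c g gef ef by (intro nice_tri) auto
  moreover have "insert e (insert f ?B) = B" using eB by auto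
  moreover have "tri_ext e f g (Z Int Pow ?B) = ser_ext e f Z Int Pow B"
  proof -
   have "z \<in> tri_ext e f g (Z Int Pow ?B) \<longleftrightarrow> z \<in> ser_ext e f Z Int Pow B" for z
   proof (cases "e \<in> z \<longleftrightarrow> f \<in> z")
    case True
    show ?thesis
    proof (cases "e \<in> z")
     case ez: True
     have "sdiff z {e, f, g} = sdiff (z - {e}) {f, g}" using ez ef gef by auto
     then have "sdiff z {e, f, g} \<in> Z \<longleftrightarrow> z - {e} \<in> Z" using set_space_sdiff_iff[OF basic(3) fgZ] by simp
     moreover have "sdiff z {e, f, g} <= ?B \<longleftrightarrow> z <= B" using ez True g gef eB by auto
     ultimately show ?thesis using ez True by (simp add: tri_ext_def ser_ext_def)
    next
     case False
     then show ?thesis using True by (auto simp: tri_ext_def ser_ext_def)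
    qed
   qed (auto simp: tri_ext_def ser_ext_def)
   then show ?thesis by blast
  qed
  ultimately show ?thesis by auto
 qed
qed

text \<open>The intermediate spaces of a simple one may have parallel elements, so the induction
  runs over all series-parallel spaces and speaks of their simplifications, the restrictions to
  transversals of the parallel classes.\<close>

lemma sp_space_nice:
 "sp_space E Z ==> transversal E (parallel_in Z) B ==> \<exists>c. nice_space B (Z Int Pow B) c"
proof (induction arbitrary: B rule: sp_space.induct)
 case sp_empty
 then have "B = {}" by (auto simp: transversal_def)
 then have "nice_space B ({{}} Int Pow B) 0" using nice_empty by simp
 then show ?case by blast
next
 case (sp_coloop E Z e)
 note basic = sp_space_basic[OF sp_coloop.hyps(1)]
 have iso: "parallel_in Z a b \<longleftrightarrow> a = b" if "a = e | b = e" for a b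
  using that basic(2) sp_coloop.hyps(2) by (auto simp: parallel_in_def)
 have eB: "e \<in> B" using transversalD(2)[OF sp_coloop.prems, of e] iso by auto
 have BE: "B - {e} <= E" using transversalD(1)[OF sp_coloop.prems] by auto
 have "transversal E (parallel_in Z) (B - {e})"
 proof (rule transversalI)
  show "B - {e} <= E" by (rule BE)
  show "\<exists>b\<in>B - {e}. parallel_in Z a b" if a: "a \<in> E" for a
  proof -
   obtain b where b: "b \<in> B" "parallel_in Z a b" using transversalD(2)[OF sp_coloop.prems, of a] a by auto
   then have "b ~= e" using iso[of a b] a sp_coloop.hyps(2) by auto
   then show ?thesis using b by auto
  qed
  show "b = c" if "a \<in> E" "b \<in> B - {e}" "c \<in> B - {e}" "parallel_in Z a b" "parallel_in Z a c" for a b c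
   using transversalD(3)[OF sp_coloop.prems, of a b c] that by auto
 qed
 then obtain c where "nice_space (B - {e}) (Z Int Pow (B - {e})) c" using sp_coloop.IH by auto
 then have "nice_space (insert e (B - {e})) (Z Int Pow (B - {e})) c" by (rule nice_coloop) simp
 moreover have "Z Int Pow (B - {e}) = Z Int Pow B" using basic(2) sp_coloop.hyps(2) by auto
 ultimately show ?case using eB by (auto simp: insert_absorb)
next
 case (sp_parallel E Z f e)
 show ?case by (rule nice_parallel_step[OF sp_parallel.hyps sp_parallel.IH sp_parallel.prems])
next
 case (sp_series E Z f e)
 show ?case by (rule nice_series_step[OF sp_series.hyps sp_series.IH sp_series.prems])
qed

lemma sp_space_simple_nice:
 assumes sp: "sp_space E Z" and simple: "!!z. z \<in> Z ==> z ~= {} ==> 3 <= card z"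
 shows "\<exists>c. nice_space E Z c"
proof -
 have "parallel_in Z a b \<longleftrightarrow> a = b" for a b
 proof -
  have "{a, b} ~: Z"
  proof
   assume "{a, b} \<in> Z"
   then have "3 <= card {a, b}" using simple by blast
   moreover have "card {a, b} <= 2" by (simp add: card_insert_if)
   ultimately show False by simp
  qed
  then show ?thesis by (auto simp: parallel_in_def)
 qed
 then have "transversal E (parallel_in Z) E" by (intro transversalI) auto
 moreover have "Z Int Pow E = Z" using sp_space_basic(2)[OF sp] by auto
 ultimately show ?thesis using sp_space_nice[OF sp, of E] by auto
qed

section \<open>Spaces of small deficiency\<close>

lemma tri_space_basic:
 assumes "tri_space E Z"
 shows "finite E" "Z <= Pow E" "sp_space E Z" "card E = 2 * c + 1 ==> card Z = 2 ^ c" "odd (card E)"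
  and "!!z. z \<in> Z ==> z ~= {} ==> 3 <= card z"
proof -
 have "finite E & Z <= Pow E & sp_space E Z & (\<exists>c. card E = 2 * c + 1 & card Z = 2 ^ c) &
   (\<forall>z\<in>Z. z ~= {} --> 3 <= card z)"
  using assms
 proof induction
  case (tri_single e)
  then show ?case using sp_coloop[OF sp_empty, of e] by simp
 next
  case (tri_glue E Z g e f)
  then have sub: "Z <= Pow E" and fin: "finite E" and sp: "sp_space E Z" by auto
  obtain c where c: "card E = 2 * c + 1" "card Z = 2 ^ c" using tri_glue.IH by auto
  have "sp_space (insert e (insert f E)) (ser_ext e f (par_ext f g Z))"
   using sp tri_glue.hyps by (intro sp_series sp_parallel) auto
  then have "sp_space (insert e (insert f E)) (tri_ext e f g Z)"
   using tri_ext_eq[OF sub tri_glue.hyps(3,4,5,2)] by simp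
  moreover have "card (tri_ext e f g Z) = 2 ^ Suc c"
   using card_tri_ext[OF sub tri_glue.hyps(3,4,5,2) fin] c by simp
  moreover have "card (insert e (insert f E)) = 2 * Suc c + 1" using tri_glue.hyps fin c by simp
  moreover have "3 <= card z" if z: "z \<in> tri_ext e f g Z" "z ~= {}" for z
  proof (cases "e \<in> z")
   case True
   let ?w = "sdiff z {e, f, g}"
   have w: "?w \<in> Z" and fz: "f \<in> z" using z True by (auto simp: tri_ext_def)
   have finz: "finite z" using tri_ext_sub[OF sub tri_glue.hyps(2), of e f] z fin
    by (meson PowD finite_insert finite_subset subsetD)
   have ne: "z - {e, f} ~= {}"
   proof
    assume "z - {e, f} = {}"
    then have "z = {e, f}" using True fz by auto
    then have "?w = {g}" using tri_glue.hyps by auto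
    then show False using w sp_space_basic(4)[OF sp] by simp
   qed
   have "{e, f} <= z" "card {e, f} = 2" using True fz tri_glue.hyps(5) by auto
   then have "card z = card (z - {e, f}) + 2"
    using finz card_Diff_subset[of "{e, f}" z] card_mono[of z "{e, f}"] by simp
   moreover have "card (z - {e, f}) > 0" using ne finz by (simp add: card_gt_0_iff)
   ultimately show ?thesis by simp
  next
   case False
   then show ?thesis using z tri_glue.IH by (simp add: tri_ext_def)
  qed
  ultimately show ?case using tri_ext_sub[OF sub tri_glue.hyps(2)] fin by blast
 qed
 then show "finite E" "Z <= Pow E" "sp_space E Z" "card E = 2 * c + 1 ==> card Z = 2 ^ c" "odd (card E)"
  "!!z. z \<in> Z ==> z ~= {} ==> 3 <= card z" by auto
qed

lemma tri_space_rename: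
 assumes "tri_space E Z" "inj_on \<phi> E"
 shows "tri_space (\<phi> ` E) ((`) \<phi> ` Z)"
 using assms
proof induction
 case (tri_single e)
 then show ?case using tri_space.tri_single by simp
next
 case (tri_glue E Z g e f)
 have new: "\<phi> e ~: \<phi> ` E" "\<phi> f ~: \<phi> ` E" "\<phi> e ~= \<phi> f"
  using tri_glue.prems tri_glue.hyps by (auto simp: inj_on_def)
 have "inj_on \<phi> E" using tri_glue.prems by (auto intro: inj_on_subset)
 then have "tri_space (insert (\<phi> e) (insert (\<phi> f) (\<phi> ` E))) (tri_ext (\<phi> e) (\<phi> f) (\<phi> g) ((`) \<phi> ` Z))"
  using tri_glue.IH tri_glue.hyps(2) new by (intro tri_space.tri_glue) auto
 then show ?case
  using rename_tri_ext[OF tri_space_basic(2)[OF tri_glue.hyps(1)] tri_glue.hyps(3,4,5,2) tri_glue.prems] by simp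
qed

text \<open>Every element lies on one of the glued triangles, so there are no coloops; deleting a
  point will therefore halve the space.\<close>

lemma tri_space_card_3: "tri_space E Z ==> x \<in> E ==> card E ~= 1 ==> \<exists>z\<in>Z. x \<in> z"
proof (induction rule: tri_space.induct)
 case (tri_glue E Z g e f)
 note basic = tri_space_basic[OF tri_glue.hyps(1)]
 have "sdiff {e, f, g} {e, f, g} \<in> Z" using set_space_empty[OF sp_space_basic(3)[OF basic(3)]] by simp
 then have T: "{e, f, g} \<in> tri_ext e f g Z" by (simp add: tri_ext_def)
 show ?case
 proof (cases "x \<in> {e, f, g}")
  case True
  then show ?thesis using T by (rule bexI)
 next
  case False
  then have xE: "x \<in> E" using tri_glue.prems by auto
  have "card E ~= 1"
  proof
   assume "card E = 1"
   then obtain a where "E = {a}" by (rule card_1_singletonE)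
   then show False using xE tri_glue.hyps(2) False by simp
  qed
  then obtain z where z: "z \<in> Z" "x \<in> z" using tri_glue.IH xE by auto
  then have "e ~: z" "f ~: z" using basic(2) tri_glue.hyps by auto
  then have "z \<in> tri_ext e f g Z" using z(1) by (simp add: tri_ext_def)
  then show ?thesis using z(2) by (rule bexI[rotated])
 qed
qed simp

definition replace_elem :: "'a => 'a => 'a => 'a" where
 "replace_elem f x a = (if a = f then x else a)"

lemma replace_elem_image: "replace_elem f x ` z = (if f \<in> z then insert x (z - {f}) else z)"
 by (auto simp: replace_elem_def image_iff)

lemma replace_elem_inj: "x ~: E ==> inj_on (replace_elem f x) E"
 by (auto simp: inj_on_def replace_elem_def split: if_splits)

lemma in_rename_single:
 assumes "Z <= Pow E" "x ~: E"
  and False: "f ~= x"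
 shows "w \<in> (`) (replace_elem f x) ` Z \<longleftrightarrow> f ~: w & (if x \<in> w then insert f (w - {x}) else w) \<in> Z"
proof -
 let ?\<phi> = "replace_elem f x"
 note img = replace_elem_image[of f x]
 show ?thesis
 proof
  assume "w \<in> (`) ?\<phi> ` Z"
  then obtain z where z: "z \<in> Z" "w = ?\<phi> ` z" by auto
  then have "x ~: z" using assms by auto
  show "f ~: w & (if x \<in> w then insert f (w - {x}) else w) \<in> Z"
  proof (cases "f \<in> z")
   case True
   then have "w = insert x (z - {f})" using z img by simp
   moreover from this have "insert f (w - {x}) = z" using True \<open>x ~: z\<close> by auto
   ultimately show ?thesis using z False by auto
  next
   case nf: False
   then have "w = z" using z img by simp
   then show ?thesis using z nf \<open>x ~: z\<close> by simp
  qed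
 next
  assume h: "f ~: w & (if x \<in> w then insert f (w - {x}) else w) \<in> Z"
  have "?\<phi> ` (if x \<in> w then insert f (w - {x}) else w) = w" using h False by (auto simp: img)
  then show "w \<in> (`) ?\<phi> ` Z" using h by (metis image_eqI)
 qed
qed

text \<open>The old f is renamed to x, the triangle {e, f, x} is glued onto it, and x is deleted:
  what remains of the old element is the path e, f.\<close>

lemma tri_space_subdivide:
 assumes T: "tri_space E Z" and f: "f \<in> E" and e: "e ~: E" and x: "x ~: insert e E"
 defines "Z0 \<equiv> tri_ext e f x ((`) (replace_elem f x) ` Z)"
 shows "tri_space (insert x (insert e E)) Z0" "{z \<in> Z0. x ~: z} = ser_ext e f Z"
proof -
 let ?\<phi> = "replace_elem f x"
 have sub: "Z <= Pow E" by (rule tri_space_basic(2)[OF T])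
 have "inj_on ?\<phi> E" using x by (intro replace_elem_inj) auto
 then have T': "tri_space (?\<phi> ` E) ((`) ?\<phi> ` Z)" by (rule tri_space_rename[OF T])
 have img: "?\<phi> ` E = insert x (E - {f})" using f by (simp add: replace_elem_image)
 have "tri_space (insert e (insert f (insert x (E - {f})))) Z0"
  unfolding Z0_def using T' e f x unfolding img by (intro tri_glue) auto
 moreover have "insert e (insert f (insert x (E - {f}))) = insert x (insert e E)" using f by auto
 ultimately show "tri_space (insert x (insert e E)) Z0" by simp
 have fx: "f ~= x" "e ~= x" "e ~= f" using x f e by auto
 have mem: "w \<in> (`) ?\<phi> ` Z \<longleftrightarrow> f ~: w & (if x \<in> w then insert f (w - {x}) else w) \<in> Z" for w
  using in_rename_single[OF sub _ fx(1), of w] x by auto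
 have "z \<in> Z0 & x ~: z \<longleftrightarrow> z \<in> ser_ext e f Z" for z
 proof (cases "x \<in> z")
  case True
  then have "z - {e} ~: Z" using sub x fx by auto
  then show ?thesis using True by (simp add: ser_ext_def)
 next
  case False
  show ?thesis
  proof (cases "e \<in> z & f \<in> z")
   case True
   have "x \<in> sdiff z {e, f, x}" "f ~: sdiff z {e, f, x}" using True False by auto
   moreover have "insert f (sdiff z {e, f, x} - {x}) = z - {e}" using True False fx by auto
   ultimately have "sdiff z {e, f, x} \<in> (`) ?\<phi> ` Z \<longleftrightarrow> z - {e} \<in> Z" by (simp add: mem)
   then show ?thesis using True False by (simp add: Z0_def tri_ext_def ser_ext_def)
  next
   case h: False
   then show ?thesis using False by (auto simp: Z0_def tri_ext_def ser_ext_def mem)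
  qed
 qed
 then show "{z \<in> Z0. x ~: z} = ser_ext e f Z" by blast
qed

text \<open>A triangle adds two elements and one dimension, any other step one element and no
  dimension, and the first step is a coloop. So 2 c + 1 elements leave room for triangles only, and
  2 c + 2 for one further coloop or subdivision, either of which is the deletion of a point x from a
  space of triangles.\<close>

lemma nice_space_deficiency:
 assumes "nice_space E Z c" "E ~= {}"
 shows "2 * c + 1 <= card E" "card E = 2 * c + 1 ==> tri_space E Z"
  "card E = 2 * c + 2 ==> x ~: E ==> \<exists>Z0. tri_space (insert x E) Z0 & Z = {z \<in> Z0. x ~: z}"
proof -
 have "2 * c + 1 <= card E & (card E = 2 * c + 1 --> tri_space E Z) &
  (card E = 2 * c + 2 --> (\<forall>x. x ~: E --> (\<exists>Z0. tri_space (insert x E) Z0 & Z = {z \<in> Z0. x ~: z})))"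
  using assms
 proof induction
  case (nice_coloop E Z c e)
  note basic = nice_space_basic[OF nice_coloop.hyps(1)]
  show ?case
  proof (cases "E = {}")
   case True
   then show ?thesis using basic(4) tri_single[of e] by simp
  next
   case False
   then have IH: "2 * c + 1 <= card E" "card E = 2 * c + 1 ==> tri_space E Z" using nice_coloop.IH by auto
   have card: "card (insert e E) = card E + 1" using basic(1) nice_coloop.hyps(2) by simp
   have "\<exists>Z0. tri_space (insert x (insert e E)) Z0 & Z = {z \<in> Z0. x ~: z}"
    if eq: "card (insert e E) = 2 * c + 2" and x: "x ~: insert e E" for x
   proof -
    have T: "tri_space E Z" using IH(2) eq card by simp
    obtain h where h: "h \<in> E" using False by auto
    \<comment> \<open>The coloop e is what is left of a triangle {x, e, h}, glued at an arbitrary h,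
      once x is deleted.\<close>
    have "tri_space (insert x (insert e E)) (tri_ext x e h Z)"
     using T h x nice_coloop.hyps(2) by (intro tri_glue) auto
    moreover have "{z \<in> tri_ext x e h Z. x ~: z} = Z"
     using basic(2) x nice_coloop.hyps(2) by (auto simp: tri_ext_def)
    ultimately show ?thesis by blast
   qed
   then show ?thesis using IH(1) card by auto
  qed
 next
  case (nice_tri E Z c g e f)
  note basic = nice_space_basic[OF nice_tri.hyps(1)]
  have "E ~= {}" using nice_tri.hyps(2) by auto
  then have IH: "2 * c + 1 <= card E" "card E = 2 * c + 1 ==> tri_space E Z"
   "!!x. card E = 2 * c + 2 ==> x ~: E ==> \<exists>Z0. tri_space (insert x E) Z0 & Z = {z \<in> Z0. x ~: z}"
   using nice_tri.IH by auto
  have card: "card (insert e (insert f E)) = card E + 2" using basic(1) nice_tri.hyps by simp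
  have "tri_space (insert e (insert f E)) (tri_ext e f g Z)" if "card E = 2 * c + 1"
   using IH(2)[OF that] nice_tri.hyps by (intro tri_glue) auto
  moreover have "\<exists>Z0. tri_space (insert x (insert e (insert f E))) Z0 & tri_ext e f g Z = {z \<in> Z0. x ~: z}"
   if eq: "card E = 2 * c + 2" and x: "x ~: insert e (insert f E)" for x
  proof -
   obtain Z0 where Z0: "tri_space (insert x E) Z0" "Z = {z \<in> Z0. x ~: z}" using IH(3)[OF eq] x by auto
   have "tri_space (insert e (insert f (insert x E))) (tri_ext e f g Z0)"
    using Z0(1) nice_tri.hyps x by (intro tri_glue) auto
   moreover have "insert e (insert f (insert x E)) = insert x (insert e (insert f E))" by auto
   moreover have "tri_ext e f g Z = {z \<in> tri_ext e f g Z0. x ~: z}"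
    unfolding Z0(2) using x nice_tri.hyps(2) by (auto simp: tri_ext_def)
   ultimately show ?thesis by auto
  qed
  ultimately show ?case using IH(1) card by auto
 next
  case (nice_subdivide E Z c f e)
  note basic = nice_space_basic[OF nice_subdivide.hyps(1)]
  have "E ~= {}" using nice_subdivide.hyps(2) by auto
  then have IH: "2 * c + 1 <= card E" "card E = 2 * c + 1 ==> tri_space E Z" using nice_subdivide.IH by auto
  have card: "card (insert e E) = card E + 1" using basic(1) nice_subdivide.hyps(3) by simp
  have "\<exists>Z0. tri_space (insert x (insert e E)) Z0 & ser_ext e f Z = {z \<in> Z0. x ~: z}"
   if "card E = 2 * c + 1" "x ~: insert e E" for x
   using tri_space_subdivide[OF IH(2)[OF that(1)] nice_subdivide.hyps(2,3) that(2)] by blast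
  then show ?case using IH(1) card by auto
 qed simp
 then show "2 * c + 1 <= card E" "card E = 2 * c + 1 ==> tri_space E Z"
  "card E = 2 * c + 2 ==> x ~: E ==> \<exists>Z0. tri_space (insert x E) Z0 & Z = {z \<in> Z0. x ~: z}" by auto
qed

text \<open>Deleting e or f leaves the other one as a coloop; deleting g leaves e and f in series in
  the place of g; deleting any other point commutes with gluing the triangle.\<close>

lemma tri_space_delete:
 "tri_space E Z ==> x \<in> E ==> sp_space (E - {x}) {z \<in> Z. x ~: z}"
proof (induction rule: tri_space.induct)
 case (tri_single e)
 then show ?case using sp_empty by (auto simp: Collect_conv_if)
next
 case (tri_glue E Z g e f)
 note basic = tri_space_basic[OF tri_glue.hyps(1)] and h = tri_glue.hyps
 have fresh: "e ~: z & f ~: z" if "z \<in> Z" for z using that basic(2) h by auto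
 consider "x = e" | "x = f" | "x = g" | "x \<in> E" "x ~= g" using tri_glue.prems by blast
 then show ?case
 proof cases
  case 1
  then have "insert e (insert f E) - {x} = insert f E" using h by auto
  moreover have "{z \<in> tri_ext e f g Z. x ~: z} = Z" using 1 fresh by (auto simp: tri_ext_def)
  ultimately show ?thesis using sp_coloop[OF basic(3) h(4)] by simp
 next
  case 2
  then have "insert e (insert f E) - {x} = insert e E" using h by auto
  moreover have "{z \<in> tri_ext e f g Z. x ~: z} = Z" using 2 fresh by (auto simp: tri_ext_def)
  ultimately show ?thesis using sp_coloop[OF basic(3) h(3)] by simp
 next
  case 3
  let ?\<phi> = "replace_elem g e"
  have "inj_on ?\<phi> E" by (rule replace_elem_inj[OF h(3)])
  then have "sp_space (?\<phi> ` E) ((`) ?\<phi> ` Z)" by (rule sp_space_rename[OF basic(3)])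
  moreover have "?\<phi> ` E = insert e (E - {g})" using h(2) by (simp add: replace_elem_image)
  ultimately have "sp_space (insert f (insert e (E - {g}))) (ser_ext f e ((`) ?\<phi> ` Z))"
   using h by (intro sp_series) auto
  moreover have "insert f (insert e (E - {g})) = insert e (insert f E) - {x}" using 3 h by auto
  moreover have "ser_ext f e ((`) ?\<phi> ` Z) = {z \<in> tri_ext e f g Z. x ~: z}"
  proof -
   have ge: "g ~= e" "g ~= f" using h by auto
   have mem: "w \<in> (`) ?\<phi> ` Z \<longleftrightarrow> g ~: w & (if e \<in> w then insert g (w - {e}) else w) \<in> Z" for w
    by (rule in_rename_single[OF basic(2) h(3) ge(1)])
   have "z \<in> ser_ext f e ((`) ?\<phi> ` Z) \<longleftrightarrow> z \<in> tri_ext e f g Z & g ~: z" for z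
   proof (cases "e \<in> z & f \<in> z & g ~: z")
    case True
    then have "insert g (z - {f} - {e}) = sdiff z {e, f, g}" by auto
    then show ?thesis using True h(5) by (simp add: ser_ext_def tri_ext_def mem)
   next
    case False
    then show ?thesis using ge h(5) by (auto simp: ser_ext_def tri_ext_def mem)
   qed
   then show ?thesis using 3 by blast
  qed
  ultimately show ?thesis by simp
 next
  case 4
  let ?Y = "{z \<in> Z. x ~: z}" and ?E = "E - {x}"
  have Y: "sp_space ?E ?Y" using tri_glue.IH 4 by simp
  have sub: "?Y <= Pow ?E" by (rule sp_space_basic(2)[OF Y])
  have "sp_space (insert e (insert f ?E)) (ser_ext e f (par_ext f g ?Y))"
   using Y h 4 by (intro sp_series sp_parallel) auto
  moreover have "tri_ext e f g ?Y = ser_ext e f (par_ext f g ?Y)"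
   using sub h 4 by (intro tri_ext_eq[of _ ?E]) auto
  moreover have "insert e (insert f ?E) = insert e (insert f E) - {x}" using 4 h by auto
  moreover have "{z \<in> tri_ext e f g Z. x ~: z} = tri_ext e f g ?Y" using 4 h by (auto simp: tri_ext_def)
  ultimately show ?thesis by simp
 qed
qed

text \<open>Rank m + 1 on 2 m elements means dimension c = m - 1, so |E| = 2 c + 2, the case of one
  deleted point. Conversely the deletion halves a space of dimension m, which gives the rank. A
  binary matroid determines its space, so counting the matroids means counting the deleted
  spaces.\<close>

theorem simple_qsp_eq_deletions:
 fixes E :: "'a set"
 assumes E: "card E = 2 * m" "m > 0" and x: "x ~: E"
 shows "{M. matroid M & ground M = E & rk M = m + 1 & simple M & quasi_series_parallel M} =
  bm E ` {{z \<in> Z0. x ~: z} |Z0. tri_space (insert x E) Z0}"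
  and "inj_on (bm E) {{z \<in> Z0. x ~: z} |Z0. tri_space (insert x E) Z0}"
proof -
 have fin: "finite E" and ne: "E ~= {}" using E card.infinite by fastforce+
 have del: "sp_space E {z \<in> Z0. x ~: z}" "!!z. z \<in> {z \<in> Z0. x ~: z} ==> z ~= {} ==> 3 <= card z"
  if "tri_space (insert x E) Z0" for Z0
  using tri_space_delete[OF that, of x] tri_space_basic(6)[OF that] x by auto
 have card_del: "card {z \<in> Z0. x ~: z} * 2 = 2 ^ m" if T: "tri_space (insert x E) Z0" for Z0
 proof -
  note basic = tri_space_basic[OF T] and sp = sp_space_basic[OF tri_space_basic(3)[OF T]]
  have "card (insert x E) = 2 * m + 1" using fin x E by simp
  then have cZ: "card Z0 = 2 ^ m" and "card (insert x E) ~= 1" using basic(4) E by auto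
  then obtain z0 where z0: "z0 \<in> Z0" "x \<in> z0" using tri_space_card_3[OF T, of x] by auto
  have finZ: "finite Z0" using basic(1,2) by (meson finite_Pow_iff finite_subset)
  \<comment> \<open>Adding one fixed vector through x exchanges the vectors that avoid x with those
    that contain it.\<close>
  have "bij_betw (%z. sdiff z z0) {z \<in> Z0. x ~: z} {z \<in> Z0. x \<in> z}"
   by (rule bij_betw_byWitness[of _ "%z. sdiff z z0"]) (use z0 set_space_sdiff[OF sp(3)] in auto)
  then have "card {z \<in> Z0. x ~: z} = card {z \<in> Z0. x \<in> z}" by (rule bij_betw_same_card)
  moreover have "card ({z \<in> Z0. x ~: z} Un {z \<in> Z0. x \<in> z}) = card {z \<in> Z0. x ~: z} + card {z \<in> Z0. x \<in> z}"
   using finZ by (intro card_Un_disjoint) auto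
  moreover have "{z \<in> Z0. x ~: z} Un {z \<in> Z0. x \<in> z} = Z0" by auto
  ultimately show ?thesis using cZ by simp
 qed
 show "{M. matroid M & ground M = E & rk M = m + 1 & simple M & quasi_series_parallel M} =
  bm E ` {{z \<in> Z0. x ~: z} |Z0. tri_space (insert x E) Z0}"
 proof (intro equalityI subsetI)
  fix M :: "'a matroid"
  assume "M \<in> {M. matroid M & ground M = E & rk M = m + 1 & simple M & quasi_series_parallel M}"
  then have M: "matroid M" "ground M = E" "rk M = m + 1" "simple M" "quasi_series_parallel M" by auto
  obtain Z where Z: "sp_space E Z" "M = bm E Z" using qsp_imp_sp_space[OF M(1,4,5)] M(2) by auto
  note basic = sp_space_basic[OF Z(1)]
  have "!!z. z \<in> Z ==> z ~= {} ==> 3 <= card z"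
   using M(4) simple_bm[OF fin basic(2)] Z(2) by auto
  then obtain c where c: "nice_space E Z c" using sp_space_simple_nice[OF Z(1)] by blast
  have "2 ^ c * 2 ^ (m + 1) = (2 :: nat) ^ (2 * m)"
   using rank_bm[OF fin basic(3,2)] nice_space_basic(3)[OF c] M(3) Z(2) E by simp
  then have "(2 :: nat) ^ (c + (m + 1)) = 2 ^ (2 * m)" by (simp add: power_add)
  then have "c + (m + 1) = 2 * m" by (rule power_inject_exp[THEN iffD1, rotated]) simp
  then have "card E = 2 * c + 2" using E by simp
  then obtain Z0 where "tri_space (insert x E) Z0" "Z = {z \<in> Z0. x ~: z}"
   using nice_space_deficiency(3)[OF c ne _ x] by blast
  then show "M \<in> bm E ` {{z \<in> Z0. x ~: z} |Z0. tri_space (insert x E) Z0}" using Z(2) by blast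
 next
  fix M assume "M \<in> bm E ` {{z \<in> Z0. x ~: z} |Z0. tri_space (insert x E) Z0}"
  then obtain Z0 where T: "tri_space (insert x E) Z0" and M: "M = bm E {z \<in> Z0. x ~: z}" by auto
  let ?Y = "{z \<in> Z0. x ~: z}"
  note basic = sp_space_basic[OF del(1)[OF T]]
  have "card ?Y * 2 ^ rk M = 2 ^ (2 * m)" using rank_bm[OF fin basic(3,2)] E M by simp
  moreover have "(2 :: nat) ^ (2 * m) * 2 = 2 ^ m * 2 ^ (m + 1)" by (simp add: mult_2 power_add)
  ultimately have "(card ?Y * 2) * 2 ^ rk M = 2 ^ m * 2 ^ (m + 1)" by (metis mult.assoc mult.commute)
  then have "(2 :: nat) ^ rk M = 2 ^ (m + 1)" unfolding card_del[OF T] by simp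
  then have "rk M = m + 1" by (rule power_inject_exp[THEN iffD1, rotated]) simp
  then show "M \<in> {M. matroid M & ground M = E & rk M = m + 1 & simple M & quasi_series_parallel M}"
   using M matroid_bm[OF fin basic(3)] simple_bm[OF fin basic(2)] del(2)[OF T] sp_space_imp_qsp[OF del(1)[OF T]]
   by auto
 qed
 show "inj_on (bm E) {{z \<in> Z0. x ~: z} |Z0. tri_space (insert x E) Z0}"
 proof (rule inj_onI)
  fix Y Y' assume Y: "Y \<in> {{z \<in> Z0. x ~: z} |Z0. tri_space (insert x E) Z0}"
   "Y' \<in> {{z \<in> Z0. x ~: z} |Z0. tri_space (insert x E) Z0}" "bm E Y = bm E Y'"
  have "sp_space E Y" "sp_space E Y'" using Y(1,2) del(1) by auto
  then show "Y = Y'" using bm_inject[OF fin _ _ _ _ Y(3)] sp_space_basic by blast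
 qed
qed

section \<open>Hyperforests\<close>

text \<open>Connectivity is defined on the whole type: a point outside all edges is connected to
  itself alone, so isolated vertices can be added to or removed from E freely.\<close>

definition con :: "'a set set => ('a \<times> 'a) set" where
 "con F = {(a, b). \<exists>h\<in>F. a \<in> h & b \<in> h}\<^sup>*"

lemma con_refl [simp]: "(a, a) \<in> con F"
 by (simp add: con_def)

lemma con_edge: "h \<in> F ==> a \<in> h ==> b \<in> h ==> (a, b) \<in> con F"
 unfolding con_def by (rule r_into_rtrancl) blast

lemma con_trans: "(a, b) \<in> con F ==> (b, c) \<in> con F ==> (a, c) \<in> con F"
 unfolding con_def by (rule rtrancl_trans)

lemma con_sym: "(a, b) \<in> con F ==> (b, a) \<in> con F"
proof -
 have "sym {(a, b). \<exists>h\<in>F. a \<in> h & b \<in> h}" by (auto simp: sym_def)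
 then have "sym (con F)" unfolding con_def by (rule sym_rtrancl)
 then show "(a, b) \<in> con F ==> (b, a) \<in> con F" by (rule symD)
qed

lemma con_mono: "F <= F' ==> (a, b) \<in> con F ==> (a, b) \<in> con F'"
proof -
 assume "F <= F'"
 then have "{(a, b). \<exists>h\<in>F. a \<in> h & b \<in> h} <= {(a, b). \<exists>h\<in>F'. a \<in> h & b \<in> h}" by blast
 then have "con F <= con F'" unfolding con_def by (rule rtrancl_mono)
 then show "(a, b) \<in> con F ==> (a, b) \<in> con F'" by blast
qed

definition component :: "'a set set => 'a => 'a set" where
 "component F a = {b. (a, b) \<in> con F}"

definition closed_under :: "'a set set => 'a set => bool" where
 "closed_under F S \<longleftrightarrow> (\<forall>h\<in>F. h Int S ~= {} --> h <= S)"

lemma comp_self [simp]: "a \<in> component F a"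
 by (simp add: component_def)

lemma comp_subset_closed:
 assumes "closed_under F S" "a \<in> S" shows "component F a <= S"
proof
 fix b assume "b \<in> component F a"
 then have "(a, b) \<in> {(a, b). \<exists>h\<in>F. a \<in> h & b \<in> h}\<^sup>*" by (simp add: component_def con_def)
 then show "b \<in> S"
  by (induction rule: rtrancl_induct) (use assms in \<open>auto simp: closed_under_def\<close>)
qed

lemma comp_closed: "closed_under F (component F a)"
 unfolding closed_under_def
proof (intro ballI impI subsetI)
 fix h b assume h: "h \<in> F" "h Int component F a ~= {}" and b: "b \<in> h"
 then obtain c where c: "c \<in> h" "(a, c) \<in> con F" by (auto simp: component_def)
 show "b \<in> component F a" using con_trans[OF c(2) con_edge[OF h(1) c(1) b]] by (simp add: component_def)
qed

lemma comp_eq_iff: "component F a = component F b \<longleftrightarrow> (a, b) \<in> con F"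
proof
 assume "component F a = component F b"
 then have "b \<in> component F a" by simp
 then show "(a, b) \<in> con F" by (simp add: component_def)
next
 assume ab: "(a, b) \<in> con F"
 then show "component F a = component F b" using con_trans[OF ab] con_trans[OF con_sym[OF ab]] by (auto simp: component_def)
qed

lemma comp_eq: "b \<in> component F a ==> component F b = component F a"
 using comp_eq_iff[of F a b] by (simp add: component_def)

lemma comp_disjoint: "component F a Int component F b ~= {} ==> component F a = component F b"
proof -
 assume "component F a Int component F b ~= {}"
 then obtain c where "c \<in> component F a" "c \<in> component F b" by blast
 then show ?thesis using comp_eq[of c F a] comp_eq[of c F b] by simp
qed

definition comps :: "'a set => 'a set set => 'a set set" where
 "comps E F = component F ` E"

definition triples :: "'a set => 'a set set => bool" where
 "triples E F \<longleftrightarrow> (\<forall>h\<in>F. h <= E & card h = 3)"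

lemma triples_finite: "finite E ==> triples E F ==> finite F"
 by (rule finite_subset[of _ "Pow E"]) (auto simp: triples_def)

lemma comp_subset: "triples E F ==> a \<in> E ==> component F a <= E"
 by (rule comp_subset_closed) (auto simp: closed_under_def triples_def)

text \<open>The union of the old components at the points of h is closed under the new edge set;
  conversely all of it is reached by walking through h.\<close>

lemma comp_insert:
 assumes "h ~= {}"
 shows "component (insert h F) a = (if component F a Int h = {} then component F a else \<Union>(component F ` h))"
proof (cases "component F a Int h = {}")
 case True
 have "closed_under (insert h F) (component F a)"
  using comp_closed[of F a] True by (auto simp: closed_under_def)
 then have "component (insert h F) a <= component F a" by (rule comp_subset_closed) simp
 moreover have "component F a <= component (insert h F) a" by (auto simp: component_def intro: con_mono[of F])
 ultimately show ?thesis using True by simp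
next
 case False
 then obtain c where c: "c \<in> h" "c \<in> component F a" by auto
 have "closed_under (insert h F) (\<Union>(component F ` h))"
  unfolding closed_under_def
 proof (intro ballI impI)
  fix k assume k: "k \<in> insert h F" "k Int \<Union>(component F ` h) ~= {}"
  show "k <= \<Union>(component F ` h)"
  proof (cases "k = h")
   case True
   then show ?thesis by auto
  next
   case False
   then obtain b where "b \<in> h" "k Int component F b ~= {}" "k \<in> F" using k by auto
   then show ?thesis using comp_closed[of F b] by (auto simp: closed_under_def)
  qed
 qed
 moreover have "a \<in> \<Union>(component F ` h)" using c comp_eq[OF c(2)] by auto
 ultimately have "component (insert h F) a <= \<Union>(component F ` h)" by (rule comp_subset_closed)
 moreover have "\<Union>(component F ` h) <= component (insert h F) a"
 proof
  fix d assume "d \<in> \<Union>(component F ` h)"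
  then obtain b where b: "b \<in> h" "(b, d) \<in> con F" by (auto simp: component_def)
  have "(a, c) \<in> con (insert h F)" using c by (auto simp: component_def intro: con_mono[of F])
  moreover have "(c, b) \<in> con (insert h F)" using c b by (intro con_edge[of h]) auto
  moreover have "(b, d) \<in> con (insert h F)" using b(2) by (rule con_mono[rotated]) auto
  ultimately have "(a, d) \<in> con (insert h F)" by (rule con_trans[OF con_trans])
  then show "d \<in> component (insert h F) a" by (simp add: component_def)
 qed
 ultimately show ?thesis using False by simp
qed

lemma comp_insert_mem:
 assumes "c \<in> h" shows "component (insert h F) c = \<Union>(component F ` h)"
proof -
 have "component F c Int h ~= {}" using assms comp_self[of c F] by blast
 then show ?thesis using comp_insert[of h F c] assms by auto
qed

lemma card_comps_insert:
 assumes fin: "finite E" and h: "h <= E" "h ~= {}"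
 shows "card (comps E (insert h F)) + card (component F ` h) = card (comps E F) + 1"
proof -
 let ?M = "component F ` h" and ?U = "\<Union>(component F ` h)"
 have meets: "component F a Int h ~= {} \<longleftrightarrow> component F a \<in> ?M" for a
 proof
  assume "component F a Int h ~= {}"
  then obtain c where "c \<in> h" "c \<in> component F a" by auto
  then show "component F a \<in> ?M" using comp_eq[of c F a] by auto
 next
  assume "component F a \<in> ?M"
  then obtain c where "c \<in> h" "component F a = component F c" by auto
  then show "component F a Int h ~= {}" using comp_self[of c F] by blast
 qed
 have eq: "comps E (insert h F) = insert ?U (comps E F - ?M)"
 proof (intro equalityI subsetI)
  fix C assume "C \<in> comps E (insert h F)"
  then obtain a where "a \<in> E" "C = component (insert h F) a" by (auto simp: comps_def)
  then show "C \<in> insert ?U (comps E F - ?M)"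
   using comp_insert[OF h(2), of F a] meets[of a] by (auto simp: comps_def split: if_splits)
 next
  fix C assume "C \<in> insert ?U (comps E F - ?M)"
  then consider "C = ?U" | a where "a \<in> E" "C = component F a" "C ~: ?M" by (auto simp: comps_def)
  then show "C \<in> comps E (insert h F)"
  proof cases
   case 1
   obtain c where "c \<in> h" using h(2) by auto
   then have "component (insert h F) c = ?U" by (rule comp_insert_mem)
   then show ?thesis using 1 \<open>c \<in> h\<close> h(1) by (auto simp: comps_def)
  next
   case 2
   then show ?thesis using comp_insert[OF h(2), of F a] meets[of a] by (auto simp: comps_def intro!: image_eqI[of _ _ a])
  qed
 qed
 have finC: "finite (comps E F)" using fin by (simp add: comps_def)
 have sub: "?M <= comps E F" using h(1) by (auto simp: comps_def)
 have "?U ~: comps E F - ?M"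
 proof
  assume U: "?U \<in> comps E F - ?M"
  then obtain a where "?U = component F a" by (auto simp: comps_def)
  moreover have "h <= ?U" by auto
  ultimately show False using U meets[of a] h(2) by auto
 qed
 then have "card (comps E (insert h F)) = card (comps E F - ?M) + 1" using finC by (simp add: eq)
 moreover have "card (comps E F - ?M) + card ?M = card (comps E F)"
  using finC sub by (simp add: card_Diff_subset card_mono finite_subset)
 ultimately show ?thesis by simp
qed

text \<open>Acyclicity as equality in a count: a triple lowers the number of components by at most
  two (\<open>card_comps_lower\<close>), and in a forest every triple does so.\<close>

definition forest :: "'a set => 'a set set => bool" where
 "forest E F \<longleftrightarrow> finite E & triples E F & card (comps E F) + 2 * card F = card E"

lemma card_comps_empty: "card (comps E {}) = card E"
proof -
 have "component {} a = {a}" for a :: 'a by (auto simp: component_def con_def)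
 then show ?thesis by (simp add: comps_def card_image)
qed

lemma card_comps_lower:
 assumes "finite E" "triples E F"
 shows "card E <= card (comps E F) + 2 * card F"
 using triples_finite[OF assms] assms(2)
proof (induction F)
 case (insert h F)
 have h: "h <= E" "card h = 3" using insert.prems by (auto simp: triples_def)
 then have "finite h" "h ~= {}" using card.infinite by fastforce+
 then have "card (component F ` h) <= 3" using card_image_le[of h "component F"] h by simp
 moreover have "card E <= card (comps E F) + 2 * card F"
  using insert by (auto simp: triples_def)
 ultimately show ?case using card_comps_insert[OF assms(1) h(1) \<open>h ~= {}\<close>, of F] insert.hyps by simp
qed (simp add: card_comps_empty)

text \<open>Equality in the count holds at both stages, so the new triple must merge three different
  components; conversely such a merge preserves equality.\<close>

lemma forest_insert:
 assumes fin: "finite E" and h: "h ~: F" "h <= E" "card h = 3"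
 shows "forest E (insert h F) \<longleftrightarrow> forest E F & inj_on (component F) h"
proof (cases "triples E F")
 case True
 have finF: "finite F" by (rule triples_finite[OF fin True])
 have hne: "finite h" "h ~= {}" using h(3) card.infinite by fastforce+
 have "card (component F ` h) <= 3" using card_image_le[OF hne(1), of "component F"] h by simp
 moreover have "card (component F ` h) = 3 \<longleftrightarrow> inj_on (component F) h"
  using hne(1) h(3) by (metis card_image eq_card_imp_inj_on)
 moreover have "triples E (insert h F)" using True h by (simp add: triples_def)
 ultimately show ?thesis
  using card_comps_insert[OF fin h(2) hne(2), of F] card_comps_lower[OF fin True] finF h(1) True fin
  unfolding forest_def by auto
qed (auto simp: forest_def triples_def)

lemma forest_remove:
 assumes "forest E F" "h \<in> F"
 shows "forest E (F - {h})" "inj_on (component (F - {h})) h"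
proof -
 have "insert h (F - {h}) = F" using assms(2) by auto
 moreover have "h <= E" "card h = 3" "finite E" using assms by (auto simp: forest_def triples_def)
 ultimately show "forest E (F - {h})" "inj_on (component (F - {h})) h"
  using forest_insert[of E h "F - {h}"] assms by auto
qed

lemma forest_subset:
 assumes "forest E F" "F' <= F" shows "forest E F'"
proof -
 have "finite F" using assms(1) triples_finite by (auto simp: forest_def)
 have "X <= F ==> forest E (F - X)" if "finite X" for X
  using that
 proof (induction X)
  case (insert x X)
  then have "forest E (F - X)" "x \<in> F - X" by auto
  then have "forest E (F - X - {x})" by (rule forest_remove)
  moreover have "F - X - {x} = F - insert x X" by auto
  ultimately show ?case by simp
 qed (use assms in simp)
 from this[of "F - F'"] have "forest E (F - (F - F'))" using \<open>finite F\<close> by auto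
 then show ?thesis using assms(2) by (simp add: double_diff)
qed

lemma forest_empty: "finite E ==> forest E {}"
 by (simp add: forest_def triples_def card_comps_empty)

section \<open>Counting rooted hyperforests\<close>

abbreviation roots :: "'a set => 'a set set => 'a set => bool" where
 "roots E F \<rho> \<equiv> transversal E (%a r. (a, r) \<in> con F) \<rho>"

lemma roots_bij:
 assumes "roots E F \<rho>" shows "bij_betw (component F) \<rho> (comps E F)"
 unfolding bij_betw_def
proof
 show "inj_on (component F) \<rho>"
 proof (rule inj_onI)
  fix x y assume xy: "x \<in> \<rho>" "y \<in> \<rho>" "component F x = component F y"
  then have "(x, y) \<in> con F" "x \<in> E" using comp_eq_iff[of F x y] transversalD(1)[OF assms] by auto
  then show "x = y" using transversalD(3)[OF assms, of x x y] xy by simp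
 qed
 show "component F ` \<rho> = comps E F"
 proof (intro equalityI subsetI)
  fix C assume "C \<in> comps E F"
  then obtain a where a: "a \<in> E" "C = component F a" by (auto simp: comps_def)
  then obtain r where "r \<in> \<rho>" "(a, r) \<in> con F" using transversalD(2)[OF assms] by blast
  then show "C \<in> component F ` \<rho>" using a comp_eq_iff[of F a r] by auto
 qed (use transversalD(1)[OF assms] in \<open>auto simp: comps_def\<close>)
qed

lemma roots_card: "roots E F \<rho> ==> card \<rho> = card (comps E F)"
 using roots_bij by (rule bij_betw_same_card)

text \<open>Counting replaces the uniqueness clause: a set that reaches all components and is no
  larger than their number cannot reach one twice.\<close>

lemma rootsI:
 assumes sub: "\<rho> <= E" and meet: "!!a. a \<in> E ==> \<exists>r\<in>\<rho>. (a, r) \<in> con F"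
  and fin: "finite E" and card: "card \<rho> <= card (comps E F)"
 shows "roots E F \<rho>"
proof (rule transversalI)
 have fin\<rho>: "finite \<rho>" using sub fin by (rule finite_subset)
 have "component F ` \<rho> = comps E F"
 proof (intro equalityI subsetI)
  fix C assume "C \<in> comps E F"
  then obtain a where a: "a \<in> E" "C = component F a" by (auto simp: comps_def)
  then obtain r where "r \<in> \<rho>" "(a, r) \<in> con F" using meet by blast
  then show "C \<in> component F ` \<rho>" using a comp_eq_iff[of F a r] by auto
 qed (use sub in \<open>auto simp: comps_def\<close>)
 then have "card (component F ` \<rho>) = card \<rho>" using card card_image_le[OF fin\<rho>, of "component F"] by simp
 then have inj: "inj_on (component F) \<rho>" by (rule eq_card_imp_inj_on[OF fin\<rho>])
 show "b = c" if "a \<in> E" "b \<in> \<rho>" "c \<in> \<rho>" "(a, b) \<in> con F" "(a, c) \<in> con F" for a b c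
 proof (rule inj_onD[OF inj _ that(2,3)])
  show "component F b = component F c" using that(4,5) comp_eq_iff[of F a b] comp_eq_iff[of F a c] by simp
 qed
qed (use sub meet in auto)

definition rooted :: "'a set => nat => ('a set set \<times> 'a set) set" where
 "rooted E k = {(F, \<rho>). forest E F & roots E F \<rho> & card \<rho> = k}"

lemma rooted_iff: "(F, \<rho>) \<in> rooted E k \<longleftrightarrow> forest E F & roots E F \<rho> & card \<rho> = k"
 by (simp add: rooted_def)

lemma finite_rooted: "finite E ==> finite (rooted E k)"
 by (rule finite_subset[of _ "Pow (Pow E) \<times> Pow E"])
  (auto simp: rooted_def forest_def triples_def transversal_def)

lemma rooted_card: "(F, \<rho>) \<in> rooted E k ==> k + 2 * card F = card E"
 using roots_card by (fastforce simp: rooted_iff forest_def)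

lemma rooted_full:
 assumes "finite E" shows "rooted E (card E) = {({}, E)}"
proof (intro equalityI subsetI)
 fix x :: "'a set set \<times> 'a set" assume x: "x \<in> rooted E (card E)"
 obtain F :: "'a set set" and \<rho> where F: "x = (F, \<rho>)" by (cases x)
 have "card F = 0" using rooted_card x F by fastforce
 moreover have "finite F" using x F triples_finite by (auto simp: rooted_iff forest_def)
 moreover have "\<rho> = E" using x F assms by (intro card_subset_eq) (auto simp: rooted_iff transversal_def)
 ultimately show "x \<in> {({}, E)}" using F by simp
next
 fix x :: "'a set set \<times> 'a set" assume "x \<in> {({}, E)}"
 moreover have "roots E {} E" by (rule transversalI) (auto simp: con_def)
 ultimately show "x \<in> rooted E (card E)" using assms forest_empty[of E] by (auto simp: rooted_iff)
qed

text \<open>Pitman's double counting: an edge is added at an arbitrary vertex \<open>v\<close>, joining it to the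
  roots \<open>p\<close> of two other trees.\<close>

theorem rooted_recursion:
 assumes fin: "finite E" and k: "card E = k + 2 * j + 2" "k > 0"
 shows "(j + 1) * card (rooted E k) = card (rooted E (k + 2)) * card E * ((k + 1) choose 2)"
proof -
 let ?A = "SIGMA x:rooted E k. fst x"
 let ?p = "%x v. {p. p <= {r \<in> snd x. (v, r) ~: con (fst x)} & card p = 2}"
 let ?B = "SIGMA x:rooted E (k + 2). SIGMA v:E. ?p x v"
 let ?\<Phi> = "%(x, v, p). ((insert (insert v p) (fst x), snd x - p), insert v p)"
 have B: "forest E F & roots E F \<rho> & card \<rho> = k + 2 & v \<in> E & p <= \<rho> & card p = 2 & (\<forall>r\<in>p. (v, r) ~: con F)"
  if "((F, \<rho>), v, p) \<in> ?B" for F \<rho> v p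
  using that by (auto simp: rooted_iff)
 have facts: "v ~: p & insert v p ~: F & inj_on (component F) (insert v p) & insert v p <= E & card (insert v p) = 3"
  if F: "forest E F" "roots E F \<rho>" and v: "v \<in> E" and p: "p <= \<rho>" "card p = 2" "\<forall>r\<in>p. (v, r) ~: con F"
  for F \<rho> v p
 proof -
  have vp: "v ~: p" using p(3) con_refl by auto
  have finp: "finite p" using p(2) card.infinite by fastforce
  have "insert v p ~: F"
  proof
   assume m: "insert v p \<in> F"
   obtain r where "r \<in> p" using p(2) by fastforce
   then have "(v, r) \<in> con F" using con_edge[OF m] by auto
   then show False using p(3) \<open>r \<in> p\<close> by auto
  qed
  moreover have "inj_on (component F) p" using roots_bij[OF F(2)] p(1) by (auto simp: bij_betw_def intro: inj_on_subset)
  then have "inj_on (component F) (insert v p)" using p(3) vp by (auto simp: comp_eq_iff)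
  moreover have "insert v p <= E" using v p(1) transversalD(1)[OF F(2)] by auto
  ultimately show ?thesis using vp finp p(2) by simp
 qed
 have "bij_betw ?\<Phi> ?B ?A"
  unfolding bij_betw_def
 proof (intro conjI equalityI subsetI)
  show "inj_on ?\<Phi> ?B"
  proof (rule inj_onI)
   fix y y' assume y: "y \<in> ?B" "y' \<in> ?B" "?\<Phi> y = ?\<Phi> y'"
   obtain F \<rho> v p where yy: "y = ((F, \<rho>), v, p)" by (metis prod.collapse)
   obtain F' \<rho>' v' p' where yy': "y' = ((F', \<rho>'), v', p')" by (metis prod.collapse)
   note b = B[OF y(1)[unfolded yy]] and b' = B[OF y(2)[unfolded yy']]
   have f: "v ~: p" "insert v p ~: F" "v' ~: p'" "insert v' p' ~: F'" using facts b b' by blast+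
   have h: "insert v p = insert v' p'" and \<rho>: "\<rho> - p = \<rho>' - p'"
    and ins: "insert (insert v p) F = insert (insert v' p') F'" using y(3) by (auto simp: yy yy')
   have FF: "F = F'" using insert_ident[OF f(2), of F'] f(4) ins unfolding h by simp
   have vv: "v = v'"
   proof (rule ccontr)
    \<comment> \<open>Then v is in p' and hence a root in \<open>\<rho>'\<close>. The root r of the
      tree of v in \<open>\<rho>\<close> is not in p, so it survives in \<open>\<rho>' - p'\<close>.
      Both are roots of one tree, so r = v, which is in p', a contradiction.\<close>
    assume ne: "v ~= v'"
    then have vp': "v \<in> p'" using h by auto
    obtain r where r: "r \<in> \<rho>" "(v, r) \<in> con F" using transversalD(2)[of E _ \<rho> v] b by blast
    then have "r ~: p" using b by auto
    then have "r \<in> \<rho>'" "r ~: p'" using r \<rho> by auto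
    have "v \<in> \<rho>'" using vp' b' by auto
    then have "r = v" using transversalD(3)[of E _ \<rho>' v r v] b b' r(2) FF \<open>r \<in> \<rho>'\<close> by auto
    then show False using vp' \<open>r ~: p'\<close> by simp
   qed
   then have "p = p'" using h f by auto
   moreover have "\<rho> = \<rho>'" using \<rho> b b' calculation by auto
   ultimately show "y = y'" using FF vv yy yy' by simp
  qed
 next
  fix a assume "a \<in> ?\<Phi> ` ?B"
  then obtain y where y: "y \<in> ?B" "a = ?\<Phi> y" by auto
  obtain F \<rho> v p where yy: "y = ((F, \<rho>), v, p)" by (metis prod.collapse)
  note b = B[OF y(1)[unfolded yy]]
  let ?h = "insert v p"
  have f: "v ~: p" "?h ~: F" "inj_on (component F) ?h" "?h <= E" "card ?h = 3" using facts b by blast+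
  have "forest E (insert ?h F)" using forest_insert[OF fin f(2,4,5)] b f(3) by simp
  moreover have "roots E (insert ?h F) (\<rho> - p)"
  proof (rule rootsI[OF _ _ fin])
   show "\<rho> - p <= E" using b transversalD(1) by blast
   have mono: "(a, c) \<in> con (insert ?h F)" if "(a, c) \<in> con F" for a c
    using that by (rule con_mono[rotated]) auto
   obtain s where s: "s \<in> \<rho>" "(v, s) \<in> con F" using transversalD(2)[of E _ \<rho> v] b by blast
   then have sp: "s ~: p" using b by auto
   show "\<exists>r\<in>\<rho> - p. (a, r) \<in> con (insert ?h F)" if a: "a \<in> E" for a
   proof -
    obtain r where r: "r \<in> \<rho>" "(a, r) \<in> con F" using transversalD(2)[of E _ \<rho> a] b a by blast
    show ?thesis
    proof (cases "r \<in> p")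
     case True
     then have "(r, v) \<in> con (insert ?h F)" by (intro con_edge[of ?h]) auto
     then have "(a, s) \<in> con (insert ?h F)" using mono[OF r(2)] mono[OF s(2)] con_trans by metis
     then show ?thesis using s sp by auto
    qed (use r mono in auto)
   qed
   have finp: "finite p" using b card.infinite by fastforce
   have "card (\<rho> - p) = k" using b finp by (simp add: card_Diff_subset)
   moreover have "card (comps E (insert ?h F)) = k"
    using card_comps_insert[OF fin f(4), of F] card_image[OF f(3)] f(5) roots_card[of E F \<rho>] b by auto
   ultimately show "card (\<rho> - p) <= card (comps E (insert ?h F))" by simp
  qed
  moreover have "card (\<rho> - p) = k"
  proof -
   have "finite p" using b card.infinite by fastforce
   then show ?thesis using b by (simp add: card_Diff_subset)
  qed
  ultimately show "a \<in> ?A" using y(2) by (simp add: yy rooted_iff)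
 next
  fix a assume a: "a \<in> ?A"
  obtain F1 \<rho>1 h where aa: "a = ((F1, \<rho>1), h)" by (metis prod.collapse)
  have F1: "forest E F1" "roots E F1 \<rho>1" "card \<rho>1 = k" "h \<in> F1" using a aa by (auto simp: rooted_iff)
  define F where "F = F1 - {h}"
  have F: "forest E F" "inj_on (component F) h" using forest_remove[OF F1(1,4)] by (auto simp: F_def)
  have hF: "insert h F = F1" "h ~: F" using F1(4) by (auto simp: F_def)
  have h: "h <= E" "card h = 3" using F1(1,4) by (auto simp: forest_def triples_def)
  then have hne: "finite h" "h ~= {}" using card.infinite by fastforce+
  have mono: "(a, c) \<in> con F1" if "(a, c) \<in> con F" for a c
   using that by (rule con_mono[rotated]) (auto simp: F_def)
  obtain c0 where c0: "c0 \<in> h" using hne by auto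
  obtain s where s: "s \<in> \<rho>1" "(c0, s) \<in> con F1" using transversalD(2)[OF F1(2), of c0] c0 h by blast
  have "component F1 c0 = \<Union>(component F ` h)" using comp_insert_mem[OF c0, of F] hF(1) by simp
  \<comment> \<open>Without h its tree falls into three. The vertex v is the one on the side of the
    old root s; the other two vertices of h become roots.\<close>
  then obtain v where v: "v \<in> h" "(v, s) \<in> con F" using s(2) by (auto simp: component_def)
  define p where "p = h - {v}"
  define \<rho> where "\<rho> = \<rho>1 Un p"
  have hp: "h = insert v p" "v ~: p" "card p = 2" using v h hne by (auto simp: p_def)
  have only: "r = s" if r: "r \<in> \<rho>1" "c \<in> h" "(c, r) \<in> con F1" for r c
  proof -
   have "(c0, c) \<in> con F1" using con_edge[OF F1(4)] c0 r(2) by auto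
   then have "(c0, r) \<in> con F1" using r(3) con_trans by metis
   then show ?thesis using transversalD(3)[OF F1(2), of c0 r s] c0 h r(1) s by blast
  qed
  have disj: "\<rho>1 Int p = {}"
  proof (rule ccontr)
   assume "\<rho>1 Int p ~= {}"
   then obtain r where r: "r \<in> \<rho>1" "r \<in> p" by auto
   then have "r = s" using only[of r r] by (auto simp: p_def)
   then have "component F v = component F r" using v(2) comp_eq_iff by metis
   then have "v = r" using F(2) v(1) r(2) by (auto simp: inj_on_def p_def)
   then show False using r(2) by (simp add: p_def)
  qed
  have fin\<rho>1: "finite \<rho>1" using transversalD(1)[OF F1(2)] fin finite_subset by blast
  have card\<rho>: "card \<rho> = k + 2" using disj fin\<rho>1 hp(3) F1(3) hne by (simp add: \<rho>_def card_Un_disjoint p_def)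
  have cF: "card (comps E F) = k + 2"
   using card_comps_insert[OF fin h(1) hne(2), of F] card_image[OF F(2)] h(2) hF roots_card[OF F1(2)] F1(3) by simp
  have roots: "roots E F \<rho>"
  proof (rule rootsI[OF _ _ fin])
   show "\<rho> <= E" using transversalD(1)[OF F1(2)] h by (auto simp: \<rho>_def p_def)
   show "card \<rho> <= card (comps E F)" using card\<rho> cF by simp
   show "\<exists>r\<in>\<rho>. (b, r) \<in> con F" if b: "b \<in> E" for b
   proof (cases "component F b Int h = {}")
    case True
    then have same: "component F1 b = component F b" using comp_insert[OF hne(2), of F b] hF(1) by simp
    obtain r where "r \<in> \<rho>1" "(b, r) \<in> con F1" using transversalD(2)[OF F1(2) b] by blast
    then show ?thesis using same by (auto simp: component_def \<rho>_def)
   next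
    case False
    then obtain c where c: "c \<in> h" "(b, c) \<in> con F" by (auto simp: component_def)
    show ?thesis
    proof (cases "c = v")
     case True
     then have "(b, s) \<in> con F" using c(2) v(2) con_trans by metis
     then show ?thesis using s by (auto simp: \<rho>_def)
    next
     case False
     then show ?thesis using c by (auto simp: \<rho>_def p_def)
    qed
   qed
  qed
  have "(v, r) ~: con F" if "r \<in> p" for r
  proof
   assume "(v, r) \<in> con F"
   then have "component F v = component F r" using comp_eq_iff by metis
   then have "v = r" using F(2) v(1) that by (auto simp: inj_on_def p_def)
   then show False using that by (simp add: p_def)
  qed
  then have mem: "((F, \<rho>), v, p) \<in> ?B"
   using F(1) roots card\<rho> v(1) h(1) hp(3) by (auto simp: rooted_iff \<rho>_def)
  have eq: "?\<Phi> ((F, \<rho>), v, p) = a" using hp(1) hF(1) disj by (auto simp: aa \<rho>_def)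
  show "a \<in> ?\<Phi> ` ?B" using imageI[OF mem, of ?\<Phi>] unfolding eq .
 qed
 then have "card ?B = card ?A" by (rule bij_betw_same_card)
 also have "card ?A = (\<Sum>x\<in>rooted E k. card (fst x))"
 proof (rule card_SigmaI)
  show "\<forall>a\<in>rooted E k. finite (fst a)" using triples_finite by (auto simp: rooted_def forest_def)
 qed (rule finite_rooted[OF fin])
 also have "\<dots> = (\<Sum>x\<in>rooted E k. j + 1)"
 proof (intro sum.cong refl)
  fix x assume "x \<in> rooted E k"
  then show "card (fst x) = j + 1" using rooted_card[of "fst x" "snd x" E k] k(1) by simp
 qed
 also have "\<dots> = (j + 1) * card (rooted E k)" by simp
 finally have A: "card ?B = (j + 1) * card (rooted E k)" .
 have "card ?B = (\<Sum>x\<in>rooted E (k + 2). card (SIGMA v:E. ?p x v))"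
 proof (rule card_SigmaI)
  show "\<forall>a\<in>rooted E (k + 2). finite (SIGMA v:E. ?p a v)"
  proof
   fix a assume "a \<in> rooted E (k + 2)"
   then have "snd a <= E" by (auto simp: rooted_def transversal_def)
   then have "finite (Pow (snd a))" using fin finite_subset by simp
   then have "finite (?p a v)" for v by (rule finite_subset[rotated]) blast
   then show "finite (SIGMA v:E. ?p a v)" by (rule finite_SigmaI[OF fin])
  qed
 qed (rule finite_rooted[OF fin])
 also have "\<dots> = (\<Sum>x\<in>rooted E (k + 2). card E * ((k + 1) choose 2))"
 proof (intro sum.cong refl)
  fix x assume x: "x \<in> rooted E (k + 2)"
  obtain F \<rho> where xx: "x = (F, \<rho>)" by (cases x)
  have F: "forest E F" "roots E F \<rho>" "card \<rho> = k + 2" using x xx by (auto simp: rooted_iff)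
  have fin\<rho>: "finite \<rho>" using F(3) card.infinite by fastforce
  have "card (?p x v) = (k + 1) choose 2" if v: "v \<in> E" for v
  proof -
   obtain s where s: "s \<in> \<rho>" "(v, s) \<in> con F" using transversalD(2)[OF F(2) v] by blast
   have "{r \<in> \<rho>. (v, r) ~: con F} = \<rho> - {s}"
   proof (intro equalityI subsetI)
    fix r assume "r \<in> \<rho> - {s}"
    then show "r \<in> {r \<in> \<rho>. (v, r) ~: con F}" using transversalD(3)[OF F(2) v, of r s] s by blast
   qed (use s in auto)
   then have "card {r \<in> \<rho>. (v, r) ~: con F} = k + 1" using s F(3) fin\<rho> by simp
   then show ?thesis using n_subsets[of "{r \<in> \<rho>. (v, r) ~: con F}" 2] fin\<rho> by (simp add: xx)
  qed
  moreover have "finite (?p x v)" for v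
   by (rule finite_subset[of _ "Pow \<rho>"]) (use fin\<rho> in \<open>auto simp: xx\<close>)
  ultimately show "card (SIGMA v:E. ?p x v) = card E * ((k + 1) choose 2)"
   using fin by (subst card_SigmaI) auto
 qed
 also have "\<dots> = card (rooted E (k + 2)) * card E * ((k + 1) choose 2)" by simp
 finally show ?thesis using A by simp
qed

text \<open>Iterates the double counting from the forest without edges, in which all vertices are
  roots. Denominators stay on the left so that all numbers are natural.\<close>

theorem card_rooted:
 assumes fin: "finite E" and k: "card E = k + 2 * j" "k > 0"
 shows "card (rooted E k) * (2 ^ j * fact j * fact (k - 1)) = card E ^ j * fact (card E - 1)"
 using k
proof (induction j arbitrary: k)
 case 0
 then show ?case using rooted_full[OF fin] by simp
next
 case (Suc j)
 let ?c = "card (rooted E (k + 2))"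
 have IH: "?c * (2 ^ j * fact j * fact (k + 1)) = card E ^ j * fact (card E - 1)"
  using Suc.IH[of "k + 2"] Suc.prems by simp
 have rec: "(j + 1) * card (rooted E k) = ?c * card E * ((k + 1) choose 2)"
  using rooted_recursion[OF fin, of k j] Suc.prems by simp
 have ch: "((k + 1) choose 2) * 2 * fact (k - 1) = (fact (k + 1) :: nat)"
 proof -
  have "((k + 1) choose 2) * 2 = (k + 1) * k" by (simp add: choose_two)
  moreover have "(fact (k + 1) :: nat) = (k + 1) * (k * fact (k - 1))"
   using fact_reduce[of k, where 'a = nat] Suc.prems by simp
  ultimately show ?thesis by (simp only: mult.assoc)
 qed
 have "card (rooted E k) * (2 ^ Suc j * fact (Suc j) * fact (k - 1)) =
   ((j + 1) * card (rooted E k)) * (2 ^ j * fact j * (2 * fact (k - 1)))" by (simp add: algebra_simps)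
 also have "\<dots> = card E * (?c * (2 ^ j * fact j * (((k + 1) choose 2) * 2 * fact (k - 1))))"
  unfolding rec by (simp add: algebra_simps)
 also have "\<dots> = card E * (card E ^ j * fact (card E - 1))" unfolding ch IH ..
 finally show ?case by simp
qed

section \<open>Spaces spanned by hyperforests\<close>

inductive_set sspan :: "'a set set => 'a set set" for F where
 sspan_zero: "{} \<in> sspan F"
| sspan_step: "z \<in> sspan F ==> h \<in> F ==> sdiff z h \<in> sspan F"

lemma sspan_mem: "h \<in> F ==> h \<in> sspan F"
 using sspan_step[OF sspan_zero, of h F] by simp

lemma sspan_sub: "z \<in> sspan F ==> (!!h. h \<in> F ==> h <= E) ==> z <= E"
proof (induction rule: sspan.induct)
 case (sspan_step z h)
 then have "z <= E" "h <= E" by blast+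
 then show ?case by auto
qed simp

lemma sspan_mono: "z \<in> sspan F ==> F <= F' ==> z \<in> sspan F'"
proof (induction rule: sspan.induct)
 case (sspan_step z h)
 then show ?case by (blast intro: sspan.sspan_step)
qed (rule sspan_zero)

lemma sspan_empty: "sspan {} = {{}}"
proof -
 have "z \<in> sspan {} ==> z = {}" for z :: "'a set" by (induction rule: sspan.induct) auto
 then show ?thesis using sspan_zero by blast
qed

lemma sdiff_right_commute: "sdiff (sdiff a b) c = sdiff (sdiff a c) b"
 by auto

lemma sspan_insert: "sspan (insert h F) = sspan F Un (%z. sdiff z h) ` sspan F"
proof (intro equalityI subsetI)
 fix z assume "z \<in> sspan (insert h F)"
 then show "z \<in> sspan F Un (%z. sdiff z h) ` sspan F"
 proof (induction rule: sspan.induct)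
  case (sspan_step z k)
  show ?case
  proof (cases "k = h")
   case True
   then show ?thesis using sspan_step.IH by auto
  next
   case False
   then have k: "k \<in> F" using sspan_step.hyps by simp
   from sspan_step.IH show ?thesis
   proof
    assume "z \<in> sspan F"
    then show ?thesis using sspan.sspan_step[OF _ k, of z] by blast
   next
    assume "z \<in> (%z. sdiff z h) ` sspan F"
    then obtain y where y: "y \<in> sspan F" "z = sdiff y h" by blast
    then have "sdiff z k = sdiff (sdiff y k) h" using sdiff_right_commute by metis
    then show ?thesis using sspan.sspan_step[OF y(1) k] by blast
   qed
  qed
 qed (simp add: sspan_zero)
next
 fix z assume "z \<in> sspan F Un (%z. sdiff z h) ` sspan F"
 then show "z \<in> sspan (insert h F)"
 proof
  assume "z \<in> sspan F"
  then show ?thesis by (rule sspan_mono) blast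
 next
  assume "z \<in> (%z. sdiff z h) ` sspan F"
  then obtain y where y: "y \<in> sspan F" "z = sdiff y h" by blast
  have "y \<in> sspan (insert h F)" using y(1) by (rule sspan_mono) blast
  then show ?thesis unfolding y(2) by (rule sspan_step) simp
 qed
qed

lemma card_sdiff_triple:
 assumes "finite y" "card h = 3"
 shows "card (sdiff y h) + 2 * card (y Int h) = card y + 3"
proof -
 have fin: "finite h" using assms(2) card.infinite by fastforce
 have "sdiff y h = (y - h) Un (h - y)" by auto
 then have "card (sdiff y h) = card (y - h) + card (h - y)"
  using assms(1) fin by (simp add: card_Un_disjoint Diff_Int_distrib2 Int_Diff disjoint_iff)
 moreover have "card (y - h) + card (y Int h) = card y"
  using card_Int_Diff[OF assms(1), of h] by simp
 moreover have "card (h - y) + card (y Int h) = 3"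
  using card_Int_Diff[OF fin, of y] assms(2) by (simp add: Int_commute)
 ultimately show ?thesis by simp
qed

text \<open>The points of h lie in different components, so the parts of y in the components through
  y Int h are disjoint, and each of them has at least three elements.\<close>

lemma three_per_component:
 assumes fin: "finite y"
  and y: "!!a. y Int component F a = {} | 3 <= card (y Int component F a)"
  and inj: "inj_on (component F) h"
 shows "3 * card (y Int h) <= card y"
proof -
 have "3 * card (y Int h) = (\<Sum>a\<in>y Int h. 3)" by simp
 also have "\<dots> <= (\<Sum>a\<in>y Int h. card (y Int component F a))"
 proof (rule sum_mono)
  fix a assume "a \<in> y Int h"
  then have "a \<in> y Int component F a" by simp
  then show "3 <= card (y Int component F a)" using y[of a] by blast
 qed
 also have "\<dots> = card (\<Union>a\<in>y Int h. y Int component F a)"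
 proof (rule card_UN_disjoint[symmetric])
  show "\<forall>i\<in>y Int h. \<forall>j\<in>y Int h. i ~= j --> y Int component F i Int (y Int component F j) = {}"
  proof (intro ballI impI)
   fix i j assume ij: "i \<in> y Int h" "j \<in> y Int h" "i ~= j"
   then have "component F i ~= component F j" using inj_onD[OF inj, of i j] by blast
   then have "component F i Int component F j = {}" using comp_disjoint[of F i j] by blast
   then show "y Int component F i Int (y Int component F j) = {}" by blast
  qed
 qed (use fin in auto)
 also have "\<dots> <= card y" using fin by (intro card_mono) auto
 finally show ?thesis .
qed

lemma forest_induct [consumes 1, case_names empty insert]:
 assumes "forest E F"
  and "P {}"
  and "!!h F. forest E F ==> h ~: F ==> h <= E ==> card h = 3 ==> inj_on (component F) h ==> P F ==> P (insert h F)"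
 shows "P F"
proof -
 have fin: "finite E" "finite F" using assms(1) triples_finite by (auto simp: forest_def)
 show ?thesis using fin(2) assms(1)
 proof (induction F)
  case (insert h F)
  have h: "h <= E" "card h = 3" using insert.prems by (auto simp: forest_def triples_def)
  then have "forest E F" "inj_on (component F) h"
   using forest_insert[OF fin(1) insert.hyps(2) h] insert.prems by blast+
  then show ?case using assms(3) insert h by blast
 qed (rule assms(2))
qed

lemma forest_sspan_sub: "forest E F ==> z \<in> sspan F ==> z <= E"
 by (erule sspan_sub) (auto simp: forest_def triples_def)

lemma forest_sspan_finite: "forest E F ==> z \<in> sspan F ==> finite z"
 using forest_sspan_sub[of E F z] by (auto simp: forest_def intro: finite_subset)

text \<open>A bound on the whole size would not survive the induction: adding h can cancel points of
  y in three components. The bound in each component limits this cancellation through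
  \<open>three_per_component\<close>.\<close>

lemma sspan_component:
 assumes "forest E F" "z \<in> sspan F"
 shows "z Int component F a = {} | 3 <= card (z Int component F a)"
 using assms
proof (induction arbitrary: z a rule: forest_induct)
 case empty
 then show ?case by (simp add: sspan_empty)
next
 case (insert h F)
 have hne: "h ~= {}" using insert.hyps by auto
 obtain y where y: "y \<in> sspan F" and z: "z = y | z = sdiff y h"
  using insert.prems unfolding sspan_insert by blast
 have finy: "finite y" using forest_sspan_finite[OF insert.hyps(1) y] .
 let ?D = "component (insert h F) a"
 show ?case
 proof (cases "component F a Int h = {}")
  case True
  then have D: "?D = component F a" using comp_insert[OF hne, of F a] by simp
  have "z Int ?D = y Int component F a" using z True unfolding D by auto
  then show ?thesis using insert.IH[OF y, of a] by simp
 next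
  case False
  then have D: "?D = \<Union>(component F ` h)" using comp_insert[OF hne, of F a] by simp
  have hD: "h <= ?D" unfolding D by auto
  have part: "y Int ?D Int component F b = {} | 3 <= card (y Int ?D Int component F b)" for b
  proof (cases "component F b Int ?D = {}")
   case True
   then show ?thesis by blast
  next
   case False
   then obtain c where c: "c \<in> h" "component F b Int component F c ~= {}" unfolding D by blast
   then have "component F b = component F c" by (intro comp_disjoint)
   then have "component F b <= ?D" using c(1) unfolding D by blast
   then have "y Int ?D Int component F b = y Int component F b" by blast
   then show ?thesis using insert.IH[OF y, of b] by simp
  qed
  from z show ?thesis
  proof
   assume zy: "z = y"
   show ?thesis
   proof (cases "y Int ?D = {}")
    case False
    then obtain b where "b \<in> y Int ?D" by blast
    then have "y Int ?D Int component F b ~= {}" using comp_self[of b F] by blast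
    then have "3 <= card (y Int ?D Int component F b)" using part[of b] by blast
    also have "\<dots> <= card (y Int ?D)" using finy by (intro card_mono) auto
    finally show ?thesis using zy by simp
   qed (use zy in simp)
  next
   assume zs: "z = sdiff y h"
   have "z Int ?D = sdiff (y Int ?D) h" unfolding zs using hD by auto
   moreover have "3 * card (y Int ?D Int h) <= card (y Int ?D)"
    using finy part insert.hyps by (intro three_per_component[of _ F]) auto
   ultimately show ?thesis using card_sdiff_triple[of "y Int ?D" h] finy insert.hyps by simp
  qed
 qed
qed

text \<open>Write z = y + h with y from the smaller forest and t = |y Int h|. Then |z| = |y| + 3 - 2
  t and 3 t \<le> |y|. For y nonempty, |z| = 3 is impossible, and |z| = 4 forces t = 1 and |y| = 3,
  so y is an edge. Thus the short vectors reveal the edges.\<close>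

lemma sspan_small:
 assumes "forest E F" "z \<in> sspan F" "z ~= {}"
 shows "3 <= card z & (card z = 3 --> z \<in> F) & (card z = 4 --> (\<exists>h\<in>F. \<exists>k\<in>F. z = sdiff h k))"
 using assms
proof (induction arbitrary: z rule: forest_induct)
 case empty
 then show ?case by (simp add: sspan_empty)
next
 case (insert h F)
 obtain y where y: "y \<in> sspan F" and z: "z = y | z = sdiff y h"
  using insert.prems unfolding sspan_insert by blast
 have finy: "finite y" using forest_sspan_finite[OF insert.hyps(1) y] .
 have t: "3 * card (y Int h) <= card y"
  using finy sspan_component[OF insert.hyps(1) y] insert.hyps(5) by (intro three_per_component[of _ F]) auto
 from z show ?case
 proof
  assume "z = y"
  then show ?thesis using insert.IH[OF y] insert.prems by blast
 next
  assume zs: "z = sdiff y h"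
  show ?thesis
  proof (cases "y = {}")
   case True
   then show ?thesis using zs insert.hyps by simp
  next
   case False
   note IH = insert.IH[OF y False]
   have c: "card z + 2 * card (y Int h) = card y + 3"
    using card_sdiff_triple[OF finy insert.hyps(4)] zs by simp
   have "card z >= 3" using c t by simp
   moreover have "card z ~= 3" using c t IH by linarith
   moreover have "\<exists>h'\<in>insert h F. \<exists>k\<in>insert h F. z = sdiff h' k" if "card z = 4"
   proof -
    have "card y = 3" using c t IH that by linarith
    then show ?thesis using IH zs by blast
   qed
   ultimately show ?thesis by blast
  qed
 qed
qed

text \<open>Two common points of h and k would stay connected through k after removing h, against
  the fact that h joins three components.\<close>

lemma forest_inter:
 assumes F: "forest E F" and hk: "h \<in> F" "k \<in> F" "h ~= k" and ab: "a \<in> h" "a \<in> k" "b \<in> h" "b \<in> k"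
 shows "a = b"
proof -
 have "(a, b) \<in> con (F - {h})" using hk ab by (intro con_edge[of k]) auto
 then have "component (F - {h}) a = component (F - {h}) b" by (simp only: comp_eq_iff)
 then show ?thesis using inj_onD[OF forest_remove(2)[OF F hk(1)]] ab by blast
qed

lemma isolated_component:
 assumes "!!h. h \<in> F ==> x ~: h" shows "component F x = {x}"
proof -
 have "component F x <= {x}" by (rule comp_subset_closed) (use assms in \<open>auto simp: closed_under_def\<close>)
 then show ?thesis using comp_self[of x F] by blast
qed

lemma comps_add_point:
 assumes "triples E F" "x ~: E" "finite E"
 shows "card (comps (insert x E) F) = card (comps E F) + 1"
proof -
 have x: "component F x = {x}" by (rule isolated_component) (use assms in \<open>auto simp: triples_def\<close>)
 have "{x} ~: comps E F"
 proof
  assume "{x} \<in> comps E F"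
  then obtain a where a: "a \<in> E" "{x} = component F a" by (auto simp: comps_def)
  then have "a \<in> {x}" using comp_self[of a F] by metis
  then have "a = x" by simp
  then show False using a assms by simp
 qed
 then show ?thesis using assms(3) by (simp add: comps_def x)
qed

lemma forest_add_point:
 assumes "triples E F" "x ~: E"
 shows "forest (insert x E) F \<longleftrightarrow> forest E F"
proof (cases "finite E")
 case True
 have "triples (insert x E) F" using assms(1) by (auto simp: triples_def)
 then show ?thesis using comps_add_point[OF assms True] True assms by (auto simp: forest_def)
qed (simp add: forest_def)

section \<open>Hypertrees and the spaces that they span\<close>

definition hypertree :: "'a set => 'a set set => bool" where
 "hypertree E F \<longleftrightarrow> forest E F & card E = 2 * card F + 1"

lemma hypertree_iff: "hypertree E F \<longleftrightarrow> forest E F & card (comps E F) = 1"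
 by (auto simp: hypertree_def forest_def)

lemma hypertree_connected:
 assumes "hypertree E F" "a \<in> E" shows "component F a = E"
proof -
 have "card (comps E F) = 1" using assms(1) by (simp add: hypertree_iff)
 then obtain C where C: "comps E F = {C}" by (auto simp: card_1_singleton_iff)
 have all: "component F b = C" if "b \<in> E" for b using that C by (auto simp: comps_def)
 have "E <= C"
 proof
  fix b assume "b \<in> E"
  then show "b \<in> C" using all[of b] comp_self[of b F] by simp
 qed
 moreover have "component F a <= E"
  using assms by (intro comp_subset) (auto simp: hypertree_def forest_def)
 ultimately show ?thesis using all[OF assms(2)] by blast
qed

text \<open>A glued triangle {e, f, g} becomes a new edge; e and f are new isolated vertices, so it
  joins three different components.\<close>

lemma tri_space_imp_sspan: "tri_space E Z ==> \<exists>F. hypertree E F & Z = sspan F"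
proof (induction rule: tri_space.induct)
 case (tri_single e)
 have "hypertree {e} {}" using forest_empty[of "{e}"] by (simp add: hypertree_def)
 then show ?case using sspan_empty by blast
next
 case (tri_glue E Z g e f)
 then obtain F where F: "hypertree E F" "Z = sspan F" by blast
 have fin: "finite E" and tr: "triples E F" and fo: "forest E F" using F(1) by (auto simp: hypertree_def forest_def)
 let ?h = "{e, f, g}" and ?E = "insert e (insert f E)"
 have sub: "!!k. k \<in> F ==> k <= E" using tr by (auto simp: triples_def)
 have ef: "e ~= g" "f ~= g" using tri_glue.hyps by auto
 have new: "?h ~: F" using sub tri_glue.hyps by blast
 have tr': "triples (insert f E) F" using tr by (auto simp: triples_def)
 have fo': "forest ?E F"
  using forest_add_point[OF tr', of e] forest_add_point[OF tr, of f] fo tri_glue.hyps by simp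
 have c: "component F e = {e}" "component F f = {f}"
  by (rule isolated_component, use sub tri_glue.hyps in blast)+
 have "{e} ~= component F g" "{f} ~= component F g" using comp_self[of g F] ef by fastforce+
 then have "inj_on (component F) ?h" using c tri_glue.hyps(5) by auto
 moreover have "finite ?E" using fin by simp
 moreover have "?h <= ?E" using tri_glue.hyps by blast
 moreover have "card ?h = 3" using ef tri_glue.hyps by simp
 ultimately have "forest ?E (insert ?h F)" using forest_insert[of ?E ?h F] new fo' by blast
 moreover have "card ?E = 2 * card (insert ?h F) + 1"
  using F(1) fin new tri_glue.hyps triples_finite[OF fin tr] by (simp add: hypertree_def)
 moreover have "tri_ext e f g Z = sspan (insert ?h F)"
  using tri_ext_image[of Z E e f g] tri_space_basic(2)[OF tri_glue.hyps(1)] tri_glue.hyps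
  by (simp add: sspan_insert F(2))
 ultimately show ?case unfolding hypertree_def by blast
qed

text \<open>Let L be the set of vertices of degree one. If no edge contained two of them, then |L|
  \<le> |F|. The degrees sum to 3 |F|, but all other vertices have degree at least two, so the sum
  is at least 2 |E| - |L| = 4 |F| + 2 - |L| \<ge> 3 |F| + 2.\<close>

lemma hypertree_leaf:
 assumes F: "hypertree E F" "F ~= {}"
 shows "\<exists>h\<in>F. \<exists>e\<in>h. \<exists>f\<in>h. e ~= f & (\<forall>k\<in>F. e \<in> k | f \<in> k --> k = h)"
proof (rule ccontr)
 assume neg: "\<not> ?thesis"
 have fin: "finite E" and tr: "triples E F" and fo: "forest E F" using F(1) by (auto simp: hypertree_def forest_def)
 have finF: "finite F" by (rule triples_finite[OF fin tr])
 have cE: "card E = 2 * card F + 1" using F(1) by (simp add: hypertree_def)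
 define d where "d a = card {h \<in> F. a \<in> h}" for a
 define L where "L = {a \<in> E. d a = 1}"
 have hE: "h <= E" "card h = 3" if "h \<in> F" for h using tr that by (auto simp: triples_def)
 have L: "L <= E" "finite L" using fin by (auto simp: L_def)
 have "sum d E = (\<Sum>h\<in>F. card {a \<in> E. a \<in> h})"
  unfolding d_def by (rule sum_multicount_gen[OF fin finF]) simp
 also have "\<dots> = (\<Sum>h\<in>F. 3)"
 proof (intro sum.cong refl)
  fix h assume h: "h \<in> F"
  then have "{a \<in> E. a \<in> h} = h" using hE(1)[OF h] by blast
  then show "card {a \<in> E. a \<in> h} = 3" using hE(2)[OF h] by simp
 qed
 finally have dE: "sum d E = 3 * card F" by simp
 have "card L = sum d L" by (simp add: L_def)
 also have "\<dots> = (\<Sum>h\<in>F. card {a \<in> L. a \<in> h})"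
  unfolding d_def by (rule sum_multicount_gen[OF L(2) finF]) simp
 also have "\<dots> <= (\<Sum>h\<in>F. 1)"
 proof (rule sum_mono)
  fix h assume h: "h \<in> F"
  have only: "k = h" if "a \<in> L" "a \<in> h" "k \<in> F" "a \<in> k" for a k
  proof -
   have "card {k \<in> F. a \<in> k} = 1" using that by (simp add: L_def d_def)
   then obtain k0 where k0: "{k \<in> F. a \<in> k} = {k0}" by (auto simp: card_1_singleton_iff)
   have "k \<in> {k \<in> F. a \<in> k}" "h \<in> {k \<in> F. a \<in> k}" using that h by simp_all
   then show ?thesis unfolding k0 by simp
  qed
  have "a = b" if ab: "a \<in> L" "a \<in> h" "b \<in> L" "b \<in> h" for a b
  proof (rule ccontr)
   assume "a ~= b"
   moreover have "\<forall>k\<in>F. a \<in> k | b \<in> k --> k = h" using only[OF ab(1,2)] only[OF ab(3,4)] by blast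
   ultimately show False using neg h ab by blast
  qed
  then have "\<forall>a\<in>{a \<in> L. a \<in> h}. \<forall>b\<in>{a \<in> L. a \<in> h}. a = b" by blast
  then show "card {a \<in> L. a \<in> h} <= 1" using L(2) by (auto intro: card_le_Suc0_iff_eq[THEN iffD2])
 qed
 finally have cL: "card L <= card F" by simp
 have pos: "d a >= 1" if a: "a \<in> E" for a
 proof (rule ccontr)
  assume "\<not> d a >= 1"
  then have "card {h \<in> F. a \<in> h} = 0" by (simp add: d_def)
  moreover have "finite {h \<in> F. a \<in> h}" using finF by simp
  ultimately have "{h \<in> F. a \<in> h} = {}" by (simp only: card_0_eq)
  then have "component F a = {a}" by (intro isolated_component) blast
  then have "card E = 1" using hypertree_connected[OF F(1) a] by simp
  then show False using cE F(2) finF by simp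
 qed
 have "2 * (card E - card L) = (\<Sum>a\<in>E - L. 2)" using L by (simp add: card_Diff_subset)
 also have "\<dots> <= sum d (E - L)"
 proof (rule sum_mono)
  fix a assume a: "a \<in> E - L"
  then have "d a ~= 1" by (simp add: L_def)
  then show "2 <= d a" using pos[of a] a by simp
 qed
 also have "sum d (E - L) = sum d E - sum d L" using L fin by (simp add: sum_diff_nat)
 also have "sum d L = card L" by (simp add: L_def)
 finally show False using dE cE cL by simp
qed

text \<open>Removing a leaf edge together with its two vertices of degree one undoes a triangle
  step.\<close>

lemma sspan_imp_tri_space: "hypertree E F ==> tri_space E (sspan F)"
proof (induction "card F" arbitrary: E F)
 case 0
 then have "finite F" using triples_finite by (auto simp: hypertree_def forest_def)
 then have "F = {}" "card E = 1" using 0 by (auto simp: hypertree_def)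
 then show ?case using tri_single by (auto simp: card_1_singleton_iff sspan_empty)
next
 case (Suc n)
 have fin: "finite E" and tr: "triples E F" and fo: "forest E F"
  using Suc.prems by (auto simp: hypertree_def forest_def)
 have finF: "finite F" by (rule triples_finite[OF fin tr])
 have "F ~= {}" using Suc.hyps(2) by auto
 then obtain h e f where hF: "h \<in> F" and e: "e \<in> h" and f: "f \<in> h" and ef: "e ~= f"
  and leaf: "\<forall>k\<in>F. e \<in> k | f \<in> k --> k = h" using hypertree_leaf[OF Suc.prems] by blast
 have h: "h <= E" "card h = 3" using tr hF by (auto simp: triples_def)
 have finh: "finite h" using h fin finite_subset by blast
 have "card (h - {e, f}) = 1" using h(2) e f ef finh by (simp add: card_Diff_subset)
 then obtain g where g: "h - {e, f} = {g}" by (auto simp: card_1_singleton_iff)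
 then have hefg: "h = {e, f, g}" "g ~= e" "g ~= f" using e f by blast+
 let ?F = "F - {h}" and ?E = "E - {e, f}"
 have sub: "k <= ?E" if "k \<in> ?F" for k
 proof -
  have "k <= E" using that tr by (auto simp: triples_def)
  moreover have "e ~: k" "f ~: k" using that leaf by blast+
  ultimately show ?thesis by blast
 qed
 have tr1: "triples ?E ?F" using sub tr by (auto simp: triples_def)
 then have tr2: "triples (insert f ?E) ?F" by (auto simp: triples_def)
 have E: "insert e (insert f ?E) = E" using e f h by blast
 have "forest (insert e (insert f ?E)) ?F" using forest_remove(1)[OF fo hF] by (simp only: E)
 then have "forest (insert f ?E) ?F" using forest_add_point[OF tr2, of e] ef by simp
 then have "forest ?E ?F" using forest_add_point[OF tr1, of f] by simp
 moreover have "card ?E = 2 * card ?F + 1"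
 proof -
  have "{e, f} <= E" using e f h by blast
  then have "card ?E = card E - 2" using ef by (simp add: card_Diff_subset)
  moreover have "card F = Suc (card ?F)" using card.remove[OF finF hF] .
  ultimately show ?thesis using Suc.prems by (simp add: hypertree_def)
 qed
 ultimately have H: "hypertree ?E ?F" by (simp add: hypertree_def)
 have "n = card ?F" using Suc.hyps(2) card.remove[OF finF hF] by simp
 then have T: "tri_space ?E (sspan ?F)" using Suc.hyps(1) H by blast
 have gE: "g \<in> ?E" using hefg h(1) by blast
 have "tri_space (insert e (insert f ?E)) (tri_ext e f g (sspan ?F))"
  using T gE ef by (intro tri_glue) auto
 moreover have "tri_ext e f g (sspan ?F) = sspan F"
 proof -
  have "tri_ext e f g (sspan ?F) = sspan (insert h ?F)"
   using tri_ext_image[of "sspan ?F" ?E e f g] tri_space_basic(2)[OF T] gE ef hefg(1)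
   unfolding sspan_insert by simp
  moreover have "insert h ?F = F" using hF by blast
  ultimately show ?thesis by simp
 qed
 ultimately show ?case by (simp only: E)
qed

theorem tri_space_iff: "tri_space E Z \<longleftrightarrow> (\<exists>F. hypertree E F & Z = sspan F)"
 using tri_space_imp_sspan sspan_imp_tri_space by blast

section \<open>Hyperforests with two components\<close>

abbreviation separated :: "'a set => 'a set set => ('a set \<times> 'a) set" where
 "separated E F \<equiv> {(h, v). h \<in> F & v \<in> E & (\<forall>a\<in>h. (v, a) ~: con F)}"

lemma component_card_le:
 assumes F: "forest E F" and a: "a \<in> E"
 shows "card (component F a) <= 1 + 2 * card {h \<in> F. h <= component F a}"
proof -
 let ?C = "component F a" and ?G = "{h \<in> F. h <= component F a}"
 have fin: "finite E" and tr: "triples E F" using F by (auto simp: forest_def)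
 have CE: "?C <= E" by (rule comp_subset[OF tr a])
 then have finC: "finite ?C" using fin by (rule finite_subset)
 have trG: "triples ?C ?G" using tr by (auto simp: triples_def)
 have "component ?G b = ?C" if b: "b \<in> ?C" for b
 proof
  show sub: "component ?G b <= ?C" by (rule comp_subset[OF trG b])
  have "closed_under F (component ?G b)"
   unfolding closed_under_def
  proof (intro ballI impI)
   fix h assume h: "h \<in> F" "h Int component ?G b ~= {}"
   then have "h Int ?C ~= {}" using sub by blast
   then have "h <= ?C" using comp_closed[of F a] h(1) by (simp add: closed_under_def)
   then have "h \<in> ?G" using h(1) by simp
   then show "h <= component ?G b" using comp_closed[of ?G b] h(2) unfolding closed_under_def by blast
  qed
  then have "component F b <= component ?G b" by (rule comp_subset_closed) simp
  then show "?C <= component ?G b" using comp_eq[OF b] by simp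
 qed
 then have "comps ?C ?G <= {?C}" by (auto simp: comps_def)
 then have "card (comps ?C ?G) <= 1" using card_mono[of "{?C}" "comps ?C ?G"] by simp
 then show ?thesis using card_comps_lower[OF finC trG] by simp
qed

text \<open>Components with a and b edges have 2 a + 1 and 2 b + 1 vertices. There are (2 a + 1) (2
  b + 1) root sets and a (2 b + 1) + b (2 a + 1) separated pairs; the difference a + b + 1 no longer
  depends on how the edges are distributed. This is what makes unrooted forests countable.\<close>

lemma two_comps_roots:
 assumes F: "forest E F" and c: "card (comps E F) = 2"
 shows "card {\<rho>. roots E F \<rho>} = card F + 1 + card (separated E F)"
proof -
 have fin: "finite E" and tr: "triples E F" using F by (auto simp: forest_def)
 have finF: "finite F" by (rule triples_finite[OF fin tr])
 have num: "2 + 2 * card F = card E" using F c by (simp add: forest_def)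
 obtain A B where AB: "comps E F = {A, B}" "A ~= B" using c by (auto simp: card_2_iff)
 have "A \<in> comps E F" "B \<in> comps E F" by (simp_all add: AB(1))
 then obtain a b where a: "a \<in> E" "A = component F a" and b: "b \<in> E" "B = component F b"
  unfolding comps_def by blast
 have disj: "A Int B = {}" using comp_disjoint[of F a b] AB(2) a(2) b(2) by blast
 have sub: "A <= E" "B <= E" using comp_subset[OF tr] a b by simp_all
 have cover: "component F c = A | component F c = B" if "c \<in> E" for c
 proof -
  have "component F c \<in> comps E F" using that by (simp add: comps_def)
  then show ?thesis unfolding AB(1) by simp
 qed
 have memA: "component F c = A" if "c \<in> A" for c using comp_eq[of c F a] that a by simp
 have memB: "component F c = B" if "c \<in> B" for c using comp_eq[of c F b] that b by simp
 have E: "E = A Un B"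
 proof
  show "E <= A Un B"
  proof
   fix c assume "c \<in> E"
   then show "c \<in> A Un B" using cover[of c] comp_self[of c F] by blast
  qed
 qed (use sub in blast)
 have finAB: "finite A" "finite B" using sub fin finite_subset by blast+
 have cE: "card E = card A + card B" unfolding E using disj finAB by (rule card_Un_disjoint[rotated 2])
 let ?FA = "{h \<in> F. h <= A}" and ?FB = "{h \<in> F. h <= B}"
 have hne: "h ~= {}" if "h \<in> F" for h using tr that by (auto simp: triples_def)
 have F_split: "F = ?FA Un ?FB"
 proof
  show "F <= ?FA Un ?FB"
  proof
   fix h assume h: "h \<in> F"
   then have "h <= E" using tr by (auto simp: triples_def)
   then have "h Int A ~= {} | h Int B ~= {}" using hne[OF h] E by blast
   then have "h <= A | h <= B"
    using comp_closed[of F a] comp_closed[of F b] h a(2) b(2) unfolding closed_under_def by blast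
   then show "h \<in> ?FA Un ?FB" using h by blast
  qed
 qed blast
 have FAB: "?FA Int ?FB = {}" using hne disj by blast
 have cF: "card F = card ?FA + card ?FB"
  using card_Un_disjoint[OF _ _ FAB] finF F_split by simp
 have cA: "card A = 1 + 2 * card ?FA" and cB: "card B = 1 + 2 * card ?FB"
  using component_card_le[OF F a(1)] component_card_le[OF F b(1)] cE cF num unfolding a(2)[symmetric] b(2)[symmetric]
  by linarith+
 have "{\<rho>. roots E F \<rho>} = (%(s, t). {s, t}) ` (A \<times> B)"
 proof (intro equalityI subsetI)
  fix \<rho> assume "\<rho> \<in> {\<rho>. roots E F \<rho>}"
  then have \<rho>: "roots E F \<rho>" by simp
  then have bij: "bij_betw (component F) \<rho> {A, B}" using roots_bij[OF \<rho>] AB(1) by simp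
  then have im: "component F ` \<rho> = {A, B}" and inj: "inj_on (component F) \<rho>" by (simp_all add: bij_betw_def)
  have "A \<in> component F ` \<rho>" "B \<in> component F ` \<rho>" unfolding im by simp_all
  then obtain s t where s: "s \<in> \<rho>" "component F s = A" and t: "t \<in> \<rho>" "component F t = B"
   by (elim imageE) simp
  have "r = s | r = t" if r: "r \<in> \<rho>" for r
  proof -
   have "component F r \<in> {A, B}" unfolding im[symmetric] using r by (rule imageI)
   then show ?thesis using inj_onD[OF inj _ r s(1)] inj_onD[OF inj _ r t(1)] s(2) t(2) by auto
  qed
  then have "\<rho> = {s, t}" using s(1) t(1) by blast
  moreover have "s \<in> A" "t \<in> B" using comp_self[of s F] comp_self[of t F] s(2) t(2) by simp_all
  ultimately show "\<rho> \<in> (%(s, t). {s, t}) ` (A \<times> B)" by auto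
 next
  fix \<rho> assume "\<rho> \<in> (%(s, t). {s, t}) ` (A \<times> B)"
  then obtain s t where st: "s \<in> A" "t \<in> B" "\<rho> = {s, t}" by auto
  have "roots E F \<rho>"
  proof (rule rootsI[OF _ _ fin])
   show "\<rho> <= E" using st E by blast
   show "card \<rho> <= card (comps E F)" using c st(3) by (simp add: card_insert_if)
   show "\<exists>r\<in>\<rho>. (c, r) \<in> con F" if "c \<in> E" for c
    using cover[OF that] memA[OF st(1)] memB[OF st(2)] st(3) comp_eq_iff[of F c s] comp_eq_iff[of F c t] by auto
  qed
  then show "\<rho> \<in> {\<rho>. roots E F \<rho>}" by simp
 qed
 moreover have "inj_on (%(s, t). {s, t}) (A \<times> B)"
 proof (rule inj_onI)
  fix y y' assume y: "y \<in> A \<times> B" "y' \<in> A \<times> B" "(%(s, t). {s, t}) y = (%(s, t). {s, t}) y'"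
  obtain s t s' t' where yy: "y = (s, t)" "y' = (s', t')" by (metis surj_pair)
  have "s \<in> A" "t \<in> B" "s' \<in> A" "t' \<in> B" "{s, t} = {s', t'}" using y by (auto simp: yy)
  then show "y = y'" using disj by (auto simp: yy doubleton_eq_iff)
 qed
 ultimately have R: "card {\<rho>. roots E F \<rho>} = card A * card B"
  by (simp add: card_image card_cartesian_product)
 have "separated E F = (?FA \<times> B) Un (?FB \<times> A)"
 proof (intro equalityI subsetI)
  fix y assume "y \<in> separated E F"
  then obtain h v where y: "y = (h, v)" "h \<in> F" "v \<in> E" and sep: "\<forall>s\<in>h. (v, s) ~: con F" by auto
  obtain s where s: "s \<in> h" using hne[OF y(2)] by blast
  then have ne: "component F v ~= component F s" using sep comp_eq_iff[of F v s] by blast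
  have "h <= A | h <= B" using y(2) F_split by blast
  then show "y \<in> (?FA \<times> B) Un (?FB \<times> A)"
  proof
   assume hA: "h <= A"
   then have "component F v = B" using ne cover[OF y(3)] memA[of s] s by auto
   then have "v \<in> B" using comp_self[of v F] by simp
   then show ?thesis using hA y by blast
  next
   assume hB: "h <= B"
   then have "component F v = A" using ne cover[OF y(3)] memB[of s] s by auto
   then have "v \<in> A" using comp_self[of v F] by simp
   then show ?thesis using hB y by blast
  qed
 next
  fix y assume y: "y \<in> (?FA \<times> B) Un (?FB \<times> A)"
  obtain h v where yy: "y = (h, v)" by (cases y)
  have "(v, s) ~: con F" if s: "s \<in> h" for s
  proof -
   have "(s \<in> A & v \<in> B) | (s \<in> B & v \<in> A)" using y s unfolding yy by blast
   then have "component F v ~= component F s" using memA[of s] memA[of v] memB[of s] memB[of v] AB(2) by auto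
   then show ?thesis using comp_eq_iff[of F v s] by simp
  qed
  moreover have "h \<in> F" "v \<in> E" using y E unfolding yy by blast+
  ultimately show "y \<in> separated E F" by (simp add: yy)
 qed
 moreover have "(?FA \<times> B) Int (?FB \<times> A) = {}" using disj by blast
 ultimately have S: "card (separated E F) = card ?FA * card B + card ?FB * card A"
  using card_Un_disjoint[of "?FA \<times> B" "?FB \<times> A"] finF finAB by (simp add: card_cartesian_product)
 show ?thesis unfolding R S cF cA cB by (simp add: algebra_simps)
qed

definition two_forests :: "'a set => 'a set set set" where
 "two_forests E = {F. forest E F & card (comps E F) = 2}"

lemma finite_two_forests: "finite E ==> finite (two_forests E)"
 by (rule finite_subset[of _ "Pow (Pow E)"]) (auto simp: two_forests_def forest_def triples_def)

lemma finite_separated: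
 assumes "forest E F" shows "finite (separated E F)"
proof -
 have "finite (F \<times> E)" using assms triples_finite[of E F] by (simp add: forest_def)
 then show ?thesis by (rule finite_subset[rotated]) blast
qed

text \<open>Removing h leaves four components, rooted at v and at the three vertices of h.
  Conversely a marked root is v and the other three roots form the edge to be added.\<close>

lemma separated_bij:
 "bij_betw (%(F, h, v). ((F - {h}, insert v h), v)) (SIGMA F:two_forests E. separated E F)
   (SIGMA y:rooted E 4. snd y)"
 (is "bij_betw ?f ?X ?Y")
proof (rule bij_betw_byWitness[where f' = "%((F, \<rho>), v). (insert (\<rho> - {v}) F, \<rho> - {v}, v)"])
 let ?g = "%((F, \<rho>), v). (insert (\<rho> - {v}) F, \<rho> - {v}, v)"
 have fwd: "?g (?f (F, h, v)) = (F, h, v) & ?f (F, h, v) \<in> ?Y" if "(F, h, v) \<in> ?X" for F h v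
 proof -
  have F: "forest E F" "card (comps E F) = 2" and hF: "h \<in> F" and v: "v \<in> E"
   and sep: "!!a. a \<in> h ==> (v, a) ~: con F" using that by (auto simp: two_forests_def)
  have fin: "finite E" and tr: "triples E F" using F by (auto simp: forest_def)
  have finF: "finite F" by (rule triples_finite[OF fin tr])
  have h: "h <= E" "card h = 3" using tr hF by (auto simp: triples_def)
  have finh: "finite h" using h fin finite_subset by blast
  have vh: "v ~: h" using sep[of v] by auto
  have ins: "insert h (F - {h}) = F" using hF by blast
  obtain c where c: "c \<in> h" using h by fastforce
  have fo: "forest E (F - {h})" by (rule forest_remove(1)[OF F(1) hF])
  have comps4: "card (comps E (F - {h})) = 4"
   using fo F card.remove[OF finF hF] by (simp add: forest_def)
  have ne: "component F v ~= component F c" using sep[OF c] comp_eq_iff[of F v c] by blast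
  have all: "{component F v, component F c} = comps E F"
  proof (rule card_subset_eq)
   show "{component F v, component F c} <= comps E F" using v c h by (auto simp: comps_def)
   show "card {component F v, component F c} = card (comps E F)" using ne F(2) by simp
  qed (use fin in \<open>simp add: comps_def\<close>)
  have two: "component F b = component F v | component F b = component F c" if "b \<in> E" for b
  proof -
   have "component F b \<in> comps E F" using that by (simp add: comps_def)
   then show ?thesis unfolding all[symmetric] by simp
  qed
  have "roots E (F - {h}) (insert v h)"
  proof (rule rootsI[OF _ _ fin])
   show "insert v h <= E" using v h by blast
   show "card (insert v h) <= card (comps E (F - {h}))" using comps4 h finh vh by simp
   show "\<exists>r\<in>insert v h. (b, r) \<in> con (F - {h})" if b: "b \<in> E" for b
   proof (cases "component (F - {h}) b Int h = {}")
    case False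
    then show ?thesis by (auto simp: component_def)
   next
    case True
    then have same: "component F b = component (F - {h}) b"
     using comp_insert[of h "F - {h}" b] c unfolding ins by auto
    have "c ~: component F b" using True c unfolding same by blast
    then have "component F b ~= component F c" using comp_self[of c F] by metis
    then have "v \<in> component F b" using two[OF b] comp_self[of v F] by simp
    then show ?thesis unfolding same by (auto simp: component_def)
   qed
  qed
  moreover have "card (insert v h) = 4" using h finh vh by simp
  ultimately have "?f (F, h, v) \<in> ?Y" using fo by (simp add: rooted_iff)
  moreover have "?g (?f (F, h, v)) = (F, h, v)" using vh ins by simp
  ultimately show ?thesis by blast
 qed
 have bwd: "?f (?g ((F, \<rho>), v)) = ((F, \<rho>), v) & ?g ((F, \<rho>), v) \<in> ?X" if "((F, \<rho>), v) \<in> ?Y" for F \<rho> v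
 proof -
  have F: "forest E F" "roots E F \<rho>" "card \<rho> = 4" and v: "v \<in> \<rho>" using that by (auto simp: rooted_iff)
  let ?h = "\<rho> - {v}"
  have fin: "finite E" and tr: "triples E F" using F by (auto simp: forest_def)
  have finF: "finite F" by (rule triples_finite[OF fin tr])
  have fin\<rho>: "finite \<rho>" using F(3) card.infinite by fastforce
  have \<rho>E: "\<rho> <= E" by (rule transversalD(1)[OF F(2)])
  have h: "?h <= E" "card ?h = 3" using \<rho>E F(3) v fin\<rho> by auto
  have inj: "inj_on (component F) \<rho>" using roots_bij[OF F(2)] by (simp add: bij_betw_def)
  have injh: "inj_on (component F) ?h" using inj by (rule inj_on_subset) blast
  have new: "?h ~: F"
  proof
   assume hF: "?h \<in> F"
   have "?h ~= {}" using h(2) by (metis card.empty zero_neq_numeral)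
   then obtain s where s: "s \<in> ?h" by blast
   have "card (?h - {s}) = 2" using h(2) s by simp
   then have "?h - {s} ~= {}" by (metis card.empty zero_neq_numeral)
   then obtain t where t: "t \<in> ?h" "t ~= s" by blast
   have "component F s = component F t" using con_edge[OF hF s t(1)] comp_eq_iff[of F s t] by simp
   then show False using inj_onD[OF injh _ s t(1)] t(2) by blast
  qed
  have fo: "forest E (insert ?h F)" using forest_insert[OF fin new h] F(1) injh by blast
  have "card (comps E F) = 4" using roots_card[OF F(2)] F(3) by simp
  then have two: "card (comps E (insert ?h F)) = 2"
   using fo F(1) finF new by (simp add: forest_def)
  have "component F v Int ?h = {}"
  proof (rule ccontr)
   assume "component F v Int ?h ~= {}"
   then obtain s where s: "s \<in> ?h" "s \<in> component F v" by blast
   then have "component F s = component F v" by (intro comp_eq)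
   then show False using inj_onD[OF inj, of s v] s v by blast
  qed
  moreover have "?h ~= {}" using h(2) by (metis card.empty zero_neq_numeral)
  ultimately have same: "component (insert ?h F) v = component F v"
   using comp_insert[of ?h F v] by simp
  have sep: "(v, s) ~: con (insert ?h F)" if s: "s \<in> ?h" for s
  proof
   assume "(v, s) \<in> con (insert ?h F)"
   then have "s \<in> component (insert ?h F) v" by (simp add: component_def)
   then show False using \<open>component F v Int ?h = {}\<close> s unfolding same by blast
  qed
  have "?g ((F, \<rho>), v) \<in> ?X" using fo two v \<rho>E sep by (auto simp: two_forests_def)
  moreover have "?f (?g ((F, \<rho>), v)) = ((F, \<rho>), v)" using new v by (auto simp: insert_absorb)
  ultimately show ?thesis by blast
 qed
 show "\<forall>a\<in>?X. ?g (?f a) = a" using fwd by fast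
 show "\<forall>a\<in>?Y. ?f (?g a) = a" using bwd by fast
 show "?f ` ?X <= ?Y" using fwd by fast
 show "?g ` ?Y <= ?X" using bwd by fast
qed

text \<open>Summing \<open>two_comps_roots\<close> over all forests: |F| + 1 is the constant m, and
  each rooted forest with four components has four roots to mark.\<close>

theorem card_two_forests:
 assumes fin: "finite E" and cE: "card E = 2 * m"
 shows "m * card (two_forests E) + 4 * card (rooted E 4) = card (rooted E 2)"
proof -
 have T: "forest E F" "card (comps E F) = 2" "card F + 1 = m" if "F \<in> two_forests E" for F
  using that cE by (auto simp: two_forests_def forest_def)
 have fr: "finite {\<rho>. roots E F \<rho>}" for F
  by (rule finite_subset[of _ "Pow E"]) (use fin in \<open>auto simp: transversal_def\<close>)
 have "rooted E 2 = (SIGMA F:two_forests E. {\<rho>. roots E F \<rho>})"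
 proof (intro equalityI subsetI)
  fix y assume y: "y \<in> rooted E 2"
  obtain F \<rho> where yy: "y = (F, \<rho>)" by (cases y)
  have "forest E F" "roots E F \<rho>" "card \<rho> = 2" using y by (auto simp: yy rooted_iff)
  then show "y \<in> (SIGMA F:two_forests E. {\<rho>. roots E F \<rho>})"
   using roots_card[of E F \<rho>] by (simp add: yy two_forests_def)
 next
  fix y assume y: "y \<in> (SIGMA F:two_forests E. {\<rho>. roots E F \<rho>})"
  obtain F \<rho> where yy: "y = (F, \<rho>)" by (cases y)
  have "forest E F" "roots E F \<rho>" "card (comps E F) = 2" using y by (auto simp: yy two_forests_def)
  then show "y \<in> rooted E 2" using roots_card[of E F \<rho>] by (simp add: yy rooted_iff)
 qed
 then have "card (rooted E 2) = (\<Sum>F\<in>two_forests E. card {\<rho>. roots E F \<rho>})"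
  using card_SigmaI[OF finite_two_forests[OF fin], of "%F. {\<rho>. roots E F \<rho>}"] fr by simp
 also have "\<dots> = (\<Sum>F\<in>two_forests E. m + card (separated E F))"
 proof (intro sum.cong refl)
  fix F assume F: "F \<in> two_forests E"
  show "card {\<rho>. roots E F \<rho>} = m + card (separated E F)"
   using two_comps_roots[OF T(1,2)[OF F]] T(3)[OF F] by simp
 qed
 also have "\<dots> = m * card (two_forests E) + (\<Sum>F\<in>two_forests E. card (separated E F))"
  by (simp add: sum.distrib)
 also have "(\<Sum>F\<in>two_forests E. card (separated E F)) = card (SIGMA F:two_forests E. separated E F)"
  by (rule card_SigmaI[symmetric, OF finite_two_forests[OF fin]]) (use T(1) finite_separated in blast)
 also have "\<dots> = card (SIGMA y:rooted E 4. snd y)" by (rule bij_betw_same_card[OF separated_bij])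
 also have "\<dots> = (\<Sum>y\<in>rooted E 4. card (snd y))"
 proof (rule card_SigmaI[OF finite_rooted[OF fin]], rule ballI)
  fix y assume "y \<in> rooted E 4"
  then have "card (snd y) = 4" by (auto simp: rooted_def)
  then show "finite (snd y)" using card.infinite by fastforce
 qed
 also have "\<dots> = (\<Sum>y\<in>rooted E 4. 4)" by (intro sum.cong refl) (auto simp: rooted_def)
 finally show ?thesis by simp
qed

section \<open>Deleting a point from a hypertree\<close>

definition avoid :: "'a => 'a set set => 'a set set" where
 "avoid x F = {h \<in> F. x ~: h}"

definition link :: "'a => 'a set set => 'a set set" where
 "link x F = (%h. h - {x}) ` {h \<in> F. x \<in> h}"

lemma linkD: "p \<in> link x F ==> x ~: p & insert x p \<in> F"
 by (auto simp: link_def insert_absorb)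

lemma avoid_link: "F = avoid x F Un insert x ` link x F"
proof (intro equalityI subsetI)
 fix h assume h: "h \<in> F"
 show "h \<in> avoid x F Un insert x ` link x F"
 proof (cases "x \<in> h")
  case True
  then have "h - {x} \<in> link x F" "h = insert x (h - {x})" using h by (auto simp: link_def)
  then show ?thesis by blast
 qed (use h in \<open>simp add: avoid_def\<close>)
next
 fix h assume "h \<in> avoid x F Un insert x ` link x F"
 then show "h \<in> F" using linkD[of _ x F] by (auto simp: avoid_def)
qed

text \<open>Two edges at x share only x, so the pairs in the link are disjoint. A component of the
  remaining forest without a linked vertex would be closed in F; since there are as many linked
  vertices as components, they form a root set.\<close>

lemma link_props:
 assumes F: "hypertree (insert x E) F" and x: "x ~: E"
 shows "p \<in> link x F ==> p <= E & card p = 2"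
  and "p \<in> link x F ==> q \<in> link x F ==> p ~= q ==> p Int q = {}"
  and "(avoid x F, \<Union>(link x F)) \<in> rooted E (2 * card (link x F))"
  and "finite (link x F)"
  and "E ~= {} ==> link x F ~= {}"
proof -
 let ?V = "insert x E" and ?G = "avoid x F" and ?L = "link x F"
 have finV: "finite ?V" and tr: "triples ?V F" and fo: "forest ?V F" and cV: "card ?V = 2 * card F + 1"
  using F by (auto simp: hypertree_def forest_def)
 have finE: "finite E" using finV by simp
 have finF: "finite F" by (rule triples_finite[OF finV tr])
 have hV: "h <= ?V" "card h = 3" if "h \<in> F" for h using tr that by (auto simp: triples_def)
 have p: "p <= E & card p = 2" if "p \<in> ?L" for p
 proof -
  have p: "x ~: p" "insert x p \<in> F" using linkD[OF that] by auto
  then have "p <= E" using hV(1)[OF p(2)] by blast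
  moreover have "finite p" using calculation finE by (rule finite_subset)
  ultimately show ?thesis using hV(2)[OF p(2)] p(1) by simp
 qed
 then show "p \<in> ?L ==> p <= E & card p = 2" .
 have disj: "p Int q = {}" if pq: "p \<in> ?L" "q \<in> ?L" "p ~= q" for p q
 proof (rule ccontr)
  assume "p Int q ~= {}"
  then obtain c where c: "c \<in> p" "c \<in> q" by blast
  have P: "x ~: p" "insert x p \<in> F" and Q: "x ~: q" "insert x q \<in> F"
   using linkD[OF pq(1)] linkD[OF pq(2)] by simp_all
  have "insert x p ~= insert x q" using P(1) Q(1) pq(3) insert_ident by metis
  then have "x = c" using forest_inter[OF fo P(2) Q(2), of x c] c by blast
  then show False using c P(1) by simp
 qed
 then show "p \<in> ?L ==> q \<in> ?L ==> p ~= q ==> p Int q = {}" .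
 show finL: "finite ?L" using finF by (simp add: link_def)
 have conn: "component F a = ?V" if "a \<in> ?V" for a by (rule hypertree_connected[OF F that])
 show "?L ~= {}" if "E ~= {}"
 proof
  assume "?L = {}"
  then have "!!h. h \<in> F ==> x ~: h" by (auto simp: link_def)
  then have "component F x = {x}" by (rule isolated_component)
  then show False using conn[of x] that x by auto
 qed
 have trG: "triples E ?G"
  unfolding triples_def
 proof (intro ballI conjI)
  fix h assume h: "h \<in> ?G"
  then have "h \<in> F" "x ~: h" by (simp_all add: avoid_def)
  then show "h <= E" "card h = 3" using hV by blast+
 qed
 have "forest ?V ?G" by (rule forest_subset[OF fo]) (auto simp: avoid_def)
 then have foG: "forest E ?G" using forest_add_point[OF trG x] by simp
 have "card F = card ?G + card ?L"
 proof -
  have "inj_on (%h. h - {x}) {h \<in> F. x \<in> h}"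
   by (rule inj_on_inverseI[of _ "insert x"]) (auto simp: insert_absorb)
  then have "card ?L = card {h \<in> F. x \<in> h}" unfolding link_def by (rule card_image)
  moreover have "F = ?G Un {h \<in> F. x \<in> h}" "?G Int {h \<in> F. x \<in> h} = {}" by (auto simp: avoid_def)
  ultimately show ?thesis using card_Un_disjoint[of ?G "{h \<in> F. x \<in> h}"] finF by (simp add: avoid_def)
 qed
 then have cc: "card (comps E ?G) = 2 * card ?L" using foG cV x finE by (simp add: forest_def)
 have "card (\<Union>?L) = sum card ?L"
 proof (rule card_Union_disjoint)
  show "pairwise disjnt ?L" using disj by (simp add: pairwise_def disjnt_def)
  show "finite A" if "A \<in> ?L" for A using p[OF that] finE finite_subset by blast
 qed
 also have "\<dots> = (\<Sum>q\<in>?L. 2)" by (rule sum.cong) (use p in simp_all)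
 finally have cU: "card (\<Union>?L) = 2 * card ?L" by simp
 have "roots E ?G (\<Union>?L)"
 proof (rule rootsI[OF _ _ finE])
  show "\<Union>?L <= E" using p by blast
  show "card (\<Union>?L) <= card (comps E ?G)" using cU cc by simp
  show "\<exists>r\<in>\<Union>?L. (a, r) \<in> con ?G" if a: "a \<in> E" for a
  proof (rule ccontr)
   assume neg: "\<not> ?thesis"
   let ?C = "component ?G a"
   have C: "?C <= E" by (rule comp_subset[OF trG a])
   have "closed_under F ?C"
    unfolding closed_under_def
   proof (intro ballI impI)
    fix h assume h: "h \<in> F" "h Int ?C ~= {}"
    show "h <= ?C"
    proof (cases "x \<in> h")
     case False
     then have "h \<in> ?G" using h(1) by (simp add: avoid_def)
     then show ?thesis using comp_closed[of ?G a] h(2) unfolding closed_under_def by blast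
    next
     case True
     then have "h - {x} \<in> ?L" using h(1) by (auto simp: link_def)
     moreover obtain c where "c \<in> h" "c \<in> ?C" using h(2) by blast
     moreover have "c ~= x" using calculation(3) C x by blast
     ultimately show ?thesis using neg by (auto simp: component_def)
    qed
   qed
   then have "component F a <= ?C" by (rule comp_subset_closed) simp
   then show False using conn[of a] a C x by auto
  qed
 qed
 then show "(?G, \<Union>?L) \<in> rooted E (2 * card ?L)" using foG cU by (simp add: rooted_iff)
qed

lemma avoid_insert: "x \<in> h ==> avoid x (insert h F) = avoid x F"
 by (auto simp: avoid_def)

lemma avoid_self: "(!!h. h \<in> F ==> x ~: h) ==> avoid x F = F"
 by (auto simp: avoid_def)

lemma link_insert: "x ~: p ==> link x (insert (insert x p) F) = insert p (link x F)"
 by (auto simp: link_def)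

lemma link_self: "(!!h. h \<in> F ==> x ~: h) ==> link x F = {}"
 by (auto simp: link_def)

text \<open>Facts for joining a new vertex x to pairs of roots: x and all the roots lie in different
  components, so every such triple is admissible.\<close>

lemma rooted_attach:
 assumes G: "(G, \<rho>) \<in> rooted E k" and x: "x ~: E"
 shows "forest (insert x E) G" and "inj_on (component G) (insert x \<rho>)" and "x ~: \<rho>" and "\<rho> <= E" and "finite \<rho>"
  and "!!h. h \<in> G ==> x ~: h" and "card E = 2 * card G + k" and "finite G" and "finite E"
  and "!!r. r \<in> \<rho> ==> component G r <= E"
  and "!!p r. p <= \<rho> ==> r \<in> \<rho> - p ==> component G r Int insert x p = {}"
proof -
 have F: "forest E G" "roots E G \<rho>" "card \<rho> = k" using G by (auto simp: rooted_iff)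
 show fin: "finite E" using F by (simp add: forest_def)
 have tr: "triples E G" using F by (simp add: forest_def)
 show "finite G" by (rule triples_finite[OF fin tr])
 show "forest (insert x E) G" using forest_add_point[OF tr x] F by simp
 show \<rho>E: "\<rho> <= E" by (rule transversalD(1)[OF F(2)])
 then show "x ~: \<rho>" "finite \<rho>" using x fin finite_subset by blast+
 show xh: "x ~: h" if "h \<in> G" for h using tr that x by (auto simp: triples_def)
 have cx: "component G x = {x}" by (rule isolated_component[OF xh])
 show cE: "component G r <= E" if "r \<in> \<rho>" for r using comp_subset[OF tr] that \<rho>E by blast
 have inj: "inj_on (component G) \<rho>" using roots_bij[OF F(2)] by (simp add: bij_betw_def)
 have "component G x ~: component G ` \<rho>"
 proof
  assume "component G x \<in> component G ` \<rho>"
  then obtain r where r: "r \<in> \<rho>" "component G x = component G r" by blast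
  then have "x \<in> component G r" using comp_self[of x G] by simp
  then show False using cE[OF r(1)] x by blast
 qed
 then show "inj_on (component G) (insert x \<rho>)" using inj \<open>x ~: \<rho>\<close> by simp
 show "card E = 2 * card G + k" using F roots_card[OF F(2)] by (simp add: forest_def)
 show "component G r Int insert x p = {}" if pr: "p <= \<rho>" "r \<in> \<rho> - p" for p r
 proof (rule ccontr)
  assume "component G r Int insert x p ~= {}"
  then obtain s where s: "s \<in> component G r" "s \<in> insert x p" by blast
  have "s ~= x" using s(1) cE[of r] pr x by blast
  then have "s \<in> p" "component G s = component G r" using s comp_eq[OF s(1)] by blast+
  then show False using inj_onD[OF inj, of s r] pr by blast
 qed
qed

lemma rooted_2_hypertree:
 assumes G: "(G, \<rho>) \<in> rooted E 2" and x: "x ~: E"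
 shows "hypertree (insert x E) (insert (insert x \<rho>) G)"
  "avoid x (insert (insert x \<rho>) G) = G" "link x (insert (insert x \<rho>) G) = {\<rho>}"
proof -
 note A = rooted_attach[OF G x]
 have new: "insert x \<rho> ~: G" using A(6) by blast
 have c: "card (insert x \<rho>) = 3" using G A(3,5) by (simp add: rooted_iff)
 have "forest (insert x E) (insert (insert x \<rho>) G)"
  using forest_insert[of "insert x E" "insert x \<rho>" G] new c A by blast
 then show "hypertree (insert x E) (insert (insert x \<rho>) G)"
  using A(7,8,9) x new by (simp add: hypertree_def)
 show "avoid x (insert (insert x \<rho>) G) = G" using avoid_insert[of x "insert x \<rho>" G] avoid_self[OF A(6)] by simp
 show "link x (insert (insert x \<rho>) G) = {\<rho>}" using link_insert[OF A(3)] link_self[OF A(6)] by simp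
qed

text \<open>Any split of the four roots into two pairs gives a hypertree: the first triple leaves
  the components of the other two roots untouched, so the second one is admissible too.\<close>

lemma rooted_4_hypertree:
 assumes G: "(G, \<rho>) \<in> rooted E 4" and x: "x ~: E" and p: "p <= \<rho>" "card p = 2"
 shows "hypertree (insert x E) (insert (insert x (\<rho> - p)) (insert (insert x p) G))"
  "avoid x (insert (insert x (\<rho> - p)) (insert (insert x p) G)) = G"
  "link x (insert (insert x (\<rho> - p)) (insert (insert x p) G)) = {\<rho> - p, p}"
proof -
 note A = rooted_attach[OF G x]
 let ?q = "\<rho> - p" and ?G = "insert (insert x p) G" and ?V = "insert x E"
 have c\<rho>: "card \<rho> = 4" using G by (simp add: rooted_iff)
 have finp: "finite p" using p(1) A(5) by (rule finite_subset)
 have cq: "card ?q = 2" using c\<rho> p finp by (simp add: card_Diff_subset)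
 have xp: "x ~: p" "x ~: ?q" using A(3) p(1) by blast+
 have new: "insert x p ~: G" "insert x ?q ~: G" using A(6) by blast+
 have "?q ~= {}" using cq by (metis card.empty zero_neq_numeral)
 then obtain r where r: "r \<in> ?q" by blast
 have "insert x ?q ~= insert x p"
 proof
  assume eq: "insert x ?q = insert x p"
  have "r \<in> insert x p" unfolding eq[symmetric] using r by simp
  then show False using r A(3) by auto
 qed
 then have new2: "insert x ?q ~: ?G" using new by blast
 have c: "card (insert x p) = 3" "card (insert x ?q) = 3" using p(2) cq xp finp A(5) by simp_all
 have "inj_on (component G) (insert x p)" by (rule inj_on_subset[OF A(2)]) (use p in blast)
 then have fo: "forest ?V ?G"
  using forest_insert[of ?V "insert x p" G] new c A(1,4,9) p by blast
 have same: "component ?G r = component G r" if r: "r \<in> ?q" for r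
  using comp_insert[of "insert x p" G r] A(11)[OF p(1) r] by simp
 have "inj_on (component G) ?q" by (rule inj_on_subset[OF A(2)]) blast
 moreover have "component G ` ?q = component ?G ` ?q" using same by simp
 ultimately have "inj_on (component ?G) ?q" using same by (simp add: inj_on_def)
 moreover have "component ?G x ~: component ?G ` ?q"
 proof
  assume "component ?G x \<in> component ?G ` ?q"
  then obtain r where r: "r \<in> ?q" "component ?G x = component ?G r" by blast
  then have "x \<in> component G r" using comp_self[of x ?G] same[OF r(1)] by simp
  then show False using A(10)[of r] r(1) x by blast
 qed
 moreover have "?q - {x} = ?q" using xp(2) by blast
 ultimately have "inj_on (component ?G) (insert x ?q)" by (simp only: inj_on_insert) blast
 then have "forest ?V (insert (insert x ?q) ?G)"
  using forest_insert[of ?V "insert x ?q" ?G] new2 c(2) A(4,9) fo by blast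
 then show "hypertree ?V (insert (insert x ?q) ?G)"
  using A(7,8,9) x new new2 by (simp add: hypertree_def)
 show "avoid x (insert (insert x ?q) ?G) = G"
  using avoid_insert[of x "insert x ?q" ?G] avoid_insert[of x "insert x p" G] avoid_self[OF A(6)] by simp
 show "link x (insert (insert x ?q) ?G) = {?q, p}"
  using link_insert[OF xp(2), of ?G] link_insert[OF xp(1), of G] link_self[OF A(6)] by simp
qed

section \<open>Recovering a hypertree from its space with one point deleted\<close>

definition del :: "'a => 'a set set => 'a set set" where
 "del x F = {z \<in> sspan F. x ~: z}"

definition threes :: "'a set set => 'a set set" where
 "threes W = {z \<in> W. card z = 3}"

text \<open>The vectors of size four that are not explained by two visible edges, that is by vectors
  of size three. They are the trace left by pairs of edges at the deleted point.\<close>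

definition fours :: "'a set set => 'a set set" where
 "fours W = {z \<in> W. card z = 4 & \<not> (\<exists>h\<in>threes W. \<exists>k\<in>threes W. z = sdiff h k)}"

definition joins :: "'a set set => 'a set set" where
 "joins L = {p Un q |p q. p \<in> L & q \<in> L & p ~= q}"

lemma threes_sspan:
 assumes "forest E F" shows "threes (sspan F) = F"
proof (intro equalityI subsetI)
 fix z assume "z \<in> threes (sspan F)"
 then have z: "z \<in> sspan F" "card z = 3" by (auto simp: threes_def)
 then have "z ~= {}" by auto
 then show "z \<in> F" using sspan_small[OF assms z(1)] z(2) by blast
next
 fix z assume "z \<in> F"
 then show "z \<in> threes (sspan F)" using sspan_mem[of z F] assms by (auto simp: threes_def forest_def triples_def)
qed

lemma threes_del:
 assumes F: "forest V F" shows "threes (del x F) = avoid x F"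
proof -
 have "threes (del x F) = {z \<in> threes (sspan F). x ~: z}" by (auto simp: threes_def del_def)
 then show ?thesis using threes_sspan[OF F] by (simp add: avoid_def)
qed

text \<open>A vector of size four is the sum of two edges, both or neither through x. Two edges
  through x give the union of two link pairs. Such a union is not a sum of edges h, k avoiding x:
  these share at most one point, and two points of h - k would be two roots in one component, so h
  would have at most two points.\<close>

lemma fours_del:
 assumes F: "hypertree (insert x E) F" and x: "x ~: E"
 shows "fours (del x F) = joins (link x F)"
proof -
 note L = link_props[OF F x]
 have fo: "forest (insert x E) F" using F by (simp add: hypertree_def)
 have T: "threes (del x F) = avoid x F" by (rule threes_del[OF fo])
 have R: "roots E (avoid x F) (\<Union>(link x F))" using L(3) by (simp add: rooted_iff)
 have tr: "card h = 3" if "h \<in> F" for h using fo that by (auto simp: forest_def triples_def)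
 have D: "z \<in> fours (del x F) \<longleftrightarrow> z \<in> sspan F & x ~: z & card z = 4 &
   \<not> (\<exists>h\<in>avoid x F. \<exists>k\<in>avoid x F. z = sdiff h k)" for z
  unfolding fours_def T unfolding del_def by blast
 show ?thesis
 proof (intro equalityI subsetI)
  fix z assume "z \<in> fours (del x F)"
  then have z: "z \<in> sspan F" "x ~: z" "card z = 4"
   and neg: "\<not> (\<exists>h\<in>avoid x F. \<exists>k\<in>avoid x F. z = sdiff h k)" unfolding D by blast+
  have "z ~= {}" using z(3) by auto
  then obtain h k where hk: "h \<in> F" "k \<in> F" "z = sdiff h k" using sspan_small[OF fo z(1)] z(3) by blast
  have iff: "x \<in> h \<longleftrightarrow> x \<in> k" using z(2) unfolding hk(3) by simp
  have xh: "x \<in> h"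
  proof (rule ccontr)
   assume "x ~: h"
   then have "h \<in> avoid x F" "k \<in> avoid x F" using iff hk by (simp_all add: avoid_def)
   then show False using neg hk(3) by blast
  qed
  let ?p = "h - {x}" and ?q = "k - {x}"
  have p: "?p \<in> link x F" and q: "?q \<in> link x F" using xh iff hk(1,2) by (auto simp: link_def)
  have z2: "z = sdiff ?p ?q" unfolding hk(3) using xh iff by auto
  have ne: "?p ~= ?q" using z2 \<open>z ~= {}\<close> by auto
  have "?p Int ?q = {}" by (rule L(2)[OF p q ne])
  then have "z = ?p Un ?q" unfolding z2 by auto
  then show "z \<in> joins (link x F)" unfolding joins_def using p q ne by blast
 next
  fix z assume "z \<in> joins (link x F)"
  then obtain p q where z: "z = p Un q" and pq: "p \<in> link x F" "q \<in> link x F" "p ~= q"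
   unfolding joins_def by blast
  have P: "x ~: p" "insert x p \<in> F" and Q: "x ~: q" "insert x q \<in> F" using linkD[OF pq(1)] linkD[OF pq(2)] by simp_all
  have disj: "p Int q = {}" by (rule L(2)[OF pq])
  have c: "card p = 2" "card q = 2" using L(1) pq by simp_all
  then have fin: "finite p" "finite q" using card.infinite by fastforce+
  have "z = sdiff (insert x p) (insert x q)" using disj P Q unfolding z by auto
  then have "z \<in> sspan F" using sspan_step[OF sspan_mem[OF P(2)] Q(2)] by simp
  moreover have "x ~: z" using P Q z by simp
  moreover have "card z = 4" unfolding z using card_Un_disjoint[OF fin disj] c by simp
  moreover have "z ~= sdiff h k" if hk: "h \<in> avoid x F" "k \<in> avoid x F" for h k
  proof
   assume zz: "z = sdiff h k"
   have hF: "h \<in> F" "k \<in> F" using hk by (simp_all add: avoid_def)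
   have fh: "finite h" using tr[OF hF(1)] card.infinite by fastforce
   have ne: "h ~= k" using zz \<open>card z = 4\<close> by auto
   have "a = b" if ab: "a \<in> h Int k" "b \<in> h Int k" for a b
    using forest_inter[OF fo hF ne, of a b] ab by simp
   then have i1: "card (h Int k) <= 1" using card_le_Suc0_iff_eq[of "h Int k"] fh by simp
   have "a = b" if ab: "a \<in> h - k" "b \<in> h - k" for a b
   proof -
    have "a \<in> z" "b \<in> z" using ab unfolding zz by simp_all
    then have U: "a \<in> \<Union>(link x F)" "b \<in> \<Union>(link x F)" using z pq by blast+
    have "(a, b) \<in> con (avoid x F)" using con_edge[OF hk(1)] ab by simp
    moreover have "a \<in> E" using U(1) L(1) by blast
    ultimately show ?thesis using transversalD(3)[OF R, of a a b] U by simp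
   qed
   then have "card (h - k) <= 1" using card_le_Suc0_iff_eq[of "h - k"] fh by simp
   then show False using card_Int_Diff[OF fh, of k] i1 tr[OF hF(1)] by simp
  qed
  ultimately show "z \<in> fours (del x F)" unfolding D by blast
 qed
qed

lemma joins_pair: "p ~= q ==> joins {p, q} = {p Un q}"
 by (auto simp: joins_def)

lemma joins_single: "joins {p} = {}"
 by (auto simp: joins_def)

text \<open>Given three disjoint pairs p, q, r, the pair p is the intersection of p Un q and p Un r.
  Conversely, two joins that meet in two points share exactly one pair. With two pairs only there is
  a single join, and the pairing is lost.\<close>

lemma joins_many:
 assumes disj: "!!p q. p \<in> L ==> q \<in> L ==> p ~= q ==> p Int q = {}"
  and two: "!!p. p \<in> L ==> card p = 2" and L: "card L >= 3"
 shows "L = {A Int B |A B. A \<in> joins L & B \<in> joins L & card (A Int B) = 2}"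
  and "A0 \<in> joins L ==> \<exists>B\<in>joins L. B ~= A0"
proof -
 have finL: "finite L" using L card.infinite by fastforce
 have other: "\<exists>r\<in>L. r ~= p & r ~= q" for p q
 proof (rule ccontr)
  assume "\<not> ?thesis"
  then have "L <= {p, q}" by blast
  then have "card L <= card {p, q}" by (rule card_mono[rotated]) simp
  then show False using L by (simp add: card_insert_if split: if_splits)
 qed
 have ne: "p ~= {}" if "p \<in> L" for p using two[OF that] by auto
 have int: "(p Un q) Int (p Un r) = p" if "p \<in> L" "q \<in> L" "r \<in> L" "q ~= p" "r ~= p" "q ~= r" for p q r
  using disj[of q r] disj[of p r] disj[of p q] that by blast
 show "L = {A Int B |A B. A \<in> joins L & B \<in> joins L & card (A Int B) = 2}"
 proof (intro equalityI subsetI)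
  fix p assume p: "p \<in> L"
  obtain q where q: "q \<in> L" "q ~= p" using other[of p p] by blast
  obtain r where r: "r \<in> L" "r ~= p" "r ~= q" using other[of p q] by blast
  have i: "(p Un q) Int (p Un r) = p" using int[OF p q(1) r(1) q(2) r(2)] r(3) by simp
  have "p Un q \<in> joins L" "p Un r \<in> joins L" unfolding joins_def using p q r by blast+
  moreover have "card ((p Un q) Int (p Un r)) = 2" unfolding i by (rule two[OF p])
  ultimately show "p \<in> {A Int B |A B. A \<in> joins L & B \<in> joins L & card (A Int B) = 2}"
   using i[symmetric] by blast
 next
  fix s assume "s \<in> {A Int B |A B. A \<in> joins L & B \<in> joins L & card (A Int B) = 2}"
  then obtain A B where AB: "A \<in> joins L" "B \<in> joins L" "card (A Int B) = 2" "s = A Int B" by blast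
  obtain p q where A: "A = p Un q" "p \<in> L" "q \<in> L" "p ~= q" using AB(1) unfolding joins_def by blast
  obtain p' q' where B: "B = p' Un q'" "p' \<in> L" "q' \<in> L" "p' ~= q'" using AB(2) unfolding joins_def by blast
  have fin: "finite p" "finite q" using two[OF A(2)] two[OF A(3)] card.infinite by fastforce+
  have cA: "card A = 4" unfolding A(1) using card_Un_disjoint[OF fin disj[OF A(2-4)]] two A by simp
  have neAB: "A ~= B" using AB(3) cA by auto
  have neI: "A Int B ~= {}" using AB(3) by auto
  have "p = p' | p = q' | q = p' | q = q'"
  proof (rule ccontr)
   assume "\<not> ?thesis"
   then have n: "p ~= p'" "p ~= q'" "q ~= p'" "q ~= q'" by simp_all
   have "p Int p' = {}" "p Int q' = {}" "q Int p' = {}" "q Int q' = {}"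
    by (rule disj[OF A(2) B(2) n(1)], rule disj[OF A(2) B(3) n(2)],
      rule disj[OF A(3) B(2) n(3)], rule disj[OF A(3) B(3) n(4)])
   then show False using neI unfolding A(1) B(1) by blast
  qed
  then show "s \<in> L"
  proof (elim disjE)
   assume e: "p = p'"
   then have "q ~= q'" using neAB A(1) B(1) by blast
   then have "A Int B = p" using int[of p q q'] A B unfolding A(1) B(1) e by simp
   then show ?thesis using AB(4) A(2) by simp
  next
   assume e: "p = q'"
   then have "q ~= p'" using neAB A(1) B(1) by blast
   then have "A Int B = p" using int[of p q p'] A B unfolding A(1) B(1) e by (simp add: Un_commute)
   then show ?thesis using AB(4) A(2) by simp
  next
   assume e: "q = p'"
   then have "p ~= q'" using neAB A(1) B(1) by blast
   then have "A Int B = q" using int[of q p q'] A B unfolding A(1) B(1) e by (simp add: Un_commute)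
   then show ?thesis using AB(4) A(3) by simp
  next
   assume e: "q = q'"
   then have "p ~= p'" using neAB A(1) B(1) by blast
   then have "A Int B = q" using int[of q p p'] A B unfolding A(1) B(1) e by (simp add: Un_commute)
   then show ?thesis using AB(4) A(3) by simp
  qed
 qed
 show "\<exists>B\<in>joins L. B ~= A0" if A0: "A0 \<in> joins L"
 proof -
  obtain p q where A: "A0 = p Un q" "p \<in> L" "q \<in> L" "p ~= q" using A0 unfolding joins_def by blast
  obtain r where r: "r \<in> L" "r ~= p" "r ~= q" using other[of p q] by blast
  have m1: "p Un r \<in> joins L" unfolding joins_def using A(2) r by blast
  have m2: "p Un r ~= A0"
  proof
   assume "p Un r = A0"
   then have "r <= p Un q" unfolding A(1) by blast
   moreover have "r Int p = {}" "r Int q = {}" using disj[OF r(1) A(2) r(2)] disj[OF r(1) A(3) r(3)] by simp_all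
   ultimately have "r = {}" by blast
   then show False using ne[OF r(1)] by simp
  qed
  show ?thesis by (rule bexI[of "%B. B ~= A0", OF m2 m1])
 qed
qed

lemma exists_roots:
 assumes fin: "finite E" shows "\<exists>\<rho>. roots E F \<rho>"
proof -
 let ?s = "%C. SOME a. a \<in> E & component F a = C"
 have s: "?s C \<in> E & component F (?s C) = C" if "C \<in> comps E F" for C
 proof -
  have "\<exists>a. a \<in> E & component F a = C" using that by (auto simp: comps_def)
  then show ?thesis by (rule someI_ex)
 qed
 have "roots E F (?s ` comps E F)"
 proof (rule rootsI[OF _ _ fin])
  show "?s ` comps E F <= E" using s by blast
  show "card (?s ` comps E F) <= card (comps E F)" by (rule card_image_le) (use fin in \<open>simp add: comps_def\<close>)
  show "\<exists>r\<in>?s ` comps E F. (a, r) \<in> con F" if "a \<in> E" for a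
  proof -
   have m: "component F a \<in> comps E F" using that by (simp add: comps_def)
   have "component F a = component F (?s (component F a))" using s[OF m] by (elim conjE) (erule sym)
   then have "(a, ?s (component F a)) \<in> con F" by (rule iffD1[OF comp_eq_iff])
   then show ?thesis using m by blast
  qed
 qed
 then show ?thesis by blast
qed

section \<open>Counting deleted spaces by the degree of the deleted vertex\<close>

context
 fixes E :: "'a set" and x :: 'a
 assumes fin: "finite E" and x: "x ~: E" and ne: "E ~= {}"
begin

abbreviation hts :: "'a set set set" where
 "hts \<equiv> {F. hypertree (insert x E) F}"

abbreviation hts_deg :: "nat => 'a set set set" where
 "hts_deg d \<equiv> {F. hypertree (insert x E) F & card (link x F) = d}"

abbreviation hts_high :: "'a set set set" where
 "hts_high \<equiv> {F. hypertree (insert x E) F & card (link x F) >= 3}"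

lemma finite_hts: "finite hts"
 by (rule finite_subset[of _ "Pow (Pow (insert x E))"])
  (use fin in \<open>auto simp: hypertree_def forest_def triples_def\<close>)

lemma hts_split: "hts = hts_deg 1 Un hts_deg 2 Un hts_high"
proof -
 have "card (link x F) = 1 | card (link x F) = 2 | card (link x F) >= 3" if "hypertree (insert x E) F" for F
 proof -
  have "card (link x F) ~= 0" using link_props(4,5)[OF that x] ne by simp
  then show ?thesis by linarith
 qed
 then show ?thesis by blast
qed

text \<open>The only edge at x cannot occur in a vector avoiding x, so the deleted space retains the
  forest but not the two roots.\<close>

lemma deg1:
 assumes F: "F \<in> hts_deg 1"
 shows "(avoid x F, \<Union>(link x F)) \<in> rooted E 2" "F = insert (insert x (\<Union>(link x F))) (avoid x F)"
  "del x F = sspan (avoid x F)" "fours (del x F) = {}"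
proof -
 have H: "hypertree (insert x E) F" and c: "card (link x F) = 1" using F by auto
 show "(avoid x F, \<Union>(link x F)) \<in> rooted E 2" using link_props(3)[OF H x] c by simp
 obtain p where p: "link x F = {p}" using c by (auto simp: card_1_singleton_iff)
 then show F_eq: "F = insert (insert x (\<Union>(link x F))) (avoid x F)" using avoid_link[of F x] by simp
 show "fours (del x F) = {}" using fours_del[OF H x] joins_single by (simp add: p)
 have G: "z \<in> sspan (avoid x F) ==> x ~: z" for z
  using sspan_sub[of z "avoid x F" "- {x}"] by (auto simp: avoid_def)
 have "sspan F = sspan (avoid x F) Un (%z. sdiff z (insert x (\<Union>(link x F)))) ` sspan (avoid x F)"
  by (subst F_eq) (rule sspan_insert)
 then show "del x F = sspan (avoid x F)" using G by (auto simp: del_def)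
qed

text \<open>The two edges at x occur together or not at all and contribute the union of their pairs:
  the set of four roots is retained, its splitting into pairs is not.\<close>

lemma deg2:
 assumes F: "F \<in> hts_deg 2"
 shows "(avoid x F, \<Union>(link x F)) \<in> rooted E 4"
  "del x F = sspan (avoid x F) Un (%z. sdiff z (\<Union>(link x F))) ` sspan (avoid x F)"
  "fours (del x F) = {\<Union>(link x F)}"
  "p \<in> link x F ==> p <= \<Union>(link x F) & card p = 2 &
   F = insert (insert x (\<Union>(link x F) - p)) (insert (insert x p) (avoid x F))"
proof -
 have H: "hypertree (insert x E) F" and c: "card (link x F) = 2" using F by auto
 show "(avoid x F, \<Union>(link x F)) \<in> rooted E 4" using link_props(3)[OF H x] c by simp
 obtain a b where ab: "link x F = {a, b}" "a ~= b" using c by (auto simp: card_2_iff)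
 have disj: "a Int b = {}" using link_props(2)[OF H x, of a b] ab by simp
 have xab: "x ~: a" "x ~: b" using linkD[of a x F] linkD[of b x F] ab by simp_all
 have F_eq: "F = insert (insert x b) (insert (insert x a) (avoid x F))"
  using avoid_link[of F x] unfolding ab by auto
 show "fours (del x F) = {\<Union>(link x F)}" using fours_del[OF H x] joins_pair[OF ab(2)] by (simp add: ab)
 show "p <= \<Union>(link x F) & card p = 2 &
   F = insert (insert x (\<Union>(link x F) - p)) (insert (insert x p) (avoid x F))" if p: "p \<in> link x F"
 proof -
  have "p = a | p = b" using p ab by simp
  then have "insert x (\<Union>(link x F) - p) = (if p = a then insert x b else insert x a)"
   using disj ab by auto
  then have "F = insert (insert x (\<Union>(link x F) - p)) (insert (insert x p) (avoid x F))"
   using F_eq \<open>p = a | p = b\<close> insert_commute by metis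
  moreover have "card p = 2" using link_props(1)[OF H x p] by simp
  ultimately show ?thesis using p by blast
 qed
 have G: "z \<in> sspan (avoid x F) ==> x ~: z" for z
  using sspan_sub[of z "avoid x F" "- {x}"] by (auto simp: avoid_def)
 let ?S = "sspan (avoid x F)"
 have S: "sspan F = ?S Un (%z. sdiff z (insert x a)) ` ?S Un (%z. sdiff z (insert x b)) ` (?S Un (%z. sdiff z (insert x a)) ` ?S)"
  by (subst F_eq) (simp only: sspan_insert)
 have ab2: "sdiff (sdiff z (insert x a)) (insert x b) = sdiff z (a Un b)" for z
  using disj xab by auto
 show "del x F = ?S Un (%z. sdiff z (\<Union>(link x F))) ` ?S"
 proof (intro equalityI subsetI)
  fix z assume z: "z \<in> del x F"
  then have xz: "x ~: z" by (simp add: del_def)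
  have "z \<in> sspan F" using z by (simp add: del_def)
  then consider "z \<in> ?S" | y where "y \<in> ?S" "z = sdiff y (insert x a)" | y where "y \<in> ?S" "z = sdiff y (insert x b)"
   | y where "y \<in> ?S" "z = sdiff (sdiff y (insert x a)) (insert x b)" unfolding S by blast
  then show "z \<in> ?S Un (%z. sdiff z (\<Union>(link x F))) ` ?S"
  proof cases
   case (4 y)
   then have "z = sdiff y (\<Union>(link x F))" using ab2[of y] ab(1) by simp
   then show ?thesis using 4(1) by blast
  qed (use xz G in auto)
 next
  fix z assume "z \<in> ?S Un (%z. sdiff z (\<Union>(link x F))) ` ?S"
  then consider "z \<in> ?S" | y where "y \<in> ?S" "z = sdiff y (\<Union>(link x F))" by blast
  then show "z \<in> del x F"
  proof cases
   case 1
   then show ?thesis using G[OF 1] unfolding del_def S by simp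
  next
   case (2 y)
   then have z: "z = sdiff (sdiff y (insert x a)) (insert x b)" using ab2[of y] ab(1) by simp
   have "z \<in> sspan F" unfolding S z using 2(1) by blast
   moreover have "x ~: z" using G[OF 2(1)] unfolding z by simp
   ultimately show ?thesis by (simp add: del_def)
  qed
 qed
qed

text \<open>From degree three on, the link pairs are intersections of members of
  \<open>fours\<close>, so nothing is lost.\<close>

lemma deg3:
 assumes F: "F \<in> hts_high"
 shows "F = avoid x F Un insert x ` {A Int B |A B. A \<in> fours (del x F) & B \<in> fours (del x F) & card (A Int B) = 2}"
  "!!A. fours (del x F) ~= {A}" "fours (del x F) ~= {}"
proof -
 have H: "hypertree (insert x E) F" and c: "card (link x F) >= 3" using F by auto
 note L = link_props[OF H x]
 have J: "fours (del x F) = joins (link x F)" by (rule fours_del[OF H x])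
 have many: "link x F = {A Int B |A B. A \<in> joins (link x F) & B \<in> joins (link x F) & card (A Int B) = 2}"
  by (rule joins_many(1)[OF L(2) _ c]) (use L(1) in simp_all)
 show "F = avoid x F Un insert x ` {A Int B |A B. A \<in> fours (del x F) & B \<in> fours (del x F) & card (A Int B) = 2}"
  unfolding J many[symmetric] by (rule avoid_link)
 have nj: "joins (link x F) ~= {}"
 proof
  assume "joins (link x F) = {}"
  then have "link x F = {}" using many by blast
  then show False using c by simp
 qed
 then show "fours (del x F) ~= {}" by (simp add: J)
 show "fours (del x F) ~= {A}" for A
 proof
  assume "fours (del x F) = {A}"
  then have A: "joins (link x F) = {A}" using J by simp
  have "\<exists>B\<in>joins (link x F). B ~= A"
   by (rule joins_many(2)[OF L(2) _ c]) (use L(1) A in simp_all)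
  then show False unfolding A by simp
 qed
qed

end

context
 fixes E :: "'a set" and x :: 'a
 assumes fin: "finite E" and x: "x ~: E" and ne: "E ~= {}"
begin

lemma card_hts_deg1: "card (hts_deg E x 1) = card (rooted E 2)"
proof (rule bij_betw_same_card[OF bij_betw_byWitness])
 let ?f = "%F. (avoid x F, \<Union>(link x F))" and ?g = "%(G, \<rho>). insert (insert x \<rho>) G"
 have fwd: "?g (?f F) = F & ?f F \<in> rooted E 2" if "F \<in> hts_deg E x 1" for F
  using deg1(1,2)[OF fin x ne that] by simp
 have bwd: "?f (?g y) = y & ?g y \<in> hts_deg E x 1" if y: "y \<in> rooted E 2" for y
 proof -
  obtain G \<rho> where yy: "y = (G, \<rho>)" by (cases y)
  note R = rooted_2_hypertree[OF y[unfolded yy] x]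
  show ?thesis using R by (simp add: yy)
 qed
 show "\<forall>F\<in>hts_deg E x 1. ?g (?f F) = F" by (intro ballI conjunct1[OF fwd])
 show "\<forall>y\<in>rooted E 2. ?f (?g y) = y" by (intro ballI conjunct1[OF bwd])
 show "?f ` hts_deg E x 1 <= rooted E 2" by (intro image_subsetI conjunct2[OF fwd])
 show "?g ` rooted E 2 <= hts_deg E x 1" by (intro image_subsetI conjunct2[OF bwd])
qed

text \<open>Double counting with one link pair marked: two choices for each hypertree, against the
  six two-element subsets of four roots.\<close>

lemma card_hts_deg2: "card (hts_deg E x 2) = 3 * card (rooted E 4)"
proof -
 let ?P = "%y. {p. p <= snd y & card p = 2}"
 let ?X = "SIGMA F:hts_deg E x 2. link x F" and ?Y = "SIGMA y:rooted E 4. ?P y"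
 let ?f = "%(F, p). ((avoid x F, \<Union>(link x F)), p)"
 let ?g = "%((G, \<rho>), p). (insert (insert x (\<rho> - p)) (insert (insert x p) G), p)"
 have fwd: "?g (?f (F, p)) = (F, p) & ?f (F, p) \<in> ?Y" if "(F, p) \<in> ?X" for F p
 proof -
  have F: "F \<in> hts_deg E x 2" and p: "p \<in> link x F" using that by auto
  show ?thesis using deg2(1)[OF fin x ne F] deg2(4)[OF fin x ne F p] by simp
 qed
 have bwd: "?f (?g ((G, \<rho>), p)) = ((G, \<rho>), p) & ?g ((G, \<rho>), p) \<in> ?X" if "((G, \<rho>), p) \<in> ?Y" for G \<rho> p
 proof -
  have y: "(G, \<rho>) \<in> rooted E 4" and p: "p <= \<rho>" "card p = 2" using that by auto
  note R = rooted_4_hypertree[OF y x p]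
  have c4: "card \<rho> = 4" using y by (simp add: rooted_iff)
  have "\<rho> - p ~= p"
  proof
   assume "\<rho> - p = p"
   then have "\<rho> = p" using p(1) by blast
   then show False using c4 p(2) by simp
  qed
  then have "card (link x (insert (insert x (\<rho> - p)) (insert (insert x p) G))) = 2" unfolding R(3) by simp
  moreover have "\<Union>{\<rho> - p, p} = \<rho>" using p(1) by blast
  ultimately show ?thesis using R by simp
 qed
 have fwd': "?g (?f a) = a & ?f a \<in> ?Y" if a: "a \<in> ?X" for a
 proof -
  obtain F p where aa: "a = (F, p)" by (cases a)
  show ?thesis unfolding aa by (rule fwd[OF a[unfolded aa]])
 qed
 have bwd': "?f (?g a) = a & ?g a \<in> ?X" if a: "a \<in> ?Y" for a
 proof -
  obtain G \<rho> p where aa: "a = ((G, \<rho>), p)" by (metis surj_pair)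
  show ?thesis unfolding aa by (rule bwd[OF a[unfolded aa]])
 qed
 have "bij_betw ?f ?X ?Y"
 proof (rule bij_betw_byWitness[where f' = ?g])
  show "\<forall>a\<in>?X. ?g (?f a) = a" by (intro ballI conjunct1[OF fwd'])
  show "\<forall>a\<in>?Y. ?f (?g a) = a" by (intro ballI conjunct1[OF bwd'])
  show "?f ` ?X <= ?Y" by (intro image_subsetI conjunct2[OF fwd'])
  show "?g ` ?Y <= ?X" by (intro image_subsetI conjunct2[OF bwd'])
 qed
 then have eq: "card ?X = card ?Y" by (rule bij_betw_same_card)
 have "finite (hts_deg E x 2)" by (rule finite_subset[OF _ finite_hts[OF fin x ne]]) blast
 then have "card ?X = (\<Sum>F\<in>hts_deg E x 2. card (link x F))"
 proof (rule card_SigmaI, intro ballI)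
  fix F assume "F \<in> hts_deg E x 2"
  then show "finite (link x F)" using link_props(4)[of x E F] x by simp
 qed
 also have "\<dots> = (\<Sum>F\<in>hts_deg E x 2. 2)" by (rule sum.cong) simp_all
 finally have X: "card ?X = 2 * card (hts_deg E x 2)" by simp
 have P: "finite (?P y) & card (?P y) = 6" if "y \<in> rooted E 4" for y
 proof -
  have c: "card (snd y) = 4" using that by (auto simp: rooted_def)
  then have f: "finite (snd y)" using card.infinite by fastforce
  have "card (?P y) = 4 choose 2" using n_subsets[OF f, of 2] c by simp
  moreover have "(4 choose 2 :: nat) = 6" by (simp add: choose_two)
  moreover have "finite (?P y)" by (rule finite_subset[of _ "Pow (snd y)"]) (use f in auto)
  ultimately show ?thesis by simp
 qed
 have "card ?Y = (\<Sum>y\<in>rooted E 4. card (?P y))"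
  by (rule card_SigmaI[OF finite_rooted[OF fin]]) (use P in blast)
 also have "\<dots> = (\<Sum>y\<in>rooted E 4. 6)" by (rule sum.cong) (use P in simp_all)
 finally show ?thesis using X eq by simp
qed

text \<open>The space is spanned by the remaining forest, which is recovered from it by
  \<open>threes\<close>. Every forest with two components occurs, since it has some root
  set.\<close>

lemma card_del_deg1: "card (del x ` hts_deg E x 1) = card (two_forests E)"
proof -
 have "del x ` hts_deg E x 1 = sspan ` two_forests E"
 proof (intro equalityI subsetI)
  fix W assume "W \<in> del x ` hts_deg E x 1"
  then obtain F where F: "F \<in> hts_deg E x 1" "W = del x F" by blast
  note d = deg1[OF fin x ne F(1)]
  have "avoid x F \<in> two_forests E"
   using d(1) roots_card[of E "avoid x F" "\<Union>(link x F)"] by (simp add: rooted_iff two_forests_def)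
  then show "W \<in> sspan ` two_forests E" unfolding F(2) d(3) by (rule imageI)
 next
  fix W assume "W \<in> sspan ` two_forests E"
  then obtain G where G: "forest E G" "card (comps E G) = 2" "W = sspan G" by (auto simp: two_forests_def)
  obtain \<rho> where \<rho>: "roots E G \<rho>" using exists_roots[OF fin, of G] by blast
  then have "(G, \<rho>) \<in> rooted E 2" using G(1,2) roots_card[OF \<rho>] by (simp add: rooted_iff)
  note R = rooted_2_hypertree[OF this x]
  let ?F = "insert (insert x \<rho>) G"
  have F: "?F \<in> hts_deg E x 1" using R(1,3) by simp
  have "W = del x ?F" unfolding deg1(3)[OF fin x ne F] R(2) by (rule G(3))
  then show "W \<in> del x ` hts_deg E x 1" using F by blast
 qed
 moreover have "inj_on sspan (two_forests E)"
  by (rule inj_on_inverseI[of _ threes]) (use threes_sspan in \<open>auto simp: two_forests_def\<close>)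
 ultimately show ?thesis by (simp add: card_image)
qed

lemma threes_del_hts: "hypertree (insert x E) F ==> threes (del x F) = avoid x F"
 using threes_del[of "insert x E" F x] by (simp add: hypertree_def)

text \<open>The space is determined by the forest and the set of four roots, and returns them as
  \<open>threes\<close> and the only member of \<open>fours\<close>.\<close>

lemma card_del_deg2: "card (del x ` hts_deg E x 2) = card (rooted E 4)"
proof -
 let ?D = "%(G, \<rho>). sspan G Un (%z. sdiff z \<rho>) ` sspan G"
 let ?c = "%W. (threes W, \<Union>(fours W))"
 have D: "\<exists>F\<in>hts_deg E x 2. y = (avoid x F, \<Union>(link x F))" if y: "y \<in> rooted E 4" for y
 proof -
  obtain G \<rho> where yy: "y = (G, \<rho>)" by (cases y)
  have r: "(G, \<rho>) \<in> rooted E 4" using y yy by simp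
  have c4: "card \<rho> = 4" using r by (simp add: rooted_iff)
  obtain p where p: "p <= \<rho>" "card p = 2" using obtain_subset_with_card_n[of 2 \<rho>] c4 by auto
  note R = rooted_4_hypertree[OF r x p]
  have "\<rho> - p ~= p"
  proof
   assume "\<rho> - p = p"
   then have "\<rho> = p" using p(1) by blast
   then show False using c4 p(2) by simp
  qed
  then have "card (link x (insert (insert x (\<rho> - p)) (insert (insert x p) G))) = 2" unfolding R(3) by simp
  moreover have "\<Union>{\<rho> - p, p} = \<rho>" using p(1) by blast
  ultimately show ?thesis using R by (intro bexI[of _ "insert (insert x (\<rho> - p)) (insert (insert x p) G)"]) (simp_all add: yy)
 qed
 have del: "del x F = ?D (avoid x F, \<Union>(link x F)) & ?c (del x F) = (avoid x F, \<Union>(link x F)) &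
   (avoid x F, \<Union>(link x F)) \<in> rooted E 4" if F: "F \<in> hts_deg E x 2" for F
  using deg2(1,2,3)[OF fin x ne F] threes_del_hts[of F] F by simp
 have "del x ` hts_deg E x 2 = ?D ` rooted E 4"
 proof (intro equalityI subsetI)
  fix W assume "W \<in> del x ` hts_deg E x 2"
  then obtain F where F: "F \<in> hts_deg E x 2" "W = del x F" by blast
  have "W = ?D (avoid x F, \<Union>(link x F))" using del[OF F(1)] F(2) by simp
  then show "W \<in> ?D ` rooted E 4" using del[OF F(1)] by (intro image_eqI[of _ _ "(avoid x F, \<Union>(link x F))"]) simp_all
 next
  fix W assume "W \<in> ?D ` rooted E 4"
  then obtain y where y: "y \<in> rooted E 4" "W = ?D y" by blast
  obtain F where F: "F \<in> hts_deg E x 2" "y = (avoid x F, \<Union>(link x F))" using D[OF y(1)] by blast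
  have "W = del x F" using del[OF F(1)] unfolding y(2) F(2) by simp
  then show "W \<in> del x ` hts_deg E x 2" using F(1) by simp
 qed
 moreover have "inj_on ?D (rooted E 4)"
 proof (rule inj_on_inverseI[of _ ?c])
  fix y assume "y \<in> rooted E 4"
  then obtain F where F: "F \<in> hts_deg E x 2" "y = (avoid x F, \<Union>(link x F))" using D[of y] by blast
  have Dy: "?D y = del x F" using del[OF F(1)] unfolding F(2) by simp
  have cy: "?c (del x F) = y" using del[OF F(1)] unfolding F(2) by blast
  show "?c (?D y) = y" unfolding Dy by (rule cy)
 qed
 ultimately show ?thesis by (simp add: card_image)
qed

lemma inj_del_high: "inj_on (del x) (hts_high E x)"
proof (rule inj_onI)
 fix F F' assume F: "F \<in> hts_high E x" "F' \<in> hts_high E x" and eq: "del x F = del x F'"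
 have a: "avoid x F = avoid x F'" using threes_del_hts[of F] threes_del_hts[of F'] F eq by simp
 show "F = F'"
  by (subst deg3(1)[OF fin x ne F(1)], subst deg3(1)[OF fin x ne F(2)]) (simp only: a eq)
qed

text \<open>The three degree classes give disjoint families of spaces, having no, exactly one, or
  several members in \<open>fours\<close>. With T forests of two components, R2 and R4 rooted ones
  and C hypertrees of higher degree, T + R4 + C spaces face R2 + 3 R4 + C hypertrees.\<close>

theorem card_deletions:
 "card (del x ` {F. hypertree (insert x E) F}) + card (rooted E 2) + 2 * card (rooted E 4) =
  card (two_forests E) + card {F. hypertree (insert x E) F}"
proof -
 let ?A = "hts_deg E x 1" and ?B = "hts_deg E x 2" and ?C = "hts_high E x"
 have f: "finite ?A" "finite ?B" "finite ?C"
  by (rule finite_subset[OF _ finite_hts[OF fin x ne]], blast)+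
 have "card (hts E x) = card (?A Un ?B Un ?C)" by (rule arg_cong[of _ _ card, OF hts_split[OF fin x ne]])
 also have "\<dots> = card (?A Un ?B) + card ?C" by (rule card_Un_disjoint) (use f in auto)
 also have "card (?A Un ?B) = card ?A + card ?B" by (rule card_Un_disjoint) (use f in auto)
 finally have H: "card (hts E x) = card (rooted E 2) + 3 * card (rooted E 4) + card ?C"
  using card_hts_deg1 card_hts_deg2 by simp
 have fA: "fours W = {}" if "W \<in> del x ` ?A" for W
  using that by (rule imageE) (simp only: deg1(4)[OF fin x ne])
 have fB: "\<exists>z. fours W = {z}" if W: "W \<in> del x ` ?B" for W
 proof -
  obtain F where F: "F \<in> ?B" "W = del x F" using W by (rule imageE)
  show ?thesis unfolding F(2) deg2(3)[OF fin x ne F(1)] by (rule exI) (rule refl)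
 qed
 have fC: "fours W ~= {}" "fours W ~= {z}" if W: "W \<in> del x ` ?C" for W z
 proof -
  obtain F where F: "F \<in> ?C" "W = del x F" using W by (rule imageE)
  show "fours W ~= {}" "fours W ~= {z}" unfolding F(2) using deg3(2,3)[OF fin x ne F(1)] by simp_all
 qed
 have d1: "(del x ` ?A Un del x ` ?B) Int del x ` ?C = {}"
 proof (rule equals0I)
  fix W assume "W \<in> (del x ` ?A Un del x ` ?B) Int del x ` ?C"
  then have W: "W \<in> del x ` ?A | W \<in> del x ` ?B" and WC: "W \<in> del x ` ?C" by blast+
  from W show False
  proof
   assume "W \<in> del x ` ?A"
   then show False using fA fC(1)[OF WC] by blast
  next
   assume "W \<in> del x ` ?B"
   then obtain z where "fours W = {z}" using fB by blast
   then show False using fC(2)[OF WC] by simp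
  qed
 qed
 have d2: "del x ` ?A Int del x ` ?B = {}"
 proof (rule equals0I)
  fix W assume "W \<in> del x ` ?A Int del x ` ?B"
  then have W: "W \<in> del x ` ?A" "W \<in> del x ` ?B" by blast+
  obtain z where "fours W = {z}" using fB[OF W(2)] by blast
  then show False using fA[OF W(1)] by simp
 qed
 have "del x ` hts E x = del x ` ?A Un del x ` ?B Un del x ` ?C"
  using arg_cong[of _ _ "image (del x)", OF hts_split[OF fin x ne]] unfolding image_Un .
 then have "card (del x ` hts E x) = card (del x ` ?A) + card (del x ` ?B) + card (del x ` ?C)"
  using card_Un_disjoint[OF _ _ d1] card_Un_disjoint[OF _ _ d2] f by simp
 then have "card (del x ` hts E x) = card (two_forests E) + card (rooted E 4) + card ?C"
  using card_del_deg1 card_del_deg2 card_image[OF inj_del_high] by simp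
 then show ?thesis using H by simp
qed

end

lemma card_hypertrees: "card V * card {F. hypertree V F} = card (rooted V 1)"
proof -
 have "bij_betw (%(F, v). (F, {v})) ({F. hypertree V F} \<times> V) (rooted V 1)"
  unfolding bij_betw_def
 proof
  show "inj_on (%(F, v). (F, {v})) ({F. hypertree V F} \<times> V)" by (auto simp: inj_on_def)
  show "(%(F, v). (F, {v})) ` ({F. hypertree V F} \<times> V) = rooted V 1"
  proof (intro equalityI subsetI)
   fix y assume "y \<in> (%(F, v). (F, {v})) ` ({F. hypertree V F} \<times> V)"
   then obtain F v where y: "y = (F, {v})" "hypertree V F" "v \<in> V" by auto
   have fo: "forest V F" and c: "card (comps V F) = 1" and fin: "finite V"
    using y(2) by (auto simp: hypertree_iff forest_def)
   have "roots V F {v}"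
   proof (rule rootsI[OF _ _ fin])
    show "\<exists>r\<in>{v}. (a, r) \<in> con F" if "a \<in> V" for a
     using hypertree_connected[OF y(2) that] y(3) by (auto simp: component_def)
   qed (use y(3) c in simp_all)
   then show "y \<in> rooted V 1" using fo by (simp add: y(1) rooted_iff)
  next
   fix y assume y: "y \<in> rooted V 1"
   obtain F \<rho> where yy: "y = (F, \<rho>)" by (cases y)
   have F: "forest V F" "roots V F \<rho>" "card \<rho> = 1" using y by (auto simp: yy rooted_iff)
   obtain v where v: "\<rho> = {v}" using F(3) by (auto simp: card_1_singleton_iff)
   have "hypertree V F" using F roots_card[OF F(2)] by (simp add: hypertree_iff)
   moreover have "v \<in> V" using transversalD(1)[OF F(2)] v by simp
   ultimately show "y \<in> (%(F, v). (F, {v})) ` ({F. hypertree V F} \<times> V)" by (auto simp: yy v)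
  qed
 qed
 then have "card ({F. hypertree V F} \<times> V) = card (rooted V 1)" by (rule bij_betw_same_card)
 then show ?thesis by (simp add: card_cartesian_product mult.commute)
qed

section \<open>The number of simple quasi series-parallel matroids\<close>

lemma card_simple_qsp:
 assumes m: "m > 0"
 shows "card (simple_qsp_matroids (2 * m) (m + 1)) =
  card (del 0 ` {F. hypertree (insert 0 {1..2 * m}) F})"
proof -
 have c: "card {1..2 * m} = 2 * m" and x: "0 ~: {1..2 * m}" by simp_all
 have "{{z \<in> Z. 0 ~: z} |Z. tri_space (insert 0 {1..2 * m}) Z} = del 0 ` {F. hypertree (insert 0 {1..2 * m}) F}"
  unfolding tri_space_iff del_def by blast
 then show ?thesis
  unfolding simple_qsp_matroids_def simple_qsp_eq_deletions(1)[OF c m x]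
  using card_image[OF simple_qsp_eq_deletions(2)[OF c m x]] by simp
qed

lemma rooted_too_many:
 assumes "finite E" "card E < k" shows "rooted E k = {}"
proof -
 have "card \<rho> <= card E" if "(F, \<rho>) \<in> rooted E k" for F \<rho>
  using that assms(1) transversalD(1)[of E "%a r. (a, r) \<in> con F" \<rho>] by (intro card_mono) (simp_all add: rooted_iff)
 then show ?thesis using assms(2) by (fastforce simp: rooted_iff)
qed

lemma card_rooted_even:
 assumes fin: "finite E" and E: "card E = 2 * m" and i: "0 < i" "i <= m"
 shows "card (rooted E (2 * i)) * (fact (2 * i - 1) * fact (m - i)) = m ^ (m - i) * fact (2 * m - 1)"
proof -
 have "card E = 2 * i + 2 * (m - i)" using E i by simp
 then have "card (rooted E (2 * i)) * (2 ^ (m - i) * fact (m - i) * fact (2 * i - 1)) = (2 * m) ^ (m - i) * fact (2 * m - 1)"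
  using card_rooted[OF fin, of "2 * i" "m - i"] i E by simp
 then have "2 ^ (m - i) * (card (rooted E (2 * i)) * (fact (2 * i - 1) * fact (m - i))) = 2 ^ (m - i) * (m ^ (m - i) * fact (2 * m - 1))"
  by (simp add: power_mult_distrib algebra_simps)
 then show ?thesis by (subst (asm) mult_cancel1) simp
qed

lemma double_fact_odd: "fact (2 * Suc k) = double_fact (Suc (2 * k)) * (2 ^ Suc k * fact (Suc k))"
proof (induction k)
 case (Suc k)
 have "(fact (2 * Suc (Suc k)) :: nat) = (2 * Suc (Suc k)) * ((2 * Suc k + 1) * fact (2 * Suc k))"
  by (simp add: algebra_simps)
 also have "\<dots> = double_fact (Suc (2 * Suc k)) * (2 ^ Suc (Suc k) * fact (Suc (Suc k)))"
  unfolding Suc by (simp add: algebra_simps)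
 finally show ?case .
qed simp

lemma card_hypertrees_odd:
 assumes V: "card V = 2 * m + 1" and m: "m > 0"
 shows "card {F. hypertree V F} * (2 ^ m * fact m) = (2 * m + 1) ^ (m - 1) * fact (2 * m)"
  and "card {F. hypertree V F} = (2 * m + 1) ^ (m - 1) * double_fact (2 * m - 1)"
proof -
 let ?H = "card {F. hypertree V F}"
 have fin: "finite V" using V card.infinite by fastforce
 have "(2 * m + 1) * ?H * (2 ^ m * fact m) = (2 * m + 1) ^ m * fact (2 * m)"
  using card_rooted[OF fin, of 1 m] card_hypertrees[of V] V by simp
 also have "\<dots> = (2 * m + 1) * ((2 * m + 1) ^ (m - 1) * fact (2 * m))"
  using power_eq_if[of "2 * m + 1" m] m by (simp add: algebra_simps)
 finally have "(2 * m + 1) * (?H * (2 ^ m * fact m)) = (2 * m + 1) * ((2 * m + 1) ^ (m - 1) * fact (2 * m))"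
  by (simp only: mult.assoc)
 then show *: "?H * (2 ^ m * fact m) = (2 * m + 1) ^ (m - 1) * fact (2 * m)"
  by (subst (asm) mult_cancel1) simp
 obtain k where k: "m = Suc k" using m by (cases m) auto
 have "fact (2 * m) = double_fact (2 * m - 1) * (2 ^ m * fact m)" using double_fact_odd[of k] unfolding k by simp
 then have "?H * (2 ^ m * fact m) = ((2 * m + 1) ^ (m - 1) * double_fact (2 * m - 1)) * (2 ^ m * fact m)"
  using * by (simp only: mult.assoc)
 then show "?H = (2 * m + 1) ^ (m - 1) * double_fact (2 * m - 1)" by (subst (asm) mult_cancel2) simp
qed

text \<open>The deleted point is 0. Here r and s count rooted hyperforests on 2 m vertices with two
  and four components, w unrooted ones with two components, and h hypertrees on 2 m + 1 vertices.
  For m = 1 there are not enough vertices for four components.\<close>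

lemma simple_qsp_counts:
 fixes m :: nat
 assumes m: "m > 0"
 obtains w r s h where "card (simple_qsp_matroids (2 * m) (m + 1)) + r + 2 * s = w + h"
  "m * w + 4 * s = r" "r * fact (m - 1) = m ^ (m - 1) * fact (2 * m - 1)" "m = 1 ==> s = 0"
  "m >= 2 ==> s * (6 * fact (m - 2)) = m ^ (m - 2) * fact (2 * m - 1)"
  "h * (2 ^ m * fact m) = (2 * m + 1) ^ (m - 1) * fact (2 * m)"
  "h = (2 * m + 1) ^ (m - 1) * double_fact (2 * m - 1)"
proof -
 let ?E = "{1..2 * m}"
 have fin: "finite ?E" and c: "card ?E = 2 * m" and x: "0 ~: ?E" and ne: "?E ~= {}" using m by simp_all
 have V: "card (insert 0 ?E) = 2 * m + 1" using fin c x by simp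
 show thesis
 proof (rule that)
  show "card (simple_qsp_matroids (2 * m) (m + 1)) + card (rooted ?E 2) + 2 * card (rooted ?E 4) =
    card (two_forests ?E) + card {F. hypertree (insert 0 ?E) F}"
   unfolding card_simple_qsp[OF m] by (rule card_deletions[OF fin x ne])
  show "m * card (two_forests ?E) + 4 * card (rooted ?E 4) = card (rooted ?E 2)"
   by (rule card_two_forests[OF fin c])
  show "card (rooted ?E 2) * fact (m - 1) = m ^ (m - 1) * fact (2 * m - 1)"
   using card_rooted_even[OF fin c, of 1] m by simp
  show "card (rooted ?E 4) = 0" if "m = 1" using rooted_too_many[OF fin, of 4] c that by simp
  show "card (rooted ?E 4) * (6 * fact (m - 2)) = m ^ (m - 2) * fact (2 * m - 1)" if "m >= 2"
   using card_rooted_even[OF fin c, of 2] that by (simp add: fact_numeral)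
 qed (use card_hypertrees_odd[OF V m] in simp_all)
qed

section \<open>Flats of braid matroids\<close>

text \<open>All elements of z other than e reduce modulo Z to subsets of a basis B of F. So z itself
  reduces to a vector through e inside \<open>insert e B\<close>, and that set is dependent.\<close>

lemma rank_insert_closure:
 assumes E: "finite E" and Z: "set_space Z" and z: "z \<in> Z" "e \<in> z" "z <= insert e F" and FE: "insert e F <= E"
 shows "rank_of (bm E Z) (insert e F) = rank_of (bm E Z) F"
proof (cases "e \<in> F")
 case False
 note M = matroid_bm[OF E Z]
 obtain B where B: "B \<in> indep (bm E Z)" "B <= F" "card B = rank_of (bm E Z) F" by (rule rank_basis[OF M])
 have finB: "finite B" using finite_indep[OF M B(1)] .
 have dep: "insert x B ~: indep (bm E Z)" if x: "x \<in> F - B" for x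
 proof
  assume "insert x B \<in> indep (bm E Z)"
  then have "card (insert x B) <= rank_of (bm E Z) F" using x B by (intro rank_ge[OF M]) auto
  then show False using x B finB by simp
 qed
 have cl: "\<exists>w\<in>Z. x \<in> w & w <= insert x B" if x: "x \<in> F - B" for x
 proof -
  obtain w where w: "w \<in> Z" "w <= insert x B" "w ~= {}"
   using dep[OF x] x B FE by (auto simp: indep_bm)
  then have "\<not> w <= B" using B by (auto simp: indep_bm)
  then show ?thesis using w by auto
 qed
 have "finite (z - {e})" using z FE E by (meson finite_Diff finite_subset)
 moreover have "\<exists>w\<in>Z. x \<in> w & w <= insert x B" if "x \<in> z - {e} - B" for x
  using that z cl by blast
 ultimately obtain B' where B': "B' <= B" "sdiff (z - {e}) B' \<in> Z"
  using reduce_mod_space[OF Z, of "z - {e}" B] by blast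
 have "e ~: B'" using B' B False by auto
 then have "sdiff z (sdiff (z - {e}) B') = insert e B'" using z by (auto simp: set_eq_iff)
 then have "insert e B' \<in> Z" using set_space_sdiff[OF Z z(1) B'(2)] by simp
 moreover have "insert e B' <= insert e B" "insert e B' ~= {}" using B' by auto
 ultimately have "insert e B ~: indep (bm E Z)" unfolding indep_bm by blast
 then have "rank_of (bm E Z) (insert e F) = card B"
  using B dep by (intro rank_eq_card[OF M]) auto
 then show ?thesis using B by simp
qed (simp add: insert_absorb)

section \<open>Cycles and cuts in complete graphs, and flats as sets of monochromatic edges\<close>

abbreviation complete_edges :: "nat => nat set set" where
 "complete_edges k \<equiv> edges (complete_graph k)"

lemma complete_edges: "complete_edges k = {e. e <= {1..k} & card e = 2}"
 by (simp add: complete_graph_def)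

lemma loopless_complete_graph: "loopless_graph (complete_graph k)"
proof -
 have "finite {e. e <= {1..k} & card e = 2}" by (rule finite_subset[of _ "Pow {1..k}"]) auto
 then show ?thesis by (simp add: loopless_graph_def complete_graph_def)
qed

lemma finite_complete_edges: "finite (complete_edges k)"
 using loopless_complete_graph by (simp add: loopless_graph_def)

abbreviation complete_cycles :: "nat => nat set set set" where
 "complete_cycles k \<equiv> cycle_space (complete_graph k)"

lemma complete_cycles:
 "z \<in> complete_cycles k \<longleftrightarrow> z <= complete_edges k & (\<forall>v. even (card {e \<in> z. v \<in> e}))"
 by (simp add: cycle_space_def complete_graph_def)

lemmas space_complete = set_space_cycle_space[OF finite_complete_edges]

lemma braid_eq_bm: "braid_matroid k = bm (complete_edges k) (complete_cycles k)"
 unfolding braid_matroid_def by (rule graphic_matroid_eq_bm[OF loopless_complete_graph])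

lemma matroid_braid: "matroid (braid_matroid k)"
 unfolding braid_eq_bm by (rule matroid_bm[OF finite_complete_edges space_complete])

lemma edge_cases:
 assumes "e \<in> complete_edges k"
 obtains u v where "e = {u, v}" "u ~= v" "u \<in> {1..k}" "v \<in> {1..k}"
 using assms unfolding complete_edges by (auto simp: card_2_iff)

lemma edge_iff: "{u, v} \<in> complete_edges k \<longleftrightarrow> u ~= v & u \<in> {1..k} & v \<in> {1..k}"
 by (auto simp: complete_edges card_insert_if)

lemma loopless_braid: "loopless (braid_matroid k)"
 unfolding loopless_def braid_eq_bm ground_bm
proof
 fix e assume e: "e \<in> complete_edges k"
 then obtain u v where uv: "e = {u, v}" by (rule edge_cases)
 have "z = {}" if z: "z \<in> complete_cycles k" "z <= {e}" for z
 proof (rule ccontr)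
  assume "z ~= {}"
  then have "z = {e}" using z by auto
  then have "{e' \<in> z. u \<in> e'} = {e}" using uv by auto
  then have "card {e' \<in> z. u \<in> e'} = 1" by simp
  moreover have "even (card {e' \<in> z. u \<in> e'})" using z by (simp add: complete_cycles)
  ultimately show False by simp
 qed
 then show "{e} \<in> indep (bm (complete_edges k) (complete_cycles k))" using e by (auto simp: indep_bm)
qed

lemma triangle_in_cycles:
 assumes "u ~= v" "v ~= w" "u ~= w" "{u, v, w} <= {1..k}"
 shows "{{u, v}, {v, w}, {u, w}} \<in> complete_cycles k"
 unfolding complete_cycles
proof (intro conjI allI)
 show "{{u, v}, {v, w}, {u, w}} <= complete_edges k" using assms by (auto simp: edge_iff)
 fix x
 have "{e \<in> {{u, v}, {v, w}, {u, w}}. x \<in> e} =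
  (if x = u then {{u, v}, {u, w}} else if x = v then {{u, v}, {v, w}} else if x = w then {{v, w}, {u, w}} else {})"
  using assms by auto
 moreover have "{u, v} ~= {u, w}" "{u, v} ~= {v, w}" "{v, w} ~= {u, w}"
  using assms by (auto simp: doubleton_eq_iff)
 ultimately show "even (card {e \<in> {{u, v}, {v, w}, {u, w}}. x \<in> e})" by simp
qed

text \<open>A cycle crosses every cut an even number of times.\<close>

lemma even_cut:
 assumes z: "z \<in> complete_cycles k" and W: "finite W"
 shows "even (card {e \<in> z. odd (card (e Int W))})"
proof -
 have fin: "finite z" using z finite_complete_edges finite_subset by (auto simp: complete_cycles)
 have "(\<Sum>e\<in>z. card (e Int W)) = (\<Sum>e\<in>z. \<Sum>w\<in>W. if w \<in> e then 1 else 0)"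
  using W by (intro sum.cong refl) (simp add: sum.If_cases Int_commute)
 also have "\<dots> = (\<Sum>w\<in>W. \<Sum>e\<in>z. if w \<in> e then 1 else 0)" by (rule sum.swap)
 also have "\<dots> = (\<Sum>w\<in>W. card {e \<in> z. w \<in> e})"
  using fin by (intro sum.cong refl) (simp add: sum.If_cases Int_def)
 finally have "even (\<Sum>e\<in>z. card (e Int W))" using z by (simp add: complete_cycles dvd_sum)
 then show ?thesis using even_sum_iff[OF fin, of "%e. card (e Int W)"] by simp
qed

text \<open>The flats of a braid matroid in terms of colourings: intersecting two flats becomes
  pairing of functions, pulling back along a map of vertices becomes composition.\<close>

definition mono_edges :: "nat => (nat => 'c) => nat set set" where
 "mono_edges k f = {e \<in> complete_edges k. \<forall>u\<in>e. \<forall>v\<in>e. f u = f v}"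

lemma mono_edges_iff: "{u, v} \<in> mono_edges k f \<longleftrightarrow> {u, v} \<in> complete_edges k & f u = f v"
 by (auto simp: mono_edges_def)

lemma mono_edges_subset: "mono_edges k f <= complete_edges k"
 by (auto simp: mono_edges_def)

lemma edge_subset_iff:
 assumes "A <= complete_edges k"
 shows "A <= B \<longleftrightarrow> (\<forall>u v. {u, v} \<in> A --> {u, v} \<in> B)"
 using assms by (metis edge_cases subset_iff)

lemma edge_set_eq_iff:
 assumes "A <= complete_edges k" "B <= complete_edges k"
 shows "A = B \<longleftrightarrow> (\<forall>u v. {u, v} \<in> A \<longleftrightarrow> {u, v} \<in> B)"
 using edge_subset_iff[OF assms(1), of B] edge_subset_iff[OF assms(2), of A] by blast

text \<open>If e were the only edge of z with ends of different colours, the colour class W of one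
  end would be crossed by z exactly once.\<close>

lemma mono_edges_cut:
 assumes z: "z \<in> complete_cycles k" "e \<in> z" "z <= insert e (mono_edges k f)"
 shows "e \<in> mono_edges k f"
proof (rule ccontr)
 assume ne: "e ~: mono_edges k f"
 have e: "e \<in> complete_edges k" using z by (auto simp: complete_cycles)
 then obtain u v where uv: "e = {u, v}" "u ~= v" "u \<in> {1..k}" "v \<in> {1..k}" by (rule edge_cases)
 then have fuv: "f u ~= f v" using ne e mono_edges_iff by metis
 define W where "W = {w \<in> {1..k}. f w = f u}"
 have "odd (card (e' Int W)) \<longleftrightarrow> e' = e" if e': "e' \<in> z" for e'
 proof (cases "e' = e")
  case True
  have "e Int W = {u}" using uv fuv by (auto simp: W_def)
  then show ?thesis using True by simp
 next
  case False
  then have m: "e' \<in> mono_edges k f" using e' z by auto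
  then have "e' \<in> complete_edges k" by (simp add: mono_edges_def)
  then obtain x y where xy: "e' = {x, y}" "x ~= y" "x \<in> {1..k}" "y \<in> {1..k}" by (rule edge_cases)
  then have "f x = f y" using m mono_edges_iff by metis
  then have "x \<in> W \<longleftrightarrow> y \<in> W" using xy by (simp add: W_def)
  then have "e' Int W = {} | e' Int W = e'" using xy by auto
  moreover have "card e' = 2" using xy by simp
  ultimately have "even (card (e' Int W))" by (elim disjE) simp_all
  then show ?thesis using False by simp
 qed
 then have "{e' \<in> z. odd (card (e' Int W))} = {e}" using z by auto
 then have "card {e' \<in> z. odd (card (e' Int W))} = 1" by simp
 moreover have "finite W" by (simp add: W_def)
 ultimately show False using even_cut[OF z(1), of W] by simp
qed

lemma mono_edges_flat: "mono_edges k f \<in> flats (braid_matroid k)"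
 unfolding flats_def
proof (intro CollectI conjI ballI)
 show "mono_edges k f <= ground (braid_matroid k)" using mono_edges_subset by (simp add: braid_eq_bm)
 fix e assume e: "e \<in> ground (braid_matroid k) - mono_edges k f"
 obtain B where B: "B \<in> indep (braid_matroid k)" "B <= mono_edges k f"
  "card B = rank_of (braid_matroid k) (mono_edges k f)" by (rule rank_basis[OF matroid_braid])
 have "insert e B \<in> indep (braid_matroid k)"
  unfolding braid_eq_bm indep_bm
 proof (intro conjI ballI impI)
  show "insert e B <= complete_edges k" using e B mono_edges_subset by (auto simp: braid_eq_bm)
  fix z assume z: "z \<in> complete_cycles k" "z <= insert e B"
  then have "e ~: z" using mono_edges_cut[of z k e f] e B by blast
  then show "z = {}" using z B by (auto simp: braid_eq_bm indep_bm)
 qed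
 then have "card (insert e B) <= rank_of (braid_matroid k) (insert e (mono_edges k f))"
  using B by (intro rank_ge[OF matroid_braid]) auto
 moreover have "e ~: B" using e B by auto
 ultimately show "rank_of (braid_matroid k) (mono_edges k f) <
   rank_of (braid_matroid k) (insert e (mono_edges k f))"
  using B finite_indep[OF matroid_braid B(1)] by simp
qed

lemma flat_closed:
 assumes F: "F \<in> flats (braid_matroid k)" and z: "z \<in> complete_cycles k" "e \<in> z" "z <= insert e F"
 shows "e \<in> F"
proof (rule ccontr)
 assume "e ~: F"
 have e: "e \<in> complete_edges k" using z by (auto simp: complete_cycles)
 have FE: "F <= complete_edges k" using flats_subset[OF matroid_braid F] by (simp add: braid_eq_bm)
 have "rank_of (braid_matroid k) (insert e F) = rank_of (braid_matroid k) F"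
  unfolding braid_eq_bm using z e FE by (intro rank_insert_closure finite_complete_edges space_complete) auto
 moreover have "rank_of (braid_matroid k) F < rank_of (braid_matroid k) (insert e F)"
  using F e \<open>e ~: F\<close> by (auto simp: flats_def braid_eq_bm)
 ultimately show False by simp
qed

text \<open>Triangles make adjacency within F transitive. A vertex is coloured by the least member
  of its class.\<close>

lemma flat_eq_mono_edges:
 assumes F: "F \<in> flats (braid_matroid k)"
 shows "\<exists>f :: nat => nat. F = mono_edges k f"
proof -
 have FE: "F <= complete_edges k" using flats_subset[OF matroid_braid F] by (simp add: braid_eq_bm)
 have tr: "u = w | {u, w} \<in> F" if uv: "{u, v} \<in> F" and vw: "{v, w} \<in> F" for u v w
 proof (cases "u = w")
  case False
  have "{u, v} \<in> complete_edges k" "{v, w} \<in> complete_edges k" using uv vw FE by auto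
  then have "{{u, v}, {v, w}, {u, w}} \<in> complete_cycles k"
   using False by (intro triangle_in_cycles) (auto simp: edge_iff)
  then have "{u, w} \<in> F" by (rule flat_closed[OF F]) (use uv vw in auto)
  then show ?thesis ..
 qed simp
 define f where "f u = Min {v. v = u | {u, v} \<in> F}" for u
 have cls: "{w. w = u | {u, w} \<in> F} = {w. w = v | {v, w} \<in> F}" if "{u, v} \<in> F" for u v
  using that tr[of v u] tr[of u v] by (auto simp: insert_commute)
 have fin: "finite {w. w = u | {u, w} \<in> F}" for u
 proof (rule finite_subset)
  show "{w. w = u | {u, w} \<in> F} <= insert u {1..k}" using FE by (auto simp: edge_iff dest!: subsetD)
 qed simp
 have fmem: "f u = u | {u, f u} \<in> F" for u
  using Min_in[OF fin, of u] by (auto simp: f_def)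
 have "{u, v} \<in> F \<longleftrightarrow> {u, v} \<in> complete_edges k & f u = f v" for u v
 proof
  assume "{u, v} \<in> F"
  then show "{u, v} \<in> complete_edges k & f u = f v" using FE cls[of u v] by (auto simp: f_def)
 next
  assume h: "{u, v} \<in> complete_edges k & f u = f v"
  then have "u ~= v" by (simp add: edge_iff)
  then show "{u, v} \<in> F" using fmem[of u] fmem[of v] h tr[of u "f u" v] by (auto simp: insert_commute)
 qed
 then have "F = mono_edges k f"
  unfolding edge_set_eq_iff[OF FE mono_edges_subset] mono_edges_iff by blast
 then show ?thesis by blast
qed

text \<open>The stars centred at the least vertex \<open>\<rho> v\<close> of each class form a
  basis: a cycle in them would have a leaf of degree one, and any other monochromatic edge closes a
  triangle with two edges of a star.\<close>

lemma rank_mono_edges: "rank_of (braid_matroid k) (mono_edges k f) + card (f ` {1..k}) = k"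
proof -
 define \<rho> where "\<rho> v = Min {w \<in> {1..k}. f w = f v}" for v
 have \<rho>: "\<rho> v \<in> {1..k}" "f (\<rho> v) = f v" if "v \<in> {1..k}" for v
 proof -
  have "\<rho> v \<in> {w \<in> {1..k}. f w = f v}" unfolding \<rho>_def using that by (intro Min_in) auto
  then show "\<rho> v \<in> {1..k}" "f (\<rho> v) = f v" by auto
 qed
 have \<rho>_eq: "\<rho> v = \<rho> w" if "f v = f w" for v w using that by (simp add: \<rho>_def)
 have idem: "\<rho> (\<rho> v) = \<rho> v" if "v \<in> {1..k}" for v by (rule \<rho>_eq[OF \<rho>(2)[OF that]])
 define U where "U = {v \<in> {1..k}. \<rho> v ~= v}"
 define T where "T = (%v. {\<rho> v, v}) ` U"
 have "inj_on (%v. {\<rho> v, v}) U"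
 proof (rule inj_onI)
  fix v w assume vw: "v \<in> U" "w \<in> U" "{\<rho> v, v} = {\<rho> w, w}"
  then have "\<rho> (\<rho> w) = \<rho> w" using idem[of w] by (simp add: U_def)
  then show "v = w" using vw by (auto simp: doubleton_eq_iff U_def)
 qed
 then have cardT: "card T = card U" by (simp add: T_def card_image)
 have Tedge: "{\<rho> v, v} \<in> mono_edges k f" if "v \<in> U" for v
  using that \<rho>[of v] by (auto simp: mono_edges_iff edge_iff U_def)
 have "rank_of (braid_matroid k) (mono_edges k f) = card T"
 proof (rule rank_eq_card[OF matroid_braid])
  show "T \<in> indep (braid_matroid k)"
   unfolding braid_eq_bm indep_bm
  proof (intro conjI ballI impI)
   show "T <= complete_edges k" using Tedge mono_edges_subset by (auto simp: T_def)
   fix z assume z: "z \<in> complete_cycles k" "z <= T"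
   show "z = {}"
   proof (rule ccontr)
    assume "z ~= {}"
    then obtain v where v: "v \<in> U" "{\<rho> v, v} \<in> z" using z by (auto simp: T_def)
    have "e = {\<rho> v, v}" if ez: "e \<in> z" "v \<in> e" for e
    proof -
     obtain w where w: "w \<in> U" "e = {\<rho> w, w}" using ez z by (auto simp: T_def)
     have "v ~= \<rho> w" using v w idem[of w] by (auto simp: U_def)
     then show ?thesis using w ez by auto
    qed
    then have "{e \<in> z. v \<in> e} = {{\<rho> v, v}}" using v by blast
    then have "card {e \<in> z. v \<in> e} = 1" by simp
    moreover have "even (card {e \<in> z. v \<in> e})" using z by (simp add: complete_cycles)
    ultimately show False by simp
   qed
  qed
  show "T <= mono_edges k f" using Tedge by (auto simp: T_def)
  fix e assume e: "e \<in> mono_edges k f - T"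
  then have ek: "e \<in> complete_edges k" using mono_edges_subset by auto
  then obtain u v where uv: "e = {u, v}" "u ~= v" "u \<in> {1..k}" "v \<in> {1..k}" by (rule edge_cases)
  have fuv: "f u = f v" using e uv by (auto simp: mono_edges_iff)
  let ?w = "\<rho> v"
  have w: "\<rho> u = ?w" "?w \<in> {1..k}" using \<rho>_eq[OF fuv] \<rho>(1)[OF uv(4)] by simp_all
  have "u ~= ?w" "v ~= ?w"
   using e uv w by (auto simp: T_def U_def image_iff insert_commute)
  then have "{{u, v}, {v, ?w}, {u, ?w}} \<in> complete_cycles k"
   using uv w by (intro triangle_in_cycles) auto
  moreover have "{u, ?w} \<in> T" "{v, ?w} \<in> T"
   using uv w \<open>u ~= ?w\<close> \<open>v ~= ?w\<close> by (auto simp: T_def U_def insert_commute intro!: rev_image_eqI)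
  then have "{{u, v}, {v, ?w}, {u, ?w}} <= insert e T" unfolding uv(1) by simp
  ultimately show "insert e T ~: indep (braid_matroid k)"
   unfolding braid_eq_bm indep_bm by (metis insert_not_empty)
 qed
 moreover have "card U + card (f ` {1..k}) = k"
 proof -
  let ?R = "{v \<in> {1..k}. \<rho> v = v}"
  have "f ` {1..k} = f ` ?R"
  proof (intro equalityI subsetI)
   fix c assume "c \<in> f ` {1..k}"
   then obtain v where v: "v \<in> {1..k}" "c = f v" by auto
   then have "\<rho> (\<rho> v) = \<rho> v" using idem by blast
   then show "c \<in> f ` ?R" using v \<rho>[of v] by (intro image_eqI[of _ _ "\<rho> v"]) auto
  qed auto
  moreover have "inj_on f ?R" using \<rho>_eq by (intro inj_onI) (metis (mono_tags, lifting) mem_Collect_eq)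
  ultimately have "card (f ` {1..k}) = card ?R" by (simp add: card_image)
  moreover have "card (U Un ?R) = card U + card ?R" by (intro card_Un_disjoint) (auto simp: U_def)
  moreover have "U Un ?R = {1..k}" by (auto simp: U_def)
  ultimately show ?thesis by simp
 qed
 ultimately show ?thesis using cardT by simp
qed

lemma rank_braid:
 assumes "k > 0" shows "rk (braid_matroid k) = k - 1"
proof -
 have "mono_edges k (%_. 0 :: nat) = ground (braid_matroid k)" by (auto simp: mono_edges_def braid_eq_bm)
 moreover have "(%_. 0 :: nat) ` {1..k} = {0}" using assms by (simp add: image_constant_conv)
 ultimately show ?thesis using rank_mono_edges[of k "%_. 0 :: nat"] assms by simp
qed

text \<open>The flats above \<open>mono_edges k q\<close> are colourings that are constant on the
  fibres of q, so they descend to the vertices 1, ..., m; the map \<open>\<psi>\<close> pulls flats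
  of the smaller matroid back along q.\<close>

lemma klp_braid_interval:
 assumes q: "q ` {1..k} = {1..m}"
 shows "klp (flats (braid_matroid k)) (rank_of (braid_matroid k)) (mono_edges k q) =
  klp (flats (braid_matroid m)) (rank_of (braid_matroid m)) {}"
proof -
 let ?Lk = "flats (braid_matroid k)" and ?Lm = "flats (braid_matroid m)"
 define \<psi> where "\<psi> H = {e \<in> complete_edges k. \<forall>u\<in>e. \<forall>v\<in>e. q u = q v | {q u, q v} \<in> H}" for H
 have qk: "q v \<in> {1..m}" if "v \<in> {1..k}" for v using q that by auto
 have \<psi>_iff: "{u, v} \<in> \<psi> H \<longleftrightarrow> {u, v} \<in> complete_edges k & (q u = q v | {q u, q v} \<in> H)" for u v H
  by (auto simp: \<psi>_def insert_commute)
 have \<psi>_sub: "\<psi> H <= complete_edges k" for H by (auto simp: \<psi>_def)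
 have \<psi>_mono: "\<psi> (mono_edges m f) = mono_edges k (f \<circ> q)" for f :: "nat => nat"
  by (subst edge_set_eq_iff[OF \<psi>_sub mono_edges_subset])
   (use qk in \<open>auto simp: \<psi>_iff mono_edges_iff edge_iff simp del: atLeastAtMost_iff\<close>)
 have flat_sub: "H <= complete_edges j" if "H \<in> flats (braid_matroid j)" for H j
  using flats_subset[OF matroid_braid that] by (simp add: braid_eq_bm)
 have ord: "\<psi> H <= \<psi> H' \<longleftrightarrow> H <= H'" if H: "H \<in> ?Lm" for H H'
 proof
  assume sub: "\<psi> H <= \<psi> H'"
  show "H <= H'"
  proof (subst edge_subset_iff[OF flat_sub[OF H]], intro allI impI)
   fix i j assume ij: "{i, j} \<in> H"
   then have ij': "i ~= j" "i \<in> {1..m}" "j \<in> {1..m}" using flat_sub[OF H] edge_iff by blast+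
   then obtain u v where uv: "u \<in> {1..k}" "v \<in> {1..k}" "q u = i" "q v = j" unfolding q[symmetric] by auto
   then have "{u, v} \<in> \<psi> H" using ij ij' by (auto simp: \<psi>_iff edge_iff)
   then have "{u, v} \<in> \<psi> H'" using sub by auto
   then show "{i, j} \<in> H'" using uv ij' by (auto simp: \<psi>_iff)
  qed
 qed (auto simp: \<psi>_def)
 have fam: "ranked_family (flats (braid_matroid j)) (rank_of (braid_matroid j))" for j
  by (rule ranked_family_flats[OF matroid_braid])
 show ?thesis
 proof (rule klp_iso[OF fam fam, where \<phi>=\<psi>, symmetric])
  show "{} \<in> ?Lm" by (rule empty_flat[OF matroid_braid loopless_braid])
  show "mono_edges k q \<in> ?Lk" by (rule mono_edges_flat)
  show "\<psi> Y <= \<psi> Z \<longleftrightarrow> Y <= Z" if "Y \<in> ?Lm" for Y Z using ord[OF that] .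
  show "rank_of (braid_matroid k) (\<psi> Y) + rank_of (braid_matroid m) {} =
    rank_of (braid_matroid m) Y + rank_of (braid_matroid k) (mono_edges k q)" if Y: "Y \<in> ?Lm" for Y
  proof -
   obtain f :: "nat => nat" where f: "Y = mono_edges m f" using flat_eq_mono_edges[OF Y] ..
   have "(f \<circ> q) ` {1..k} = f ` {1..m}" by (metis image_comp q)
   then have "rank_of (braid_matroid k) (\<psi> Y) + card (f ` {1..m}) = k"
    using rank_mono_edges[of k "f \<circ> q"] unfolding f \<psi>_mono by metis
   moreover have "card (q ` {1..k}) = m" unfolding q by simp
   ultimately show ?thesis
    using rank_mono_edges[of m f] rank_mono_edges[of k q] rank_empty[OF matroid_braid, of m]
    unfolding f by linarith
  qed
  show "bij_betw \<psi> {Y \<in> ?Lm. {} <= Y} {Y \<in> ?Lk. mono_edges k q <= Y}"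
   unfolding bij_betw_def
  proof (intro conjI equalityI subsetI)
   show "inj_on \<psi> {Y \<in> ?Lm. {} <= Y}" using ord by (auto simp: inj_on_def)
  next
   fix Y assume "Y \<in> \<psi> ` {Y \<in> ?Lm. {} <= Y}"
   then obtain H where H: "H \<in> ?Lm" "Y = \<psi> H" by auto
   obtain f :: "nat => nat" where f: "H = mono_edges m f" using flat_eq_mono_edges[OF H(1)] ..
   have "mono_edges k q <= mono_edges k (f \<circ> q)"
    by (subst edge_subset_iff[OF mono_edges_subset]) (auto simp: mono_edges_iff)
   then show "Y \<in> {Y \<in> ?Lk. mono_edges k q <= Y}" using H f mono_edges_flat by (auto simp: \<psi>_mono)
  next
   fix Y assume Y: "Y \<in> {Y \<in> ?Lk. mono_edges k q <= Y}"
   then obtain f :: "nat => nat" where f: "Y = mono_edges k f" using flat_eq_mono_edges by blast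
   define f' where "f' i = f (SOME u. u \<in> {1..k} & q u = i)" for i
   have f': "f' (q v) = f v" if v: "v \<in> {1..k}" for v
   proof -
    let ?u = "SOME u. u \<in> {1..k} & q u = q v"
    have u: "?u \<in> {1..k} & q ?u = q v" by (rule someI[of _ v]) (use v in simp)
    have "f ?u = f v"
    proof (cases "?u = v")
     case False
     then have "{?u, v} \<in> mono_edges k q" using u v by (simp add: mono_edges_iff edge_iff)
     then have "{?u, v} \<in> mono_edges k f" using Y f by auto
     then show ?thesis by (simp add: mono_edges_iff)
    qed simp
    then show ?thesis by (simp add: f'_def)
   qed
   have "mono_edges k (f' \<circ> q) = mono_edges k f"
    by (subst edge_set_eq_iff[OF mono_edges_subset mono_edges_subset])
     (auto simp: mono_edges_iff edge_iff f')
   then have "\<psi> (mono_edges m f') = Y" using f by (simp add: \<psi>_mono)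
   then show "Y \<in> \<psi> ` {Y \<in> ?Lm. {} <= Y}" using mono_edges_flat by auto
  qed
 qed
qed

section \<open>Set partitions\<close>

definition block_of :: "'a set set => 'a => 'a set" where
 "block_of Q v = (THE b. b \<in> Q & v \<in> b)"

lemma block_of_eq:
 assumes "partition_on V Q" "b \<in> Q" "v \<in> b"
 shows "block_of Q v = b"
 unfolding block_of_def
proof (rule the_equality)
 fix c assume "c \<in> Q & v \<in> c"
 then show "c = b" using assms partition_onD2[OF assms(1)] by (auto simp: disjoint_def)
qed (use assms in simp)

lemma block_of_mem:
 assumes "partition_on V Q" "v \<in> V"
 shows "block_of Q v \<in> Q" "v \<in> block_of Q v"
proof -
 obtain b where "b \<in> Q" "v \<in> b" using assms partition_onD1[OF assms(1)] by auto
 then show "block_of Q v \<in> Q" "v \<in> block_of Q v" using block_of_eq[OF assms(1)] by auto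
qed

lemma block_of_image: "partition_on V Q ==> block_of Q ` V = Q"
proof (intro equalityI subsetI)
 fix b assume Q: "partition_on V Q" and b: "b \<in> Q"
 then obtain v where "v \<in> b" using partition_onD3 by (metis all_not_in_conv)
 then show "b \<in> block_of Q ` V" using block_of_eq[OF Q b] partition_onD1[OF Q] b by blast
qed (auto simp: block_of_mem)

lemma partition_block_eq:
 assumes "partition_on V Q" "v \<in> V"
 shows "block_of Q v = {w \<in> V. block_of Q w = block_of Q v}"
proof (intro equalityI subsetI)
 fix w assume "w \<in> block_of Q v"
 then show "w \<in> {w \<in> V. block_of Q w = block_of Q v}"
  using block_of_eq[OF assms(1) block_of_mem(1)[OF assms]] block_of_mem(1)[OF assms] partition_onD1[OF assms(1)]
  by blast
qed (use block_of_mem[OF assms(1)] in auto)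

lemma finite_partition: "partition_on V Q ==> finite V ==> finite Q"
 using block_of_image by (metis finite_imageI)

lemma sum_card_partition:
 assumes "partition_on V Q" "finite V"
 shows "(\<Sum>b\<in>Q. card b) = card V"
proof -
 have "card (\<Union>Q) = sum card Q"
  using assms partition_onD1[OF assms(1)] partition_onD2[OF assms(1)]
  by (intro card_Union_disjoint) (auto simp: disjoint_def pairwise_def disjnt_def intro: finite_subset)
 then show ?thesis using partition_onD1[OF assms(1)] by simp
qed

text \<open>The empty set as b stands for no block at all: x then becomes a singleton block.\<close>

definition extend_block :: "'a => 'a set set => 'a set => 'a set set" where
 "extend_block x Q b = insert (insert x b) (Q - {b})"

lemma partition_on_extend_block:
 assumes Q: "partition_on V Q" and x: "x ~: V" and b: "b \<in> insert {} Q"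
 shows "partition_on (insert x V) (extend_block x Q b)"
proof (rule partition_onI)
 have "b <= V" using b partition_onD1[OF Q] by auto
 have U: "V = \<Union>Q" using partition_onD1[OF Q] .
 show "\<Union>(extend_block x Q b) = insert x V" unfolding U extend_block_def using b by auto
 show "{} ~: extend_block x Q b" using partition_onD3[OF Q] by (auto simp: extend_block_def)
 show "disjnt c d" if "c \<in> extend_block x Q b" "d \<in> extend_block x Q b" "c ~= d" for c d
  using that b x partition_onD2[OF Q] unfolding U extend_block_def disjoint_def disjnt_def by auto
qed

lemma extend_block_bij:
 assumes x: "x ~: V"
 shows "bij_betw (%(Q, b). extend_block x Q b) (SIGMA Q:{Q. partition_on V Q}. insert {} Q)
  {P. partition_on (insert x V) P}"
proof -
 let ?f = "%(Q, b). extend_block x Q b"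
 let ?g = "%P. ((%c. c - {x}) ` P - {{}}, block_of P x - {x})"
 let ?S = "SIGMA Q:{Q. partition_on V Q}. insert {} Q"
 have 1: "(%(Q, b). extend_block x Q b) ` (SIGMA Q:{Q. partition_on V Q}. insert {} Q) <=
   {P. partition_on (insert x V) P}"
  using partition_on_extend_block[OF _ x] by auto
 have 2: "\<forall>a\<in>?S. ?g (?f a) = a"
 proof
  fix a assume "a \<in> ?S"
  then obtain Q b where a: "a = (Q, b)" and Q: "partition_on V Q" and b: "b \<in> insert {} Q" by auto
  have nx: "c - {x} = c" if "c \<in> insert {} Q" for c using x that partition_onD1[OF Q] by auto
  have "block_of (extend_block x Q b) x = insert x b"
   by (rule block_of_eq[OF partition_on_extend_block[OF Q x b]]) (auto simp: extend_block_def)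
  moreover have "(%c. c - {x}) ` extend_block x Q b = insert b (Q - {b})"
   using nx b by (auto simp: extend_block_def image_iff)
  ultimately show "?g (?f a) = a"
   unfolding a using nx[OF b] b partition_onD3[OF Q] by auto
 qed
 have *: "partition_on V ((%c. c - {x}) ` P - {{}}) & block_of P x - {x} \<in> insert {} ((%c. c - {x}) ` P - {{}}) &
   extend_block x ((%c. c - {x}) ` P - {{}}) (block_of P x - {x}) = P"
  if P: "partition_on (insert x V) P" for P
 proof -
  let ?Q = "(%c. c - {x}) ` P - {{}}" and ?c = "block_of P x"
  have c: "?c \<in> P" "x \<in> ?c" using block_of_mem[OF P, of x] by auto
  have dj: "b Int c = {}" if "b \<in> P" "c \<in> P" "b ~= c" for b c
   using that partition_onD2[OF P] by (auto simp: disjoint_def)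
  have nx: "b - {x} = b" if "b \<in> P" "b ~= ?c" for b using dj[OF that(1) c(1) that(2)] c by auto
  have ne: "b ~= {}" if "b \<in> P" for b using partition_onD3[OF P] that by auto
  have Q: "?Q = (P - {?c}) Un ({?c - {x}} - {{}})"
  proof (intro equalityI subsetI)
   fix d assume "d \<in> ?Q"
   then obtain b where b: "b \<in> P" "d = b - {x}" "d ~= {}" by auto
   then show "d \<in> (P - {?c}) Un ({?c - {x}} - {{}})" using nx[OF b(1)] by (cases "b = ?c") auto
  next
   fix d assume "d \<in> (P - {?c}) Un ({?c - {x}} - {{}})"
   then show "d \<in> ?Q" using c(1) nx[of d] ne[of d] by (cases "d \<in> P - {?c}") force+
  qed
  have "partition_on V ?Q"
  proof (rule partition_onI)
   have "\<Union>?Q = \<Union>P - {x}" by auto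
   also have "\<Union>P = insert x V" using partition_onD1[OF P] by simp
   finally show "\<Union>?Q = V" using x by simp
   show "disjnt b d" if "b \<in> ?Q" "d \<in> ?Q" "b ~= d" for b d
   proof -
    obtain b' d' where "b' \<in> P" "b = b' - {x}" "d' \<in> P" "d = d' - {x}" using \<open>b \<in> ?Q\<close> \<open>d \<in> ?Q\<close> by auto
    then show ?thesis using dj[of b' d'] \<open>b ~= d\<close> by (auto simp: disjnt_def)
   qed
  qed auto
  moreover have "?c - {x} \<in> insert {} ?Q" unfolding Q by auto
  moreover have "extend_block x ?Q (?c - {x}) = P"
  proof -
   have "insert x (?c - {x}) = ?c" using c by auto
   moreover have "?c - {x} ~: P"
   proof
    assume m: "?c - {x} \<in> P"
    have "?c - {x} ~= ?c" using c by auto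
    then have "(?c - {x}) Int ?c = {}" using dj m c by blast
    then show False using ne[OF m] by blast
   qed
   then have "?Q - {?c - {x}} = P - {?c}" unfolding Q by auto
   ultimately show ?thesis using c by (auto simp: extend_block_def)
  qed
  ultimately show ?thesis by blast
 qed
 have 3: "\<forall>P\<in>{P. partition_on (insert x V) P}. ?f (?g P) = P" using * by simp
 have 4: "?g ` {P. partition_on (insert x V) P} <= ?S" using * by blast
 show ?thesis by (rule bij_betw_byWitness[OF 2 3 1 4])
qed

lemma sum_partitions_insert:
 assumes "finite V" "x ~: V"
 shows "(\<Sum>P | partition_on (insert x V) P. h P) =
  (\<Sum>Q | partition_on V Q. h (extend_block x Q {}) + (\<Sum>b\<in>Q. h (extend_block x Q b)))"
proof -
 have "(\<Sum>P | partition_on (insert x V) P. h P) =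
   (\<Sum>(Q, b)\<in>(SIGMA Q:{Q. partition_on V Q}. insert {} Q). h (extend_block x Q b))"
  by (subst sum.reindex_bij_betw[OF extend_block_bij[OF assms(2)], symmetric]) (simp add: case_prod_beta)
 also have "\<dots> = (\<Sum>Q | partition_on V Q. \<Sum>b\<in>insert {} Q. h (extend_block x Q b))"
  using assms(1) finite_partition finitely_many_partition_on by (subst sum.Sigma) auto
 also have "\<dots> = (\<Sum>Q | partition_on V Q. h (extend_block x Q {}) + (\<Sum>b\<in>Q. h (extend_block x Q b)))"
 proof (intro sum.cong refl)
  fix Q assume "Q \<in> {Q. partition_on V Q}"
  then show "(\<Sum>b\<in>insert {} Q. h (extend_block x Q b)) =
    h (extend_block x Q {}) + (\<Sum>b\<in>Q. h (extend_block x Q b))"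
   using finite_partition[OF _ assms(1)] partition_onD3 by (subst sum.insert) auto
 qed
 finally show ?thesis .
qed

lemma card_extend_block:
 assumes "partition_on V Q" "finite V" "x ~: V" "b \<in> insert {} Q"
 shows "card (extend_block x Q b) = (if b = {} then Suc (card Q) else card Q)"
proof -
 have fin: "finite Q" by (rule finite_partition[OF assms(1,2)])
 have "insert x b ~: Q - {b}" using assms(3) partition_onD1[OF assms(1)] by auto
 then have "card (extend_block x Q b) = Suc (card (Q - {b}))" using fin by (simp add: extend_block_def)
 moreover have "Suc (card (Q - {b})) = card Q" if "b ~= {}"
  using assms(4) that fin by (intro card_Suc_Diff1) auto
 moreover have "Q - {{}} = Q" using partition_onD3[OF assms(1)] by auto
 ultimately show ?thesis by auto
qed

section \<open>Characteristic polynomials and colourings\<close>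

definition part_flat :: "nat => nat set set => nat set set" where
 "part_flat k Q = mono_edges k (block_of Q)"

lemma part_flat_bij: "bij_betw (part_flat k) {Q. partition_on {1..k} Q} (flats (braid_matroid k))"
 unfolding bij_betw_def
proof (intro conjI equalityI subsetI)
 show "inj_on (part_flat k) {Q. partition_on {1..k} Q}"
 proof (rule inj_onI)
  fix Q P assume *: "Q \<in> {Q. partition_on {1..k} Q}" "P \<in> {Q. partition_on {1..k} Q}"
   "part_flat k Q = part_flat k P"
  have rel: "block_of Q u = block_of Q v \<longleftrightarrow> block_of P u = block_of P v" if "u \<in> {1..k}" "v \<in> {1..k}" for u v
  proof (cases "u = v")
   case False
   then have "{u, v} \<in> complete_edges k" using that by (simp add: edge_iff)
   then show ?thesis using *(3) mono_edges_iff[of u v k "block_of Q"] mono_edges_iff[of u v k "block_of P"]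
    by (simp add: part_flat_def)
  qed simp
  have "block_of Q v = block_of P v" if "v \<in> {1..k}" for v
   using partition_block_eq[of "{1..k}" Q v] partition_block_eq[of "{1..k}" P v] * that rel[OF _ that] by blast
  then have "block_of Q ` {1..k} = block_of P ` {1..k}" by (intro image_cong refl)
  then show "Q = P" using * block_of_image by (metis mem_Collect_eq)
 qed
next
 fix F assume "F \<in> part_flat k ` {Q. partition_on {1..k} Q}"
 then show "F \<in> flats (braid_matroid k)" by (auto simp: part_flat_def mono_edges_flat)
next
 fix F assume "F \<in> flats (braid_matroid k)"
 then obtain f :: "nat => nat" where f: "F = mono_edges k f" using flat_eq_mono_edges by blast
 define Q where "Q = (%u. {v \<in> {1..k}. f v = f u}) ` {1..k}"
 have Q: "partition_on {1..k} Q"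
  by (rule partition_onI) (auto simp: Q_def disjnt_def)
 have blk: "block_of Q u = {v \<in> {1..k}. f v = f u}" if "u \<in> {1..k}" for u
  by (rule block_of_eq[OF Q]) (use that in \<open>auto simp: Q_def\<close>)
 have "block_of Q u = block_of Q v \<longleftrightarrow> f u = f v" if "u \<in> {1..k}" "v \<in> {1..k}" for u v
  unfolding blk[OF that(1)] blk[OF that(2)] using that by fastforce
 then have "part_flat k Q = F"
  unfolding part_flat_def f edge_set_eq_iff[OF mono_edges_subset mono_edges_subset] mono_edges_iff
  by (meson edge_iff)
 then show "F \<in> part_flat k ` {Q. partition_on {1..k} Q}" using Q by blast
qed

lemma rank_part_flat:
 assumes "partition_on {1..k} Q"
 shows "rank_of (braid_matroid k) (part_flat k Q) + card Q = k"
 using rank_mono_edges[of k "block_of Q"] unfolding part_flat_def block_of_image[OF assms] .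

definition part_char :: "nat => nat set set => int poly" where
 "part_char k Q = chi (flats (braid_matroid k)) (rank_of (braid_matroid k)) {} (part_flat k Q)"

text \<open>The proper colourings, with q colours, of the disjoint union of the complete graphs on
  the blocks.\<close>

definition block_colorings :: "'a set => 'a set set => nat => ('a => nat) set" where
 "block_colorings V Q q = {g \<in> V \<rightarrow>\<^sub>E {..<q}. \<forall>b\<in>Q. inj_on g b}"

lemma card_factoring_functions:
 assumes "finite V"
 shows "card {g \<in> V \<rightarrow>\<^sub>E {..<q}. \<forall>u\<in>V. \<forall>v\<in>V. f u = f v --> g u = g v} = q ^ card (f ` V)"
proof -
 have "bij_betw (%h. restrict (h \<circ> f) V) (f ` V \<rightarrow>\<^sub>E {..<q})
   {g \<in> V \<rightarrow>\<^sub>E {..<q}. \<forall>u\<in>V. \<forall>v\<in>V. f u = f v --> g u = g v}" (is "bij_betw ?F ?A ?B")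
  unfolding bij_betw_def
 proof (intro conjI equalityI subsetI)
  show "inj_on ?F ?A"
  proof (rule inj_onI)
   fix h h' assume h: "h \<in> ?A" "h' \<in> ?A" "?F h = ?F h'"
   show "h = h'"
   proof (rule PiE_ext[OF h(1,2)])
    fix c assume "c \<in> f ` V"
    then obtain v where "v \<in> V" "c = f v" by auto
    then show "h c = h' c" using fun_cong[OF h(3), of v] by simp
   qed
  qed
 next
  fix g assume "g \<in> ?F ` ?A"
  then show "g \<in> ?B" by fastforce
 next
  fix g assume g: "g \<in> ?B"
  define h where "h = restrict (%c. g (SOME v. v \<in> V & f v = c)) (f ` V)"
  have hv: "h (f v) = g v" if "v \<in> V" for v
  proof -
   have "(SOME w. w \<in> V & f w = f v) \<in> V & f (SOME w. w \<in> V & f w = f v) = f v"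
    by (rule someI[of _ v]) (use that in simp)
   then have "g (SOME w. w \<in> V & f w = f v) = g v" using g that by blast
   then show ?thesis using that by (simp add: h_def)
  qed
  have gE: "g \<in> V \<rightarrow>\<^sub>E {..<q}" using g by blast
  have gV: "g v \<in> {..<q}" if "v \<in> V" for v by (rule PiE_mem[OF gE that])
  have "h \<in> ?A"
  proof (rule PiE_I)
   fix c assume "c \<in> f ` V"
   then show "h c \<in> {..<q}" using hv gV by fastforce
  qed (simp add: h_def)
  moreover have "?F h = g"
  proof
   fix v show "?F h v = g v"
   proof (cases "v \<in> V")
    case False
    then have "g v = undefined" by (rule PiE_arb[OF gE])
    then show ?thesis using False by simp
   qed (simp add: hv)
  qed
  ultimately show "g \<in> ?F ` ?A" by blast
 qed
 then have "card ?B = card ?A" by (rule bij_betw_same_card[symmetric])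
 also have "\<dots> = q ^ card (f ` V)" using card_funcsetE[of "f ` V" "{..<q}"] assms by simp
 finally show ?thesis .
qed

text \<open>Up to a power of q this is the chromatic polynomial of a disjoint union of complete
  graphs. The number N classifies all colourings by the flat Y of monochromatic edges inside blocks;
  its sums over upper intervals are powers of q, and Moebius inversion isolates the value at Y =
  {}.\<close>

lemma part_char_colorings:
 assumes Q: "partition_on {1..k} Q"
 shows "int q ^ card Q * poly (part_char k Q) (int q) = int (card (block_colorings {1..k} Q q))"
proof -
 let ?L = "flats (braid_matroid k)" and ?r = "rank_of (braid_matroid k)" and ?F = "part_flat k Q"
 interpret ranked_family ?L ?r by (rule ranked_family_flats[OF matroid_braid])
 let ?C = "{1..k} \<rightarrow>\<^sub>E {..<q}"
 have finC: "finite ?C" by (intro finite_PiE) auto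
 have F: "?F \<in> ?L" by (simp add: part_flat_def mono_edges_flat)
 have E: "{} \<in> ?L" by (rule empty_flat[OF matroid_braid loopless_braid])
 define N where "N Y = card {g \<in> ?C. mono_edges k g Int ?F = Y}" for Y
 \<comment> \<open>The pair of two colourings has as monochromatic edges those common to both, so
   the intersection is again a flat.\<close>
 have inter: "mono_edges k g Int ?F = mono_edges k (%v. (g v, block_of Q v))" for g :: "nat => nat"
  unfolding mono_edges_def part_flat_def prod.inject by blast
 have Nsum: "(\<Sum>Y\<in>interval ?L Z ?F. N Y) = q ^ (k - ?r Z)" if Z: "Z \<in> interval ?L {} ?F" for Z
 proof -
  have ZL: "Z \<in> ?L" "Z <= ?F" using Z by (auto simp: interval_def)
  obtain f :: "nat => nat" where f: "Z = mono_edges k f" using flat_eq_mono_edges[OF ZL(1)] by blast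
  let ?S = "{g \<in> ?C. Z <= mono_edges k g}"
  have "(\<Sum>Y\<in>interval ?L Z ?F. N Y) =
    (\<Sum>Y\<in>interval ?L Z ?F. \<Sum>g\<in>{g. g \<in> ?S & mono_edges k g Int ?F = Y}. 1)"
  proof (intro sum.cong refl)
   fix Y assume Y: "Y \<in> interval ?L Z ?F"
   then have "{g. g \<in> ?S & mono_edges k g Int ?F = Y} = {g \<in> ?C. mono_edges k g Int ?F = Y}"
    unfolding interval_def by blast
   then show "N Y = (\<Sum>g\<in>{g. g \<in> ?S & mono_edges k g Int ?F = Y}. 1)" by (simp add: N_def)
  qed
  also have "\<dots> = (\<Sum>g\<in>?S. 1)"
  proof (rule sum.group)
   show "finite ?S" using finC by simp
   show "(%g. mono_edges k g Int ?F) ` ?S <= interval ?L Z ?F"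
   proof
    fix Y assume "Y \<in> (%g. mono_edges k g Int ?F) ` ?S"
    then obtain g :: "nat => nat" where g: "Z <= mono_edges k g" "Y = mono_edges k g Int ?F" by blast
    then have "Y \<in> ?L" by (simp only: inter mono_edges_flat)
    then show "Y \<in> interval ?L Z ?F" using g ZL(2) unfolding interval_def by blast
   qed
  qed simp
  also have "\<dots> = card ?S" by simp
  also have "?S = {g \<in> ?C. \<forall>u\<in>{1..k}. \<forall>v\<in>{1..k}. f u = f v --> g u = g v}"
  proof -
   have "Z <= mono_edges k g \<longleftrightarrow> (\<forall>u\<in>{1..k}. \<forall>v\<in>{1..k}. f u = f v --> g u = g v)" for g :: "nat => nat"
    unfolding f edge_subset_iff[OF mono_edges_subset] mono_edges_iff edge_iff by metis
   then show ?thesis by simp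
  qed
  also have "card \<dots> = q ^ card (f ` {1..k})" by (rule card_factoring_functions) simp
  also have "card (f ` {1..k}) = k - ?r Z" using rank_mono_edges[of k f] by (simp add: f)
  finally show ?thesis .
 qed
 have rF: "?r ?F + card Q = k" by (rule rank_part_flat[OF Q])
 have "int q ^ card Q * poly (part_char k Q) (int q) =
   (\<Sum>Z\<in>interval ?L {} ?F. moebius ?L {} Z * int (q ^ (k - ?r Z)))"
  unfolding part_char_def chi_def poly_sum sum_distrib_left
 proof (intro sum.cong refl)
  fix Z assume "Z \<in> interval ?L {} ?F"
  then have "?r Z <= ?r ?F" using F by (intro r_mono) (auto simp: interval_def)
  then have "k - ?r Z = card Q + (?r ?F - ?r Z)" using rF by simp
  then show "int q ^ card Q * poly (monom (moebius ?L {} Z) (?r ?F - ?r Z)) (int q) =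
    moebius ?L {} Z * int (q ^ (k - ?r Z))"
   by (simp add: poly_monom power_add)
 qed
 also have "\<dots> = (\<Sum>Z\<in>interval ?L {} ?F. \<Sum>Y\<in>interval ?L Z ?F. moebius ?L {} Z * int (N Y))"
  by (intro sum.cong refl) (simp add: Nsum[symmetric] sum_distrib_left)
 also have "\<dots> = (\<Sum>Y\<in>interval ?L {} ?F. \<Sum>Z\<in>interval ?L {} Y. moebius ?L {} Z * int (N Y))"
  by (rule interval_swap[symmetric])
 also have "\<dots> = (\<Sum>Y\<in>interval ?L {} ?F. (if {} = Y then 1 else 0) * int (N Y))"
 proof (intro sum.cong refl)
  fix Y assume "Y \<in> interval ?L {} ?F"
  then show "(\<Sum>Z\<in>interval ?L {} Y. moebius ?L {} Z * int (N Y)) = (if {} = Y then 1 else 0) * int (N Y)"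
   using moebius_sum_left[OF E, of Y] by (simp add: interval_def flip: sum_distrib_right)
 qed
 also have "\<dots> = int (N {})"
 proof -
  have "{} \<in> interval ?L {} ?F" using E by (simp add: interval_def)
  moreover have "(\<Sum>Y\<in>interval ?L {} ?F. (if {} = Y then 1 else 0) * int (N Y)) =
    (\<Sum>Y\<in>interval ?L {} ?F. if {} = Y then int (N Y) else 0)" by (intro sum.cong) auto
  ultimately show ?thesis by (simp add: sum.delta)
 qed
 also have "N {} = card {g \<in> ?C. mono_edges k g Int ?F = {}}" by (simp add: N_def)
 also have "{g \<in> ?C. mono_edges k g Int ?F = {}} = block_colorings {1..k} Q q"
 proof -
  have "mono_edges k g Int ?F = {} \<longleftrightarrow> (\<forall>b\<in>Q. inj_on g b)" for g :: "nat => nat"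
  proof -
   have "mono_edges k g Int ?F = {} \<longleftrightarrow>
     (\<forall>u v. \<not> ({u, v} \<in> complete_edges k & g u = g v & block_of Q u = block_of Q v))"
    using edge_subset_iff[of "mono_edges k g Int ?F" k "{}"] mono_edges_subset[of k g]
    by (auto simp: mono_edges_iff part_flat_def)
   also have "\<dots> \<longleftrightarrow> (\<forall>b\<in>Q. inj_on g b)"
   proof
    assume h: "\<forall>u v. \<not> ({u, v} \<in> complete_edges k & g u = g v & block_of Q u = block_of Q v)"
    show "\<forall>b\<in>Q. inj_on g b"
    proof (intro ballI inj_onI, rule ccontr)
     fix b u v assume "b \<in> Q" "u \<in> b" "v \<in> b" "g u = g v" "u ~= v"
     moreover have "u \<in> {1..k}" "v \<in> {1..k}" using calculation partition_onD1[OF Q] by blast+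
     ultimately show False using h block_of_eq[OF Q] edge_iff[of u v k] by metis
    qed
   next
    assume h: "\<forall>b\<in>Q. inj_on g b"
    show "\<forall>u v. \<not> ({u, v} \<in> complete_edges k & g u = g v & block_of Q u = block_of Q v)"
     unfolding edge_iff using h block_of_mem[OF Q] by (metis inj_onD)
   qed
   finally show ?thesis .
  qed
  then show ?thesis by (simp add: block_colorings_def)
 qed
 finally show ?thesis .
qed

text \<open>The block b already shows \<open>card b\<close> distinct colours, which are forbidden
  for x. The difference is taken in the integers; if it is negative, there is no colouring of
  V.\<close>

lemma card_block_colorings_extend:
 assumes Q: "partition_on V Q" and V: "finite V" "x ~: V" and b: "b \<in> insert {} Q"
 shows "int (card (block_colorings (insert x V) (extend_block x Q b) q)) =
  (int q - int (card b)) * int (card (block_colorings V Q q))"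
proof -
 let ?G = "block_colorings V Q q" and ?S = "SIGMA g:block_colorings V Q q. {..<q} - g ` b"
 have bV: "b <= V" using b partition_onD1[OF Q] by auto
 have inj: "inj_on g b" if "g \<in> ?G" for g using that b by (auto simp: block_colorings_def)
 have finG: "finite ?G" unfolding block_colorings_def using V by (simp add: finite_PiE)
 have cV: "c <= V" if "c \<in> Q" for c using that partition_onD1[OF Q] by auto
 have upd: "inj_on (g(x := y)) c \<longleftrightarrow> inj_on g c" if "c <= V" for g y c
  using that V(2) by (intro inj_on_cong) auto
 have updx: "inj_on (g(x := y)) (insert x b) \<longleftrightarrow> inj_on g b & y ~: g ` b" for g y
 proof -
  have "g(x := y) ` b = g ` b" using bV V(2) by (intro image_cong) auto
  moreover have "b - {x} = b" using bV V(2) by auto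
  ultimately show ?thesis using upd[OF bV, of g y] by (simp add: inj_on_insert)
 qed
 have "block_colorings (insert x V) (extend_block x Q b) q = (%(g, y). g(x := y)) ` ?S"
 proof (intro equalityI subsetI)
  fix g assume g: "g \<in> block_colorings (insert x V) (extend_block x Q b) q"
  define g' where "g' = g(x := undefined)"
  have gg': "g = g'(x := g x)" by (simp add: g'_def)
  have "g' \<in> V \<rightarrow>\<^sub>E {..<q}" using g V(2) by (auto simp: g'_def block_colorings_def PiE_def extensional_def Pi_def)
  moreover have ib: "inj_on g' b & g x ~: g' ` b"
   using g updx[of g' "g x"] gg' by (simp add: block_colorings_def extend_block_def)
  moreover have "inj_on g' c" if "c \<in> Q" for c
  proof (cases "c = b")
   case False
   then have "inj_on g c" using g that by (simp add: block_colorings_def extend_block_def)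
   then show ?thesis using upd[OF cV[OF that], of g' "g x"] gg' by simp
  qed (use ib in simp)
  moreover have "g x \<in> {..<q}" using g by (auto simp: block_colorings_def)
  ultimately have "(g', g x) \<in> ?S" by (simp add: block_colorings_def)
  then show "g \<in> (%(g, y). g(x := y)) ` ?S" using gg' by (intro image_eqI[of _ _ "(g', g x)"]) simp_all
 next
  fix g assume "g \<in> (%(g, y). g(x := y)) ` ?S"
  then obtain g' y where g': "g' \<in> ?G" "y \<in> {..<q} - g' ` b" "g = g'(x := y)" by auto
  have "g \<in> insert x V \<rightarrow>\<^sub>E {..<q}"
   using g' by (auto simp: block_colorings_def intro!: PiE_fun_upd)
  moreover have "inj_on g (insert x b)" using updx[of g' y] inj[OF g'(1)] g' by simp
  moreover have "inj_on g c" if "c \<in> Q" for c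
   using upd[OF cV[OF that], of g' y] that g' by (auto simp: block_colorings_def)
  ultimately show "g \<in> block_colorings (insert x V) (extend_block x Q b) q"
   by (auto simp: block_colorings_def extend_block_def)
 qed
 moreover have "inj_on (%(g, y). g(x := y)) ?S"
 proof (rule inj_onI, clarify)
  fix g y g' y' assume h: "g \<in> ?G" "g' \<in> ?G" "g(x := y) = g'(x := y')"
  have "g x = undefined" "g' x = undefined" using h(1,2) V(2) by (auto simp: block_colorings_def PiE_def extensional_def)
  then show "g = g' & y = y'" using h(3) by (metis fun_upd_same fun_upd_triv fun_upd_upd)
 qed
 ultimately have "card (block_colorings (insert x V) (extend_block x Q b) q) = card ?S"
  by (simp add: card_image)
 also have "\<dots> = (\<Sum>g\<in>?G. card ({..<q} - g ` b))" using finG by (intro card_SigmaI) auto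
 finally have "int (card (block_colorings (insert x V) (extend_block x Q b) q)) =
   (\<Sum>g\<in>?G. int (card ({..<q} - g ` b)))" by simp
 also have "\<dots> = (\<Sum>g\<in>?G. int q - int (card b))"
 proof (intro sum.cong refl)
  fix g assume g: "g \<in> ?G"
  have sub: "g ` b <= {..<q}" using g bV by (auto simp: block_colorings_def)
  have "card (g ` b) = card b" using inj[OF g] by (rule card_image)
  moreover have "card (g ` b) <= card {..<q}" using sub by (intro card_mono) auto
  moreover have "card ({..<q} - g ` b) = card {..<q} - card (g ` b)"
   using sub finite_subset by (intro card_Diff_subset) auto
  ultimately show "int (card ({..<q} - g ` b)) = int q - int (card b)" by simp
 qed
 finally show ?thesis by (simp add: mult.commute)
qed

lemma poly_eqI_nat:
 fixes p r :: "int poly"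
 assumes "!!q :: nat. q > 0 ==> poly p (int q) = poly r (int q)"
 shows "p = r"
proof (rule ccontr)
 assume "p ~= r"
 then have "finite {x. poly (p - r) x = 0}" by (intro poly_roots_finite) simp
 moreover have "int ` {0<..} <= {x. poly (p - r) x = 0}" using assms by auto
 ultimately have "finite (int ` {0<..})" by (rule rev_finite_subset)
 then have "finite {0::nat<..}" by (rule finite_imageD) (simp add: inj_on_def)
 then show False using infinite_Ioi by blast
qed

text \<open>Comparison at all positive integers q. For a new singleton the additional factor q is
  matched by the additional block in the exponent of q, so the polynomial does not change.\<close>

lemma part_char_extend:
 assumes Q: "partition_on {1..k} Q" and b: "b \<in> insert {} Q"
 shows "part_char (Suc k) (extend_block (Suc k) Q b) =
  (if b = {} then part_char k Q else [:- int (card b), 1:] * part_char k Q)"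
proof (rule poly_eqI_nat)
 fix q :: nat assume q: "q > 0"
 have V: "finite {1..k}" "Suc k ~: {1..k}" "{1..Suc k} = insert (Suc k) {1..k}" by auto
 note P = partition_on_extend_block[OF Q V(2) b]
 have "int q ^ card (extend_block (Suc k) Q b) * poly (part_char (Suc k) (extend_block (Suc k) Q b)) (int q) =
   (int q - int (card b)) * (int q ^ card Q * poly (part_char k Q) (int q))"
  using part_char_colorings[of "Suc k" "extend_block (Suc k) Q b" q] P part_char_colorings[OF Q, of q]
   card_block_colorings_extend[OF Q V(1,2) b, of q]
  unfolding V(3) by metis
 then show "poly (part_char (Suc k) (extend_block (Suc k) Q b)) (int q) =
   poly (if b = {} then part_char k Q else [:- int (card b), 1:] * part_char k Q) (int q)"
 proof (cases "b = {}")
  case False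
  then have "int q ^ card Q * poly (part_char (Suc k) (extend_block (Suc k) Q b)) (int q) =
    int q ^ card Q * ((int q - int (card b)) * poly (part_char k Q) (int q))"
   using \<open>int q ^ _ * _ = _\<close> by (simp add: card_extend_block[OF Q V(1,2) b] mult.left_commute)
  then have "poly (part_char (Suc k) (extend_block (Suc k) Q b)) (int q) =
    (int q - int (card b)) * poly (part_char k Q) (int q)" using q by simp
  then show ?thesis using False by (simp add: algebra_simps)
 next
  case True
  then have "card (extend_block (Suc k) Q b) = Suc (card Q)"
   using card_extend_block[OF Q V(1,2) b] by simp
  then have "int q ^ Suc (card Q) * poly (part_char (Suc k) (extend_block (Suc k) Q b)) (int q) =
    int q ^ Suc (card Q) * poly (part_char k Q) (int q)"
   using \<open>int q ^ _ * _ = _\<close> True by simp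
  then show ?thesis using q True by (simp only: mult_cancel_left) simp
 qed
qed

section \<open>The recursion for braid matroids\<close>

definition real_eval :: "int poly => real => real" where
 "real_eval p t = poly (map_poly real_of_int p) t"

lemma real_eval_0 [simp]: "real_eval 0 t = 0"
 by (simp add: real_eval_def)

lemma real_eval_pCons [simp]: "real_eval (pCons a p) t = real_of_int a + t * real_eval p t"
 by (simp add: real_eval_def map_poly_pCons)

lemma real_eval_1 [simp]: "real_eval 1 t = 1"
 by (simp add: one_pCons)

lemma real_eval_add [simp]: "real_eval (p + q) t = real_eval p t + real_eval q t"
 by (induction p q rule: poly_induct2) (simp_all add: algebra_simps)

lemma real_eval_smult [simp]: "real_eval (smult a p) t = real_of_int a * real_eval p t"
 by (induction p) (simp_all add: algebra_simps)

lemma real_eval_diff [simp]: "real_eval (p - q) t = real_eval p t - real_eval q t"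
 using real_eval_add[of "p - q" q t] by simp

lemma real_eval_mult [simp]: "real_eval (p * q) t = real_eval p t * real_eval q t"
 by (induction p) (simp_all add: algebra_simps)

lemma real_eval_sum [simp]: "real_eval (sum f A) t = (\<Sum>x\<in>A. real_eval (f x) t)"
 by (induction A rule: infinite_finite_induct) simp_all

lemma real_eval_altdef: "degree p <= d ==> real_eval p t = (\<Sum>i\<le>d. real_of_int (coeff p i) * t ^ i)"
proof -
 assume d: "degree p <= d"
 have "degree (map_poly real_of_int p) <= degree p" by (simp add: degree_map_poly)
 then have "real_eval p t = (\<Sum>i\<le>d. coeff (map_poly real_of_int p) i * t ^ i)"
  unfolding real_eval_def poly_altdef using d
  by (intro sum.mono_neutral_left) (auto simp: coeff_eq_0)
 then show ?thesis by (simp add: coeff_map_poly)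
qed

lemma real_eval_reversal:
 assumes "degree p <= d" "t ~= 0"
 shows "real_eval (reversal d p) t = t ^ d * real_eval p (1 / t)"
proof -
 have "real_eval (reversal d p) t = (\<Sum>i\<le>d. real_of_int (coeff p (d - i)) * t ^ i)"
  using assms by (subst real_eval_altdef[OF degree_reversal]) (simp_all add: coeff_reversal)
 also have "\<dots> = (\<Sum>i\<le>d. real_of_int (coeff p i) * t ^ (d - i))"
  by (rule sum.reindex_bij_witness[of _ "%i. d - i" "%i. d - i"]) auto
 also have "\<dots> = t ^ d * (\<Sum>i\<le>d. real_of_int (coeff p i) * (1 / t) ^ i)"
  unfolding sum_distrib_left using assms(2)
  by (intro sum.cong refl) (simp add: power_diff field_simps)
 finally show ?thesis using real_eval_altdef[OF assms(1)] by simp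
qed

text \<open>The right-hand side of the recursion with an arbitrary function of the number of blocks.
  The generality is needed for the next steps: removing a point changes the function.\<close>

definition partition_sum :: "nat => real => (nat => real) => real" where
 "partition_sum k t g = (\<Sum>Q | partition_on {1..k} Q. real_eval (part_char k Q) t * g (card Q))"

lemma partition_sum_0: "partition_sum 0 t g = g 0"
proof -
 have "{Q. partition_on {1..0::nat} Q} = {{}}" by (auto simp: partition_on_def)
 moreover have "part_flat 0 {} = {}" by (auto simp: part_flat_def mono_edges_def complete_edges)
 moreover have "{} \<in> flats (braid_matroid 0)" by (rule empty_flat[OF matroid_braid loopless_braid])
 ultimately show ?thesis
  by (simp add: partition_sum_def part_char_def ranked_family.chi_self[OF ranked_family_flats[OF matroid_braid]])
qed

text \<open>The last point is either a singleton, which raises the number of blocks, or lies in a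
  block b and contributes t - |b|; over m blocks of k points these factors add up to t m -
  k.\<close>

lemma partition_sum_Suc:
 "partition_sum (Suc k) t g = partition_sum k t (%m. g (Suc m) + (t * real m - real k) * g m)"
proof -
 have V: "finite {1..k}" "Suc k ~: {1..k}" "{1..Suc k} = insert (Suc k) {1..k}" by auto
 show ?thesis
  unfolding partition_sum_def V(3) sum_partitions_insert[OF V(1,2)]
 proof (intro sum.cong refl)
  fix Q assume "Q \<in> {Q. partition_on {1..k} Q}"
  then have Q: "partition_on {1..k} Q" by simp
  have ne: "b ~= {}" if "b \<in> Q" for b using partition_onD3[OF Q] that by auto
  have "(\<Sum>b\<in>Q. real_eval (part_char (Suc k) (extend_block (Suc k) Q b)) t * g (card (extend_block (Suc k) Q b))) =
   (\<Sum>b\<in>Q. (t - real (card b)) * (real_eval (part_char k Q) t * g (card Q)))"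
  proof (intro sum.cong refl)
   fix b assume b: "b \<in> Q"
   then show "real_eval (part_char (Suc k) (extend_block (Suc k) Q b)) t * g (card (extend_block (Suc k) Q b)) =
     (t - real (card b)) * (real_eval (part_char k Q) t * g (card Q))"
    using ne[OF b] by (simp add: part_char_extend[OF Q] card_extend_block[OF Q V(1,2)] algebra_simps)
  qed
  also have "\<dots> = (\<Sum>b\<in>Q. t - real (card b)) * (real_eval (part_char k Q) t * g (card Q))"
   by (simp add: sum_distrib_right)
  also have "(\<Sum>b\<in>Q. t - real (card b)) = t * real (card Q) - real k"
   using sum_card_partition[OF Q] by (simp add: sum_subtractf mult.commute flip: of_nat_sum)
  finally show "real_eval (part_char (Suc k) (extend_block (Suc k) Q {})) t * g (card (extend_block (Suc k) Q {})) +
    (\<Sum>b\<in>Q. real_eval (part_char (Suc k) (extend_block (Suc k) Q b)) t * g (card (extend_block (Suc k) Q b))) =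
    real_eval (part_char k Q) t * (g (Suc (card Q)) + (t * real (card Q) - real k) * g (card Q))"
   by (simp add: part_char_extend[OF Q] card_extend_block[OF Q V(1,2)] algebra_simps)
 qed
qed

lemma kl_braid_degree: "k >= 2 ==> 2 * degree (kl_poly (braid_matroid k)) < k - 1"
 using kl_of_props(2)[OF matroid_braid loopless_braid, of k] kl_poly_eq[OF matroid_braid loopless_braid, of k]
 by (simp add: rank_braid kl_of_def matroid_braid loopless_braid)

lemma kl_braid_1: "kl_poly (braid_matroid 1) = 1"
 using kl_of_props(1)[OF matroid_braid loopless_braid, of 1] kl_poly_eq[OF matroid_braid loopless_braid, of 1]
 by (simp add: rank_braid kl_of_def matroid_braid loopless_braid)

lemma klp_part_flat:
 assumes Q: "partition_on {1..k} Q"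
 shows "klp (flats (braid_matroid k)) (rank_of (braid_matroid k)) (part_flat k Q) =
  kl_poly (braid_matroid (card Q))"
proof -
 have "finite Q" by (rule finite_partition[OF Q]) simp
 then obtain \<beta> where \<beta>: "bij_betw \<beta> Q {1..card Q}" using ex_bij_betw_finite_nat[of Q]
  by (metis card_atLeastAtMost diff_Suc_1 finite_atLeastAtMost finite_same_card_bij)
 have "(\<beta> \<circ> block_of Q) ` {1..k} = {1..card Q}"
  using \<beta> block_of_image[OF Q] by (metis bij_betw_imp_surj_on image_comp)
 moreover have "mono_edges k (\<beta> \<circ> block_of Q) = part_flat k Q"
  unfolding part_flat_def edge_set_eq_iff[OF mono_edges_subset mono_edges_subset] mono_edges_iff edge_iff comp_def
  using \<beta> block_of_mem(1)[OF Q] by (metis bij_betw_def inj_on_eq_iff)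
 ultimately show ?thesis
  using klp_braid_interval[of "\<beta> \<circ> block_of Q" k "card Q"] kl_poly_eq[OF matroid_braid loopless_braid]
  by metis
qed

theorem kl_braid_recursion:
 assumes "k > 0" "t ~= 0"
 shows "t ^ (k - 1) * real_eval (kl_poly (braid_matroid k)) (1 / t) =
  partition_sum k t (%m. real_eval (kl_poly (braid_matroid m)) t)"
proof -
 let ?L = "flats (braid_matroid k)" and ?r = "rank_of (braid_matroid k)"
 interpret ranked_family ?L ?r by (rule ranked_family_flats[OF matroid_braid])
 have E: "{} \<in> ?L" by (rule empty_flat[OF matroid_braid loopless_braid])
 have U: "?r (\<Union>?L) - ?r {} = k - 1"
  using Union_flats[OF matroid_braid, of k] rank_braid[OF assms(1)] rank_empty[OF matroid_braid, of k] by simp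
 have kl: "kl_poly (braid_matroid k) = klp ?L ?r {}" by (rule kl_poly_eq[OF matroid_braid loopless_braid])
 have deg: "degree (kl_poly (braid_matroid k)) <= k - 1"
  unfolding kl using degree_klp_le[OF E] U by simp
 have "reversal (k - 1) (kl_poly (braid_matroid k)) = (\<Sum>F\<in>?L. chi ?L ?r {} F * klp ?L ?r F)"
  using klp_recursion[OF E] unfolding kl U by simp
 also have "\<dots> = (\<Sum>Q | partition_on {1..k} Q. part_char k Q * kl_poly (braid_matroid (card Q)))"
  by (subst sum.reindex_bij_betw[OF part_flat_bij, symmetric]) (simp add: part_char_def klp_part_flat)
 finally show ?thesis
  using real_eval_reversal[OF deg assms(2)] by (simp add: partition_sum_def)
qed

section \<open>A parametrized system of differential equations for power series\<close>

definition agree :: "nat => real fps => real fps => bool" where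
 "agree n x y \<longleftrightarrow> (\<forall>i<n. fps_nth x i = fps_nth y i)"

lemma agree_refl [simp]: "agree n x x"
 and agree_0 [simp]: "agree 0 x y"
 by (simp_all add: agree_def)

lemma agree_add: "agree n x y ==> agree n u v ==> agree n (x + u) (y + v)"
 and agree_diff: "agree n x y ==> agree n u v ==> agree n (x - u) (y - v)"
 by (simp_all add: agree_def)

lemma agree_mult: "agree n x y ==> agree n u v ==> agree n (x * u) (y * v)"
 by (auto simp: agree_def fps_mult_nth intro!: sum.cong)

lemma agree_power: "agree n x y ==> agree n (x ^ k) (y ^ k)"
 by (induction k) (auto intro: agree_mult)

lemma agree_integral: "agree n x y ==> agree (Suc n) (fps_integral x c) (fps_integral y c)"
 by (auto simp: agree_def fps_integral_def)

lemma agree_trans: "agree n x y ==> agree n y z ==> agree n x z"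
 and agree_sym: "agree n x y ==> agree n y x"
 by (simp_all add: agree_def)

lemma agree_all: "(!!n. agree n x y) ==> x = y"
 by (intro fps_ext) (auto simp: agree_def)

lemma agree_inverse:
 assumes "agree n x y" "fps_nth x 0 ~= 0" "fps_nth y 0 ~= 0"
 shows "agree n (inverse x) (inverse y)"
proof -
 have "agree n ((inverse x * inverse y) * y) ((inverse x * inverse y) * x)"
  using agree_sym[OF assms(1)] by (intro agree_mult) auto
 then show ?thesis
  using assms inverse_mult_eq_1[of x] inverse_mult_eq_1[of y]
  by (metis mult.assoc mult.commute mult.right_neutral)
qed

text \<open>Agreement up to order n passes to the derivatives and from there to order n + 1.\<close>

lemma fps_deriv_determined:
 assumes "fps_nth x 0 = fps_nth y 0"
  and step: "!!n. agree n x y ==> agree n (fps_deriv x) (fps_deriv y)"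
 shows "x = (y :: real fps)"
proof (rule agree_all)
 fix n show "agree n x y"
 proof (induction n)
  case (Suc n)
  have "fps_nth x n = fps_nth y n"
  proof (cases n)
   case (Suc m)
   then have "agree n (fps_deriv x) (fps_deriv y)" using Suc.IH step by simp
   then have "fps_nth (fps_deriv x) m = fps_nth (fps_deriv y) m" using Suc by (simp add: agree_def)
   then show ?thesis using Suc by simp
  qed (use assms in simp)
  then show ?case using Suc.IH by (auto simp: agree_def less_Suc_eq)
 qed simp
qed

lemma fps_linear_ode_zero:
 assumes "fps_deriv x = c * x" "fps_nth x 0 = 0"
 shows "x = (0 :: real fps)"
proof (rule fps_deriv_determined)
 fix n assume "agree n x 0"
 then show "agree n (fps_deriv x) (fps_deriv 0)"
  using agree_mult[of n c c x 0] assms(1) by simp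
qed (use assms in simp)

text \<open>The components are \<open>\<nu>\<close>, \<open>G\<close>, \<open>J = 1 / (1 - \<nu>\<^sup>2)\<close> and \<open>h\<close>.\<close>

definition picard :: "real => real fps \<times> real fps \<times> real fps \<times> real fps =>
  real fps \<times> real fps \<times> real fps \<times> real fps" where
 "picard s = (%(a, b, c, d).
   (fps_integral (b * (1 + fps_const s * a) * c) 0,
   fps_integral (b ^ 2 * a * c) 1,
   fps_integral (2 * a * (b * (1 + fps_const s * a) * c) * c ^ 2) 1,
   fps_integral ((1 + fps_const s * d) * b) 0))"

fun agree4 :: "nat => real fps \<times> real fps \<times> real fps \<times> real fps =>
  real fps \<times> real fps \<times> real fps \<times> real fps => bool" where
 "agree4 n (a, b, c, d) (a', b', c', d') \<longleftrightarrow> agree n a a' & agree n b b' & agree n c c' & agree n d d'"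

lemma agree4_picard: "agree4 n x y ==> agree4 (Suc n) (picard s x) (picard s y)"
 by (cases x; cases y)
  (auto simp: picard_def intro!: agree_integral agree_mult agree_add agree_power)

definition iterate :: "real => nat => real fps \<times> real fps \<times> real fps \<times> real fps" where
 "iterate s n = (picard s ^^ n) (0, 0, 0, 0)"

lemma iterate_Suc: "iterate s (Suc n) = picard s (iterate s n)"
 by (simp add: iterate_def)

lemma agree4_iterate_Suc: "agree4 n (iterate s n) (iterate s (Suc n))"
proof (induction n)
 case 0
 then show ?case by (cases "iterate s 0"; cases "iterate s (Suc 0)") simp
next
 case (Suc n)
 then show ?case by (metis agree4_picard iterate_Suc)
qed

lemma agree4_refl: "agree4 n x x" by (cases x) simp

lemma agree4_trans: "agree4 n x y ==> agree4 n y z ==> agree4 n x z"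
 by (cases x; cases y; cases z) (auto intro: agree_trans)

lemma agree4_mono: "agree4 n x y ==> m <= n ==> agree4 m x y"
 by (cases x; cases y) (auto simp: agree_def)

lemma agree4_iterate: "n <= m ==> agree4 n (iterate s n) (iterate s m)"
proof (induction m rule: dec_induct)
 case (step m)
 then show ?case using agree4_iterate_Suc agree4_mono agree4_trans by blast
qed (rule agree4_refl)

text \<open>The limit of the iteration, taken along the diagonal: each application of
  \<open>picard\<close> gains one order, so the coefficient of order n is final from iterate n + 1
  on.\<close>

definition ode_nu :: "real => real fps" where
 "ode_nu s = Abs_fps (%n. fps_nth (fst (iterate s (Suc n))) n)"
definition ode_G :: "real => real fps" where
 "ode_G s = Abs_fps (%n. fps_nth (fst (snd (iterate s (Suc n)))) n)"
definition ode_J :: "real => real fps" where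
 "ode_J s = Abs_fps (%n. fps_nth (fst (snd (snd (iterate s (Suc n))))) n)"
definition ode_h :: "real => real fps" where
 "ode_h s = Abs_fps (%n. fps_nth (snd (snd (snd (iterate s (Suc n))))) n)"

abbreviation ode_sol :: "real => real fps \<times> real fps \<times> real fps \<times> real fps" where
 "ode_sol s \<equiv> (ode_nu s, ode_G s, ode_J s, ode_h s)"

lemma agree4_ode_sol: "agree4 n (iterate s n) (ode_sol s)"
proof -
 obtain a b c d where it: "iterate s n = (a, b, c, d)" by (cases "iterate s n")
 have "agree4 (Suc i) (iterate s (Suc i)) (a, b, c, d)" if "i < n" for i
  using agree4_iterate[of "Suc i" n s] that it by simp
 then have "fps_nth a i = fps_nth (ode_nu s) i & fps_nth b i = fps_nth (ode_G s) i &
   fps_nth c i = fps_nth (ode_J s) i & fps_nth d i = fps_nth (ode_h s) i" if "i < n" for i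
  using that unfolding ode_nu_def ode_G_def ode_J_def ode_h_def
  by (cases "iterate s (Suc i)") (fastforce simp: agree_def)
 then show ?thesis by (simp add: it agree_def)
qed

lemma picard_ode_sol: "picard s (ode_sol s) = ode_sol s"
proof -
 have "agree4 (Suc n) (picard s (ode_sol s)) (ode_sol s)" for n
 proof -
  have "agree4 (Suc n) (picard s (iterate s n)) (picard s (ode_sol s))"
   by (rule agree4_picard[OF agree4_ode_sol])
  moreover have "agree4 (Suc n) (picard s (iterate s n)) (ode_sol s)"
   using agree4_ode_sol[of "Suc n" s] by (simp add: iterate_Suc)
  moreover have "agree4 k x y ==> agree4 k y x" for k x y
   by (cases x; cases y) (auto intro: agree_sym)
  ultimately show ?thesis using agree4_trans by blast
 qed
 then have "agree4 n (picard s (ode_sol s)) (ode_sol s)" for n using agree4_mono by (metis le_SucI order_refl)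
 then show ?thesis by (cases "picard s (ode_sol s)") (auto intro: agree_all)
qed

lemma ode_fixpoint:
 "ode_nu s = fps_integral (ode_G s * (1 + fps_const s * ode_nu s) * ode_J s) 0"
 "ode_G s = fps_integral (ode_G s ^ 2 * ode_nu s * ode_J s) 1"
 "ode_J s = fps_integral (2 * ode_nu s * (ode_G s * (1 + fps_const s * ode_nu s) * ode_J s) * ode_J s ^ 2) 1"
 "ode_h s = fps_integral ((1 + fps_const s * ode_h s) * ode_G s) 0"
 using picard_ode_sol[of s] by (simp_all add: picard_def)

lemma ode_deriv:
 "fps_deriv (ode_nu s) = ode_G s * (1 + fps_const s * ode_nu s) * ode_J s"
 "fps_deriv (ode_G s) = ode_G s ^ 2 * ode_nu s * ode_J s"
 "fps_deriv (ode_J s) = 2 * ode_nu s * fps_deriv (ode_nu s) * ode_J s ^ 2"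
 "fps_deriv (ode_h s) = (1 + fps_const s * ode_h s) * ode_G s"
 by (subst ode_fixpoint, simp add: fps_deriv_fps_integral)+

lemma ode_init:
 "fps_nth (ode_nu s) 0 = 0" "fps_nth (ode_G s) 0 = 1" "fps_nth (ode_J s) 0 = 1" "fps_nth (ode_h s) 0 = 0"
 by (subst ode_fixpoint, simp)+

lemma ode_J_eq: "ode_J s * (1 - ode_nu s ^ 2) = 1"
proof -
 let ?E = "ode_J s * (1 - ode_nu s ^ 2) - 1"
 have "fps_deriv ?E = (2 * ode_nu s * fps_deriv (ode_nu s) * ode_J s) * ?E"
  by (simp add: ode_deriv(3) power2_eq_square algebra_simps)
 then have "?E = 0" by (rule fps_linear_ode_zero) (simp add: ode_init power2_eq_square)
 then show ?thesis by simp
qed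

text \<open>A first integral of the system: the defect satisfies a homogeneous linear equation and
  has no constant term. At s = 0 it reads nu = X G.\<close>

lemma ode_G_eq: "ode_G s * (fps_const s + fps_X) = fps_const s + ode_nu s"
proof -
 let ?H = "ode_G s * (fps_const s + fps_X) - (fps_const s + ode_nu s)"
 let ?n = "ode_nu s" and ?G = "ode_G s" and ?J = "ode_J s"
 have "fps_deriv ?H = ?G ^ 2 * ?n * ?J * (fps_const s + fps_X) + ?G * (?J * (1 - ?n ^ 2))
   - ?G * (1 + fps_const s * ?n) * ?J"
  by (simp add: ode_deriv(1,2) ode_J_eq)
 also have "\<dots> = (?G * ?n * ?J) * ?H" by (simp add: power2_eq_square algebra_simps)
 finally have "?H = 0" by (rule fps_linear_ode_zero) (simp add: ode_init)
 then show ?thesis by simp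
qed

lemma ode_nu_deriv:
 "fps_deriv (ode_nu s) * (1 - ode_nu s ^ 2) = ode_G s * (1 + fps_const s * ode_nu s)"
 using ode_J_eq[of s] by (simp add: ode_deriv(1) mult.assoc)

lemma ode_G_deriv:
 "fps_deriv (ode_G s) * (1 + fps_const s * ode_nu s) = ode_G s * ode_nu s * fps_deriv (ode_nu s)"
 by (simp add: ode_deriv(1,2) power2_eq_square algebra_simps)

section \<open>The inversion symmetry\<close>

text \<open>By \<open>ode_phi_eq_kl\<close> this is, for s nonzero, the exponential generating
  function of s^(n-1) P(1 / s^2) over the braid matroids. Since f' = 1 + s h, its coefficients of
  order at least two carry a factor s.\<close>

definition ode_f :: "real => real fps" where
 "ode_f s = fps_integral (1 + fps_const s * ode_h s) 0"

lemma ode_f_deriv: "fps_deriv (ode_f s) = 1 + fps_const s * ode_h s"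
 by (simp add: ode_f_def fps_deriv_fps_integral)

lemma ode_f_0: "fps_nth (ode_f s) 0 = 0"
 by (simp add: ode_f_def)

lemma ode_f_deriv2: "fps_deriv (fps_deriv (ode_f s)) = fps_const s * fps_deriv (ode_f s) * ode_G s"
 by (simp add: ode_f_deriv ode_deriv(4) mult.assoc)

text \<open>The series \<open>s ((1 + s y)\<^bsup>1/s\<^sup>2\<^esup> - 1)\<close>.\<close>

definition shift_fps :: "real => real fps" where
 "shift_fps s = Abs_fps (%n. if n = 0 then 0 else (\<Prod>j=1..<n. 1 / s - real j * s) / fact n)"

lemma shift_fps_0: "fps_nth (shift_fps s) 0 = 0"
 by (simp add: shift_fps_def)

lemma shift_fps_deriv:
 assumes "s ~= 0"
 shows "(1 + fps_const s * fps_X) * fps_deriv (shift_fps s) = 1 + fps_const (1 / s) * shift_fps s"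
proof (rule fps_ext)
 fix n
 let ?P = "%n. \<Prod>j=1..<n. 1 / s - real j * s"
 have nth: "fps_nth (shift_fps s) n = (if n = 0 then 0 else ?P n / fact n)" for n by (simp add: shift_fps_def)
 have "fps_nth ((1 + fps_const s * fps_X) * fps_deriv (shift_fps s)) n =
   real (Suc n) * fps_nth (shift_fps s) (Suc n) + s * real n * fps_nth (shift_fps s) n"
  by (cases n) (simp_all add: distrib_right mult.assoc fps_X_mult_nth)
 also have "\<dots> = fps_nth (1 + fps_const (1 / s) * shift_fps s) n"
 proof (cases "n = 0")
  case False
  have "real (Suc n) * fps_nth (shift_fps s) (Suc n) = ?P n * (1 / s - real n * s) / fact n"
   using False by (simp add: nth prod.atLeastLessThan_Suc field_simps del: of_nat_Suc)
  then show ?thesis using False by (simp add: nth field_simps)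
 qed (simp add: nth)
 finally show "fps_nth ((1 + fps_const s * fps_X) * fps_deriv (shift_fps s)) n =
   fps_nth (1 + fps_const (1 / s) * shift_fps s) n" .
qed

text \<open>After the substitution the equation for nu becomes x' (1 - x^2) (1 + s X) = (1 + x / s)
  (1 + s x). The right-hand side is unchanged under s -> 1 / s, and the series with parameter 1 / s
  satisfies the same equation.\<close>

lemma ode_nu_shift:
 assumes s: "s ~= 0"
 shows "ode_nu s oo shift_fps s = ode_nu (1 / s)"
proof -
 let ?K = "shift_fps s" and ?Y = "1 + fps_const s * fps_X :: real fps" and ?r = "fps_const (1 / s) :: real fps"
 note K0 = shift_fps_0[of s]
 have sr: "fps_const s * ?r = 1" using s by simp
 define R where "R x = ?r * (fps_const s + x) * (1 + fps_const s * x)" for x :: "real fps"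
 have 1: "fps_deriv (ode_nu s oo ?K) * (1 - (ode_nu s oo ?K) ^ 2) * ?Y = R (ode_nu s oo ?K)"
 proof -
  have eq: "fps_deriv (ode_nu s) * (1 - ode_nu s ^ 2) * (fps_const s + fps_X) =
    (fps_const s + ode_nu s) * (1 + fps_const s * ode_nu s)"
  proof -
   have "fps_deriv (ode_nu s) * (1 - ode_nu s ^ 2) * (fps_const s + fps_X) =
     (ode_G s * (fps_const s + fps_X)) * (1 + fps_const s * ode_nu s)"
    unfolding ode_nu_deriv by (simp only: ac_simps)
   then show ?thesis unfolding ode_G_eq .
  qed
  have "(fps_deriv (ode_nu s) * (1 - ode_nu s ^ 2) * (fps_const s + fps_X)) oo ?K =
    (fps_deriv (ode_nu s) oo ?K) * (1 - (ode_nu s oo ?K) ^ 2) * (fps_const s + ?K)"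
   using K0 by (simp add: fps_compose_mult_distrib fps_compose_add_distrib fps_compose_sub_distrib fps_compose_power)
  moreover have "((fps_const s + ode_nu s) * (1 + fps_const s * ode_nu s)) oo ?K =
    (fps_const s + (ode_nu s oo ?K)) * (1 + fps_const s * (ode_nu s oo ?K))"
   using K0 by (simp add: fps_compose_mult_distrib fps_compose_add_distrib)
  ultimately have comp: "(fps_deriv (ode_nu s) oo ?K) * (1 - (ode_nu s oo ?K) ^ 2) * (fps_const s + ?K) =
    (fps_const s + (ode_nu s oo ?K)) * (1 + fps_const s * (ode_nu s oo ?K))" using eq by simp
  have "?Y * fps_deriv ?K = ?r * (fps_const s + ?K)"
   using shift_fps_deriv[OF s] sr by (simp add: distrib_left mult.commute)
  then have "fps_deriv (ode_nu s oo ?K) * (1 - (ode_nu s oo ?K) ^ 2) * ?Y =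
    ?r * ((fps_deriv (ode_nu s) oo ?K) * (1 - (ode_nu s oo ?K) ^ 2) * (fps_const s + ?K))"
   using fps_compose_deriv[OF K0, of "ode_nu s"] by (simp add: mult.assoc mult.left_commute mult.commute)
  then show ?thesis unfolding comp R_def by (simp add: mult.assoc)
 qed
 have 2: "fps_deriv (ode_nu (1 / s)) * (1 - ode_nu (1 / s) ^ 2) * ?Y = R (ode_nu (1 / s))"
 proof -
  let ?n = "ode_nu (1 / s)"
  have Y: "?Y = fps_const s * (?r + fps_X)" using sr by (simp add: distrib_left)
  have "fps_deriv ?n * (1 - ?n ^ 2) * (?r + fps_X) = (1 + ?r * ?n) * (?r + ?n)"
  proof -
   have "fps_deriv ?n * (1 - ?n ^ 2) * (?r + fps_X) = (1 + ?r * ?n) * (ode_G (1 / s) * (?r + fps_X))"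
    unfolding ode_nu_deriv by (simp only: ac_simps)
   then show ?thesis unfolding ode_G_eq .
  qed
  then have "fps_deriv ?n * (1 - ?n ^ 2) * ?Y = fps_const s * ((1 + ?r * ?n) * (?r + ?n))"
   unfolding Y by (simp add: mult.left_commute)
  also have "\<dots> = (fps_const s * ?r) * (fps_const s * ((1 + ?r * ?n) * (?r + ?n)))" using sr by simp
  also have "\<dots> = ?r * (fps_const s * (1 + ?r * ?n)) * (fps_const s * (?r + ?n))"
   by (simp only: ac_simps)
  also have "fps_const s * (1 + ?r * ?n) = fps_const s + ?n"
   using sr by (simp add: distrib_left flip: mult.assoc)
  also have "fps_const s * (?r + ?n) = 1 + fps_const s * ?n" using sr by (simp add: distrib_left)
  finally show ?thesis by (simp add: R_def)
 qed
 show ?thesis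
 proof (rule fps_deriv_determined)
  show "fps_nth (ode_nu s oo ?K) 0 = fps_nth (ode_nu (1 / s)) 0" using ode_init by simp
  fix n assume ag: "agree n (ode_nu s oo ?K) (ode_nu (1 / s))"
  have solve: "fps_deriv x = R x * inverse ((1 - x ^ 2) * ?Y)"
   if "fps_deriv x * (1 - x ^ 2) * ?Y = R x" "fps_nth x 0 = 0" for x
  proof -
   have "fps_nth ((1 - x ^ 2) * ?Y) 0 ~= 0" using that(2) by (simp add: power2_eq_square)
   then have "((1 - x ^ 2) * ?Y) * inverse ((1 - x ^ 2) * ?Y) = 1" by (rule inverse_mult_eq_1')
   then have "fps_deriv x = fps_deriv x * (((1 - x ^ 2) * ?Y) * inverse ((1 - x ^ 2) * ?Y))" by simp
   also have "\<dots> = (fps_deriv x * (1 - x ^ 2) * ?Y) * inverse ((1 - x ^ 2) * ?Y)" by (simp only: mult.assoc)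
   finally show ?thesis unfolding that(1) .
  qed
  have "agree n (R (ode_nu s oo ?K)) (R (ode_nu (1 / s)))"
   unfolding R_def using ag by (intro agree_mult agree_add) auto
  moreover have "agree n (inverse ((1 - (ode_nu s oo ?K) ^ 2) * ?Y)) (inverse ((1 - ode_nu (1 / s) ^ 2) * ?Y))"
   using ag ode_init by (intro agree_inverse agree_mult agree_diff agree_power) (auto simp: power2_eq_square)
  ultimately show "agree n (fps_deriv (ode_nu s oo ?K)) (fps_deriv (ode_nu (1 / s)))"
   using solve[OF 1] solve[OF 2] ode_init by (simp add: agree_mult)
 qed
qed

text \<open>The derivatives Q of both sides solve the same linear equation (1 + s X) Q' = (1 / s +
  nu) Q, with nu taken at parameter 1 / s, and both have constant term 1.\<close>

theorem ode_f_shift: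
 assumes s: "s ~= 0"
 shows "ode_f s oo shift_fps s = ode_f (1 / s)"
proof -
 let ?K = "shift_fps s" and ?Y = "1 + fps_const s * fps_X :: real fps" and ?r = "fps_const (1 / s) :: real fps"
 note K0 = shift_fps_0[of s]
 have sr: "fps_const s * ?r = 1" using s by simp
 have K1: "fps_nth (fps_deriv ?K) 0 = 1" by (simp add: shift_fps_def)
 have YK: "?Y * fps_deriv ?K = 1 + ?r * ?K" by (rule shift_fps_deriv[OF s])
 have YK2: "?Y * fps_deriv (fps_deriv ?K) = (?r - fps_const s) * fps_deriv ?K"
 proof -
  have "?Y * fps_deriv (fps_deriv ?K) + fps_const s * fps_deriv ?K = ?r * fps_deriv ?K"
   using arg_cong[OF YK, of fps_deriv] by simp
  then show ?thesis by (simp only: left_diff_distrib eq_diff_eq)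
 qed
 define P where "P = fps_deriv (ode_f s) oo ?K"
 have P': "fps_deriv P = (fps_deriv (fps_deriv (ode_f s)) oo ?K) * fps_deriv ?K"
  unfolding P_def by (rule fps_compose_deriv[OF K0])
 have comp: "fps_deriv (fps_deriv (ode_f s)) oo ?K = fps_const s * P * (ode_G s oo ?K)"
  unfolding ode_f_deriv2 P_def using K0 by (simp add: fps_compose_mult_distrib)
 have GK: "(ode_G s oo ?K) * (fps_const s + ?K) = fps_const s + ode_nu (1 / s)"
 proof -
  have "(ode_G s * (fps_const s + fps_X)) oo ?K = (fps_const s + ode_nu s) oo ?K" by (simp add: ode_G_eq)
  then show ?thesis
   using K0 ode_nu_shift[OF s] by (simp add: fps_compose_mult_distrib fps_compose_add_distrib)
 qed
 let ?Q = "P * fps_deriv ?K"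
 have YQ: "?Y * fps_deriv ?Q = (?r + ode_nu (1 / s)) * ?Q"
 proof -
  have sYK: "fps_const s * (?Y * fps_deriv ?K) = fps_const s + ?K"
   unfolding YK using sr by (simp add: distrib_left flip: mult.assoc)
  have "?Y * fps_deriv ?Q = P * fps_deriv ?K * ((ode_G s oo ?K) * (fps_const s * (?Y * fps_deriv ?K)))
    + P * (?Y * fps_deriv (fps_deriv ?K))"
   by (simp add: P' comp algebra_simps)
  also have "\<dots> = P * fps_deriv ?K * (fps_const s + ode_nu (1 / s)) + P * ((?r - fps_const s) * fps_deriv ?K)"
   unfolding sYK GK YK2 ..
  also have "\<dots> = (?r + ode_nu (1 / s)) * ?Q" by (simp add: algebra_simps del: fps_const_sub)
  finally show ?thesis .
 qed
 let ?P' = "fps_deriv (ode_f (1 / s))"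
 have YP: "?Y * fps_deriv ?P' = (?r + ode_nu (1 / s)) * ?P'"
 proof -
  have Y: "?Y = fps_const s * (?r + fps_X)" using sr by (simp add: distrib_left)
  have "?Y * fps_deriv ?P' = (fps_const s * ?r) * (?P' * (ode_G (1 / s) * (?r + fps_X)))"
   unfolding Y ode_f_deriv2 by (simp only: ac_simps)
  then show ?thesis unfolding ode_G_eq sr by (simp add: mult.commute)
 qed
 have "?Q - ?P' = 0"
 proof (rule fps_linear_ode_zero)
  have Yinv: "inverse ?Y * ?Y = 1" by (rule inverse_mult_eq_1) simp
  have "?Y * fps_deriv (?Q - ?P') = (?r + ode_nu (1 / s)) * (?Q - ?P')"
   using YQ YP by (simp add: algebra_simps)
  moreover have "fps_deriv (?Q - ?P') = inverse ?Y * (?Y * fps_deriv (?Q - ?P'))"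
   using Yinv by (simp only: mult.assoc[symmetric] mult_1_left)
  ultimately show "fps_deriv (?Q - ?P') = (inverse ?Y * (?r + ode_nu (1 / s))) * (?Q - ?P')"
   by (simp only: mult.assoc)
  show "fps_nth (?Q - ?P') 0 = 0" using K1 by (simp add: P_def ode_f_deriv ode_init)
 qed
 then have "fps_deriv (ode_f s oo ?K) = fps_deriv (ode_f (1 / s))"
  using fps_compose_deriv[OF K0, of "ode_f s"] by (simp add: P_def)
 then show ?thesis by (subst (asm) fps_deriv_eq_iff) (simp add: ode_f_0)
qed

section \<open>Polynomial dependence on the parameter\<close>

text \<open>Polynomial coefficients make values and derivatives at s = 0 available, although the
  substitution behind the symmetry involves 1 / s.\<close>

definition poly_family :: "(real => real fps) => bool" where
 "poly_family X \<longleftrightarrow> (\<forall>n. \<exists>p. \<forall>s. fps_nth (X s) n = poly p s)"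

lemma poly_family_const: "poly_family (%_. x)"
 unfolding poly_family_def by (intro allI exI[of _ "[:fps_nth x _:]"]) simp

lemma poly_family_param: "poly_family fps_const"
 unfolding poly_family_def
proof
 fix n show "\<exists>p. \<forall>s :: real. fps_nth (fps_const s) n = poly p s"
 proof (cases n)
  case 0
  then have "\<forall>s. fps_nth (fps_const s) n = poly [:0, 1:] (s :: real)" by simp
  then show ?thesis by blast
 next
  case (Suc m)
  then have "\<forall>s. fps_nth (fps_const s) n = poly 0 (s :: real)" by simp
  then show ?thesis by blast
 qed
qed

lemma poly_family_add:
 assumes "poly_family X" "poly_family Y" shows "poly_family (%s. X s + Y s)"
 unfolding poly_family_def
proof
 fix n
 obtain p q where "!!s. fps_nth (X s) n = poly p s" "!!s. fps_nth (Y s) n = poly q s"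
  using assms unfolding poly_family_def by meson
 then show "\<exists>p. \<forall>s. fps_nth (X s + Y s) n = poly p s" by (intro exI[of _ "p + q"]) simp
qed

lemma poly_family_mult:
 assumes "poly_family X" "poly_family Y" shows "poly_family (%s. X s * Y s)"
 unfolding poly_family_def
proof
 fix n
 obtain p q where "!!s n. fps_nth (X s) n = poly (p n) s" "!!s n. fps_nth (Y s) n = poly (q n) s"
  using assms unfolding poly_family_def by metis
 then show "\<exists>p. \<forall>s. fps_nth (X s * Y s) n = poly p s"
  by (intro exI[of _ "\<Sum>i=0..n. p i * q (n - i)"]) (simp add: fps_mult_nth poly_sum)
qed

lemma poly_family_power: "poly_family X ==> poly_family (%s. X s ^ k)"
 by (induction k) (auto intro: poly_family_mult poly_family_const)

lemma poly_family_integral: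
 assumes "poly_family X" shows "poly_family (%s. fps_integral (X s) c)"
 unfolding poly_family_def
proof
 fix n
 obtain p where p: "!!s n. fps_nth (X s) n = poly (p n) s" using assms unfolding poly_family_def by metis
 show "\<exists>p. \<forall>s. fps_nth (fps_integral (X s) c) n = poly p s"
  by (intro exI[of _ "if n = 0 then [:c:] else smult (inverse (real n)) (p (n - 1))"])
   (simp add: fps_integral_def p)
qed

lemma poly_family_iterate:
 "poly_family (%s. fst (iterate s n)) & poly_family (%s. fst (snd (iterate s n))) &
  poly_family (%s. fst (snd (snd (iterate s n)))) & poly_family (%s. snd (snd (snd (iterate s n))))"
proof (induction n)
 case 0
 then show ?case by (simp add: iterate_def poly_family_const)
next
 case (Suc n)
 then show ?case
  unfolding iterate_Suc picard_def case_prod_beta fst_conv snd_conv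
  by (intro conjI poly_family_integral poly_family_mult poly_family_add poly_family_power
    poly_family_param poly_family_const) auto
qed

lemma poly_family_ode:
 "poly_family ode_nu" "poly_family ode_G" "poly_family ode_h"
 using poly_family_iterate unfolding poly_family_def ode_nu_def ode_G_def ode_h_def by simp_all

definition param_deriv :: "(real => real fps) => real fps => bool" where
 "param_deriv X x \<longleftrightarrow> (\<forall>n. ((%s. fps_nth (X s) n) has_real_derivative fps_nth x n) (at 0))"

lemma param_deriv_exists:
 assumes "poly_family X"
 obtains x where "param_deriv X x"
proof -
 obtain p where p: "!!s n. fps_nth (X s) n = poly (p n) s" using assms unfolding poly_family_def by metis
 have "param_deriv X (Abs_fps (%n. poly (pderiv (p n)) 0))"
  unfolding param_deriv_def p by (auto intro: poly_DERIV)
 then show ?thesis by (rule that)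
qed

lemma param_deriv_unique: "param_deriv X x ==> param_deriv X y ==> x = y"
 by (rule fps_ext) (auto simp: param_deriv_def intro: DERIV_unique)

lemma param_deriv_const: "param_deriv (%_. x) 0"
 by (simp add: param_deriv_def)

lemma param_deriv_param: "param_deriv fps_const 1"
 unfolding param_deriv_def
proof
 fix n show "((%s :: real. fps_nth (fps_const s) n) has_real_derivative fps_nth 1 n) (at 0)"
  by (cases n) (auto intro!: derivative_eq_intros)
qed

lemma param_deriv_add: "param_deriv X x ==> param_deriv Y y ==> param_deriv (%s. X s + Y s) (x + y)"
 by (auto simp: param_deriv_def intro!: DERIV_add)

lemma param_deriv_mult:
 assumes "param_deriv X x" "param_deriv Y y"
 shows "param_deriv (%s. X s * Y s) (x * Y 0 + X 0 * y)"
 unfolding param_deriv_def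
proof
 fix n
 have "((%s. \<Sum>i=0..n. fps_nth (X s) i * fps_nth (Y s) (n - i)) has_real_derivative
   (\<Sum>i=0..n. fps_nth x i * fps_nth (Y 0) (n - i) + fps_nth y (n - i) * fps_nth (X 0) i)) (at 0)"
  using assms unfolding param_deriv_def by (intro DERIV_sum DERIV_mult) auto
 then show "((%s. fps_nth (X s * Y s) n) has_real_derivative fps_nth (x * Y 0 + X 0 * y) n) (at 0)"
  by (simp add: fps_mult_nth sum.distrib mult.commute[of "fps_nth y _"])
qed

lemma param_deriv_deriv: "param_deriv X x ==> param_deriv (%s. fps_deriv (X s)) (fps_deriv x)"
 by (auto simp: param_deriv_def intro!: DERIV_cmult)

section \<open>First-order expansion at parameter zero\<close>

text \<open>At s = 0 the series belong to triangular cacti. With R = y G, the relation G' = G R R'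
  means R = y exp(R^2 / 2), so R is the series of hypertrees with a marked vertex, and W, which has
  y W' = R, that of unmarked ones.\<close>

abbreviation "cac_G \<equiv> ode_G 0"
abbreviation "cac_R \<equiv> ode_nu 0"
abbreviation "cac_W \<equiv> ode_h 0"

lemma cac_R: "cac_R = fps_X * cac_G"
 using ode_G_eq[of 0] by (simp add: mult.commute)

lemma cac_R_deriv: "fps_deriv cac_R * (1 - cac_R ^ 2) = cac_G"
 using ode_nu_deriv[of 0] by simp

lemma cac_G_deriv: "fps_deriv cac_G = cac_G * cac_R * fps_deriv cac_R"
 using ode_G_deriv[of 0] by simp

lemma cac_W_deriv: "fps_deriv cac_W = cac_G"
 using ode_deriv(4)[of 0] by simp

text \<open>Combinatorially, R^3 / 6 counts hypertrees with a marked edge, and the number of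
  vertices minus twice the number of edges is 1. The proof compares derivatives, using R' (1 - R^2)
  = G.\<close>

lemma cac_W: "cac_W = cac_R - fps_const (1 / 3) * cac_R ^ 3"
proof -
 have "fps_const (1 / 3) * (3 :: real fps) = 1" by (simp add: numeral_fps_const)
 then have third: "fps_const (1 / 3) * (3 * x) = (x :: real fps)" for x by (simp flip: mult.assoc)
 have "fps_deriv (cac_R - fps_const (1 / 3) * cac_R ^ 3) = fps_deriv cac_R * (1 - cac_R ^ 2)"
  by (simp add: fps_deriv_power third algebra_simps)
 then have "fps_deriv cac_W = fps_deriv (cac_R - fps_const (1 / 3) * cac_R ^ 3)"
  unfolding cac_W_deriv cac_R_deriv by simp
 then show ?thesis by (subst (asm) fps_deriv_eq_iff) (simp add: ode_init power3_eq_cube)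
qed

text \<open>Differentiating three relations in s at 0 gives linear equations for the first-order
  terms n1, G1, h1 of nu, G, h. One integrates to G1 = G (R n1 - R^3 / 3); together with n1 = y G1 +
  G - 1 and R' (1 - R^2) = G it yields G1 = R' (R G - R - R^3 / 3). Finally h1' = W G + G1 is
  integrated.\<close>

theorem ode_h_param_deriv:
 assumes "param_deriv ode_h h1"
 shows "h1 = cac_G - 1 - fps_const (1 / 2) * cac_R ^ 2 - fps_const (1 / 12) * cac_R ^ 4
  + fps_const (1 / 2) * cac_W ^ 2"
proof -
 obtain G1 where G1: "param_deriv ode_G G1" by (rule param_deriv_exists[OF poly_family_ode(2)])
 obtain n1 where n1: "param_deriv ode_nu n1" by (rule param_deriv_exists[OF poly_family_ode(1)])
 let ?R = cac_R and ?G = cac_G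
 have e1: "G1 * fps_X + ?G = 1 + n1"
 proof -
  have "param_deriv (%s. ode_G s * (fps_const s + fps_X)) (G1 * (fps_const 0 + fps_X) + ode_G 0 * (1 + 0))"
   by (intro param_deriv_mult G1 param_deriv_add param_deriv_param param_deriv_const)
  moreover have "param_deriv (%s. fps_const s + ode_nu s) (1 + n1)"
   by (intro n1 param_deriv_add param_deriv_param)
  ultimately show ?thesis unfolding ode_G_eq using param_deriv_unique by fastforce
 qed
 have e2: "fps_deriv G1 + fps_deriv ?G * ?R =
   G1 * ?R * fps_deriv ?R + ?G * n1 * fps_deriv ?R + ?G * ?R * fps_deriv n1"
 proof -
  have "param_deriv (%s. fps_deriv (ode_G s) * (1 + fps_const s * ode_nu s))
    (fps_deriv G1 * (1 + fps_const 0 * ode_nu 0) + fps_deriv (ode_G 0) * (0 + (1 * ode_nu 0 + fps_const 0 * n1)))"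
   by (intro param_deriv_mult param_deriv_deriv G1 n1 param_deriv_add param_deriv_param param_deriv_const)
  moreover have "param_deriv (%s. ode_G s * ode_nu s * fps_deriv (ode_nu s))
    ((G1 * ode_nu 0 + ode_G 0 * n1) * fps_deriv (ode_nu 0) + ode_G 0 * ode_nu 0 * fps_deriv n1)"
   by (intro param_deriv_mult param_deriv_deriv G1 n1)
  ultimately show ?thesis unfolding ode_G_deriv using param_deriv_unique by (fastforce simp: algebra_simps)
 qed
 have e3: "fps_deriv h1 = cac_W * ?G + G1"
 proof -
  have "param_deriv (%s. (1 + fps_const s * ode_h s) * ode_G s)
    ((0 + (1 * ode_h 0 + fps_const 0 * h1)) * ode_G 0 + (1 + fps_const 0 * ode_h 0) * G1)"
   by (intro param_deriv_mult param_deriv_deriv G1 assms param_deriv_add param_deriv_param param_deriv_const)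
  moreover have "param_deriv (%s. fps_deriv (ode_h s)) (fps_deriv h1)" by (intro param_deriv_deriv assms)
  ultimately show ?thesis unfolding ode_deriv(4) using param_deriv_unique by fastforce
 qed
 have init: "fps_nth x 0 = 0" if "param_deriv X x" "!!s. fps_nth (X s) 0 = c" for X x c
 proof -
  have "((%s. fps_nth (X s) 0) has_real_derivative fps_nth x 0) (at 0)"
   using that(1) unfolding param_deriv_def by blast
  then have "((%s. c) has_real_derivative fps_nth x 0) (at 0)" by (simp add: that(2))
  then show ?thesis using DERIV_const DERIV_unique by blast
 qed
 have G10: "fps_nth G1 0 = 0" by (rule init[OF G1 ode_init(2)])
 have h10: "fps_nth h1 0 = 0" by (rule init[OF assms ode_init(4)])
 let ?t = "fps_const (1 / 3) :: real fps"
 have "?t * 3 = 1" by (simp add: numeral_fps_const)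
 then have third: "?t * (3 * x) = x" for x by (simp flip: mult.assoc)
 have G1_eq: "G1 = ?G * (?R * n1 - ?t * ?R ^ 3)"
 proof -
  define T where "T = ?t * ?R ^ 3"
  \<comment> \<open>The candidate for G1 comes from integrating \<open>e2\<close>; its defect Q
    solves Q' = R R' Q without constant term.\<close>
  let ?Q = "G1 - ?G * (?R * n1 - T)"
  have dG1: "fps_deriv G1 = G1 * ?R * fps_deriv ?R + ?G * n1 * fps_deriv ?R + ?G * ?R * fps_deriv n1
    - ?G * ?R * fps_deriv ?R * ?R"
   using e2 unfolding cac_G_deriv by (simp add: algebra_simps)
  have d3: "fps_deriv T = ?R ^ 2 * fps_deriv ?R"
   by (simp add: T_def fps_deriv_power third mult.assoc mult.left_commute mult.commute)
  have "fps_deriv ?Q = fps_deriv G1 - (?G * (?R * fps_deriv n1 + fps_deriv ?R * n1 - ?R ^ 2 * fps_deriv ?R)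
    + ?G * ?R * fps_deriv ?R * (?R * n1 - T))"
   by (simp only: fps_deriv_sub fps_deriv_mult d3 cac_G_deriv)
  also have "\<dots> = (?R * fps_deriv ?R) * ?Q"
   unfolding dG1 by (simp add: power2_eq_square algebra_simps)
  finally have "?Q = 0" by (rule fps_linear_ode_zero) (simp add: T_def G10 ode_init power3_eq_cube)
  then show ?thesis by (simp add: T_def)
 qed
 have n1_eq: "n1 = G1 * fps_X + ?G - 1" using e1 by (simp add: algebra_simps)
 have "(1 - ?R ^ 2) * G1 = ?G * (?R * ?G - ?R - ?t * ?R ^ 3)"
 proof -
  have "G1 = ?R * G1 * (fps_X * ?G) + ?G * ?R * ?G - ?G * ?R - ?G * (?t * ?R ^ 3)"
   by (subst (1) G1_eq, subst n1_eq) (simp add: algebra_simps)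
  then have "G1 = ?R * G1 * ?R + ?G * ?R * ?G - ?G * ?R - ?G * (?t * ?R ^ 3)" unfolding cac_R[symmetric] .
  then show ?thesis by (simp add: power2_eq_square algebra_simps)
 qed
 also have "\<dots> = (1 - ?R ^ 2) * (fps_deriv ?R * (?R * ?G - ?R - ?t * ?R ^ 3))"
  by (subst cac_R_deriv[symmetric]) (simp add: mult.assoc mult.left_commute mult.commute)
 finally have G1_final: "G1 = fps_deriv ?R * (?R * ?G - ?R - ?t * ?R ^ 3)"
 proof -
  assume eq: "(1 - ?R ^ 2) * G1 = (1 - ?R ^ 2) * (fps_deriv ?R * (?R * ?G - ?R - ?t * ?R ^ 3))"
  have "fps_nth (1 - ?R ^ 2) 0 = 1" by (simp add: ode_init power2_eq_square)
  then have "1 - ?R ^ 2 ~= 0" by (metis fps_zero_nth zero_neq_one)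
  then show ?thesis using eq by simp
 qed
 \<comment> \<open>An antiderivative of W G + G1, found from G' = G R R' and W' = G.\<close>
 let ?S = "?G - 1 - fps_const (1 / 2) * ?R ^ 2 - fps_const (1 / 12) * ?R ^ 4 + fps_const (1 / 2) * cac_W ^ 2"
 have half: "fps_const (1 / 2) * (2 * x) = x" for x :: "real fps"
 proof -
  have "fps_const (1 / 2) * (2 :: real fps) = 1" by (simp add: numeral_fps_const)
  then show ?thesis by (simp flip: mult.assoc)
 qed
 have twelfth: "fps_const (1 / 12) * (4 * x) = ?t * x" for x :: "real fps"
 proof -
  have "fps_const (1 / 12) * (4 :: real fps) = ?t" by (simp add: numeral_fps_const)
  then show ?thesis by (simp flip: mult.assoc)
 qed
 have "fps_deriv ?S = ?G * ?R * fps_deriv ?R - ?R * fps_deriv ?R - ?t * (?R ^ 3 * fps_deriv ?R) + cac_W * ?G"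
 proof -
  have "fps_deriv (fps_const (1 / 2) * x ^ 2) = x * fps_deriv x" for x :: "real fps"
   using half[of "x * fps_deriv x"] by (simp add: fps_deriv_power mult.assoc mult.left_commute mult.commute)
  moreover have "fps_deriv (fps_const (1 / 12) * ?R ^ 4) = ?t * (?R ^ 3 * fps_deriv ?R)"
   using twelfth[of "?R ^ 3 * fps_deriv ?R"] by (simp add: fps_deriv_power mult.assoc mult.left_commute mult.commute)
  ultimately show ?thesis
   by (simp only: fps_deriv_sub fps_deriv_add cac_G_deriv cac_W_deriv fps_deriv_1 diff_0_right)
 qed
 also have "\<dots> = fps_deriv h1" unfolding e3 G1_final by (simp add: algebra_simps)
 finally show ?thesis
  by (subst (asm) fps_deriv_eq_iff) (simp add: h10 ode_init power2_eq_square power4_eq_xxxx)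
qed

section \<open>Coefficients\<close>

text \<open>A substitute for Lagrange inversion. From G' = y G^2 (G + y G') the derivative of G^k is
  expressed through G^(k+2), which relates the coefficient of order n + 2 for k to that of order n
  for k + 2.\<close>

lemma cac_G_power_rec:
 assumes "k > 0"
 shows "fps_deriv (cac_G ^ k) * of_nat (k + 2) =
  of_nat k * (of_nat (k + 2) * (fps_X * cac_G ^ (k + 2)) + fps_X ^ 2 * fps_deriv (cac_G ^ (k + 2)))"
proof -
 let ?G = cac_G and ?D = "fps_deriv cac_G"
 have D: "?D = ?G * (fps_X * ?G) * (?G + fps_X * ?D)"
  using cac_G_deriv unfolding cac_R by (simp add: algebra_simps)
 obtain j where k: "k = Suc j" using assms gr0_implies_Suc by blast
 have pow: "fps_deriv (?G ^ Suc i) = of_nat (Suc i) * (?D * ?G ^ i)" for i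
  by (simp only: fps_deriv_power fps_of_nat mult.assoc diff_Suc_1)
 have "fps_deriv (?G ^ k) = of_nat k * (?D * ?G ^ j)" unfolding k by (rule pow)
 also have "\<dots> = of_nat k * (?G * (fps_X * ?G) * (?G + fps_X * ?D) * ?G ^ j)" by (subst D) simp
 finally have 1: "fps_deriv (?G ^ k) = of_nat k * (?G * (fps_X * ?G) * (?G + fps_X * ?D) * ?G ^ j)" .
 have 2: "fps_deriv (?G ^ (k + 2)) = of_nat (k + 2) * (?D * ?G ^ (k + 1))"
  using pow[of "k + 1"] by (simp only: add_2_eq_Suc' Suc_eq_plus1)
 have 3: "?G ^ (k + 1) = ?G ^ 2 * ?G ^ j" "?G ^ (k + 2) = ?G ^ 3 * ?G ^ j"
  by (simp_all add: k power2_eq_square power3_eq_cube mult.assoc)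
 have "of_nat k * (?G * (fps_X * ?G) * (?G + fps_X * D) * P) * m =
   of_nat k * (m * (fps_X * (?G ^ 3 * P)) + fps_X ^ 2 * (m * (D * (?G ^ 2 * P))))" for m D P
  by (simp add: power2_eq_square power3_eq_cube algebra_simps)
 then show ?thesis unfolding 1 unfolding 2 unfolding 3 .
qed

lemma power_rec_nth:
 fixes A B :: "real fps"
 assumes "fps_deriv A * of_nat (k + 2) = of_nat k * (of_nat (k + 2) * (fps_X * B) + fps_X ^ 2 * fps_deriv B)"
 shows "real (n + 2) * fps_nth A (n + 2) * real (k + 2) = real k * real (k + n + 2) * fps_nth B n"
  and "fps_nth A 1 = 0"
proof -
 have nat: "of_nat a = fps_const (real a)" for a by (simp add: fps_of_nat)
 have eq: "fps_nth (fps_deriv A * of_nat (k + 2)) i =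
   fps_nth (of_nat k * (of_nat (k + 2) * (fps_X * B) + fps_X ^ 2 * fps_deriv B)) i" for i
  using assms by simp
 have X2: "fps_nth (fps_X ^ 2 * fps_deriv B) (n + 1) = real n * fps_nth B n"
  by (cases n) (simp_all add: fps_X_power_mult_nth)
 have "real (n + 2) * fps_nth A (n + 2) * real (k + 2) =
   real k * (real (k + 2) * fps_nth B n + fps_nth (fps_X ^ 2 * fps_deriv B) (n + 1))"
  using eq[of "n + 1"] unfolding nat by simp
 then show "real (n + 2) * fps_nth A (n + 2) * real (k + 2) = real k * real (k + n + 2) * fps_nth B n"
  unfolding X2 by (simp add: algebra_simps)
 show "fps_nth A 1 = 0"
  using eq[of 0] unfolding nat by (simp add: fps_X_power_mult_nth)
qed

lemmas cac_G_power_nth_rec = power_rec_nth[OF cac_G_power_rec]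

text \<open>The recursion preserves k + 2 j, the exponent plus the order, so the base N of the power
  is constant along the induction.\<close>

lemma cac_G_power_even:
 "k > 0 ==> real (k + 2 * j) * fps_nth (cac_G ^ k) (2 * j) = real k * real (k + 2 * j) ^ j / (2 ^ j * fact j)"
proof (induction j arbitrary: k)
 case 0
 then show ?case by (simp add: ode_init power_0_left fps_power_zeroth)
next
 case (Suc j)
 let ?c = "%k n. fps_nth (cac_G ^ k) n" and ?N = "real (k + 2 * Suc j)"
 have N: "real (k + 2 + 2 * j) = ?N" by simp
 have IH: "?N * ?c (k + 2) (2 * j) = real (k + 2) * ?N ^ j / (2 ^ j * fact j)"
  using Suc.IH[of "k + 2"] unfolding N by simp
 have rec: "real (2 * Suc j) * ?c k (2 * Suc j) * real (k + 2) = real k * (?N * ?c (k + 2) (2 * j))"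
  using cac_G_power_nth_rec(1)[OF Suc.prems, of "2 * j"] by (simp add: algebra_simps)
 have "real (k + 2) * (real (2 * Suc j) * ?c k (2 * Suc j)) = real (k + 2) * (real k * ?N ^ j / (2 ^ j * fact j))"
  using rec unfolding IH by (simp add: algebra_simps)
 then have "real (2 * Suc j) * ?c k (2 * Suc j) = real k * ?N ^ j / (2 ^ j * fact j)"
  by (subst (asm) mult_left_cancel) auto
 then have "?c k (2 * Suc j) = real k * ?N ^ j / (2 ^ j * fact j) / real (2 * Suc j)"
  by (metis nonzero_mult_div_cancel_left of_nat_eq_0_iff Suc_neq_Zero mult_eq_0_iff zero_neq_numeral)
 then show ?case by (simp add: field_simps)
qed

section \<open>The top coefficient for braid matroids\<close>

lemma partition_sum_scale: "partition_sum k t (%m. c * g m) = c * partition_sum k t g"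
 unfolding partition_sum_def sum_distrib_left by (intro sum.cong) auto

lemma partition_sum_diff: "partition_sum k t (%m. g m - h m) = partition_sum k t g - partition_sum k t h"
 unfolding partition_sum_def by (simp add: right_diff_distrib sum_subtractf)

text \<open>Only the partition into singletons has k blocks. This comes out of the recursion, since
  the modified function again vanishes below the smaller k.\<close>

lemma partition_sum_low: "(!!m. m < k ==> g m = 0) ==> partition_sum k t g = g k"
proof (induction k arbitrary: g)
 case (Suc k)
 have "partition_sum k t (%m. g (Suc m) + (t * real m - real k) * g m) = g (Suc k) + (t * real k - real k) * g k"
  by (rule Suc.IH) (use Suc.prems in auto)
 then show ?case using Suc.prems by (simp add: partition_sum_Suc)
qed (simp add: partition_sum_0)

lemma partition_sum_cong:
 assumes "k > 0" "!!m. 0 < m ==> m <= k ==> g m = h m"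
 shows "partition_sum k t g = partition_sum k t h"
 unfolding partition_sum_def
proof (intro sum.cong refl arg_cong2[where f="(*)"] assms(2))
 fix Q assume "Q \<in> {Q. partition_on {1..k} Q}"
 then have Q: "partition_on {1..k} Q" by simp
 show "card Q <= k" using rank_part_flat[OF Q] by simp
 have "Q ~= {}" using partition_onD1[OF Q] assms(1) by auto
 then show "0 < card Q" using finite_partition[OF Q] by (simp add: card_gt_0_iff)
qed

section \<open>Exponential generating functions and the recursion as a substitution\<close>

definition egf :: "(nat => real) => real fps" where
 "egf g = Abs_fps (%n. g n / fact n)"

lemma egf_deriv: "fps_deriv (egf g) = egf (%m. g (Suc m))"
 by (rule fps_ext) (simp add: egf_def field_simps del: of_nat_Suc)

lemma egf_X_deriv: "fps_X * fps_deriv (egf g) = egf (%m. real m * g m)"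
proof (rule fps_ext)
 fix n show "fps_nth (fps_X * fps_deriv (egf g)) n = fps_nth (egf (%m. real m * g m)) n"
  by (cases n) (simp_all add: egf_def)
qed

lemma egf_add: "egf (%m. g m + h m) = egf g + egf h"
 and egf_scale: "egf (%m. c * g m) = fps_const c * egf g"
 by (rule fps_ext, simp add: egf_def add_divide_distrib)+

definition shift_coeff :: "nat => real => (nat => real) => real" where
 "shift_coeff n s g = fact n * fps_nth (egf g oo shift_fps s) n"

lemma shift_coeff_add: "shift_coeff n s (%m. g m + h m) = shift_coeff n s g + shift_coeff n s h"
 and shift_coeff_scale: "shift_coeff n s (%m. c * g m) = c * shift_coeff n s g"
 using fps_compose_mult_distrib[OF shift_fps_0, of "fps_const c" "egf g" s]
 by (simp_all add: shift_coeff_def egf_add egf_scale fps_compose_add_distrib algebra_simps)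

lemma shift_coeff_0: "shift_coeff 0 s g = g 0"
 by (simp add: shift_coeff_def egf_def)

lemma shift_coeff_Suc:
 assumes "s ~= 0"
 shows "shift_coeff (Suc n) s g = shift_coeff n s (%m. g (Suc m) + (real m / s - s * real n) * g m)"
proof -
 let ?K = "shift_fps s" and ?H = "egf g oo shift_fps s" and ?Y = "1 + fps_const s * fps_X :: real fps"
 let ?g = "%m. g (Suc m) + 1 / s * (real m * g m)"
 note K0 = shift_fps_0[of s]
 have "egf ?g = egf (%m. g (Suc m)) + fps_const (1 / s) * egf (%m. real m * g m)"
  by (simp only: egf_add egf_scale)
 also have "\<dots> = fps_deriv (egf g) + fps_const (1 / s) * (fps_X * fps_deriv (egf g))"
  unfolding egf_X_deriv by (simp only: egf_deriv)
 also have "\<dots> = fps_deriv (egf g) * (1 + fps_const (1 / s) * fps_X)" by (simp add: algebra_simps)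
 finally have "egf ?g oo ?K = (fps_deriv (egf g) oo ?K) * (1 + fps_const (1 / s) * ?K)"
  using K0 by (simp add: fps_compose_mult_distrib fps_compose_add_distrib)
 also have "\<dots> = (fps_deriv (egf g) oo ?K) * (?Y * fps_deriv ?K)"
  unfolding shift_fps_deriv[OF assms] ..
 also have "\<dots> = ?Y * fps_deriv ?H"
  unfolding fps_compose_deriv[OF K0] by (simp only: mult.left_commute)
 finally have "fps_nth (egf ?g oo ?K) n = real (Suc n) * fps_nth ?H (Suc n) + s * real n * fps_nth ?H n"
  by (cases n) (simp_all add: distrib_right mult.assoc)
 then have "shift_coeff n s ?g = shift_coeff (Suc n) s g + s * real n * shift_coeff n s g"
  by (simp add: shift_coeff_def algebra_simps)
 moreover have "shift_coeff n s (%m. g (Suc m) + (real m / s - s * real n) * g m) =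
   shift_coeff n s (%m. ?g m + (- (s * real n)) * g m)"
  by (rule arg_cong[where f="shift_coeff n s"]) (auto simp: algebra_simps)
 moreover have "\<dots> = shift_coeff n s ?g + - (s * real n) * shift_coeff n s g"
  by (rule trans[OF shift_coeff_add]) (simp only: shift_coeff_scale)
 ultimately show ?thesis by simp
qed

text \<open>Both sides satisfy the recursion that removes the last point. Thus, at t = 1 / s^2,
  summing over partitions with characteristic polynomials is substituting \<open>shift_fps\<close>
  into the generating function.\<close>

lemma shift_coeff_eq:
 assumes s: "s ~= 0"
 shows "shift_coeff n s g = s ^ n * partition_sum n (1 / s ^ 2) (%m. g m / s ^ m)"
proof (induction n arbitrary: g)
 case (Suc n)
 let ?g = "%m. g (Suc m) + (real m / s - s * real n) * g m"
 have "shift_coeff (Suc n) s g = s ^ n * partition_sum n (1 / s ^ 2) (%m. ?g m / s ^ m)"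
  using shift_coeff_Suc[OF s] Suc.IH by simp
 also have "(%m. ?g m / s ^ m) =
   (%m. s * (g (Suc m) / s ^ Suc m + (1 / s ^ 2 * real m - real n) * (g m / s ^ m)))"
  using s by (auto simp: field_simps power2_eq_square)
 finally show ?case by (simp add: partition_sum_scale partition_sum_Suc)
qed (simp add: shift_coeff_0 partition_sum_0)

lemma poly_eqI_nonzero:
 fixes p q :: "real poly"
 assumes "!!s. s ~= 0 ==> poly p s = poly q s"
 shows "p = q"
proof (rule ccontr)
 assume "p ~= q"
 then have "finite {x. poly (p - q) x = 0}" by (intro poly_roots_finite) simp
 moreover have "{0<..} <= {x. poly (p - q) x = 0}" using assms by auto
 ultimately have "finite {0::real<..}" by (rule rev_finite_subset)
 then show False using infinite_Ioi by blast
qed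

text \<open>Invariance identifies the reflected polynomial with X^deg d times d, of degree 2 deg d.
  Reflection does not raise the degree, so d is constant, with value 0 at 0.\<close>

lemma poly_inversion_invariant:
 fixes d :: "real poly"
 assumes "poly d 0 = 0" and inv: "!!s. s ~= 0 ==> poly d (1 / s) = poly d s"
 shows "d = 0"
proof (rule ccontr)
 assume d: "d ~= 0"
 have "reflect_poly d = monom 1 (degree d) * d"
 proof (rule poly_eqI_nonzero)
  fix s :: real assume "s ~= 0"
  then show "poly (reflect_poly d) s = poly (monom 1 (degree d) * d) s"
   using inv[of s] by (simp add: poly_reflect_poly_nz poly_monom inverse_eq_divide)
 qed
 then have "degree (monom 1 (degree d) * d) <= degree d" using degree_reflect_poly_le[of d] by simp
 moreover have "degree (monom 1 (degree d) * d) = degree d + degree d"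
  using d by (simp add: degree_mult_eq degree_monom_eq monom_eq_0_iff)
 ultimately have "degree d = 0" by simp
 then obtain c where "d = [:c:]" by (rule degree_eq_zeroE)
 then show False using assms(1) d by simp
qed

definition ode_phi :: "nat => real => real" where
 "ode_phi n s = fact n * fps_nth (ode_f s) n"

lemma egf_ode_phi: "egf (%m. ode_phi m s) = ode_f s"
 by (rule fps_ext) (simp add: egf_def ode_phi_def)

lemma ode_f_nth: "fps_nth (ode_f s) (Suc n) = fps_nth (1 + fps_const s * ode_h s) n / real (Suc n)"
 by (simp add: ode_f_def fps_integral_def field_simps)

lemma ode_phi_1: "ode_phi 1 s = 1"
 using ode_f_nth[of s 0] by (simp add: ode_phi_def ode_init)

lemma ode_phi_Suc: "n > 0 ==> ode_phi (Suc n) s = fact n * (s * fps_nth (ode_h s) n)"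
 using ode_f_nth[of s n] by (simp add: ode_phi_def del: of_nat_Suc)

abbreviation kl_val :: "nat => real => real" where
 "kl_val n t \<equiv> real_eval (kl_poly (braid_matroid n)) t"

text \<open>This is s^(n-1) P(1 / s^2) as a polynomial. For n \<ge> 2 the bound 2 deg P < n - 1
  keeps the exponents positive, so no subtraction is cut off and there is no constant term.\<close>

definition kl_scaled :: "nat => real poly" where
 "kl_scaled n = (\<Sum>i\<le>degree (kl_poly (braid_matroid n)).
   monom (real_of_int (coeff (kl_poly (braid_matroid n)) i)) (n - 1 - 2 * i))"

lemma kl_scaled_eval:
 assumes "n >= 2" "s ~= 0"
 shows "poly (kl_scaled n) s = s ^ (n - 1) * kl_val n (1 / s ^ 2)"
 unfolding kl_scaled_def real_eval_altdef[OF order_refl] poly_sum poly_monom sum_distrib_left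
proof (intro sum.cong refl)
 fix i assume "i \<in> {..degree (kl_poly (braid_matroid n))}"
 then have "2 * i <= n - 1" using kl_braid_degree[OF assms(1)] by simp
 then have "n - 1 = (n - 1 - 2 * i) + 2 * i" by simp
 then have "s ^ (n - 1) = s ^ (n - 1 - 2 * i) * (s ^ 2) ^ i" by (metis power_add power_mult)
 then show "real_of_int (coeff (kl_poly (braid_matroid n)) i) * s ^ (n - 1 - 2 * i) =
   s ^ (n - 1) * (real_of_int (coeff (kl_poly (braid_matroid n)) i) * (1 / s ^ 2) ^ i)"
  using assms(2) by (simp add: power_one_over)
qed

lemma kl_scaled_0:
 assumes "n >= 2" shows "poly (kl_scaled n) 0 = 0"
 unfolding kl_scaled_def poly_sum poly_monom
proof (intro sum.neutral ballI)
 fix i assume "i \<in> {..degree (kl_poly (braid_matroid n))}"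
 then have "n - 1 - 2 * i > 0" using kl_braid_degree[OF assms(1)] by simp
 then show "real_of_int (coeff (kl_poly (braid_matroid n)) i) * 0 ^ (n - 1 - 2 * i) = 0" by simp
qed

text \<open>Both sides satisfy the Kazhdan--Lusztig recursion, so their difference is invariant under
  \<open>s \<mapsto> 1/s\<close>; being a polynomial in \<open>s\<close> that vanishes at \<open>0\<close>, it is zero.\<close>

theorem ode_phi_eq_kl:
 assumes "n > 0" "s ~= 0"
 shows "ode_phi n s = s ^ (n - 1) * kl_val n (1 / s ^ 2)"
 using assms
proof (induction n arbitrary: s rule: less_induct)
 case (less n)
 show ?case
 proof (cases "n = 1")
  case True
  then show ?thesis using ode_phi_1 kl_braid_1 by simp
 next
  case False
  then have n: "n >= 2" using less.prems by simp
  obtain q where q: "!!s. fps_nth (ode_h s) (n - 1) = poly q s"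
   using poly_family_ode(3) unfolding poly_family_def by meson
  define d where "d = smult (fact (n - 1)) (pCons 0 q) - kl_scaled n"
  have phi: "ode_phi n s = poly (smult (fact (n - 1)) (pCons 0 q)) s" for s
   using ode_phi_Suc[of "n - 1" s] n q by simp
  have d: "poly d s = ode_phi n s - s ^ (n - 1) * kl_val n (1 / s ^ 2)" if "s ~= 0" for s
   using kl_scaled_eval[OF n that] by (simp add: d_def phi)
  have "d = 0"
  proof (rule poly_inversion_invariant)
   show "poly d 0 = 0" by (simp add: d_def kl_scaled_0[OF n])
   fix s :: real assume s: "s ~= 0"
   let ?t = "1 / s ^ 2"
   let ?g = "%m. ode_phi m s / s ^ m" and ?h = "%m. kl_val m ?t / s"
   \<comment> \<open>The value at index 0 is set to 0, where the induction hypothesis says nothing;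
     a partition of a nonempty set has at least one block, so the sum does not see it.\<close>
   let ?e = "%m. if m = 0 then 0 else ?g m - ?h m"
   have "partition_sum n ?t ?g - partition_sum n ?t ?h = partition_sum n ?t (%m. ?g m - ?h m)"
    by (rule partition_sum_diff[symmetric])
   also have "\<dots> = partition_sum n ?t ?e" by (rule partition_sum_cong) (use less.prems in auto)
   \<comment> \<open>By the induction hypothesis the terms with fewer than n blocks cancel; only the
     partition into singletons retains the unknown difference.\<close>
   also have "\<dots> = ?e n"
   proof (rule partition_sum_low)
    fix m assume m: "m < n"
    show "?e m = 0"
    proof (cases "m = 0")
     case False
     then have "ode_phi m s = s ^ (m - 1) * kl_val m ?t" using less.IH[OF m _ s] by simp
     moreover have "s ^ m = s * s ^ (m - 1)" using False by (simp add: power_eq_if)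
     ultimately show ?thesis using s False by simp
    qed simp
   qed
   finally have ps: "partition_sum n ?t ?g = partition_sum n ?t ?h + (?g n - ?h n)" using n by simp
   have rec: "partition_sum n ?t (%m. kl_val m ?t) = ?t ^ (n - 1) * kl_val n (1 / ?t)"
    using kl_braid_recursion[of n ?t] n s by simp
   have ps2: "partition_sum n ?t ?h = ?t ^ (n - 1) * kl_val n (s ^ 2) / s"
    using partition_sum_scale[of n ?t "1 / s" "%m. kl_val m ?t"] rec by simp
   have "ode_phi n (1 / s) = fact n * fps_nth (ode_f s oo shift_fps s) n"
    unfolding ode_f_shift[OF s] ode_phi_def ..
   also have "\<dots> = shift_coeff n s (%m. ode_phi m s)" by (simp add: shift_coeff_def egf_ode_phi)
   also have "\<dots> = s ^ n * (?t ^ (n - 1) * kl_val n (s ^ 2) / s + (ode_phi n s / s ^ n - kl_val n ?t / s))"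
    unfolding shift_coeff_eq[OF s] ps ps2 ..
   also have "\<dots> = (s ^ n / s) * ?t ^ (n - 1) * kl_val n (s ^ 2) + ode_phi n s - (s ^ n / s) * kl_val n ?t"
    using s by (simp add: field_simps)
   also have "s ^ n / s = s ^ (n - 1)" using s n by (simp add: power_eq_if)
   also have "s ^ (n - 1) * ?t ^ (n - 1) = (1 / s) ^ (n - 1)"
    using s by (simp add: power2_eq_square flip: power_mult_distrib)
   finally have "ode_phi n (1 / s) - (1 / s) ^ (n - 1) * kl_val n (s ^ 2) =
     ode_phi n s - s ^ (n - 1) * kl_val n ?t" by simp
   then show "poly d (1 / s) = poly d s" using d[of s] d[of "1 / s"] s by (simp add: power_one_over)
  qed
  then show ?thesis using d[OF less.prems(2)] by simp
 qed
qed

text \<open>On 2 m + 1 vertices the monomial t^(m-1) becomes s^2 in s^(2 m) P(1 / s^2). One factor s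
  is explicit in s h, so the coefficient is the first-order term of h at s = 0. Its summand -1
  affects order 0 only, and 2 m > 0.\<close>

theorem kl_braid_top_coeff:
 assumes m: "m > 0"
 shows "real_of_int (coeff (kl_poly (braid_matroid (2 * m + 1))) (m - 1)) =
  fact (2 * m) * fps_nth (cac_G - fps_const (1 / 2) * cac_R ^ 2 - fps_const (1 / 12) * cac_R ^ 4
   + fps_const (1 / 2) * cac_W ^ 2) (2 * m)"
proof -
 let ?n = "2 * m + 1" and ?P = "kl_poly (braid_matroid (2 * m + 1))"
 obtain q where q: "!!s. fps_nth (ode_h s) (2 * m) = poly q s"
  using poly_family_ode(3) unfolding poly_family_def by meson
 obtain h1 where h1: "param_deriv ode_h h1" by (rule param_deriv_exists[OF poly_family_ode(3)])
 have "smult (fact (2 * m)) (pCons 0 q) = kl_scaled ?n"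
 proof (rule poly_eqI_nonzero)
  fix s :: real assume s: "s ~= 0"
  then show "poly (smult (fact (2 * m)) (pCons 0 q)) s = poly (kl_scaled ?n) s"
   using ode_phi_eq_kl[OF _ s, of ?n] ode_phi_Suc[of "2 * m" s] kl_scaled_eval[OF _ s, of ?n] q m
   by (simp add: mult.left_commute)
 qed
 then have "coeff (smult (fact (2 * m)) (pCons 0 q)) 2 = coeff (kl_scaled ?n) 2" by simp
 moreover have "coeff (smult (fact (2 * m)) (pCons 0 q)) 2 = fact (2 * m) * coeff q 1"
  by (simp add: numeral_2_eq_2)
 moreover have "coeff (kl_scaled ?n) 2 = real_of_int (coeff ?P (m - 1))"
 proof -
  have deg: "degree ?P <= m - 1" using kl_braid_degree[of ?n] m by simp
  have "coeff (kl_scaled ?n) 2 = (\<Sum>i\<le>degree ?P. if i = m - 1 then real_of_int (coeff ?P i) else 0)"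
   unfolding kl_scaled_def coeff_sum
   by (intro sum.cong refl) (use deg m in \<open>auto simp: coeff_monom\<close>)
  also have "\<dots> = real_of_int (coeff ?P (m - 1))" by (auto simp: coeff_eq_0 sum.delta not_le)
  finally show ?thesis .
 qed
 moreover have "coeff q 1 = fps_nth h1 (2 * m)"
 proof -
  have "((%s. poly q s) has_real_derivative fps_nth h1 (2 * m)) (at 0)"
   using h1 unfolding param_deriv_def q[symmetric] by blast
  then have "poly (pderiv q) 0 = fps_nth h1 (2 * m)" using poly_DERIV DERIV_unique by blast
  then show ?thesis by (simp add: poly_0_coeff_0 coeff_pderiv)
 qed
 ultimately show ?thesis using m unfolding ode_h_param_deriv[OF h1] by simp
qed

section \<open>Comparison\<close>

text \<open>For m \<ge> 3 this is 120 times the number of rooted hyperforests with six components on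
  2 m vertices; on fewer than six vertices there are none.\<close>

definition excess :: "nat => 'a::field_char_0" where
 "excess m = (if m < 3 then 0 else of_nat m ^ (m - 3) * fact (2 * m - 1) / fact (m - 3))"

text \<open>For m \<ge> 3 all numbers are multiples of one unit t: r = 6 t m^2, s = t (m - 1) m, w =
  6 t m - 4 t (m - 1), and \<open>excess m\<close> is 6 t (m - 1) (m - 2). For m = 1 and m = 2 the
  exponents in question are negative, and the values are computed directly. The field is arbitrary
  because the reals are needed for the braid matroids and the rationals for the final
  formula.\<close>

lemma count_values:
 fixes m S w r s h :: nat
 assumes m: "m > 0" and S: "S + r + 2 * s = w + h" and w: "m * w + 4 * s = r"
  and r: "r * fact (m - 1) = m ^ (m - 1) * fact (2 * m - 1)" and s1: "m = 1 ==> s = 0"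
  and s: "m >= 2 ==> s * (6 * fact (m - 2)) = m ^ (m - 2) * fact (2 * m - 1)"
 shows "(of_nat S :: 'a::field_char_0) = of_nat h - 10 * of_nat s + excess m / 3"
  and "10 * of_nat s - excess m / 3 =
   (of_nat (m - 1) * of_nat m powi (int m - 4) * fact (2 * m + 1) / (3 * fact (m - 1)) :: 'a)"
proof -
 consider "m = 1" | "m = 2" | k where "m = k + 3"
 proof (cases "m >= 3")
  case True
  then have "m = (m - 3) + 3" by simp
  then show thesis by (rule that(3))
 next
  case False
  then have "m = 1 | m = 2" using m by linarith
  then show thesis using that(1,2) by blast
 qed
 then have "(of_nat S :: 'a) = of_nat h - 10 * of_nat s + excess m / 3 &
  10 * of_nat s - excess m / 3 =
   (of_nat (m - 1) * of_nat m powi (int m - 4) * fact (2 * m + 1) / (3 * fact (m - 1)) :: 'a)"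
 proof cases
  case 1
  then have "s = 0" "r = 1" "w = 1" using s1 r w by simp_all
  then have "S = h" using S by simp
  then show ?thesis using 1 \<open>s = 0\<close> by (simp add: excess_def)
 next
  case 2
  then have "s = 1" using s by (simp add: fact_numeral)
  moreover have "r = 12" using r 2 by (simp add: fact_numeral)
  moreover have "w = 4" using w calculation 2 by simp
  ultimately have Sh: "S + 10 = h" and s1: "s = 1" using S by simp_all
  have "(of_nat h :: 'a) = of_nat S + 10" unfolding Sh[symmetric] by simp
  moreover have "(4 :: 'a) * 2 powi (- 2) = 1" by (simp add: power_int_def field_simps power2_eq_square)
  ultimately show ?thesis using 2 s1 by (simp add: excess_def fact_numeral)
 next
  case (3 k)
  define K P B a M :: 'a where "K = of_nat k" and "P = of_nat m ^ k" and "B = fact (2 * m - 1)" and "a = fact k"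
   and "M = of_nat m"
  \<comment> \<open>The common unit, in terms of m equal to m^(m-3) (2 m - 1)! / (6 (m -
    1)!).\<close>
  define t where "t = P * B / (6 * (K + 1) * (K + 2) * a)"
  have M: "M = K + 3" by (simp add: M_def K_def 3)
  have "(of_nat (k + 1) :: 'a) ~= 0" "(of_nat (k + 2) :: 'a) ~= 0" "(of_nat m :: 'a) ~= 0"
   by (simp_all only: of_nat_eq_0_iff) (use 3 in simp_all)
  then have K: "K + 1 ~= 0" "K + 2 ~= 0" and M0: "M ~= 0" by (simp_all add: K_def M_def add.commute)
  have a0: "a ~= 0" by (simp add: a_def)
  have f: "(fact (m - 1) :: 'a) = (K + 2) * (K + 1) * a" "(fact (m - 2) :: 'a) = (K + 1) * a"
   by (simp_all add: 3 K_def a_def algebra_simps numeral_eq_Suc)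
  have c0: "6 * (K + 1) * (K + 2) * a ~= 0" by (intro no_zero_divisors) (use K a0 in simp_all)
  have "P * B = t * (6 * (K + 1) * (K + 2) * a)"
   by (rule iffD1[OF nonzero_divide_eq_eq[OF c0] t_def[symmetric]])
  then have PB: "P * B = 6 * t * (K + 1) * (K + 2) * a" by (simp only: mult_ac)
  have "(excess m :: 'a) = P * B / a" by (simp add: excess_def 3 P_def B_def a_def)
  then have ex: "(excess m :: 'a) = 6 * t * (K + 1) * (K + 2)" unfolding PB using a0 by simp
  have p: "(of_nat m ^ (m - 1) :: 'a) = P * M ^ 2" "(of_nat m ^ (m - 2) :: 'a) = P * M"
   by (simp_all add: P_def M_def 3 power_add[symmetric] power_Suc2[symmetric] del: power_Suc) 
  have "(of_nat (r * fact (m - 1)) :: 'a) = of_nat (m ^ (m - 1) * fact (2 * m - 1))" by (simp only: r)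
  then have r': "(of_nat r :: 'a) * ((K + 2) * (K + 1) * a) = P * M ^ 2 * B"
   by (simp only: of_nat_mult of_nat_fact of_nat_power f p B_def)
  have "(of_nat (s * (6 * fact (m - 2))) :: 'a) = of_nat (m ^ (m - 2) * fact (2 * m - 1))" using s 3 by simp
  then have s': "(of_nat s :: 'a) * (6 * ((K + 1) * a)) = P * M * B"
   by (simp only: of_nat_mult of_nat_fact of_nat_power of_nat_numeral f p B_def)
  have d: "(K + 2) * (K + 1) * a ~= 0" "6 * ((K + 1) * a) ~= 0" using K a0 by simp_all
  have "(of_nat r :: 'a) * ((K + 2) * (K + 1) * a) = P * B * M ^ 2" using r' by (simp only: mult_ac)
  also have "\<dots> = 6 * t * M ^ 2 * ((K + 2) * (K + 1) * a)" unfolding PB by (simp only: mult_ac)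
  finally have rv: "(of_nat r :: 'a) = 6 * t * M ^ 2" unfolding mult_right_cancel[OF d(1)] .
  have "(of_nat s :: 'a) * (6 * ((K + 1) * a)) = P * B * M" using s' by (simp only: mult_ac)
  also have "\<dots> = t * (K + 2) * M * (6 * ((K + 1) * a))" unfolding PB by (simp only: mult_ac)
  finally have sv: "(of_nat s :: 'a) = t * (K + 2) * M" unfolding mult_right_cancel[OF d(2)] .
  have "(of_nat (m * w + 4 * s) :: 'a) = of_nat r" by (simp only: w)
  then have "M * of_nat w = (of_nat r :: 'a) - 4 * of_nat s" by (simp add: M_def algebra_simps)
  then have "M * of_nat w = M * (6 * t * M - 4 * (t * (K + 2)))"
   unfolding rv sv by (simp add: algebra_simps power2_eq_square)
  then have wv: "of_nat w = 6 * t * M - 4 * (t * (K + 2))" unfolding mult_left_cancel[OF M0] .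
  have "(of_nat (S + r + 2 * s) :: 'a) = of_nat (w + h)" by (simp only: S)
  then have "(of_nat S :: 'a) = of_nat h + (of_nat w - of_nat r - 2 * of_nat s)" by (simp add: algebra_simps)
  also have "of_nat w - of_nat r - 2 * of_nat s = 2 * t * (K + 1) * (K + 2) - (10 * of_nat s :: 'a)"
   unfolding wv rv sv M by (simp add: algebra_simps power2_eq_square)
  finally have one: "(of_nat S :: 'a) = of_nat h - 10 * of_nat s + excess m / 3" by (simp add: ex)
  have "(fact (2 * m + 1) :: 'a) = (2 * M + 1) * (2 * M) * B"
  proof -
   have "2 * m = Suc (2 * m - 1)" using m by simp
   then have "(fact (2 * m) :: 'a) = of_nat (2 * m) * B" unfolding B_def by (metis fact_Suc)
   then show ?thesis by (simp add: M_def algebra_simps)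
  qed
  moreover have "M powi (int m - 4) = P / M"
  proof -
   have "int m - 4 = int k - 1" by (simp add: 3)
   then have "M powi (int m - 4) = M powi (int k) / M powi 1" by (simp only: power_int_diff[OF disjI1[OF M0]])
   then show ?thesis by (simp add: P_def M_def)
  qed
  moreover have "(of_nat (m - 1) :: 'a) = K + 2" by (simp add: 3 K_def algebra_simps)
  ultimately have "(of_nat (m - 1) * of_nat m powi (int m - 4) * fact (2 * m + 1) / (3 * fact (m - 1)) :: 'a) =
    (K + 2) * (P / M) * ((2 * M + 1) * (2 * M) * B) / (3 * ((K + 2) * (K + 1) * a))"
   using f by (simp add: M_def)
  also have "\<dots> = (K + 2) * (2 * M + 1) * 2 * (P * B) / (3 * ((K + 2) * (K + 1) * a))" using M0 by simp
  also have "\<dots> = 4 * t * (K + 2) * (2 * M + 1)"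
  proof -
   have d3: "3 * ((K + 2) * (K + 1) * a) ~= 0" using d(1) by simp
   show ?thesis unfolding nonzero_divide_eq_eq[OF d3] PB by (simp only: algebra_simps) simp
  qed
  also have "\<dots> = 10 * of_nat s - excess m / 3" unfolding sv ex M by (simp add: algebra_simps)
  finally show ?thesis using one by simp
 qed
 then show "(of_nat S :: 'a) = of_nat h - 10 * of_nat s + excess m / 3"
  and "10 * of_nat s - excess m / 3 =
   (of_nat (m - 1) * of_nat m powi (int m - 4) * fact (2 * m + 1) / (3 * fact (m - 1)) :: 'a)" by blast+
qed

lemma cac_R_power_nth: "fps_nth (cac_R ^ k) n = (if n < k then 0 else fps_nth (cac_G ^ k) (n - k))"
 by (simp add: cac_R power_mult_distrib fps_X_power_mult_nth)

text \<open>R^k / k! is the exponential generating function of rooted hyperforests with k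
  components, so for k = 2 i these are the numbers of \<open>card_rooted_even\<close> times (2
  i)!.\<close>

lemma cac_R_power_even:
 assumes i: "0 < i" "i <= m"
 shows "fact (2 * m) * fps_nth (cac_R ^ (2 * i)) (2 * m) = 2 * real i * (real m ^ (m - i) * fact (2 * m - 1) / fact (m - i))"
proof -
 have ix: "2 * m - 2 * i = 2 * (m - i)" "2 * i + 2 * (m - i) = 2 * m" "\<not> 2 * m < 2 * i" using i by simp_all
 have c: "fps_nth (cac_R ^ (2 * i)) (2 * m) = fps_nth (cac_G ^ (2 * i)) (2 * (m - i))"
  by (simp only: cac_R_power_nth ix if_False)
 have "real (2 * m) * fps_nth (cac_G ^ (2 * i)) (2 * (m - i)) =
   real (2 * i) * real (2 * m) ^ (m - i) / (2 ^ (m - i) * fact (m - i))"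
  using cac_G_power_even[of "2 * i" "m - i"] i by (simp only: ix)
 also have "real (2 * m) ^ (m - i) = 2 ^ (m - i) * real m ^ (m - i)" by (simp add: power_mult_distrib)
 finally have g: "real (2 * m) * fps_nth (cac_G ^ (2 * i)) (2 * (m - i)) = 2 * real i * real m ^ (m - i) / fact (m - i)"
  by simp
 have "2 * m = Suc (2 * m - 1)" using i by simp
 then have eq: "(fact (2 * m) :: real) = real (2 * m) * fact (2 * m - 1)" by (metis fact_Suc)
 have "fact (2 * m) * fps_nth (cac_R ^ (2 * i)) (2 * m) =
   fact (2 * m - 1) * (real (2 * m) * fps_nth (cac_G ^ (2 * i)) (2 * (m - i)))" 
  unfolding c eq by (simp only: mult_ac)
 then show ?thesis unfolding g by simp
qed

text \<open>Inserting W = R - R^3 / 3 cancels R^2 and leaves G - 5 R^4 / 12 + R^6 / 18. The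
  factorial-weighted coefficients of G, R^4 and R^6 are h, 24 s and 6 \<open>excess m\<close>,
  whence the constants 10 = 5 / 12 * 24 and 1 / 3 = 6 / 18.\<close>

lemma kl_braid_value:
 fixes m s h :: nat
 assumes m: "m > 0" and s1: "m = 1 ==> s = 0"
  and s: "m >= 2 ==> s * (6 * fact (m - 2)) = m ^ (m - 2) * fact (2 * m - 1)"
  and h: "h * (2 ^ m * fact m) = (2 * m + 1) ^ (m - 1) * fact (2 * m)"
 shows "real_of_int (coeff (kl_poly (braid_matroid (2 * m + 1))) (m - 1)) = real h - 10 * real s + excess m / 3"
proof -
 have W: "cac_W ^ 2 = cac_R ^ 2 - fps_const (2 / 3) * cac_R ^ 4 + fps_const (1 / 9) * cac_R ^ 6"
 proof -
  have "cac_W ^ 2 = cac_R ^ 2 - (2 * fps_const (1 / 3)) * cac_R ^ 4 + fps_const (1 / 3) ^ 2 * cac_R ^ 6"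
   unfolding cac_W by (simp add: power2_eq_square algebra_simps power_numeral_reduce)
  moreover have "2 * fps_const (1 / 3 :: real) = fps_const (2 / 3)" by (simp add: fps_numeral_fps_const)
  moreover have "fps_const (1 / 3 :: real) ^ 2 = fps_const (1 / 9)" by (simp add: power2_eq_square)
  ultimately show ?thesis by simp
 qed
 have s4: "fact (2 * m) * fps_nth (cac_R ^ 4) (2 * m) = 24 * real s"
 proof (cases "m = 1")
  case True
  then show ?thesis using s1 by (simp add: cac_R_power_nth)
 next
  case False
  then have m2: "2 <= m" using m by simp
  have "real (s * (6 * fact (m - 2))) = real (m ^ (m - 2) * fact (2 * m - 1))" by (simp only: s[OF m2])
  then have "real m ^ (m - 2) * fact (2 * m - 1) = 6 * real s * fact (m - 2)" by simp
  then show ?thesis using cac_R_power_even[of 2 m] m2 by simp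
 qed
 have s6: "fact (2 * m) * fps_nth (cac_R ^ 6) (2 * m) = 6 * excess m"
 proof (cases "m < 3")
  case True
  then show ?thesis by (simp add: cac_R_power_nth excess_def)
 next
  case False
  then show ?thesis using cac_R_power_even[of 3 m] by (simp add: excess_def)
 qed
 have g1: "fact (2 * m) * fps_nth cac_G (2 * m) = real h"
 proof -
  have "real (h * (2 ^ m * fact m)) = real ((2 * m + 1) ^ (m - 1) * fact (2 * m))" by (simp only: h)
  then have h': "real h * (2 ^ m * fact m) = real (2 * m + 1) ^ (m - 1) * fact (2 * m)" by simp
  have "real (1 + 2 * m) * fps_nth (cac_G ^ 1) (2 * m) = real 1 * real (1 + 2 * m) ^ m / (2 ^ m * fact m)"
   by (rule cac_G_power_even) simp
  then have "real (2 * m + 1) * fps_nth cac_G (2 * m) = real (2 * m + 1) * real (2 * m + 1) ^ (m - 1) / (2 ^ m * fact m)"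
   using power_eq_if[of "real (2 * m + 1)" m] m by (simp add: add.commute)
  then have "real (2 * m + 1) * fps_nth cac_G (2 * m) = real (2 * m + 1) * (real (2 * m + 1) ^ (m - 1) / (2 ^ m * fact m))"
   by simp
  moreover have "real (2 * m + 1) ~= 0" by (simp only: of_nat_eq_0_iff)
  ultimately have "fps_nth cac_G (2 * m) = real (2 * m + 1) ^ (m - 1) / (2 ^ m * fact m)"
   by (simp only: mult_cancel_left) simp
  then have "fact (2 * m) * fps_nth cac_G (2 * m) = real h * (2 ^ m * fact m) / (2 ^ m * fact m)"
   unfolding h' by simp
  then show ?thesis by simp
 qed
 have "real_of_int (coeff (kl_poly (braid_matroid (2 * m + 1))) (m - 1)) =
   fact (2 * m) * (fps_nth cac_G (2 * m) - 5 / 12 * fps_nth (cac_R ^ 4) (2 * m) + fps_nth (cac_R ^ 6) (2 * m) / 18)"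
  unfolding kl_braid_top_coeff[OF m] W by (simp add: algebra_simps fps_mult_left_const_nth)
 also have "\<dots> = real h - 5 / 12 * (24 * real s) + 6 * excess m / 18"
  unfolding g1[symmetric] s4[symmetric] s6[symmetric] by (simp add: algebra_simps)
 finally show ?thesis by simp
qed

theorem theorem1p3:
  fixes n :: nat
  assumes "n > 1"
  shows "coeff (kl_poly (braid_matroid (2 * n - 1))) (n - 2)
           = int (card (simple_qsp_matroids (2 * n - 2) n)) \<and>
         (of_nat (card (simple_qsp_matroids (2 * n - 2) n)) :: rat)
           = of_nat (2 * n - 1) ^ (n - 2) * of_nat (double_fact (2 * n - 3))
             - of_nat (n - 2) * of_nat (n - 1) powi (int n - 5) * fact (2 * n - 1)
               / (3 * fact (n - 2))"
proof -
  define m where "m = n - 1"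
  have m: "m > 0" and n: "n = m + 1" using assms by (simp_all add: m_def)
  have ix: "2 * n - 1 = 2 * m + 1" "n - 2 = m - 1" "2 * n - 2 = 2 * m" "2 * n - 3 = 2 * m - 1" "n - 1 = m"
    "int n - 5 = int m - 4" by (simp_all add: n)
  let ?S = "card (simple_qsp_matroids (2 * m) (m + 1))"
  obtain w r s h where c: "?S + r + 2 * s = w + h" "m * w + 4 * s = r"
      "r * fact (m - 1) = m ^ (m - 1) * fact (2 * m - 1)" "m = 1 \<Longrightarrow> s = 0"
      "m \<ge> 2 \<Longrightarrow> s * (6 * fact (m - 2)) = m ^ (m - 2) * fact (2 * m - 1)"
    and h: "h * (2 ^ m * fact m) = (2 * m + 1) ^ (m - 1) * fact (2 * m)"
      "h = (2 * m + 1) ^ (m - 1) * double_fact (2 * m - 1)"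
    by (rule simple_qsp_counts[OF m]) (rule that; blast)
  have "real_of_int (coeff (kl_poly (braid_matroid (2 * m + 1))) (m - 1)) = real ?S"
    by (rule trans[OF kl_braid_value[OF m c(4,5) h(1)] count_values(1)[OF m c, symmetric]])
  then have "coeff (kl_poly (braid_matroid (2 * m + 1))) (m - 1) = int ?S" by linarith
  \<comment> \<open>The same evaluation over the rationals, where the closed form with its possibly
    negative exponent lives.\<close>
  moreover have "(of_nat ?S :: rat) = of_nat h - 10 * of_nat s + excess m / 3" by (rule count_values(1)[OF m c])
  then have e: "(of_nat ?S :: rat) = of_nat h - (10 * of_nat s - excess m / 3)" by simp
  have "10 * of_nat s - excess m / 3 =
      (of_nat (m - 1) * of_nat m powi (int m - 4) * fact (2 * m + 1) / (3 * fact (m - 1)) :: rat)"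
    by (rule count_values(2)[OF m c])
  then have "(of_nat ?S :: rat) = of_nat (2 * m + 1) ^ (m - 1) * of_nat (double_fact (2 * m - 1))
      - of_nat (m - 1) * of_nat m powi (int m - 4) * fact (2 * m + 1) / (3 * fact (m - 1))"
    unfolding e h(2) by (simp only: of_nat_mult of_nat_power)
  ultimately show ?thesis unfolding ix n[symmetric] by simp
qed

end
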